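(* Let $\mathcal{M}$ be a bicomplete abelian category with enough projectives and enough injectives in which every coproduct of monomorphisms is a monomorphism and every product of epimorphisms is an epimorphism, and let $Q$ be a right rooted quiver. Let $(\mathcal{W},\mathcal{F})$ be a hereditary injective cotorsion pair in $\mathcal{M}$ with $\mathcal{W}$ closed under small products. Then there exists an injective model structure on the category of representations $\mathrm{Rep}_Q\mathcal{M}$ with hereditary Hovey triple $$(\mathrm{Rep}_Q\mathcal{M},\ \mathrm{Rep}_Q\mathcal{W},\ \Psi(\mathcal{F})).$$
   Context: **Cotorsion pairs.** For a class $\mathcal{S}$ of objects in an abelian category $\mathcal{A}$, $\mathcal{S}^{\perp}$ is the class of $M$ with $\mathrm{Ext}^1_{\mathcal{A}}(S,M)=0$ for all $S\in\mathcal{S}$, and ${}^{\perp}\mathcal{S}$ is the class of $M$ with $\mathrm{Ext}^1_{\mathcal{A}}(M,S)=0$ for all $S\in\mathcal{S}$. A pair $(\mathcal{X},\mathcal{Y})$ of classes is a cotorsion pair if $\mathcal{X}={}^{\perp}\mathcal{Y}$ and $\mathcal{Y}=\mathcal{X}^{\perp}$. It is complete if for every object $M$ there are short exact sequences $0\to Y\to X\to M\to 0$ and $0\to M\to Y'\to X'\to 0$ with $X,X'\in\mathcal{X}$ and $Y,Y'\in\mathcal{Y}$. It is hereditary if $\mathrm{Ext}^i_{\mathcal{A}}(X,Y)=0$ for all $X\in\mathcal{X}$, $Y\in\mathcal{Y}$, $i\ge 1$. **Hovey triples and model structures.** A class $\mathcal{W}$ is thick if it is closed under direct summands and whenever two of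 the three terms in a short exact sequence are in $\mathcal{W}$, so is the third. A Hovey triple on $\mathcal{A}$ is a triple $(\mathcal{C},\mathcal{W},\mathcal{F})$ of classes of objects with $\mathcal{W}$ thick such that $(\mathcal{C}\cap\mathcal{W},\mathcal{F})$ and $(\mathcal{C},\mathcal{W}\cap\mathcal{F})$ are complete cotorsion pairs; it is hereditary if both of these cotorsion pairs are hereditary. By Hovey's correspondence, a Hovey triple is the same as an abelian model structure on $\mathcal{A}$ with $\mathcal{C}$, $\mathcal{W}$, $\mathcal{F}$ the classes of cofibrant, trivial and fibrant objects: the (trivial) cofibrations are the monomorphisms with cokernel in $\mathcal{C}$ (resp. $\mathcal{C}\cap\mathcal{W}$) and the (trivial) fibrations are the epimorphisms with kernel in $\mathcal{F}$ (resp. $\mathcal{F}\cap\mathcal{W}$). If $\mathcal{A}$ has enough injectives, a complete cotorsion pair $(\mathcal{W},\mathcal{F})$ in $\mathcal{A}$ is called injective if $\mathcal{W}\cap\mathcal{F}=\mathrm{Inj}\,\mathcal{A}$ (the class of injective objects) and $\mathcal{W}$ is thick; then $(\mathcal{A},\mathcal{W},\mathcal{F})$ is a Hovey triple. An abelian model structure is called injective if its Hovey triple is of the form $(\mathcal{A},\mathcal{W},\mathcal{F})$ for an injective cotorsion pair $(\mathcal{W},\mathcal{F})$ in $\mathcal{A}$. **Quivers.** A quiver $Q$ is a directed graph with vertex set $Q_0$ and arrow set $Q_1$; $s(\alpha)$ and $t(\alpha)$ denote the source and target of $\alpha\in Q_1$. Put $W_0=\emptyset$, $W_{\beta+1}=\{i\in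 Q_0 \mid i$ is not the source of any arrow with target outside $W_\beta\}$, and $W_\alpha=\bigcup_{\beta<\alpha}W_\beta$ for limit ordinals $\alpha$. $Q$ is right rooted if $W_\lambda=Q_0$ for some ordinal $\lambda$ (equivalently, $Q$ has no infinite path of the form $\bullet\to\bullet\to\bullet\to\cdots$). $\mathrm{Rep}_Q\mathcal{M}$ is the category of $\mathcal{M}$-valued representations of $Q$, i.e. functors to $\mathcal{M}$ from the category freely generated by $Q$. For a class $\mathcal{X}$ of objects of $\mathcal{M}$, $\mathrm{Rep}_Q\mathcal{X}$ is the class of $X\in\mathrm{Rep}_Q\mathcal{M}$ with $X(i)\in\mathcal{X}$ for all $i\in Q_0$. For a representation $X$ and $i\in Q_0$ let $\psi_i^X:X(i)\to\prod_{\alpha:i\to j}X(j)$ be the natural map, the product being over all arrows with source $i$. For a class $\mathcal{B}$ of objects of $\mathcal{M}$, $$\Psi(\mathcal{B})=\{X\in\mathrm{Rep}_Q\mathcal{M}\mid \forall i\in Q_0:\ \psi_i^X \text{ is epic},\ X(i)\in\mathcal{B},\ \ker\psi_i^X\in\mathcal{B}\}.$$ *)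

theory Defs
  imports "HOL-Algebra.Group" "Graph_Theory.Arc_Walk" "HOL-Library.FuncSet"
begin

section \<open>Categories\<close>

text \<open>
  Composition is written in the usual order: \<open>g \<cdot>\<^bsub>C\<^esub> f\<close> is meant for \<open>Cod C f = Dom C g\<close>
  and is unspecified otherwise.
\<close>

record ('o, 'm) cat =
  Ob :: "'o set"
  Ar :: "'m set"
  Dom :: "'m \<Rightarrow> 'o"
  Cod :: "'m \<Rightarrow> 'o"
  Ident :: "'o \<Rightarrow> 'm"
  Comp :: "'m \<Rightarrow> 'm \<Rightarrow> 'm" (infixl "\<cdot>\<index>" 70)

definition Hom :: "('o, 'm) cat \<Rightarrow> 'o \<Rightarrow> 'o \<Rightarrow> 'm set" where
  "Hom C a b = {f \<in> Ar C. Dom C f = a \<and> Cod C f = b}"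

locale category =
  fixes C :: "('o, 'm) cat" (structure)
  assumes Dom_in_Ob: "f \<in> Ar C \<Longrightarrow> Dom C f \<in> Ob C"
    and Cod_in_Ob: "f \<in> Ar C \<Longrightarrow> Cod C f \<in> Ob C"
    and Ident_in_Hom: "a \<in> Ob C \<Longrightarrow> Ident C a \<in> Hom C a a"
    and Comp_in_Hom: "f \<in> Hom C a b \<Longrightarrow> g \<in> Hom C b c \<Longrightarrow> g \<cdot> f \<in> Hom C a c"
    and Comp_assoc:
      "f \<in> Hom C a b \<Longrightarrow> g \<in> Hom C b c \<Longrightarrow> h \<in> Hom C c d \<Longrightarrow> (h \<cdot> g) \<cdot> f = h \<cdot> (g \<cdot> f)"
    and Comp_Ident_right: "f \<in> Hom C a b \<Longrightarrow> f \<cdot> Ident C a = f"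
    and Comp_Ident_left: "f \<in> Hom C a b \<Longrightarrow> Ident C b \<cdot> f = f"

definition op_cat :: "('o, 'm) cat \<Rightarrow> ('o, 'm) cat" where
  "op_cat C = \<lparr>Ob = Ob C, Ar = Ar C, Dom = Cod C, Cod = Dom C, Ident = Ident C,
     Comp = (\<lambda>g f. f \<cdot>\<^bsub>C\<^esub> g)\<rparr>"

text \<open>
  Functors and natural transformations are extensional functions, so that they are determined by
  their values on the objects and arrows of the source category.
\<close>

record ('o, 'm, 'p, 'n) fctr =
  FOb :: "'o \<Rightarrow> 'p"
  FAr :: "'m \<Rightarrow> 'n"

definition is_functor :: "('o, 'm) cat \<Rightarrow> ('p, 'n) cat \<Rightarrow> ('o, 'm, 'p, 'n) fctr \<Rightarrow> bool" where
  "is_functor J C F \<longleftrightarrow>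
     FOb F \<in> extensional (Ob J) \<and> FAr F \<in> extensional (Ar J) \<and>
     (\<forall>a\<in>Ob J. FOb F a \<in> Ob C \<and> FAr F (Ident J a) = Ident C (FOb F a)) \<and>
     (\<forall>f\<in>Ar J. FAr F f \<in> Hom C (FOb F (Dom J f)) (FOb F (Cod J f))) \<and>
     (\<forall>f\<in>Ar J. \<forall>g\<in>Ar J. Cod J f = Dom J g \<longrightarrow> FAr F (g \<cdot>\<^bsub>J\<^esub> f) = FAr F g \<cdot>\<^bsub>C\<^esub> FAr F f)"

record ('o, 'm, 'p, 'n) ntrans =
  NDom :: "('o, 'm, 'p, 'n) fctr"
  NCod :: "('o, 'm, 'p, 'n) fctr"
  NComponent :: "'o \<Rightarrow> 'n"

definition is_ntrans :: "('o, 'm) cat \<Rightarrow> ('p, 'n) cat \<Rightarrow> ('o, 'm, 'p, 'n) ntrans \<Rightarrow> bool" where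
  "is_ntrans J C \<eta> \<longleftrightarrow>
     is_functor J C (NDom \<eta>) \<and> is_functor J C (NCod \<eta>) \<and>
     NComponent \<eta> \<in> extensional (Ob J) \<and>
     (\<forall>a\<in>Ob J. NComponent \<eta> a \<in> Hom C (FOb (NDom \<eta>) a) (FOb (NCod \<eta>) a)) \<and>
     (\<forall>f\<in>Ar J. NComponent \<eta> (Cod J f) \<cdot>\<^bsub>C\<^esub> FAr (NDom \<eta>) f =
                FAr (NCod \<eta>) f \<cdot>\<^bsub>C\<^esub> NComponent \<eta> (Dom J f))"

definition functor_cat ::
    "('o, 'm) cat \<Rightarrow> ('p, 'n) cat \<Rightarrow> (('o, 'm, 'p, 'n) fctr, ('o, 'm, 'p, 'n) ntrans) cat" where
  "functor_cat J C = \<lparr>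
     Ob = {F. is_functor J C F},
     Ar = {\<eta>. is_ntrans J C \<eta>},
     Dom = NDom,
     Cod = NCod,
     Ident = (\<lambda>F. \<lparr>NDom = F, NCod = F, NComponent = (\<lambda>a\<in>Ob J. Ident C (FOb F a))\<rparr>),
     Comp = (\<lambda>\<theta> \<eta>. \<lparr>NDom = NDom \<eta>, NCod = NCod \<theta>,
                    NComponent = (\<lambda>a\<in>Ob J. NComponent \<theta> a \<cdot>\<^bsub>C\<^esub> NComponent \<eta> a)\<rparr>)\<rparr>"


section \<open>Limits and smallness\<close>

definition is_cone ::
    "('i, 'j) cat \<Rightarrow> ('o, 'm) cat \<Rightarrow> ('i, 'j, 'o, 'm) fctr \<Rightarrow> 'o \<Rightarrow> ('i \<Rightarrow> 'm) \<Rightarrow> bool" where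
  "is_cone J C D L \<pi> \<longleftrightarrow>
     L \<in> Ob C \<and> (\<forall>j\<in>Ob J. \<pi> j \<in> Hom C L (FOb D j)) \<and>
     (\<forall>u\<in>Ar J. FAr D u \<cdot>\<^bsub>C\<^esub> \<pi> (Dom J u) = \<pi> (Cod J u))"

definition is_limit ::
    "('i, 'j) cat \<Rightarrow> ('o, 'm) cat \<Rightarrow> ('i, 'j, 'o, 'm) fctr \<Rightarrow> 'o \<Rightarrow> ('i \<Rightarrow> 'm) \<Rightarrow> bool" where
  "is_limit J C D L \<pi> \<longleftrightarrow>
     is_cone J C D L \<pi> \<and>
     (\<forall>L' \<pi>'. is_cone J C D L' \<pi>' \<longrightarrow>
        (\<exists>!h. h \<in> Hom C L' L \<and> (\<forall>j\<in>Ob J. \<pi> j \<cdot>\<^bsub>C\<^esub> h = \<pi>' j)))"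

text \<open>
  HOL has no universe of small sets. Instead, an arbitrary infinite type \<open>'u\<close> is used as a bound:
  a set is small if it injects into \<open>'u\<close>. Up to isomorphism, the small index sets are
  then the sets of type \<open>'u set\<close>, and the small categories are those of type \<open>('u, 'u) cat\<close>.
  For a given universe, take for \<open>'u\<close> any infinite small set that is at least as large as
  all small data in question; the corresponding closure hypotheses below are then instances of
  closure under all small products, limits, etc.
\<close>

definition small :: "'u itself \<Rightarrow> 'a set \<Rightarrow> bool" where
  "small U A \<longleftrightarrow> (\<exists>f :: 'a \<Rightarrow> 'u. inj_on f A)"

definition complete_cat :: "'u itself \<Rightarrow> ('o, 'm) cat \<Rightarrow> bool" where
  "complete_cat U C \<longleftrightarrow>
     (\<forall>(J :: ('u, 'u) cat) D. category J \<and> is_functor J C D \<longrightarrow> (\<exists>L \<pi>. is_limit J C D L \<pi>))"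

text \<open>
  A limit in \<open>op_cat C\<close> of a functor from \<open>J\<close> to \<open>op_cat C\<close> is a colimit in \<open>C\<close> of the same
  functor, regarded as going from \<open>op_cat J\<close> to \<open>C\<close>.
\<close>

definition bicomplete :: "'u itself \<Rightarrow> ('o, 'm) cat \<Rightarrow> bool" where
  "bicomplete U C \<longleftrightarrow> complete_cat U C \<and> complete_cat U (op_cat C)"

definition is_product ::
    "('o, 'm) cat \<Rightarrow> 'i set \<Rightarrow> ('i \<Rightarrow> 'o) \<Rightarrow> 'o \<Rightarrow> ('i \<Rightarrow> 'm) \<Rightarrow> bool" where
  "is_product C I X P \<pi> \<longleftrightarrow>
     P \<in> Ob C \<and> (\<forall>i\<in>I. \<pi> i \<in> Hom C P (X i)) \<and>
     (\<forall>A\<in>Ob C. \<forall>g. (\<forall>i\<in>I. g i \<in> Hom C A (X i)) \<longrightarrow>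
        (\<exists>!h. h \<in> Hom C A P \<and> (\<forall>i\<in>I. \<pi> i \<cdot>\<^bsub>C\<^esub> h = g i)))"

definition closed_under_products :: "'u itself \<Rightarrow> ('o, 'm) cat \<Rightarrow> 'o set \<Rightarrow> bool" where
  "closed_under_products U C W \<longleftrightarrow>
     (\<forall>(I :: 'u set) X P \<pi>. is_product C I X P \<pi> \<and> (\<forall>i\<in>I. X i \<in> W) \<longrightarrow> P \<in> W)"


section \<open>Abelian categories\<close>

definition monic :: "('o, 'm) cat \<Rightarrow> 'm \<Rightarrow> bool" where
  "monic C m \<longleftrightarrow> m \<in> Ar C \<and>
     (\<forall>a. \<forall>f\<in>Hom C a (Dom C m). \<forall>g\<in>Hom C a (Dom C m). m \<cdot>\<^bsub>C\<^esub> f = m \<cdot>\<^bsub>C\<^esub> g \<longrightarrow> f = g)"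

definition epic :: "('o, 'm) cat \<Rightarrow> 'm \<Rightarrow> bool" where
  "epic C e \<longleftrightarrow> monic (op_cat C) e"

definition zero_object :: "('o, 'm) cat \<Rightarrow> 'o \<Rightarrow> bool" where
  "zero_object C z \<longleftrightarrow> z \<in> Ob C \<and>
     (\<forall>a\<in>Ob C. (\<exists>!f. f \<in> Hom C a z) \<and> (\<exists>!f. f \<in> Hom C z a))"

definition zero_arrow :: "('o, 'm) cat \<Rightarrow> 'm \<Rightarrow> bool" where
  "zero_arrow C f \<longleftrightarrow> f \<in> Ar C \<and>
     (\<exists>z. zero_object C z \<and>
        (\<exists>g\<in>Hom C (Dom C f) z. \<exists>h\<in>Hom C z (Cod C f). f = h \<cdot>\<^bsub>C\<^esub> g))"

definition is_kernel :: "('o, 'm) cat \<Rightarrow> 'm \<Rightarrow> 'm \<Rightarrow> bool" where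
  "is_kernel C f k \<longleftrightarrow>
     f \<in> Ar C \<and> k \<in> Ar C \<and> Cod C k = Dom C f \<and> zero_arrow C (f \<cdot>\<^bsub>C\<^esub> k) \<and>
     (\<forall>h\<in>Ar C. Cod C h = Dom C f \<and> zero_arrow C (f \<cdot>\<^bsub>C\<^esub> h) \<longrightarrow>
        (\<exists>!u. u \<in> Hom C (Dom C h) (Dom C k) \<and> k \<cdot>\<^bsub>C\<^esub> u = h))"

definition is_cokernel :: "('o, 'm) cat \<Rightarrow> 'm \<Rightarrow> 'm \<Rightarrow> bool" where
  "is_cokernel C f c \<longleftrightarrow> is_kernel (op_cat C) f c"

definition preadditive :: "('o, 'm) cat \<Rightarrow> ('m \<Rightarrow> 'm \<Rightarrow> 'm) \<Rightarrow> ('o \<Rightarrow> 'o \<Rightarrow> 'm) \<Rightarrow> bool" where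
  "preadditive C add zer \<longleftrightarrow>
     (\<forall>a\<in>Ob C. \<forall>b\<in>Ob C.
        comm_group \<lparr>carrier = Hom C a b, monoid.mult = add, one = zer a b\<rparr>) \<and>
     (\<forall>a\<in>Ob C. \<forall>b\<in>Ob C. \<forall>c\<in>Ob C.
        \<forall>f\<in>Hom C a b. \<forall>f'\<in>Hom C a b. \<forall>g\<in>Hom C b c. \<forall>g'\<in>Hom C b c.
          g \<cdot>\<^bsub>C\<^esub> add f f' = add (g \<cdot>\<^bsub>C\<^esub> f) (g \<cdot>\<^bsub>C\<^esub> f') \<and>
          add g g' \<cdot>\<^bsub>C\<^esub> f = add (g \<cdot>\<^bsub>C\<^esub> f) (g' \<cdot>\<^bsub>C\<^esub> f))"

definition has_binary_products :: "('o, 'm) cat \<Rightarrow> bool" where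
  "has_binary_products C \<longleftrightarrow>
     (\<forall>a\<in>Ob C. \<forall>b\<in>Ob C. \<exists>P \<pi>. is_product C (UNIV :: bool set) (\<lambda>x. if x then a else b) P \<pi>)"

definition abelian_category :: "('o, 'm) cat \<Rightarrow> bool" where
  "abelian_category C \<longleftrightarrow>
     category C \<and> (\<exists>add zer. preadditive C add zer) \<and>
     (\<exists>z. zero_object C z) \<and> has_binary_products C \<and> has_binary_products (op_cat C) \<and>
     (\<forall>f\<in>Ar C. (\<exists>k. is_kernel C f k) \<and> (\<exists>c. is_cokernel C f c)) \<and>
     (\<forall>m. monic C m \<longrightarrow> (\<exists>f. is_kernel C f m)) \<and>
     (\<forall>e. epic C e \<longrightarrow> (\<exists>f. is_cokernel C f e))"

definition products_of_epics_epic :: "'u itself \<Rightarrow> ('o, 'm) cat \<Rightarrow> bool" where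
  "products_of_epics_epic U C \<longleftrightarrow>
     (\<forall>(I :: 'u set) X Y f P \<pi> P' \<pi>' g.
        is_product C I X P \<pi> \<and> is_product C I Y P' \<pi>' \<and>
        (\<forall>i\<in>I. f i \<in> Hom C (X i) (Y i) \<and> epic C (f i)) \<and>
        g \<in> Hom C P P' \<and> (\<forall>i\<in>I. \<pi>' i \<cdot>\<^bsub>C\<^esub> g = f i \<cdot>\<^bsub>C\<^esub> \<pi> i) \<longrightarrow> epic C g)"

definition coproducts_of_monics_monic :: "'u itself \<Rightarrow> ('o, 'm) cat \<Rightarrow> bool" where
  "coproducts_of_monics_monic U C \<longleftrightarrow> products_of_epics_epic U (op_cat C)"

definition Inj :: "('o, 'm) cat \<Rightarrow> 'o set" where
  "Inj C = {E \<in> Ob C. \<forall>m. monic C m \<longrightarrow>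
     (\<forall>f\<in>Hom C (Dom C m) E. \<exists>g\<in>Hom C (Cod C m) E. g \<cdot>\<^bsub>C\<^esub> m = f)}"

definition enough_injectives :: "('o, 'm) cat \<Rightarrow> bool" where
  "enough_injectives C \<longleftrightarrow> (\<forall>a\<in>Ob C. \<exists>E\<in>Inj C. \<exists>m\<in>Hom C a E. monic C m)"

definition enough_projectives :: "('o, 'm) cat \<Rightarrow> bool" where
  "enough_projectives C \<longleftrightarrow> enough_injectives (op_cat C)"

text \<open>\<open>short_exact C f g\<close>: the sequence \<open>0 \<rightarrow> Dom f \<rightarrow> Cod f = Dom g \<rightarrow> Cod g \<rightarrow> 0\<close> is exact.\<close>

definition short_exact :: "('o, 'm) cat \<Rightarrow> 'm \<Rightarrow> 'm \<Rightarrow> bool" where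
  "short_exact C f g \<longleftrightarrow> is_kernel C g f \<and> is_cokernel C f g"

definition is_image :: "('o, 'm) cat \<Rightarrow> 'm \<Rightarrow> 'm \<Rightarrow> bool" where
  "is_image C f m \<longleftrightarrow> (\<exists>c. is_cokernel C f c \<and> is_kernel C c m)"

definition exact_at :: "('o, 'm) cat \<Rightarrow> 'm \<Rightarrow> 'm \<Rightarrow> bool" where
  "exact_at C f g \<longleftrightarrow> (\<exists>m. is_image C f m \<and> is_kernel C g m)"


section \<open>Yoneda Ext\<close>

text \<open>
  An \<open>n\<close>-extension \<open>0 \<rightarrow> Y \<rightarrow> E\<^sub>1 \<rightarrow> \<dots> \<rightarrow> E\<^sub>n \<rightarrow> X \<rightarrow> 0\<close> is given by the list of its \<open>n + 1\<close> inner arrows.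
\<close>

definition extension :: "('o, 'm) cat \<Rightarrow> nat \<Rightarrow> 'o \<Rightarrow> 'o \<Rightarrow> 'm list \<Rightarrow> bool" where
  "extension C n X Y e \<longleftrightarrow>
     length e = Suc n \<and> set e \<subseteq> Ar C \<and> Dom C (e ! 0) = Y \<and> Cod C (e ! n) = X \<and>
     monic C (e ! 0) \<and> epic C (e ! n) \<and> (\<forall>k<n. exact_at C (e ! k) (e ! Suc k))"

definition extension_morphism ::
    "('o, 'm) cat \<Rightarrow> nat \<Rightarrow> 'o \<Rightarrow> 'o \<Rightarrow> 'm list \<Rightarrow> 'm list \<Rightarrow> bool" where
  "extension_morphism C n X Y e e' \<longleftrightarrow>
     extension C n X Y e \<and> extension C n X Y e' \<and>
     (\<exists>h :: nat \<Rightarrow> 'm. h 0 = Ident C Y \<and> h (Suc n) = Ident C X \<and>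
        (\<forall>k\<le>n. h k \<in> Hom C (Dom C (e ! k)) (Dom C (e' ! k)) \<and>
               h (Suc k) \<cdot>\<^bsub>C\<^esub> (e ! k) = (e' ! k) \<cdot>\<^bsub>C\<^esub> h k))"

definition Ext :: "('o, 'm) cat \<Rightarrow> nat \<Rightarrow> 'o \<Rightarrow> 'o \<Rightarrow> 'm list set set" where
  "Ext C n X Y =
     {e. extension C n X Y e} //
       {(e, e'). extension C n X Y e \<and> extension C n X Y e' \<and>
                 equivclp (extension_morphism C n X Y) e e'}"

text \<open>Only used for \<open>n \<ge> 1\<close>: the Ext group is zero iff it has exactly one element.\<close>

definition Ext_zero :: "('o, 'm) cat \<Rightarrow> nat \<Rightarrow> 'o \<Rightarrow> 'o \<Rightarrow> bool" where
  "Ext_zero C n X Y \<longleftrightarrow> is_singleton (Ext C n X Y)"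


section \<open>Cotorsion pairs and Hovey triples\<close>

definition right_perp :: "('o, 'm) cat \<Rightarrow> 'o set \<Rightarrow> 'o set" where
  "right_perp C S = {a \<in> Ob C. \<forall>s\<in>S. Ext_zero C 1 s a}"

definition left_perp :: "('o, 'm) cat \<Rightarrow> 'o set \<Rightarrow> 'o set" where
  "left_perp C S = {a \<in> Ob C. \<forall>s\<in>S. Ext_zero C 1 a s}"

definition cotorsion_pair :: "('o, 'm) cat \<Rightarrow> 'o set \<Rightarrow> 'o set \<Rightarrow> bool" where
  "cotorsion_pair C X Y \<longleftrightarrow> X = left_perp C Y \<and> Y = right_perp C X"

definition complete_cotorsion_pair :: "('o, 'm) cat \<Rightarrow> 'o set \<Rightarrow> 'o set \<Rightarrow> bool" where
  "complete_cotorsion_pair C X Y \<longleftrightarrow>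
     cotorsion_pair C X Y \<and>
     (\<forall>a\<in>Ob C.
        (\<exists>f g. short_exact C f g \<and> Dom C f \<in> Y \<and> Dom C g \<in> X \<and> Cod C g = a) \<and>
        (\<exists>f g. short_exact C f g \<and> Dom C f = a \<and> Dom C g \<in> Y \<and> Cod C g \<in> X))"

definition hereditary_cotorsion_pair :: "('o, 'm) cat \<Rightarrow> 'o set \<Rightarrow> 'o set \<Rightarrow> bool" where
  "hereditary_cotorsion_pair C X Y \<longleftrightarrow>
     cotorsion_pair C X Y \<and> (\<forall>x\<in>X. \<forall>y\<in>Y. \<forall>i\<ge>1. Ext_zero C i x y)"

text \<open>In an abelian category, binary products are direct sums.\<close>

definition direct_summand :: "('o, 'm) cat \<Rightarrow> 'o \<Rightarrow> 'o \<Rightarrow> bool" where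
  "direct_summand C a b \<longleftrightarrow>
     a \<in> Ob C \<and> (\<exists>a'\<in>Ob C. \<exists>\<pi>. is_product C (UNIV :: bool set) (\<lambda>x. if x then a else a') b \<pi>)"

definition thick :: "('o, 'm) cat \<Rightarrow> 'o set \<Rightarrow> bool" where
  "thick C W \<longleftrightarrow>
     W \<subseteq> Ob C \<and>
     (\<forall>a b. b \<in> W \<and> direct_summand C a b \<longrightarrow> a \<in> W) \<and>
     (\<forall>f g. short_exact C f g \<longrightarrow>
        (Dom C f \<in> W \<and> Dom C g \<in> W \<longrightarrow> Cod C g \<in> W) \<and>
        (Dom C f \<in> W \<and> Cod C g \<in> W \<longrightarrow> Dom C g \<in> W) \<and>
        (Dom C g \<in> W \<and> Cod C g \<in> W \<longrightarrow> Dom C f \<in> W))"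

definition hovey_triple :: "('o, 'm) cat \<Rightarrow> 'o set \<times> 'o set \<times> 'o set \<Rightarrow> bool" where
  "hovey_triple A = (\<lambda>(C, W, F).
     thick A W \<and> complete_cotorsion_pair A (C \<inter> W) F \<and> complete_cotorsion_pair A C (W \<inter> F))"

definition hereditary_hovey_triple :: "('o, 'm) cat \<Rightarrow> 'o set \<times> 'o set \<times> 'o set \<Rightarrow> bool" where
  "hereditary_hovey_triple A = (\<lambda>(C, W, F).
     hovey_triple A (C, W, F) \<and>
     hereditary_cotorsion_pair A (C \<inter> W) F \<and> hereditary_cotorsion_pair A C (W \<inter> F))"

definition injective_cotorsion_pair :: "('o, 'm) cat \<Rightarrow> 'o set \<Rightarrow> 'o set \<Rightarrow> bool" where
  "injective_cotorsion_pair C W F \<longleftrightarrow>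
     enough_injectives C \<and> complete_cotorsion_pair C W F \<and> W \<inter> F = Inj C \<and> thick C W"


section \<open>Model structures\<close>

definition retract_of :: "('o, 'm) cat \<Rightarrow> 'm \<Rightarrow> 'm \<Rightarrow> bool" where
  "retract_of C f g \<longleftrightarrow>
     f \<in> Ar C \<and> g \<in> Ar C \<and>
     (\<exists>i\<in>Hom C (Dom C f) (Dom C g). \<exists>r\<in>Hom C (Dom C g) (Dom C f).
      \<exists>j\<in>Hom C (Cod C f) (Cod C g). \<exists>s\<in>Hom C (Cod C g) (Cod C f).
        r \<cdot>\<^bsub>C\<^esub> i = Ident C (Dom C f) \<and> s \<cdot>\<^bsub>C\<^esub> j = Ident C (Cod C f) \<and>
        g \<cdot>\<^bsub>C\<^esub> i = j \<cdot>\<^bsub>C\<^esub> f \<and> f \<cdot>\<^bsub>C\<^esub> r = s \<cdot>\<^bsub>C\<^esub> g)"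

definition retract_closed :: "('o, 'm) cat \<Rightarrow> 'm set \<Rightarrow> bool" where
  "retract_closed C S \<longleftrightarrow> (\<forall>f g. g \<in> S \<and> retract_of C f g \<longrightarrow> f \<in> S)"

definition lifts :: "('o, 'm) cat \<Rightarrow> 'm \<Rightarrow> 'm \<Rightarrow> bool" where
  "lifts C i p \<longleftrightarrow>
     (\<forall>u\<in>Hom C (Dom C i) (Dom C p). \<forall>v\<in>Hom C (Cod C i) (Cod C p).
        p \<cdot>\<^bsub>C\<^esub> u = v \<cdot>\<^bsub>C\<^esub> i \<longrightarrow>
        (\<exists>h\<in>Hom C (Cod C i) (Dom C p). h \<cdot>\<^bsub>C\<^esub> i = u \<and> p \<cdot>\<^bsub>C\<^esub> h = v))"

definition model_structure :: "('o, 'm) cat \<Rightarrow> 'm set \<Rightarrow> 'm set \<Rightarrow> 'm set \<Rightarrow> bool" where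
  "model_structure C cof weq fib \<longleftrightarrow>
     cof \<subseteq> Ar C \<and> weq \<subseteq> Ar C \<and> fib \<subseteq> Ar C \<and>
     (\<forall>f\<in>Ar C. \<forall>g\<in>Ar C. Cod C f = Dom C g \<longrightarrow>
        (f \<in> weq \<and> g \<in> weq \<longrightarrow> g \<cdot>\<^bsub>C\<^esub> f \<in> weq) \<and>
        (f \<in> weq \<and> g \<cdot>\<^bsub>C\<^esub> f \<in> weq \<longrightarrow> g \<in> weq) \<and>
        (g \<in> weq \<and> g \<cdot>\<^bsub>C\<^esub> f \<in> weq \<longrightarrow> f \<in> weq)) \<and>
     retract_closed C cof \<and> retract_closed C weq \<and> retract_closed C fib \<and>
     (\<forall>i\<in>cof \<inter> weq. \<forall>p\<in>fib. lifts C i p) \<and>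
     (\<forall>i\<in>cof. \<forall>p\<in>fib \<inter> weq. lifts C i p) \<and>
     (\<forall>f\<in>Ar C.
        (\<exists>i\<in>cof \<inter> weq. \<exists>p\<in>fib. Cod C i = Dom C p \<and> f = p \<cdot>\<^bsub>C\<^esub> i) \<and>
        (\<exists>i\<in>cof. \<exists>p\<in>fib \<inter> weq. Cod C i = Dom C p \<and> f = p \<cdot>\<^bsub>C\<^esub> i))"

definition cofibrant_objects :: "('o, 'm) cat \<Rightarrow> 'm set \<Rightarrow> 'o set" where
  "cofibrant_objects C cof = {a \<in> Ob C. \<exists>f\<in>cof. zero_object C (Dom C f) \<and> Cod C f = a}"

definition trivial_objects :: "('o, 'm) cat \<Rightarrow> 'm set \<Rightarrow> 'o set" where
  "trivial_objects C weq = {a \<in> Ob C. \<exists>f\<in>weq. zero_object C (Dom C f) \<and> Cod C f = a}"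

definition fibrant_objects :: "('o, 'm) cat \<Rightarrow> 'm set \<Rightarrow> 'o set" where
  "fibrant_objects C fib = {a \<in> Ob C. \<exists>f\<in>fib. Dom C f = a \<and> zero_object C (Cod C f)}"

definition monics_with_cokernel_in :: "('o, 'm) cat \<Rightarrow> 'o set \<Rightarrow> 'm set" where
  "monics_with_cokernel_in C S = {f. monic C f \<and> (\<exists>c. is_cokernel C f c \<and> Cod C c \<in> S)}"

definition epics_with_kernel_in :: "('o, 'm) cat \<Rightarrow> 'o set \<Rightarrow> 'm set" where
  "epics_with_kernel_in C S = {f. epic C f \<and> (\<exists>k. is_kernel C f k \<and> Dom C k \<in> S)}"

definition hovey_triple_of ::
    "('o, 'm) cat \<Rightarrow> 'm set \<Rightarrow> 'm set \<Rightarrow> 'm set \<Rightarrow> 'o set \<times> 'o set \<times> 'o set" where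
  "hovey_triple_of A cof weq fib =
     (cofibrant_objects A cof, trivial_objects A weq, fibrant_objects A fib)"

definition abelian_model_structure :: "('o, 'm) cat \<Rightarrow> 'm set \<Rightarrow> 'm set \<Rightarrow> 'm set \<Rightarrow> bool" where
  "abelian_model_structure A cof weq fib \<longleftrightarrow>
     abelian_category A \<and> model_structure A cof weq fib \<and>
     (\<forall>C W F. hovey_triple_of A cof weq fib = (C, W, F) \<longrightarrow>
        cof = monics_with_cokernel_in A C \<and>
        cof \<inter> weq = monics_with_cokernel_in A (C \<inter> W) \<and>
        fib = epics_with_kernel_in A F \<and>
        fib \<inter> weq = epics_with_kernel_in A (F \<inter> W))"

definition injective_model_structure :: "('o, 'm) cat \<Rightarrow> 'm set \<Rightarrow> 'm set \<Rightarrow> 'm set \<Rightarrow> bool" where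
  "injective_model_structure A cof weq fib \<longleftrightarrow>
     abelian_model_structure A cof weq fib \<and>
     (\<exists>W F. injective_cotorsion_pair A W F \<and> hovey_triple_of A cof weq fib = (Ob A, W, F))"


section \<open>Quivers and their representations\<close>

definition rooted_step :: "('v, 'e) pre_digraph \<Rightarrow> 'v set \<Rightarrow> 'v set" where
  "rooted_step Q W = {i \<in> verts Q. \<not> (\<exists>\<alpha>\<in>arcs Q. tail Q \<alpha> = i \<and> head Q \<alpha> \<notin> W)}"

text \<open>
  The transfinite sequence \<open>W\<close>, indexed by the elements of a (reflexive) well-order \<open>r\<close>; the three
  clauses treat zero, successors, and limits.
\<close>

definition rooted_sequence :: "('v, 'e) pre_digraph \<Rightarrow> 'i rel \<Rightarrow> ('i \<Rightarrow> 'v set) \<Rightarrow> bool" where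
  "rooted_sequence Q r W \<longleftrightarrow>
     (\<forall>a\<in>Field r.
        (underS r a = {} \<longrightarrow> W a = {}) \<and>
        (\<forall>b\<in>underS r a. (\<forall>c\<in>underS r a. (c, b) \<in> r) \<longrightarrow> W a = rooted_step Q (W b)) \<and>
        (underS r a \<noteq> {} \<and> \<not> (\<exists>b\<in>underS r a. \<forall>c\<in>underS r a. (c, b) \<in> r) \<longrightarrow>
           W a = (\<Union>b\<in>underS r a. W b)))"

text \<open>
  The sequence increases strictly until it becomes stationary, so it only involves ordinals
  below the successor cardinal of \<open>'v\<close>. Hence well-orders on \<open>'v set\<close> suffice.
\<close>

definition right_rooted :: "('v, 'e) pre_digraph \<Rightarrow> bool" where
  "right_rooted Q \<longleftrightarrow>
     (\<exists>(r :: 'v set rel) W. Well_order r \<and> rooted_sequence Q r W \<and>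
        (\<exists>l\<in>Field r. W l = verts Q))"

text \<open>The category freely generated by \<open>Q\<close>; a path carries its end points.\<close>

definition path_cat :: "('v, 'e) pre_digraph \<Rightarrow> ('v, 'v \<times> 'e list \<times> 'v) cat" where
  "path_cat Q = \<lparr>
     Ob = verts Q,
     Ar = {(u, p, v). pre_digraph.awalk Q u p v},
     Dom = (\<lambda>(u, p, v). u),
     Cod = (\<lambda>(u, p, v). v),
     Ident = (\<lambda>u. (u, [], u)),
     Comp = (\<lambda>(v', q, w) (u, p, v). (u, p @ q, w))\<rparr>"

type_synonym ('v, 'e, 'o, 'm) rep = "('v, 'v \<times> 'e list \<times> 'v, 'o, 'm) fctr"
type_synonym ('v, 'e, 'o, 'm) rep_hom = "('v, 'v \<times> 'e list \<times> 'v, 'o, 'm) ntrans"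

definition Rep ::
    "('v, 'e) pre_digraph \<Rightarrow> ('o, 'm) cat \<Rightarrow>
     (('v, 'e, 'o, 'm) rep, ('v, 'e, 'o, 'm) rep_hom) cat" where
  "Rep Q M = functor_cat (path_cat Q) M"

definition rep_arrow :: "('v, 'e) pre_digraph \<Rightarrow> ('v, 'e, 'o, 'm) rep \<Rightarrow> 'e \<Rightarrow> 'm" where
  "rep_arrow Q X \<alpha> = FAr X (tail Q \<alpha>, [\<alpha>], head Q \<alpha>)"

definition Rep_class ::
    "('v, 'e) pre_digraph \<Rightarrow> ('o, 'm) cat \<Rightarrow> 'o set \<Rightarrow> ('v, 'e, 'o, 'm) rep set" where
  "Rep_class Q M S = {X \<in> Ob (Rep Q M). \<forall>i\<in>verts Q. FOb X i \<in> S}"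

text \<open>
  Products are determined only up to isomorphism; \<open>is_psi\<close> holds for the natural map
  into any choice of the product.
\<close>

definition is_psi ::
    "('v, 'e) pre_digraph \<Rightarrow> ('o, 'm) cat \<Rightarrow> ('v, 'e, 'o, 'm) rep \<Rightarrow> 'v \<Rightarrow> 'm \<Rightarrow> bool" where
  "is_psi Q M X i \<psi> \<longleftrightarrow>
     (\<exists>P \<pi>. is_product M {\<alpha> \<in> arcs Q. tail Q \<alpha> = i} (\<lambda>\<alpha>. FOb X (head Q \<alpha>)) P \<pi> \<and>
        \<psi> \<in> Hom M (FOb X i) P \<and>
        (\<forall>\<alpha>\<in>{\<alpha> \<in> arcs Q. tail Q \<alpha> = i}. \<pi> \<alpha> \<cdot>\<^bsub>M\<^esub> \<psi> = rep_arrow Q X \<alpha>))"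

definition Psi ::
    "('v, 'e) pre_digraph \<Rightarrow> ('o, 'm) cat \<Rightarrow> 'o set \<Rightarrow> ('v, 'e, 'o, 'm) rep set" where
  "Psi Q M B = {X \<in> Ob (Rep Q M). \<forall>i\<in>verts Q.
     FOb X i \<in> B \<and>
     (\<exists>\<psi> k. is_psi Q M X i \<psi> \<and> epic M \<psi> \<and> is_kernel M \<psi> k \<and> Dom M k \<in> B)}"

end

theory Submission
  imports Defs
begin

text \<open>
  Three facts are combined.

  First, an injective cotorsion pair \<open>(W, F)\<close> in an abelian category determines an injective model
  structure (\<open>injective_cotorsion_pair_model_structure\<close>). The cofibrations are the monomorphisms, the trivial
  cofibrations the monomorphisms with cokernel in \<open>W\<close>, the fibrations and trivial fibrations the
  epimorphisms with kernel in \<open>F\<close> and with injective kernel, respectively. Liftings exist because \<open>Ext\<^sup>1\<close>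
  vanishes (\<open>orth_lifts\<close>), and approximations of objects yield factorisations of arrows (\<open>cotorsion_factorization\<close>). For the weak
  equivalences the main point is that one may decide from any factorisation into a monomorphism and a trivial
  fibration whether an arrow is one (\<open>weq_iff\<close>). The pair is hereditary since \<open>W\<close> is closed under kernels
  of epimorphisms.

  Secondly, if products of epimorphisms are epic, each complete cotorsion pair \<open>(W, F)\<close> in \<open>M\<close> induces a
  complete cotorsion pair \<open>(Rep W, \<Psi> F)\<close> (\<open>complete_cotorsion_pair_reps\<close>). As \<open>Q\<close> is right rooted, one can
  recurse along its arrows, treating a vertex after the targets of its outgoing arrows. Once an extension to
  \<open>Y \<in> \<Psi> F\<close> is known at these targets, finding it at \<open>i\<close> is a lifting problem against \<open>\<psi>\<^sub>i\<close>, an epimorphism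
  with kernel in \<open>F\<close> (\<open>orth_Rep_Psi\<close>). For approximations, a morphism \<open>A \<rightarrow> B\<close> is factored vertex by vertex.
  With \<open>A \<rightarrow> C \<rightarrow> B\<close> constructed at the targets, let \<open>P\<close> consist of the compatible families in \<open>B i\<close> and the
  values of \<open>C\<close> there, and factor \<open>A i \<rightarrow> P\<close> in \<open>M\<close> as a monomorphism with cokernel in \<open>W\<close> and an
  epimorphism with kernel in \<open>F\<close>. Exactness of products makes \<open>P \<rightarrow> B i\<close> epic, and the kernel of \<open>C \<rightarrow> B\<close> is in
  \<open>\<Psi> F\<close> since its \<open>\<psi>\<^sub>i\<close> is a pullback of \<open>C i \<rightarrow> P\<close> (\<open>factorization_reps\<close>).

  Thirdly, applying this to all objects and injective objects shows that the injective representations are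
  those in \<open>\<Psi> (Inj M)\<close> and that there are enough of them (\<open>Inj_reps\<close>). Because \<open>W\<close> is thick and closed under
  products, \<open>Rep W \<inter> \<Psi> F = \<Psi> (W \<inter> F)\<close>. So \<open>(Rep W, \<Psi> F)\<close> is an injective cotorsion pair
  (\<open>injective_cotorsion_pair_reps\<close>).

  The definition of \<open>Ext\<close> by classes of Yoneda extensions requires two translations: \<open>Ext\<^sup>1\<close> is zero iff
  arrows extend along monomorphisms with the given cokernel (\<open>Ext_zero_iff_orth\<close>), and in higher degrees
  \<open>Ext\<close> vanishes if some extension receives morphisms from all others (\<open>absorbing\<close>).
\<close>


section \<open>Calculus in a category with additive Hom sets\<close>

lemma in_Hom [simp]: "f \<in> Hom C a b \<longleftrightarrow> f \<in> Ar C \<and> Dom C f = a \<and> Cod C f = b"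
  by (auto simp: Hom_def)

context category
begin

lemma Dom_Ob [simp]: "f \<in> Ar C \<Longrightarrow> Dom C f \<in> Ob C"
  and Cod_Ob [simp]: "f \<in> Ar C \<Longrightarrow> Cod C f \<in> Ob C"
  by (auto intro: Dom_in_Ob Cod_in_Ob)

lemma Ident_simps [simp]:
  "a \<in> Ob C \<Longrightarrow> Ident C a \<in> Ar C"
  "a \<in> Ob C \<Longrightarrow> Dom C (Ident C a) = a"
  "a \<in> Ob C \<Longrightarrow> Cod C (Ident C a) = a"
  using Ident_in_Hom[of a] by auto

lemma comp_simps [simp]:
  assumes "f \<in> Ar C" "g \<in> Ar C" "Dom C g = Cod C f"
  shows "g \<cdot> f \<in> Ar C" "Dom C (g \<cdot> f) = Dom C f" "Cod C (g \<cdot> f) = Cod C g"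
  using Comp_in_Hom[of f "Dom C f" "Cod C f" g "Cod C g"] assms by auto

lemma comp_assoc [simp]:
  "f \<in> Ar C \<Longrightarrow> g \<in> Ar C \<Longrightarrow> h \<in> Ar C \<Longrightarrow> Dom C g = Cod C f \<Longrightarrow> Dom C h = Cod C g
    \<Longrightarrow> (h \<cdot> g) \<cdot> f = h \<cdot> (g \<cdot> f)"
  using Comp_assoc[of f "Dom C f" "Cod C f" g "Cod C g" h "Cod C h"] by auto

lemma comp_Ident [simp]:
  "f \<in> Ar C \<Longrightarrow> Dom C f = a \<Longrightarrow> f \<cdot> Ident C a = f"
  "f \<in> Ar C \<Longrightarrow> Cod C f = a \<Longrightarrow> Ident C a \<cdot> f = f"
  using Comp_Ident_right[of f a "Cod C f"] Comp_Ident_left[of f "Dom C f" a] by auto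

text \<open>Composites are normalised to the right. This rule makes an equation \<open>g \<cdot> f = h\<close> applicable
  inside such a composite.\<close>

lemma comp_ext:
  assumes "g \<cdot> f = h" "f \<in> Ar C" "g \<in> Ar C" "Dom C g = Cod C f" "x \<in> Ar C" "Dom C f = Cod C x"
  shows "g \<cdot> (f \<cdot> x) = h \<cdot> x"
  using assms comp_assoc[of x f g] by simp

lemma comp_ext2:
  assumes "g \<cdot> f = k \<cdot> h" "f \<in> Ar C" "g \<in> Ar C" "Dom C g = Cod C f"
    "h \<in> Ar C" "k \<in> Ar C" "Dom C k = Cod C h" "x \<in> Ar C" "Dom C f = Cod C x" "Dom C h = Cod C x"
  shows "g \<cdot> (f \<cdot> x) = k \<cdot> (h \<cdot> x)"
  using assms comp_assoc[of x f g] comp_assoc[of x h k] by simp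

lemma monicD:
  "monic C m \<Longrightarrow> m \<cdot> f = m \<cdot> g \<Longrightarrow> f \<in> Ar C \<Longrightarrow> g \<in> Ar C \<Longrightarrow> Cod C f = Dom C m \<Longrightarrow> Cod C g = Dom C m
    \<Longrightarrow> Dom C f = Dom C g \<Longrightarrow> f = g"
  unfolding monic_def by auto

lemma monic_Ar [simp]: "monic C m \<Longrightarrow> m \<in> Ar C"
  by (simp add: monic_def)

lemma monic_comp:
  assumes "monic C f" "monic C g" "Dom C g = Cod C f"
  shows "monic C (g \<cdot> f)"
  unfolding monic_def
proof (intro conjI allI ballI impI)
  show "g \<cdot> f \<in> Ar C" using assms by simp
  fix a u v assume u: "u \<in> Hom C a (Dom C (g \<cdot> f))" and v: "v \<in> Hom C a (Dom C (g \<cdot> f))"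
    and e: "g \<cdot> f \<cdot> u = g \<cdot> f \<cdot> v"
  have "f \<cdot> u = f \<cdot> v"
    by (rule monicD[OF assms(2)]) (use assms u v e in auto)
  thus "u = v" using monicD[OF assms(1)] assms u v by auto
qed

lemma monic_cancel:
  assumes "monic C (g \<cdot> f)" "f \<in> Ar C" "g \<in> Ar C" "Dom C g = Cod C f"
  shows "monic C f"
  unfolding monic_def
proof (intro conjI allI ballI impI)
  show "f \<in> Ar C" using assms by simp
  fix a u v assume u: "u \<in> Hom C a (Dom C f)" and v: "v \<in> Hom C a (Dom C f)"
    and e: "f \<cdot> u = f \<cdot> v"
  show "u = v"
    by (rule monicD[OF assms(1)]) (use assms u v e in auto)
qed

lemma monic_Ident [simp]: "a \<in> Ob C \<Longrightarrow> monic C (Ident C a)"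
  unfolding monic_def by auto

lemma split_monic:
  assumes "r \<cdot> m = Ident C (Dom C m)" "m \<in> Ar C" "r \<in> Ar C" "Dom C r = Cod C m"
  shows "monic C m"
  by (rule monic_cancel[of r]) (use assms in auto)

end


subsection \<open>Duality\<close>

text \<open>Each statement about monomorphisms, kernels, pullbacks and products of arrows is proved once; its
  counterpart for epimorphisms, cokernels and pushouts is the same statement in the opposite category,
  translated back by these rules.\<close>

lemma op_simps [simp]:
  "Ob (op_cat C) = Ob C" "Ar (op_cat C) = Ar C" "Dom (op_cat C) = Cod C" "Cod (op_cat C) = Dom C"
  "Ident (op_cat C) = Ident C" "g \<cdot>\<^bsub>op_cat C\<^esub> f = f \<cdot>\<^bsub>C\<^esub> g"
  by (simp_all add: op_cat_def)

lemma op_op [simp]: "op_cat (op_cat C) = C"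
  by (simp add: op_cat_def)

lemma op_simps2 [simp]:
  "monic (op_cat C) = epic C" "epic (op_cat C) = monic C"
  "is_kernel (op_cat C) = is_cokernel C" "is_cokernel (op_cat C) = is_kernel C"
  "short_exact (op_cat C) f g = short_exact C g f"
  by (auto simp: fun_eq_iff epic_def is_cokernel_def short_exact_def)

lemma zero_object_op [simp]: "zero_object (op_cat C) = zero_object C"
  by (auto simp: fun_eq_iff zero_object_def)

lemma zero_arrow_op [simp]: "zero_arrow (op_cat C) = zero_arrow C"
  unfolding fun_eq_iff zero_arrow_def Bex_def by simp blast

lemma category_op: "category C \<Longrightarrow> category (op_cat C)"
proof -
  assume "category C"
  then interpret category C .
  show "category (op_cat C)"
    by unfold_locales auto
qed

lemma preadditive_op: "preadditive C add zer \<Longrightarrow> preadditive (op_cat C) add (\<lambda>a b. zer b a)"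
proof -
  have H: "Hom (op_cat C) a b = Hom C b a" for a b by auto
  show "preadditive C add zer \<Longrightarrow> preadditive (op_cat C) add (\<lambda>a b. zer b a)"
    unfolding preadditive_def H by (simp only: op_simps) blast
qed

lemma abelian_category_op: "abelian_category C \<Longrightarrow> abelian_category (op_cat C)"
proof -
  assume "abelian_category C"
  note a = this[unfolded abelian_category_def]
  from a obtain add zer where "preadditive C add zer" by blast
  then have "\<exists>add zer. preadditive (op_cat C) add zer" using preadditive_op by blast
  then show ?thesis
    unfolding abelian_category_def op_op op_simps op_simps2 zero_object_op
    using a category_op by blast
qed


locale additive = category +
  fixes add :: "'b \<Rightarrow> 'b \<Rightarrow> 'b" (infixl "\<boxplus>" 65) and zer :: "'a \<Rightarrow> 'a \<Rightarrow> 'b"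
  assumes pre: "preadditive C add zer" and zero_ex: "\<exists>z. zero_object C z"

context category
begin

lemmas op_category = category_op[OF category_axioms]

lemma epicD:
  "epic C e \<Longrightarrow> f \<cdot> e = g \<cdot> e \<Longrightarrow> f \<in> Ar C \<Longrightarrow> g \<in> Ar C \<Longrightarrow> Dom C f = Cod C e \<Longrightarrow> Dom C g = Cod C e
    \<Longrightarrow> Cod C f = Cod C g \<Longrightarrow> f = g"
  using category.monicD[OF op_category] by simp

lemma epic_Ar [simp]: "epic C m \<Longrightarrow> m \<in> Ar C"
  using category.monic_Ar[OF op_category] by simp

lemmas epic_comp = category.monic_comp[OF op_category, simplified]
lemmas epic_cancel = category.monic_cancel[OF op_category, simplified]
lemmas epic_Ident [simp] = category.monic_Ident[OF op_category, simplified]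
lemmas split_epic = category.split_monic[OF op_category, simplified]

end

context additive
begin

lemma additive_op: "additive (op_cat C) add (\<lambda>a b. zer b a)"
  by (intro additive.intro additive_axioms.intro op_category preadditive_op pre) (simp add: zero_ex)

subsection \<open>Addition of arrows\<close>

abbreviation homgrp where
  "homgrp a b \<equiv> \<lparr>carrier = Hom C a b, monoid.mult = add, one = zer a b\<rparr>"

lemma grp: "a \<in> Ob C \<Longrightarrow> b \<in> Ob C \<Longrightarrow> comm_group (homgrp a b)"
  using pre by (simp add: preadditive_def)

lemma zer_simps [simp]:
  assumes "a \<in> Ob C" "b \<in> Ob C"
  shows "zer a b \<in> Ar C" "Dom C (zer a b) = a" "Cod C (zer a b) = b"
proof -
  interpret comm_group "homgrp a b" using assms by (rule grp)
  show "zer a b \<in> Ar C" "Dom C (zer a b) = a" "Cod C (zer a b) = b"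
    using one_closed by auto
qed

lemma zer_Hom: "a \<in> Ob C \<Longrightarrow> b \<in> Ob C \<Longrightarrow> zer a b \<in> Hom C a b"
  by simp

lemma add_simps [simp]:
  assumes "f \<in> Ar C" "g \<in> Ar C" "Dom C g = Dom C f" "Cod C g = Cod C f"
  shows "f \<boxplus> g \<in> Ar C" "Dom C (f \<boxplus> g) = Dom C f" "Cod C (f \<boxplus> g) = Cod C f"
proof -
  interpret comm_group "homgrp (Dom C f) (Cod C f)" using assms by (simp add: grp)
  show "f \<boxplus> g \<in> Ar C" "Dom C (f \<boxplus> g) = Dom C f" "Cod C (f \<boxplus> g) = Cod C f"
    using m_closed[of f g] assms by auto
qed

lemma add_comm:
  assumes "f \<in> Ar C" "g \<in> Ar C" "Dom C g = Dom C f" "Cod C g = Cod C f"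
  shows "f \<boxplus> g = g \<boxplus> f"
proof -
  interpret comm_group "homgrp (Dom C f) (Cod C f)" using assms by (simp add: grp)
  show ?thesis using m_comm[of f g] assms by auto
qed

lemma add_zer [simp]:
  assumes "f \<in> Ar C" "a = Dom C f" "b = Cod C f"
  shows "f \<boxplus> zer a b = f" "zer a b \<boxplus> f = f"
proof -
  interpret comm_group "homgrp (Dom C f) (Cod C f)" using assms by (simp add: grp)
  show "f \<boxplus> zer a b = f" "zer a b \<boxplus> f = f" using l_one[of f] r_one[of f] assms by auto
qed

definition sub (infixl "\<boxminus>" 65) where
  "f \<boxminus> g = f \<boxplus> m_inv (homgrp (Dom C f) (Cod C f)) g"

lemma sub_simps [simp]:
  assumes "f \<in> Ar C" "g \<in> Ar C" "Dom C g = Dom C f" "Cod C g = Cod C f"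
  shows "f \<boxminus> g \<in> Ar C" "Dom C (f \<boxminus> g) = Dom C f" "Cod C (f \<boxminus> g) = Cod C f"
    "(f \<boxminus> g) \<boxplus> g = f"  "(f \<boxplus> g) \<boxminus> g = f"
proof -
  interpret comm_group "homgrp (Dom C f) (Cod C f)" using assms by (simp add: grp)
  have i: "m_inv (homgrp (Dom C f) (Cod C f)) g \<in> Hom C (Dom C f) (Cod C f)"
    using inv_closed[of g] assms by simp
  show "f \<boxminus> g \<in> Ar C" "Dom C (f \<boxminus> g) = Dom C f" "Cod C (f \<boxminus> g) = Cod C f"
    using i assms by (auto simp: sub_def)
  show "(f \<boxminus> g) \<boxplus> g = f"
    using i assms m_assoc[of f "m_inv (homgrp (Dom C f) (Cod C f)) g" g] l_inv[of g] by (simp add: sub_def)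
  show "(f \<boxplus> g) \<boxminus> g = f"
    using i assms m_assoc[of f g "m_inv (homgrp (Dom C f) (Cod C f)) g"] r_inv[of g] by (simp add: sub_def)
qed

lemma add_cancel:
  assumes "f \<boxplus> h = g \<boxplus> h" "f \<in> Ar C" "g \<in> Ar C" "h \<in> Ar C" "Dom C f = Dom C h" "Cod C f = Cod C h"
    "Dom C g = Dom C h" "Cod C g = Cod C h"
  shows "f = g"
  by (metis assms sub_simps(5))

lemma sub_eqI:
  assumes "f = g \<boxplus> h" "h \<in> Ar C" "g \<in> Ar C" "Dom C g = Dom C h" "Cod C g = Cod C h"
  shows "f \<boxminus> h = g"
  unfolding assms(1) by (rule sub_simps(5)) (simp_all add: assms(2-))

lemma sub_self [simp]: "f \<in> Ar C \<Longrightarrow> f \<boxminus> f = zer (Dom C f) (Cod C f)"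
  by (rule sub_eqI) auto

lemma sub_zer [simp]: "f \<in> Ar C \<Longrightarrow> a = Dom C f \<Longrightarrow> b = Cod C f \<Longrightarrow> f \<boxminus> zer a b = f"
  by (rule sub_eqI) auto

lemma sub_eq_zerD:
  assumes "f \<boxminus> g = zer (Dom C f) (Cod C f)" "f \<in> Ar C" "g \<in> Ar C" "Dom C g = Dom C f" "Cod C g = Cod C f"
  shows "f = g"
  using assms sub_simps(4)[of f g] by simp

lemma comp_add [simp]:
  assumes "f \<in> Ar C" "g \<in> Ar C" "Dom C g = Dom C f" "Cod C g = Cod C f" "h \<in> Ar C"
  shows "Dom C h = Cod C f \<Longrightarrow> h \<cdot> (f \<boxplus> g) = h \<cdot> f \<boxplus> h \<cdot> g"
    and "Cod C h = Dom C f \<Longrightarrow> (f \<boxplus> g) \<cdot> h = f \<cdot> h \<boxplus> g \<cdot> h"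
proof -
  show "h \<cdot> (f \<boxplus> g) = h \<cdot> f \<boxplus> h \<cdot> g" if "Dom C h = Cod C f"
    using pre[unfolded preadditive_def, THEN conjunct2, rule_format,
        of "Dom C f" "Cod C f" "Cod C h" f g h h] that assms by simp
  show "(f \<boxplus> g) \<cdot> h = f \<cdot> h \<boxplus> g \<cdot> h" if "Cod C h = Dom C f"
    using pre[unfolded preadditive_def, THEN conjunct2, rule_format,
        of "Dom C h" "Cod C h" "Cod C f" h h f g] that assms by simp
qed

lemma zer_comp [simp]:
  assumes "h \<in> Ar C" "a \<in> Ob C"
  shows "Dom C h = b \<Longrightarrow> h \<cdot> zer a b = zer a (Cod C h)"
    and "Cod C h = b \<Longrightarrow> zer b a \<cdot> h = zer (Dom C h) a"
proof -
  assume b: "Dom C h = b"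
  then have bO: "b \<in> Ob C" using assms by auto
  have "h \<cdot> zer a b \<boxplus> h \<cdot> zer a b = zer a (Cod C h) \<boxplus> h \<cdot> zer a b"
    using comp_add(1)[of "zer a b" "zer a b" h] assms b bO by simp
  then show "h \<cdot> zer a b = zer a (Cod C h)"
    by (rule add_cancel) (use assms b bO in auto)
next
  assume b: "Cod C h = b"
  then have bO: "b \<in> Ob C" using assms by auto
  have "zer b a \<cdot> h \<boxplus> zer b a \<cdot> h = zer (Dom C h) a \<boxplus> zer b a \<cdot> h"
    using comp_add(2)[of "zer b a" "zer b a" h] assms b bO by simp
  then show "zer b a \<cdot> h = zer (Dom C h) a"
    by (rule add_cancel) (use assms b bO in auto)
qed

lemma comp_sub [simp]:
  assumes "f \<in> Ar C" "g \<in> Ar C" "Dom C g = Dom C f" "Cod C g = Cod C f" "h \<in> Ar C"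
  shows "Dom C h = Cod C f \<Longrightarrow> h \<cdot> (f \<boxminus> g) = h \<cdot> f \<boxminus> h \<cdot> g"
    and "Cod C h = Dom C f \<Longrightarrow> (f \<boxminus> g) \<cdot> h = f \<cdot> h \<boxminus> g \<cdot> h"
proof -
  show "h \<cdot> (f \<boxminus> g) = h \<cdot> f \<boxminus> h \<cdot> g" if "Dom C h = Cod C f"
    by (rule sub_eqI[symmetric]) (use that assms comp_add(1)[of "f \<boxminus> g" g h] in auto)
  show "(f \<boxminus> g) \<cdot> h = f \<cdot> h \<boxminus> g \<cdot> h" if "Cod C h = Dom C f"
    by (rule sub_eqI[symmetric]) (use that assms comp_add(2)[of "f \<boxminus> g" g h] in auto)
qed

subsection \<open>Zero objects, kernels and cokernels\<close>

lemma zero_object_iff: "zero_object C z \<longleftrightarrow> z \<in> Ob C \<and> Ident C z = zer z z"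
proof
  assume "zero_object C z"
  then show "z \<in> Ob C \<and> Ident C z = zer z z"
    unfolding zero_object_def by (metis Ident_in_Hom zer_Hom)
next
  assume z: "z \<in> Ob C \<and> Ident C z = zer z z"
  have "f = zer (Dom C f) z" if "f \<in> Ar C" "Cod C f = z" for f
    using that z comp_Ident(2)[of f z] zer_comp(2)[of f z z] by simp
  moreover have "f = zer z (Cod C f)" if "f \<in> Ar C" "Dom C f = z" for f
    using that z comp_Ident(1)[of f z] zer_comp(1)[of f z z] by simp
  ultimately show "zero_object C z"
    using z unfolding zero_object_def Ex1_def by (metis in_Hom zer_Hom)
qed

lemma zero_object_into: "zero_object C z \<Longrightarrow> f \<in> Ar C \<Longrightarrow> Cod C f = z \<Longrightarrow> f = zer (Dom C f) z"
  and zero_object_from: "zero_object C z \<Longrightarrow> f \<in> Ar C \<Longrightarrow> Dom C f = z \<Longrightarrow> f = zer z (Cod C f)"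
  unfolding zero_object_iff using comp_Ident[of f z] zer_comp[of f z z] by metis+

lemma obtain_zero: obtains z where "zero_object C z" "z \<in> Ob C"
  using zero_ex unfolding zero_object_def by blast

lemma zero_arrow_iff: "zero_arrow C f \<longleftrightarrow> f \<in> Ar C \<and> f = zer (Dom C f) (Cod C f)"
proof
  assume "zero_arrow C f"
  then obtain z g h where z: "f \<in> Ar C" "zero_object C z" "g \<in> Hom C (Dom C f) z" "h \<in> Hom C z (Cod C f)"
    "f = h \<cdot> g" unfolding zero_arrow_def by blast
  have g: "g = zer (Dom C f) z" using zero_object_into[OF z(2), of g] z(3) by simp
  show "f \<in> Ar C \<and> f = zer (Dom C f) (Cod C f)"
    using z(1,4,5) unfolding g by simp
next
  assume f: "f \<in> Ar C \<and> f = zer (Dom C f) (Cod C f)"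
  obtain z where z: "zero_object C z" "z \<in> Ob C" by (rule obtain_zero)
  have "f = zer z (Cod C f) \<cdot> zer (Dom C f) z" using f z by simp
  then show "zero_arrow C f" unfolding zero_arrow_def
    using f z by (intro conjI exI[of _ z] bexI[of _ "zer (Dom C f) z"] bexI[of _ "zer z (Cod C f)"]) auto
qed

lemma zero_arrow_comp:
  "f \<in> Ar C \<Longrightarrow> g \<in> Ar C \<Longrightarrow> Dom C g = Cod C f \<Longrightarrow> zero_arrow C (g \<cdot> f) \<longleftrightarrow> g \<cdot> f = zer (Dom C f) (Cod C g)"
  using zero_arrow_iff[of "g \<cdot> f"] by simp

lemma monicI:
  assumes "m \<in> Ar C" "\<And>f. f \<in> Ar C \<Longrightarrow> Cod C f = Dom C m \<Longrightarrow> m \<cdot> f = zer (Dom C f) (Cod C m)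
    \<Longrightarrow> f = zer (Dom C f) (Dom C m)"
  shows "monic C m"
  unfolding monic_def
proof (intro conjI allI ballI impI)
  show "m \<in> Ar C" by fact
  fix a f g assume fg: "f \<in> Hom C a (Dom C m)" "g \<in> Hom C a (Dom C m)" "m \<cdot> f = m \<cdot> g"
  have "f \<boxminus> g = zer (Dom C (f \<boxminus> g)) (Dom C m)"
    by (rule assms(2)) (use fg assms(1) in auto)
  then show "f = g" using sub_eq_zerD[of f g] fg assms(1) by simp
qed

lemma monic_zerD:
  assumes "monic C m" "f \<in> Ar C" "Cod C f = Dom C m" "Dom C f = a" "Dom C m = c"
    "m \<cdot> f = zer (Dom C f) (Cod C m)"
  shows "f = zer a c"
proof -
  have ob: "a \<in> Ob C" "c \<in> Ob C" using assms Dom_Ob[of f] Dom_Ob[of m] by auto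
  show ?thesis
    by (rule monicD[OF assms(1)]) (use assms ob in auto)
qed

lemma is_kernel_univ:
  "is_kernel C f k \<Longrightarrow> h \<in> Ar C \<Longrightarrow> Cod C h = Dom C f \<Longrightarrow> zero_arrow C (f \<cdot> h)
    \<Longrightarrow> \<exists>!u. u \<in> Hom C (Dom C h) (Dom C k) \<and> k \<cdot> u = h"
  unfolding is_kernel_def by blast

lemma is_kernel_simps:
  assumes "is_kernel C f k"
  shows "f \<in> Ar C" "k \<in> Ar C" "Cod C k = Dom C f" "f \<cdot> k = zer (Dom C k) (Cod C f)" "monic C k"
proof -
  show *: "f \<in> Ar C" "k \<in> Ar C" "Cod C k = Dom C f" "f \<cdot> k = zer (Dom C k) (Cod C f)"
    using assms zero_arrow_comp[of k f] unfolding is_kernel_def by simp_all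
  show "monic C k"
    unfolding monic_def
  proof (intro conjI allI ballI impI)
    fix a u v assume uv: "u \<in> Hom C a (Dom C k)" "v \<in> Hom C a (Dom C k)" "k \<cdot> u = k \<cdot> v"
    have z: "f \<cdot> (k \<cdot> v) = zer a (Cod C f)"
      using * uv by (simp add: comp_ext[OF *(4)])
    have "zero_arrow C (f \<cdot> (k \<cdot> v))"
      using zero_arrow_comp[of "k \<cdot> v" f] z * uv by simp
    then have "\<exists>!u. u \<in> Hom C a (Dom C k) \<and> k \<cdot> u = k \<cdot> v"
      using is_kernel_univ[OF assms, of "k \<cdot> v"] uv * by simp
    then show "u = v" using uv by blast
  qed (use * in simp)
qed

lemma kernel_factor:
  assumes "is_kernel C f k" "h \<in> Ar C" "Cod C h = Dom C f" "f \<cdot> h = zer (Dom C h) (Cod C f)"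
  obtains u where "u \<in> Ar C" "Dom C u = Dom C h" "Cod C u = Dom C k" "k \<cdot> u = h"
proof -
  have "zero_arrow C (f \<cdot> h)" using zero_arrow_comp[of h f] assms is_kernel_simps[OF assms(1)] by simp
  then have "\<exists>u. u \<in> Hom C (Dom C h) (Dom C k) \<and> k \<cdot> u = h"
    using is_kernel_univ[OF assms(1-3)] by blast
  then show ?thesis using that by auto
qed

lemma is_kernelI:
  assumes "f \<in> Ar C" "monic C k" "Cod C k = Dom C f" "f \<cdot> k = zer (Dom C k) (Cod C f)"
    and "\<And>h. h \<in> Ar C \<Longrightarrow> Cod C h = Dom C f \<Longrightarrow> f \<cdot> h = zer (Dom C h) (Cod C f)
      \<Longrightarrow> \<exists>u. u \<in> Ar C \<and> Dom C u = Dom C h \<and> Cod C u = Dom C k \<and> k \<cdot> u = h"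
  shows "is_kernel C f k"
  unfolding is_kernel_def
proof (intro conjI ballI impI)
  show "f \<in> Ar C" "k \<in> Ar C" "Cod C k = Dom C f" using assms by auto
  show "zero_arrow C (f \<cdot> k)" using assms zero_arrow_comp[of k f] by simp
  fix h assume h: "h \<in> Ar C" "Cod C h = Dom C f \<and> zero_arrow C (f \<cdot> h)"
  then have "f \<cdot> h = zer (Dom C h) (Cod C f)" using assms zero_arrow_comp[of h f] by simp
  then obtain u where u: "u \<in> Ar C" "Dom C u = Dom C h" "Cod C u = Dom C k" "k \<cdot> u = h"
    using assms(5) h by blast
  show "\<exists>!u. u \<in> Hom C (Dom C h) (Dom C k) \<and> k \<cdot> u = h"
    by (rule ex1I[of _ u]) (use u monicD[OF assms(2)] in auto)
qed

lemmas is_cokernel_simps = additive.is_kernel_simps[OF additive_op, simplified]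
lemmas cokernel_factor = additive.kernel_factor[OF additive_op, simplified]
lemmas is_cokernelI = additive.is_kernelI[OF additive_op, simplified]
lemmas epicI = additive.monicI[OF additive_op, simplified]
lemmas epic_zerD = additive.monic_zerD[OF additive_op, simplified]

subsection \<open>Biproducts\<close>

text \<open>The inclusions are the arrows with components \<open>(1, 0)\<close> and \<open>(0, 1)\<close>. Uniqueness of arrows into
  the product gives the last equation, since both sides have components \<open>p1\<close> and \<open>p2\<close>.\<close>

lemma product_biproduct:
  assumes P: "is_product C (UNIV :: bool set) (\<lambda>x. if x then a else b) P \<pi>" and ob: "a \<in> Ob C" "b \<in> Ob C"
  obtains i1 i2 p1 p2 where "P \<in> Ob C"
    "i1 \<in> Hom C a P" "i2 \<in> Hom C b P" "p1 \<in> Hom C P a" "p2 \<in> Hom C P b"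
    "p1 \<cdot> i1 = Ident C a" "p2 \<cdot> i2 = Ident C b" "p1 \<cdot> i2 = zer b a" "p2 \<cdot> i1 = zer a b"
    "i1 \<cdot> p1 \<boxplus> i2 \<cdot> p2 = Ident C P"
proof -
  define p1 p2 where "p1 = \<pi> True" and "p2 = \<pi> False"
  have PO: "P \<in> Ob C" "p1 \<in> Hom C P a" "p2 \<in> Hom C P b"
    using P unfolding is_product_def p1_def p2_def by (auto split: if_splits)
  have univ: "\<exists>!h. h \<in> Hom C A P \<and> p1 \<cdot> h = f \<and> p2 \<cdot> h = g"
    if "A \<in> Ob C" "f \<in> Hom C A a" "g \<in> Hom C A b" for A f g
  proof -
    have "\<exists>!h. h \<in> Hom C A P \<and> (\<forall>i\<in>UNIV. \<pi> i \<cdot> h = (if i then f else g))"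
      using P that unfolding is_product_def by (auto split: if_splits)
    then show ?thesis unfolding p1_def p2_def by (auto simp: all_bool_eq)
  qed
  obtain i1 where i1: "i1 \<in> Hom C a P" "p1 \<cdot> i1 = Ident C a" "p2 \<cdot> i1 = zer a b"
    using univ[of a "Ident C a" "zer a b"] ob by auto
  obtain i2 where i2: "i2 \<in> Hom C b P" "p1 \<cdot> i2 = zer b a" "p2 \<cdot> i2 = Ident C b"
    using univ[of b "zer b a" "Ident C b"] ob by auto
  have "i1 \<cdot> p1 \<boxplus> i2 \<cdot> p2 = Ident C P"
  proof -
    have ex1: "\<exists>!h. h \<in> Hom C P P \<and> p1 \<cdot> h = p1 \<and> p2 \<cdot> h = p2" using univ[of P p1 p2] PO by auto
    have "p1 \<cdot> (i1 \<cdot> p1 \<boxplus> i2 \<cdot> p2) = p1"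
      using PO i1 i2 ob by (auto simp: comp_ext[OF i1(2)] comp_ext[OF i2(2)])
    moreover have "p2 \<cdot> (i1 \<cdot> p1 \<boxplus> i2 \<cdot> p2) = p2"
      using PO i1 i2 ob by (auto simp: comp_ext[OF i1(3)] comp_ext[OF i2(3)])
    moreover have "i1 \<cdot> p1 \<boxplus> i2 \<cdot> p2 \<in> Hom C P P" using PO i1 i2 by simp
    moreover have "Ident C P \<in> Hom C P P \<and> p1 \<cdot> Ident C P = p1 \<and> p2 \<cdot> Ident C P = p2" using PO by simp
    ultimately show ?thesis using ex1 by blast
  qed
  then show ?thesis using that[OF PO(1) i1(1) i2(1) PO(2,3) i1(2) i2(3) i2(2) i1(3)] by simp
qed

text \<open>The equations of a biproduct are self-dual, so its inclusions make it a coproduct.\<close>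

lemma has_binary_products_op:
  assumes "has_binary_products C"
  shows "has_binary_products (op_cat C)"
  unfolding has_binary_products_def
proof (intro ballI)
  fix a b assume "a \<in> Ob (op_cat C)" "b \<in> Ob (op_cat C)"
  then have ob: "a \<in> Ob C" "b \<in> Ob C" by auto
  then obtain P \<pi> where P: "is_product C (UNIV :: bool set) (\<lambda>x. if x then a else b) P \<pi>"
    using assms unfolding has_binary_products_def by blast
  obtain i1 i2 p1 p2 where B: "P \<in> Ob C"
    "i1 \<in> Hom C a P" "i2 \<in> Hom C b P" "p1 \<in> Hom C P a" "p2 \<in> Hom C P b"
    "p1 \<cdot> i1 = Ident C a" "p2 \<cdot> i2 = Ident C b" "p1 \<cdot> i2 = zer b a" "p2 \<cdot> i1 = zer a b"
    "i1 \<cdot> p1 \<boxplus> i2 \<cdot> p2 = Ident C P"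
    by (rule product_biproduct[OF P ob])
  note [simp] = B[unfolded in_Hom] ob
  define \<iota> where "\<iota> x = (if x then i1 else i2)" for x
  have "is_product (op_cat C) UNIV (\<lambda>x. if x then a else b) P \<iota>"
    unfolding is_product_def
  proof (intro conjI ballI allI impI)
    fix A g assume "A \<in> Ob (op_cat C)" and g: "\<forall>i\<in>UNIV. g i \<in> Hom (op_cat C) A (if i then a else b)"
    have g1[simp]: "g True \<in> Ar C" "Dom C (g True) = a" "Cod C (g True) = A"
      "g False \<in> Ar C" "Dom C (g False) = b" "Cod C (g False) = A"
      using g[rule_format, of True] g[rule_format, of False] by auto
    define h where "h = g True \<cdot> p1 \<boxplus> g False \<cdot> p2"
    have h[simp]: "h \<in> Ar C" "Dom C h = P" "Cod C h = A" unfolding h_def by auto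
    show "\<exists>!h. h \<in> Hom (op_cat C) A P \<and> (\<forall>i\<in>UNIV. \<iota> i \<cdot>\<^bsub>op_cat C\<^esub> h = g i)"
    proof (rule ex1I[of _ h])
      have "h \<cdot> i1 = g True" "h \<cdot> i2 = g False" unfolding h_def by simp_all
      then show "h \<in> Hom (op_cat C) A P \<and> (\<forall>i\<in>UNIV. \<iota> i \<cdot>\<^bsub>op_cat C\<^esub> h = g i)"
        by (simp add: \<iota>_def)
      fix h' assume h': "h' \<in> Hom (op_cat C) A P \<and> (\<forall>i\<in>UNIV. \<iota> i \<cdot>\<^bsub>op_cat C\<^esub> h' = g i)"
      have a: "h' \<in> Ar C" "Dom C h' = P" using h' by auto
      have e: "h' \<cdot> i1 = g True" "h' \<cdot> i2 = g False"
        using h'[THEN conjunct2, rule_format, of True] h'[THEN conjunct2, rule_format, of False]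
        by (auto simp: \<iota>_def)
      have "h' \<cdot> (i1 \<cdot> p1 \<boxplus> i2 \<cdot> p2) = h"
        unfolding h_def using a by (simp add: comp_ext[OF e(1)] comp_ext[OF e(2)] del: B(10))
      then show "h' = h" using a by simp
    qed
  qed (auto simp: \<iota>_def)
  then show "\<exists>P \<pi>. is_product (op_cat C) (UNIV :: bool set) (\<lambda>x. if x then a else b) P \<pi>" by blast
qed

end

subsection \<open>Abelian categories\<close>

locale abelian = additive +
  assumes ab: "abelian_category C"

lemma abelian_obtain:
  assumes "abelian_category C"
  obtains add zer where "abelian C add zer"
  using assms unfolding abelian_def abelian_axioms_def additive_def additive_axioms_def abelian_category_def
  by auto

context abelian
begin

lemma abelian_op: "abelian (op_cat C) add (\<lambda>a b. zer b a)"
  by (intro abelian.intro abelian_axioms.intro additive_op abelian_category_op ab)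

lemma obtain_biproduct:
  assumes "a \<in> Ob C" "b \<in> Ob C"
  obtains P i1 i2 p1 p2 where "P \<in> Ob C"
    "i1 \<in> Hom C a P" "i2 \<in> Hom C b P" "p1 \<in> Hom C P a" "p2 \<in> Hom C P b"
    "p1 \<cdot> i1 = Ident C a" "p2 \<cdot> i2 = Ident C b" "p1 \<cdot> i2 = zer b a" "p2 \<cdot> i1 = zer a b"
    "i1 \<cdot> p1 \<boxplus> i2 \<cdot> p2 = Ident C P"
proof -
  obtain P \<pi> where P: "is_product C (UNIV :: bool set) (\<lambda>x. if x then a else b) P \<pi>"
    using ab assms unfolding abelian_category_def has_binary_products_def by blast
  show ?thesis by (rule product_biproduct[OF P assms]) (rule that)
qed

lemma ex_kernel: "f \<in> Ar C \<Longrightarrow> \<exists>k. is_kernel C f k"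
  and ex_cokernel: "f \<in> Ar C \<Longrightarrow> \<exists>c. is_cokernel C f c"
  using ab unfolding abelian_category_def by blast+

text \<open>Being the kernel of some \<open>f\<close>, the monomorphism \<open>m\<close> is the kernel of its cokernel \<open>c\<close>: as \<open>f\<close> factors
  through \<open>c\<close>, every arrow killed by \<open>c\<close> is killed by \<open>f\<close>.\<close>

lemma monic_kernel_of_cokernel:
  assumes "monic C m" "is_cokernel C m c"
  shows "is_kernel C c m"
proof -
  obtain f where f: "is_kernel C f m"
    using ab assms unfolding abelian_category_def by blast
  note F = is_kernel_simps[OF f] and K = is_cokernel_simps[OF assms(2)]
  obtain f' where f': "f' \<in> Ar C" "Cod C f' = Cod C f" "Dom C f' = Cod C c" "f' \<cdot> c = f"
    by (rule cokernel_factor[OF assms(2), of f]) (use F in auto)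
  show ?thesis
  proof (rule is_kernelI)
    fix h assume h: "h \<in> Ar C" "Cod C h = Dom C c" "c \<cdot> h = zer (Dom C h) (Cod C c)"
    have "f \<cdot> h = zer (Dom C h) (Cod C f)"
      using h f'(1-3) K F by (simp add: comp_ext[OF f'(4), symmetric])
    note fct = this
    obtain u where "u \<in> Ar C" "Dom C u = Dom C h" "Cod C u = Dom C m" "m \<cdot> u = h"
      by (rule kernel_factor[OF f, of h]) (use fct h K F in auto)
    then show "\<exists>u. u \<in> Ar C \<and> Dom C u = Dom C h \<and> Cod C u = Dom C m \<and> m \<cdot> u = h" by blast
  qed (use K F assms in auto)
qed

lemmas epic_cokernel_of_kernel = abelian.monic_kernel_of_cokernel[OF abelian_op, simplified]

lemma short_exact_iff_kernel: "short_exact C k e \<longleftrightarrow> is_kernel C e k \<and> epic C e"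
  using epic_cokernel_of_kernel is_cokernel_simps unfolding short_exact_def by blast

lemma short_exact_iff_cokernel: "short_exact C m c \<longleftrightarrow> is_cokernel C m c \<and> monic C m"
  using monic_kernel_of_cokernel is_kernel_simps unfolding short_exact_def by blast

lemma short_exact_simps:
  assumes "short_exact C f g"
  shows "f \<in> Ar C" "g \<in> Ar C" "Cod C f = Dom C g" "g \<cdot> f = zer (Dom C f) (Cod C g)" "monic C f" "epic C g"
    "is_kernel C g f" "is_cokernel C f g"
  using assms is_kernel_simps[of g f] unfolding short_exact_iff_kernel
  by (auto intro: epic_cokernel_of_kernel)

end


section \<open>Exactness in abelian categories\<close>

definition is_pullback :: "('o, 'm) cat \<Rightarrow> 'm \<Rightarrow> 'm \<Rightarrow> 'm \<Rightarrow> 'm \<Rightarrow> bool" where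
  "is_pullback C f g p q \<longleftrightarrow>
     f \<in> Ar C \<and> g \<in> Ar C \<and> p \<in> Ar C \<and> q \<in> Ar C \<and> Cod C f = Cod C g \<and> Dom C p = Dom C q \<and>
     Cod C p = Dom C f \<and> Cod C q = Dom C g \<and> f \<cdot>\<^bsub>C\<^esub> p = g \<cdot>\<^bsub>C\<^esub> q \<and>
     (\<forall>x\<in>Ar C. \<forall>y\<in>Ar C. Dom C x = Dom C y \<and> Cod C x = Dom C f \<and> Cod C y = Dom C g \<and>
        f \<cdot>\<^bsub>C\<^esub> x = g \<cdot>\<^bsub>C\<^esub> y \<longrightarrow>
        (\<exists>!u. u \<in> Hom C (Dom C x) (Dom C p) \<and> p \<cdot>\<^bsub>C\<^esub> u = x \<and> q \<cdot>\<^bsub>C\<^esub> u = y))"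

definition is_pushout :: "('o, 'm) cat \<Rightarrow> 'm \<Rightarrow> 'm \<Rightarrow> 'm \<Rightarrow> 'm \<Rightarrow> bool" where
  "is_pushout C = is_pullback (op_cat C)"

lemma is_pullback_op [simp]: "is_pullback (op_cat C) = is_pushout C"
  by (simp add: is_pushout_def)

lemma is_pullback_simps:
  assumes "is_pullback C f g p q"
  shows "f \<in> Ar C" "g \<in> Ar C" "p \<in> Ar C" "q \<in> Ar C" "Cod C f = Cod C g" "Dom C p = Dom C q"
     "Cod C p = Dom C f" "Cod C q = Dom C g" "f \<cdot>\<^bsub>C\<^esub> p = g \<cdot>\<^bsub>C\<^esub> q"
  using assms by (simp_all add: is_pullback_def)

lemma pullback_univ:
  assumes "is_pullback C f g p q" "x \<in> Ar C" "y \<in> Ar C" "Dom C x = Dom C y" "Cod C x = Dom C f"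
    "Cod C y = Dom C g" "f \<cdot>\<^bsub>C\<^esub> x = g \<cdot>\<^bsub>C\<^esub> y"
  shows "\<exists>!u. u \<in> Hom C (Dom C x) (Dom C p) \<and> p \<cdot>\<^bsub>C\<^esub> u = x \<and> q \<cdot>\<^bsub>C\<^esub> u = y"
  using assms unfolding is_pullback_def by (elim conjE) (drule (1) bspec, drule (1) bspec, simp)

lemma is_pullback_sym:
  assumes "is_pullback C f g p q"
  shows "is_pullback C g f q p"
proof -
  note P = is_pullback_simps[OF assms]
  have "\<exists>!u. u \<in> Hom C (Dom C x) (Dom C q) \<and> q \<cdot>\<^bsub>C\<^esub> u = x \<and> p \<cdot>\<^bsub>C\<^esub> u = y"
    if "x \<in> Ar C" "y \<in> Ar C" "Dom C x = Dom C y" "Cod C x = Dom C g" "Cod C y = Dom C f"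
      "g \<cdot>\<^bsub>C\<^esub> x = f \<cdot>\<^bsub>C\<^esub> y" for x y
    using pullback_univ[OF assms that(2,1) that(3)[symmetric] that(5,4) that(6)[symmetric]] P(6) that(3)
    by (simp only: conj_commute[of "p \<cdot>\<^bsub>C\<^esub> _ = y"])
  then show ?thesis
    using P unfolding is_pullback_def by simp
qed

lemma is_pushout_sym: "is_pushout C f g p q \<Longrightarrow> is_pushout C g f q p"
  unfolding is_pushout_def by (rule is_pullback_sym)

context abelian
begin

lemma pullback_factor:
  assumes "is_pullback C f g p q" "x \<in> Ar C" "y \<in> Ar C" "Dom C x = Dom C y" "Cod C x = Dom C f"
    "Cod C y = Dom C g" "f \<cdot> x = g \<cdot> y"
  obtains u where "u \<in> Ar C" "Dom C u = Dom C x" "Cod C u = Dom C p" "p \<cdot> u = x" "q \<cdot> u = y"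
  using pullback_univ[OF assms] by auto

lemma pullback_unique:
  assumes "is_pullback C f g p q" "u \<in> Ar C" "v \<in> Ar C" "Dom C u = Dom C v" "Cod C u = Dom C p"
    "Cod C v = Dom C p" "p \<cdot> u = p \<cdot> v" "q \<cdot> u = q \<cdot> v"
  shows "u = v"
proof -
  note P = is_pullback_simps[OF assms(1)]
  have v: "p \<cdot> v \<in> Ar C" "q \<cdot> v \<in> Ar C" "Dom C (p \<cdot> v) = Dom C (q \<cdot> v)" "Cod C (p \<cdot> v) = Dom C f"
    "Cod C (q \<cdot> v) = Dom C g" "f \<cdot> (p \<cdot> v) = g \<cdot> (q \<cdot> v)" "Dom C (p \<cdot> v) = Dom C v"
    using assms(2-6) P by (simp_all add: comp_ext2[OF P(9)])
  have "\<exists>!w. w \<in> Hom C (Dom C v) (Dom C p) \<and> p \<cdot> w = p \<cdot> v \<and> q \<cdot> w = q \<cdot> v"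
    using pullback_univ[OF assms(1) v(1-6)] unfolding v(7) .
  moreover have "u \<in> Hom C (Dom C v) (Dom C p)" "v \<in> Hom C (Dom C v) (Dom C p)"
    using assms(2-6) by simp_all
  ultimately show ?thesis using assms(7,8) by blast
qed

text \<open>The pullback is the kernel of \<open>d = (f, -g)\<close> on the biproduct. If \<open>f\<close> is epic, so is \<open>d\<close>, which is then
  the cokernel of its kernel: an arrow \<open>h\<close> that kills the projection to \<open>Dom g\<close> factors through \<open>d\<close>, and the factor
  vanishes because it kills \<open>f\<close>.\<close>

lemma ex_pullback:
  assumes [simp]: "f \<in> Ar C" "g \<in> Ar C" and c: "Cod C g = Cod C f"
  shows "\<exists>p q. is_pullback C f g p q \<and> (epic C f \<longrightarrow> epic C q)"
proof -
  note [simp] = c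
  obtain P i1 i2 p1 p2 where B: "P \<in> Ob C"
    "i1 \<in> Hom C (Dom C f) P" "i2 \<in> Hom C (Dom C g) P" "p1 \<in> Hom C P (Dom C f)" "p2 \<in> Hom C P (Dom C g)"
    "p1 \<cdot> i1 = Ident C (Dom C f)" "p2 \<cdot> i2 = Ident C (Dom C g)" "p1 \<cdot> i2 = zer (Dom C g) (Dom C f)"
    "p2 \<cdot> i1 = zer (Dom C f) (Dom C g)" "i1 \<cdot> p1 \<boxplus> i2 \<cdot> p2 = Ident C P"
    by (rule obtain_biproduct[of "Dom C f" "Dom C g"]) auto
  note [simp] = B[unfolded in_Hom]
  define d where "d = f \<cdot> p1 \<boxminus> g \<cdot> p2"
  have d[simp]: "d \<in> Ar C" "Dom C d = P" "Cod C d = Cod C f" unfolding d_def by auto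
  obtain k where k: "is_kernel C d k" using ex_kernel[OF d(1)] by blast
  note K = is_kernel_simps[OF k]
  note [simp] = K(2-4)
  have eq: "f \<cdot> (p1 \<cdot> k) = g \<cdot> (p2 \<cdot> k)"
  proof (rule sub_eq_zerD)
    show "f \<cdot> (p1 \<cdot> k) \<boxminus> g \<cdot> (p2 \<cdot> k) = zer (Dom C (f \<cdot> (p1 \<cdot> k))) (Cod C (f \<cdot> (p1 \<cdot> k)))"
      using K(4) unfolding d_def by simp
  qed auto
  have uniq: "u = v" if "u \<in> Ar C" "v \<in> Ar C" "Dom C u = Dom C v" "Cod C u = Dom C k" "Cod C v = Dom C k"
    "p1 \<cdot> (k \<cdot> u) = p1 \<cdot> (k \<cdot> v)" "p2 \<cdot> (k \<cdot> u) = p2 \<cdot> (k \<cdot> v)" for u v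
  proof (rule monicD[OF K(5)])
    have "(i1 \<cdot> p1 \<boxplus> i2 \<cdot> p2) \<cdot> (k \<cdot> u) = (i1 \<cdot> p1 \<boxplus> i2 \<cdot> p2) \<cdot> (k \<cdot> v)"
      using that by (simp del: B(10))
    then show "k \<cdot> u = k \<cdot> v" using that by simp
  qed (use that in auto)
  have pb: "is_pullback C f g (p1 \<cdot> k) (p2 \<cdot> k)"
    unfolding is_pullback_def
  proof (intro conjI ballI impI)
    fix x y assume xy: "x \<in> Ar C" "y \<in> Ar C"
      "Dom C x = Dom C y \<and> Cod C x = Dom C f \<and> Cod C y = Dom C g \<and> f \<cdot> x = g \<cdot> y"
    define h where "h = i1 \<cdot> x \<boxplus> i2 \<cdot> y"
    have h[simp]: "h \<in> Ar C" "Dom C h = Dom C x" "Cod C h = P" unfolding h_def using xy by auto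
    have h1: "p1 \<cdot> h = x" "p2 \<cdot> h = y" unfolding h_def
      using xy
      by (simp_all add: comp_ext[OF B(6)] comp_ext[OF B(8)] comp_ext[OF B(9)] comp_ext[OF B(7)])
    have "d \<cdot> h = zer (Dom C h) (Cod C d)"
      unfolding d_def using h1 xy by simp
    note fct = this
    obtain u where u: "u \<in> Ar C" "Dom C u = Dom C h" "Cod C u = Dom C k" "k \<cdot> u = h"
      by (rule kernel_factor[OF k, of h]) (use fct in auto)
    show "\<exists>!u. u \<in> Hom C (Dom C x) (Dom C (p1 \<cdot> k)) \<and> (p1 \<cdot> k) \<cdot> u = x \<and> (p2 \<cdot> k) \<cdot> u = y"
    proof (rule ex1I[of _ u])
      show *: "u \<in> Hom C (Dom C x) (Dom C (p1 \<cdot> k)) \<and> (p1 \<cdot> k) \<cdot> u = x \<and> (p2 \<cdot> k) \<cdot> u = y"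
        using u h1 by simp
      fix v assume v: "v \<in> Hom C (Dom C x) (Dom C (p1 \<cdot> k)) \<and> (p1 \<cdot> k) \<cdot> v = x \<and> (p2 \<cdot> k) \<cdot> v = y"
      then have v1: "v \<in> Ar C" "Dom C v = Dom C x" "Cod C v = Dom C k"
        and v2: "(p1 \<cdot> k) \<cdot> v = x" "(p2 \<cdot> k) \<cdot> v = y" by simp_all
      have "p1 \<cdot> (k \<cdot> v) = x" "p2 \<cdot> (k \<cdot> v) = y" using v1 v2 by simp_all
      then show "v = u" using uniq[of v u] v1 u h1 by simp
    qed
  qed (use eq in auto)
  have "epic C (p2 \<cdot> k)" if f: "epic C f"
  proof (rule epicI)
    fix h assume h: "h \<in> Ar C" "Dom C h = Cod C (p2 \<cdot> k)" "h \<cdot> (p2 \<cdot> k) = zer (Dom C (p2 \<cdot> k)) (Cod C h)"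
    have di: "d \<cdot> i1 = f" unfolding d_def by (simp add: comp_ext[OF B(6)])
    have "epic C d" by (rule epic_cancel[of _ i1]) (use f di in auto)
    then have "is_cokernel C k d" using epic_cokernel_of_kernel k by blast
    note fct = this
    obtain t where t: "t \<in> Ar C" "Cod C t = Cod C h" "Dom C t = Cod C d" "t \<cdot> d = h \<cdot> p2"
      by (rule cokernel_factor[of k d "h \<cdot> p2"]) (use fct h in auto)
    have "t \<cdot> (d \<cdot> i1) = (h \<cdot> p2) \<cdot> i1"
      by (rule comp_ext[OF t(4)]) (use t h in auto)
    then have tf: "t \<cdot> f = zer (Dom C f) (Cod C h)"
      using di h by simp
    have "t = zer (Cod C f) (Cod C h)"
      by (rule epic_zerD[OF f]) (use t tf in auto)
    then have hp: "h \<cdot> p2 = zer P (Cod C h)" using t h by simp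
    have "h \<cdot> (p2 \<cdot> i2) = zer (Dom C g) (Cod C h)"
      by (subst comp_ext[OF hp]) (use h in auto)
    then show "h = zer (Cod C (p2 \<cdot> k)) (Cod C h)"
      using h by simp
  qed auto
  then show ?thesis using pb by blast
qed

text \<open>One pullback with an epimorphism as projection exists, and it factors through any other.\<close>

lemma pullback_epic:
  assumes pb: "is_pullback C f g p q" and f: "epic C f"
  shows "epic C q"
proof -
  note P = is_pullback_simps[OF pb]
  obtain p' q' where p': "is_pullback C f g p' q'" "epic C q'"
    using ex_pullback[of f g] P f by auto
  note P' = is_pullback_simps[OF p'(1)]
  obtain u where "u \<in> Ar C" "Dom C u = Dom C p'" "Cod C u = Dom C p" "p \<cdot> u = p'" "q \<cdot> u = q'"
    by (rule pullback_factor[OF pb, of p' q']) (use P' in auto)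
  note u = this
  show ?thesis
    by (rule epic_cancel[of q u]) (use P P' p' u in auto)
qed

text \<open>The kernel of the projection is the arrow with components \<open>(k, 0)\<close>.\<close>

lemma pullback_kernel:
  assumes pb: "is_pullback C f g p q" and k: "is_kernel C f k"
  shows "\<exists>k'. is_kernel C q k' \<and> p \<cdot> k' = k"
proof -
  note P = is_pullback_simps[OF pb] and K = is_kernel_simps[OF k]
  obtain k' where k': "k' \<in> Ar C" "Dom C k' = Dom C k" "Cod C k' = Dom C p" "p \<cdot> k' = k"
      "q \<cdot> k' = zer (Dom C k) (Dom C g)"
    by (rule pullback_factor[OF pb, of k "zer (Dom C k) (Dom C g)"]) (use P K in auto)
  have "is_kernel C q k'"
  proof (rule is_kernelI)
    show "monic C k'" by (rule monic_cancel[of p]) (use k' K P in auto)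
    fix h assume h: "h \<in> Ar C" "Cod C h = Dom C q" "q \<cdot> h = zer (Dom C h) (Cod C q)"
    have "f \<cdot> (p \<cdot> h) = zer (Dom C h) (Cod C f)"
      using h P by (simp add: comp_ext2[OF P(9)])
    note fct = this
    obtain u where u: "u \<in> Ar C" "Dom C u = Dom C h" "Cod C u = Dom C k" "k \<cdot> u = p \<cdot> h"
      by (rule kernel_factor[OF k, of "p \<cdot> h"]) (use fct h P in auto)
    have "k' \<cdot> u = h"
      by (rule pullback_unique[OF pb])
         (use h u P K k' in \<open>auto simp: comp_ext[OF k'(4)] comp_ext[OF k'(5)]\<close>)
    then show "\<exists>u. u \<in> Ar C \<and> Dom C u = Dom C h \<and> Cod C u = Dom C k' \<and> k' \<cdot> u = h"
      using u k' by auto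
  qed (use k' P in auto)
  then show ?thesis using k' by blast
qed

lemmas is_pushout_simps = is_pullback_simps[of "op_cat C", simplified]
lemmas pushout_monic = abelian.pullback_epic[OF abelian_op, simplified]
lemmas pushout_cokernel = abelian.pullback_kernel[OF abelian_op, simplified]
lemmas ex_pushout = abelian.ex_pullback[OF abelian_op, simplified]

subsection \<open>Split sequences and cokernels of composites\<close>

text \<open>Since \<open>1 - s \<cdot> g\<close> is killed by \<open>g\<close>, it factors as \<open>f \<cdot> r\<close>; this \<open>r\<close> is the retraction.\<close>

lemma split_retraction:
  assumes fg: "short_exact C f g" and s: "s \<in> Ar C" "Dom C s = Cod C g" "Cod C s = Dom C g"
    "g \<cdot> s = Ident C (Cod C g)"
  shows "\<exists>r. short_exact C s r \<and> r \<cdot> f = Ident C (Dom C f) \<and> Cod C r = Dom C f"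
proof -
  note S = short_exact_simps[OF fg]
  let ?e = "Ident C (Dom C g) \<boxminus> s \<cdot> g"
  have e: "?e \<in> Ar C" "Dom C ?e = Dom C g" "Cod C ?e = Dom C g" using S s by auto
  have ge: "g \<cdot> ?e = zer (Dom C g) (Cod C g)"
    using S s by (simp add: comp_ext[OF s(4)])
  obtain r where r: "r \<in> Ar C" "Dom C r = Dom C g" "Cod C r = Dom C f" "f \<cdot> r = ?e"
    by (rule kernel_factor[OF S(7), of ?e]) (use e ge S in auto)
  have rf: "r \<cdot> f = Ident C (Dom C f)"
    by (rule monicD[OF S(5)]) (use S s r in \<open>auto simp: comp_ext[OF r(4)]\<close>)
  have rs: "r \<cdot> s = zer (Dom C s) (Cod C r)"
    by (rule monicD[OF S(5)]) (use S s r in \<open>auto simp: comp_ext[OF r(4)]\<close>)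
  have "short_exact C s r"
    unfolding short_exact_iff_kernel
  proof
    show "epic C r" by (rule split_epic[of _ f]) (use r S rf in auto)
    show "is_kernel C r s"
    proof (rule is_kernelI)
      show "monic C s" by (rule split_monic[of g]) (use s S in auto)
      fix h assume h: "h \<in> Ar C" "Cod C h = Dom C r" "r \<cdot> h = zer (Dom C h) (Cod C r)"
      have "(f \<cdot> r) \<cdot> h = zer (Dom C h) (Dom C g)"
        using h r(1-3) S by simp
      then have "?e \<cdot> h = zer (Dom C h) (Dom C g)" unfolding r(4) .
      then have z: "h \<boxminus> s \<cdot> (g \<cdot> h) = zer (Dom C h) (Dom C g)"
        using h r S s by simp
      have "h = s \<cdot> (g \<cdot> h)"
        by (rule sub_eq_zerD) (use z h r S s in auto)
      then show "\<exists>u. u \<in> Ar C \<and> Dom C u = Dom C h \<and> Cod C u = Dom C s \<and> s \<cdot> u = h"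
        using h r S s by (intro exI[of _ "g \<cdot> h"]) simp
    qed (use r s rs in auto)
  qed
  then show ?thesis using rf r by blast
qed

lemmas retraction_split = abelian.split_retraction[OF abelian_op, simplified]

text \<open>This is the isomorphism theorem \<open>(A/C)/(B/C) = A/B\<close>.\<close>

lemma cokernel_comp_monic:
  assumes m1: "short_exact C m1 c1" and m2: "short_exact C m2 c2" and c: "short_exact C (m2 \<cdot> m1) c"
    and [simp]: "Dom C m2 = Cod C m1"
  shows "\<exists>\<phi> \<theta>. short_exact C \<phi> \<theta> \<and> Dom C \<phi> = Cod C c1 \<and> Dom C \<theta> = Cod C c \<and> Cod C \<theta> = Cod C c2"
proof -
  note S1 = short_exact_simps[OF m1] and S2 = short_exact_simps[OF m2] and S = short_exact_simps[OF c]
  note [simp] = S1(1,2,3) S2(1,2,3) S(2)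
  have Dc[simp]: "Dom C c = Dom C c2" using S(3) by simp
  have m21: "c \<cdot> (m2 \<cdot> m1) = zer (Dom C m1) (Cod C c)" using S(4) by simp
  obtain \<phi> where ph: "\<phi> \<in> Ar C" "Cod C \<phi> = Cod C c" "Dom C \<phi> = Cod C c1" "\<phi> \<cdot> c1 = c \<cdot> m2"
    by (rule cokernel_factor[OF S1(8), of "c \<cdot> m2"]) (use m21 in auto)
  obtain \<theta> where th: "\<theta> \<in> Ar C" "Cod C \<theta> = Cod C c2" "Dom C \<theta> = Cod C c" "\<theta> \<cdot> c = c2"
    by (rule cokernel_factor[OF S(8), of c2]) (auto simp: S2(4) comp_ext[OF S2(4)])
  note [simp] = ph(1-3) th(1-3)
  have tp: "\<theta> \<cdot> \<phi> = zer (Dom C \<phi>) (Cod C \<theta>)"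
    by (rule epicD[OF S1(6)]) (use ph th S2(4) in \<open>auto simp: comp_ext[OF th(4)]\<close>)
  have "short_exact C \<phi> \<theta>"
    unfolding short_exact_iff_cokernel
  proof
    show "is_cokernel C \<phi> \<theta>"
    proof (rule is_cokernelI)
      show "epic C \<theta>" by (rule epic_cancel[of _ c]) (use th S2 in auto)
      fix t assume t: "t \<in> Ar C" "Dom C t = Cod C \<phi>" "t \<cdot> \<phi> = zer (Dom C \<phi>) (Cod C t)"
      have "t \<cdot> (c \<cdot> m2) = zer (Dom C m2) (Cod C t)"
        using t(1,2) by (simp add: ph(4)[symmetric] comp_ext[OF t(3)])
      note fct = this
      obtain t' where t': "t' \<in> Ar C" "Cod C t' = Cod C t" "Dom C t' = Cod C c2" "t' \<cdot> c2 = t \<cdot> c"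
        by (rule cokernel_factor[OF S2(8), of "t \<cdot> c"]) (use fct t in auto)
      have "t' \<cdot> \<theta> = t" by (rule epicD[OF S(6)]) (use t t' th in auto)
      then show "\<exists>u. u \<in> Ar C \<and> Cod C u = Cod C t \<and> Dom C u = Cod C \<theta> \<and> u \<cdot> \<theta> = t"
        using t' by auto
    qed (use tp in auto)
    show "monic C \<phi>"
    proof (rule monicI)
      fix h assume h: "h \<in> Ar C" "Cod C h = Dom C \<phi>" "\<phi> \<cdot> h = zer (Dom C h) (Cod C \<phi>)"
      obtain p q where pq: "is_pullback C c1 h p q" "epic C q"
        using ex_pullback[of c1 h] S1 h by auto
      note P = is_pullback_simps[OF pq(1)]
      have "c \<cdot> (m2 \<cdot> p) = zer (Dom C p) (Cod C c)"
        using P h by (simp add: comp_ext[OF ph(4)[symmetric]] comp_ext[OF h(3)])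
      note fct = this
      obtain s where s: "s \<in> Ar C" "Dom C s = Dom C p" "Cod C s = Dom C m1" "(m2 \<cdot> m1) \<cdot> s = m2 \<cdot> p"
        by (rule kernel_factor[OF S(7), of "m2 \<cdot> p"]) (use fct P in auto)
      have "m1 \<cdot> s = p" by (rule monicD[OF S2(5)]) (use s P in auto)
      then have cp: "c1 \<cdot> p = zer (Dom C p) (Cod C c1)"
        using s by (auto simp: comp_ext[OF S1(4)])
      show "h = zer (Dom C h) (Dom C \<phi>)"
        by (rule epicD[OF pq(2)]) (use P h cp in auto)
    qed auto
  qed
  then show ?thesis by (intro exI[of _ \<phi>] exI[of _ \<theta>]) auto
qed

end


section \<open>Vanishing of first extensions and lifting\<close>

text \<open>The vanishing of \<open>Ext\<^sup>1(w, y)\<close> as an extension property, which is the form in which it combines with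
  lifting problems. The comparison with Yoneda extensions is postponed to \<open>Ext_zero_iff_orth\<close>.\<close>

definition orth :: "('o, 'm) cat \<Rightarrow> 'o \<Rightarrow> 'o \<Rightarrow> bool" where
  "orth C w y \<longleftrightarrow> (\<forall>f g u. short_exact C f g \<and> Cod C g = w \<and> u \<in> Hom C (Dom C f) y \<longrightarrow>
     (\<exists>v. v \<in> Hom C (Cod C f) y \<and> v \<cdot>\<^bsub>C\<^esub> f = u))"

definition obj_retract :: "('o, 'm) cat \<Rightarrow> 'o \<Rightarrow> 'o \<Rightarrow> bool" where
  "obj_retract C a b \<longleftrightarrow> (\<exists>i r. i \<in> Hom C a b \<and> r \<in> Hom C b a \<and> r \<cdot>\<^bsub>C\<^esub> i = Ident C a)"

context abelian
begin

lemma orthD: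
  assumes "orth C w y" "short_exact C f g" "Cod C g = w" "u \<in> Ar C" "Dom C u = Dom C f" "Cod C u = y"
  obtains v where "v \<in> Ar C" "Dom C v = Cod C f" "Cod C v = y" "v \<cdot> f = u"
  using assms unfolding orth_def in_Hom by blast

lemma orth_retraction:
  assumes o: "orth C w y" and fg: "short_exact C f g" "Cod C g = w" "Dom C f = y"
  obtains r where "r \<in> Ar C" "Dom C r = Cod C f" "Cod C r = y" "r \<cdot> f = Ident C y"
  by (rule orthD[OF o fg(1,2), of "Ident C y"]) (use fg short_exact_simps[OF fg(1)] in auto)

text \<open>Pushing an extension out along \<open>u\<close> replaces the problem of extending \<open>u\<close> by that of extending the
  identity.\<close>

lemma orthI_retraction:
  assumes "\<And>f g. short_exact C f g \<Longrightarrow> Cod C g = w \<Longrightarrow> Dom C f = y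
    \<Longrightarrow> \<exists>r. r \<in> Ar C \<and> Dom C r = Cod C f \<and> Cod C r = y \<and> r \<cdot> f = Ident C y"
  shows "orth C w y"
  unfolding orth_def in_Hom
proof (intro allI impI)
  fix f g u assume a: "short_exact C f g \<and> Cod C g = w \<and> u \<in> Ar C \<and> Dom C u = Dom C f \<and> Cod C u = y"
  then have fg: "short_exact C f g" and w: "Cod C g = w" and u: "u \<in> Ar C" "Dom C u = Dom C f" "Cod C u = y"
    by auto
  note S = short_exact_simps[OF fg]
  obtain p q where pq: "is_pushout C f u p q" "monic C q"
    using ex_pushout[of f u] S u by auto
  note P = is_pushout_simps[OF pq(1)]
  obtain c where c: "is_cokernel C q c" "c \<cdot> p = g"
    using pushout_cokernel[OF pq(1) S(8)] by auto
  note K = is_cokernel_simps[OF c(1)]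
  have "Cod C (c \<cdot> p) = Cod C c" using K P by simp
  then have Cc: "Cod C c = w" unfolding c(2) w by simp
  have "short_exact C q c" unfolding short_exact_iff_cokernel using c pq by simp
  then obtain r where r: "r \<in> Ar C" "Dom C r = Cod C q" "Cod C r = y" "r \<cdot> q = Ident C y"
    using assms[of q c] P u Cc by auto
  have "r \<cdot> (p \<cdot> f) = u"
    unfolding P(9) using r(1-3) P(1-8) u by (simp add: comp_ext[OF r(4)])
  then show "\<exists>v. (v \<in> Ar C \<and> Dom C v = Cod C f \<and> Cod C v = y) \<and> v \<cdot> f = u"
    using r(1-3) P(1-8) by (intro exI[of _ "r \<cdot> p"]) simp
qed

lemma orthI_section:
  assumes "y \<in> Ob C" "\<And>f g. short_exact C f g \<Longrightarrow> Cod C g = w \<Longrightarrow> Dom C f = y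
    \<Longrightarrow> \<exists>s. s \<in> Ar C \<and> Dom C s = w \<and> Cod C s = Dom C g \<and> g \<cdot> s = Ident C w"
  shows "orth C w y"
proof (rule orthI_retraction)
  fix f g assume fg: "short_exact C f g" "Cod C g = w" "Dom C f = y"
  then obtain s where s: "s \<in> Ar C" "Dom C s = Cod C g" "Cod C s = Dom C g" "g \<cdot> s = Ident C (Cod C g)"
    using assms(2)[OF fg] by auto
  obtain r where r: "short_exact C s r" "r \<cdot> f = Ident C (Dom C f)" "Cod C r = Dom C f"
    using split_retraction[OF fg(1) s] by blast
  show "\<exists>r. r \<in> Ar C \<and> Dom C r = Cod C f \<and> Cod C r = y \<and> r \<cdot> f = Ident C y"
    using short_exact_simps[OF r(1)] short_exact_simps[OF fg(1)] r fg s by (intro exI[of _ r]) auto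
qed

lemma short_exact_zer_Ident:
  assumes "zero_object C z" "a \<in> Ob C"
  shows "short_exact C (zer z a) (Ident C a)"
  unfolding short_exact_iff_kernel
proof
  have z: "z \<in> Ob C" using assms by (simp add: zero_object_iff)
  show "is_kernel C (Ident C a) (zer z a)"
  proof (rule is_kernelI)
    show "monic C (zer z a)"
    proof (rule monicI)
      show "f = zer (Dom C f) (Dom C (zer z a))" if "f \<in> Ar C" "Cod C f = Dom C (zer z a)" for f
        using zero_object_into[OF assms(1), of f] that z assms by simp
    qed (use z assms in auto)
    show "\<exists>u. u \<in> Ar C \<and> Dom C u = Dom C h \<and> Cod C u = Dom C (zer z a) \<and> zer z a \<cdot> u = h"
      if h: "h \<in> Ar C" "Cod C h = Dom C (Ident C a)" "Ident C a \<cdot> h = zer (Dom C h) (Cod C (Ident C a))" for h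
    proof -
      have "h = zer (Dom C h) a" using h assms z by simp
      then show ?thesis
        by (intro exI[of _ "zer (Dom C h) z"]) (use h(1) assms z in \<open>simp add: h(1)\<close>)
    qed
  qed (use z assms in auto)
  show "epic C (Ident C a)" using assms by simp
qed

lemmas short_exact_Ident_zer = abelian.short_exact_zer_Ident[OF abelian_op, simplified]

text \<open>In the pullback \<open>P\<close> of \<open>p\<close> along \<open>v\<close>, the arrow \<open>(k', s)\<close> from \<open>Dom k \<oplus> Dom m\<close> is the kernel
  of the epimorphism from \<open>P\<close> to \<open>Cod c\<close>; extending the first projection along it splits off \<open>Dom k\<close>
  compatibly with \<open>s\<close>.\<close>

lemma orth_lifts:
  assumes mc: "short_exact C m c" and kp: "short_exact C k p" and o: "orth C (Cod C c) (Dom C k)"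
  shows "lifts C m p"
  unfolding lifts_def
proof (intro ballI impI)
  fix u v assume uv: "u \<in> Hom C (Dom C m) (Dom C p)" "v \<in> Hom C (Cod C m) (Cod C p)" "p \<cdot> u = v \<cdot> m"
  note M = short_exact_simps[OF mc] and K = short_exact_simps[OF kp]
  have [simp]: "m \<in> Ar C" "c \<in> Ar C" "k \<in> Ar C" "p \<in> Ar C" "u \<in> Ar C" "v \<in> Ar C"
    "Dom C c = Cod C m" "Dom C p = Cod C k" "Dom C u = Dom C m" "Cod C u = Cod C k" "Dom C v = Cod C m"
    "Cod C v = Cod C p" using M K uv by auto
  obtain a b where ab: "is_pullback C p v a b" "epic C b"
    using ex_pullback[of p v] K by auto
  note P = is_pullback_simps[OF ab(1)]
  obtain k' where k': "is_kernel C b k'" "a \<cdot> k' = k"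
    using pullback_kernel[OF ab(1) K(7)] by auto
  note K' = is_kernel_simps[OF k'(1)]
  define A where "A = Dom C b"
  have [simp]: "a \<in> Ar C" "b \<in> Ar C" "Dom C a = A" "Dom C b = A" "Cod C a = Cod C k" "Cod C b = Cod C m"
    "k' \<in> Ar C" "Cod C k' = A" using P K' A_def by auto
  have [simp]: "Dom C k' = Dom C k"
  proof -
    have "Dom C (a \<cdot> k') = Dom C k'" by simp
    then show ?thesis unfolding k'(2) by simp
  qed
  have bk: "b \<cdot> k' = zer (Dom C k) (Cod C m)" and pav: "p \<cdot> a = v \<cdot> b"
    and pk: "p \<cdot> k = zer (Dom C k) (Cod C p)" and cm: "c \<cdot> m = zer (Dom C m) (Cod C c)"
    using K'(4) P(9) K(4) M(4) by auto
  obtain s where s: "s \<in> Ar C" "Dom C s = Dom C u" "Cod C s = Dom C a" "a \<cdot> s = u" "b \<cdot> s = m"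
    by (rule pullback_factor[OF ab(1), of u m]) (use uv in auto)
  note [simp] = s(1-3)
  obtain D i1 i2 p1 p2 where B: "D \<in> Ob C"
    "i1 \<in> Hom C (Dom C k) D" "i2 \<in> Hom C (Dom C m) D" "p1 \<in> Hom C D (Dom C k)" "p2 \<in> Hom C D (Dom C m)"
    "p1 \<cdot> i1 = Ident C (Dom C k)" "p2 \<cdot> i2 = Ident C (Dom C m)" "p1 \<cdot> i2 = zer (Dom C m) (Dom C k)"
    "p2 \<cdot> i1 = zer (Dom C k) (Dom C m)" "i1 \<cdot> p1 \<boxplus> i2 \<cdot> p2 = Ident C D"
    by (rule obtain_biproduct[of "Dom C k" "Dom C m"]) auto
  have [simp]: "D \<in> Ob C" "i1 \<in> Ar C" "i2 \<in> Ar C" "p1 \<in> Ar C" "p2 \<in> Ar C" "Dom C i1 = Dom C k" "Cod C i1 = D"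
    "Dom C i2 = Dom C m" "Cod C i2 = D" "Dom C p1 = D" "Cod C p1 = Dom C k" "Dom C p2 = D" "Cod C p2 = Dom C m"
    using B by auto
  define j where "j = k' \<cdot> p1 \<boxplus> s \<cdot> p2"
  have j[simp]: "j \<in> Ar C" "Dom C j = D" "Cod C j = A" unfolding j_def by auto
  have bj: "b \<cdot> j = m \<cdot> p2"
    unfolding j_def by (simp add: comp_ext[OF bk] comp_ext[OF s(5)])
  have "monic C j"
  proof (rule monicI)
    fix h assume h: "h \<in> Ar C" "Cod C h = Dom C j" "j \<cdot> h = zer (Dom C h) (Cod C j)"
    have "b \<cdot> (j \<cdot> h) = (m \<cdot> p2) \<cdot> h" by (rule comp_ext[OF bj]) (use h in auto)
    then have mp: "m \<cdot> (p2 \<cdot> h) = zer (Dom C h) (Cod C m)"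
      using h by simp
    have p2: "p2 \<cdot> h = zer (Dom C h) (Dom C m)"
      by (rule monic_zerD[OF M(5)]) (use h mp in auto)
    have kp: "k' \<cdot> (p1 \<cdot> h) = zer (Dom C h) A"
      using h p2 unfolding j_def by simp
    have p1: "p1 \<cdot> h = zer (Dom C h) (Dom C k)"
      by (rule monic_zerD[OF K'(5)]) (use h kp in auto)
    have "(i1 \<cdot> p1 \<boxplus> i2 \<cdot> p2) \<cdot> h = zer (Dom C h) D"
      using h p1 p2 by simp
    then show "h = zer (Dom C h) (Dom C j)" unfolding B(10) using h by simp
  qed simp
  have "is_kernel C (c \<cdot> b) j"
  proof (rule is_kernelI)
    show "c \<cdot> b \<cdot> j = zer (Dom C j) (Cod C (c \<cdot> b))" by (simp add: bj comp_ext[OF cm])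
    fix h assume h: "h \<in> Ar C" "Cod C h = Dom C (c \<cdot> b)" "c \<cdot> b \<cdot> h = zer (Dom C h) (Cod C (c \<cdot> b))"
    obtain t where t: "t \<in> Ar C" "Dom C t = Dom C (b \<cdot> h)" "Cod C t = Dom C m" "m \<cdot> t = b \<cdot> h"
      by (rule kernel_factor[OF M(7), of "b \<cdot> h"]) (use h in auto)
    have t': "Dom C t = Dom C h" using t h by simp
    have z: "b \<cdot> (h \<boxminus> s \<cdot> t) = zer (Dom C h) (Cod C m)"
      using h t t' by (simp add: comp_ext[OF s(5)])
    obtain w where w: "w \<in> Ar C" "Dom C w = Dom C (h \<boxminus> s \<cdot> t)" "Cod C w = Dom C k'" "k' \<cdot> w = h \<boxminus> s \<cdot> t"
      by (rule kernel_factor[OF k'(1), of "h \<boxminus> s \<cdot> t"]) (use h t(1,3) t' z in auto)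
    have w': "Dom C w = Dom C h" using w h t(1,3) t' by simp
    have "j \<cdot> (i1 \<cdot> w \<boxplus> i2 \<cdot> t) = h"
      unfolding j_def using h t(1,3) t' w(1,3) w'
      by (simp add: comp_ext[OF B(6)] comp_ext[OF B(7)] comp_ext[OF B(8)] comp_ext[OF B(9)] w(4))
    then show "\<exists>u. u \<in> Ar C \<and> Dom C u = Dom C h \<and> Cod C u = Dom C j \<and> j \<cdot> u = h"
      using w(1,3) w' t(1,3) t' by (intro exI[of _ "i1 \<cdot> w \<boxplus> i2 \<cdot> t"]) simp
  qed (use \<open>monic C j\<close> in auto)
  moreover have "epic C (c \<cdot> b)" using M(6) ab(2) epic_comp[of c b] by simp
  ultimately have S: "short_exact C j (c \<cdot> b)" unfolding short_exact_iff_kernel by simp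
  obtain r where r: "r \<in> Ar C" "Dom C r = Cod C j" "Cod C r = Dom C k" "r \<cdot> j = p1"
    by (rule orthD[OF o S, of p1]) auto
  note [simp] = r(1-3)
  have rk: "r \<cdot> k' = Ident C (Dom C k)"
  proof -
    have "(r \<cdot> j) \<cdot> i1 = Ident C (Dom C k)" unfolding r(4) by (rule B(6))
    then show ?thesis unfolding j_def by (simp add: B(6,9) comp_ext[OF B(6)] comp_ext[OF B(9)])
  qed
  have rs: "r \<cdot> s = zer (Dom C m) (Dom C k)"
  proof -
    have "(r \<cdot> j) \<cdot> i2 = zer (Dom C m) (Dom C k)" unfolding r(4) by (rule B(8))
    then show ?thesis unfolding j_def by (simp add: B(7,8))
  qed
  \<comment> \<open>The projection away from \<open>Dom k\<close>; it factors as \<open>t \<cdot> b\<close>, and \<open>a \<cdot> t\<close> will be the lift.\<close>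
  define e where "e = Ident C A \<boxminus> k' \<cdot> r"
  have AO[simp]: "A \<in> Ob C" using Dom_Ob[of b] by simp
  have [simp]: "e \<in> Ar C" "Dom C e = A" "Cod C e = A" unfolding e_def by auto
  have ek: "e \<cdot> k' = zer (Dom C k) A" unfolding e_def by (simp add: rk)
  have bcok: "is_cokernel C k' b" using epic_cokernel_of_kernel[OF ab(2) k'(1)] .
  obtain t where t: "t \<in> Ar C" "Cod C t = Cod C e" "Dom C t = Cod C b" "t \<cdot> b = e"
    by (rule cokernel_factor[OF bcok, of e]) (use ek in auto)
  note [simp] = t(1-3)
  have h1: "a \<cdot> t \<cdot> m = u"
  proof -
    have "a \<cdot> ((t \<cdot> b) \<cdot> s) = u" unfolding t(4) e_def by (simp add: rs s(4))
    then show ?thesis by (simp add: s(5))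
  qed
  have h2: "p \<cdot> (a \<cdot> t) = v"
  proof (rule epicD[OF ab(2)])
    have "p \<cdot> (a \<cdot> (t \<cdot> b)) = v \<cdot> b"
      unfolding t(4) e_def by (simp add: comp_ext[OF k'(2)] comp_ext[OF pk] pav)
    then show "(p \<cdot> (a \<cdot> t)) \<cdot> b = v \<cdot> b" by simp
  qed auto
  show "\<exists>h\<in>Hom C (Cod C m) (Dom C p). h \<cdot> m = u \<and> p \<cdot> h = v"
    by (rule bexI[of _ "a \<cdot> t"]) (use h1 h2 in auto)
qed

text \<open>This is lifting against the monomorphism from the zero object to \<open>w\<close>.\<close>

lemma orth_lift_obj:
  assumes o: "orth C w (Dom C k)" and kp: "short_exact C k p" and v: "v \<in> Ar C" "Dom C v = w" "Cod C v = Cod C p"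
  obtains h where "h \<in> Ar C" "Dom C h = w" "Cod C h = Dom C p" "p \<cdot> h = v"
proof -
  obtain z where z: "zero_object C z" "z \<in> Ob C" by (rule obtain_zero)
  have w: "w \<in> Ob C" using v by auto
  note S = short_exact_simps[OF kp]
  have "lifts C (zer z w) p"
    by (rule orth_lifts[OF short_exact_zer_Ident[OF z(1) w] kp]) (use o w in simp)
  moreover have "zer z (Dom C p) \<in> Hom C (Dom C (zer z w)) (Dom C p)" "v \<in> Hom C (Cod C (zer z w)) (Cod C p)"
    "p \<cdot> zer z (Dom C p) = v \<cdot> zer z w"
    using z w v S by auto
  ultimately obtain h where h: "h \<in> Hom C (Cod C (zer z w)) (Dom C p)" "p \<cdot> h = v"
    unfolding lifts_def by blast
  show ?thesis by (rule that[of h]) (use h z w in auto)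
qed

lemma liftsE:
  assumes "lifts C m p" "u \<in> Ar C" "Dom C u = Dom C m" "Cod C u = Dom C p"
    "v \<in> Ar C" "Dom C v = Cod C m" "Cod C v = Cod C p" "p \<cdot> u = v \<cdot> m"
  obtains h where "h \<in> Ar C" "Dom C h = Cod C m" "Cod C h = Dom C p" "h \<cdot> m = u" "p \<cdot> h = v"
proof -
  have "u \<in> Hom C (Dom C m) (Dom C p)" "v \<in> Hom C (Cod C m) (Cod C p)" using assms by auto
  then obtain h where o: "h \<in> Hom C (Cod C m) (Dom C p)" "h \<cdot> m = u" "p \<cdot> h = v"
    using assms(1,8) unfolding lifts_def by blast
  show ?thesis by (rule that[of h]) (use o in auto)
qed

text \<open>The six-term sequence of \<open>Ext\<close>, expressed by liftings: a section over \<open>Dom i\<close> exists because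
  \<open>Ext\<^sup>1(Dom i, y)\<close> vanishes, and it extends along \<open>i\<close> because \<open>Ext\<^sup>1(Cod c, y)\<close> does.\<close>

lemma orth_ext_left:
  assumes ic: "short_exact C i c" and o1: "orth C (Dom C i) y" and o2: "orth C (Cod C c) y" and y: "y \<in> Ob C"
  shows "orth C (Dom C c) y"
proof (rule orthI_section[OF y])
  fix f g assume fg: "short_exact C f g" "Cod C g = Dom C c" "Dom C f = y"
  note I = short_exact_simps[OF ic] and S = short_exact_simps[OF fg(1)]
  obtain t where t: "t \<in> Ar C" "Dom C t = Dom C i" "Cod C t = Dom C g" "g \<cdot> t = i"
    by (rule orth_lift_obj[OF _ fg(1), of "Dom C i" i]) (use o1 fg I S in auto)
  have l: "lifts C i g" by (rule orth_lifts[OF ic fg(1)]) (use o2 fg in simp)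
  obtain h where h: "h \<in> Ar C" "Dom C h = Cod C i" "Cod C h = Dom C g" "h \<cdot> i = t" "g \<cdot> h = Ident C (Dom C c)"
    by (rule liftsE[OF l, of t "Ident C (Dom C c)"]) (use t I S fg in auto)
  show "\<exists>s. s \<in> Ar C \<and> Dom C s = Dom C c \<and> Cod C s = Dom C g \<and> g \<cdot> s = Ident C (Dom C c)"
    using h I by (intro exI[of _ h]) simp
qed

lemma orth_ext_right:
  assumes ic: "short_exact C i c" and o1: "orth C w (Dom C i)" and o2: "orth C w (Cod C c)"
  shows "orth C w (Dom C c)"
  unfolding orth_def in_Hom
proof (intro allI impI)
  fix f g u assume a: "short_exact C f g \<and> Cod C g = w \<and> u \<in> Ar C \<and> Dom C u = Dom C f \<and> Cod C u = Dom C c"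
  then have fg: "short_exact C f g" "Cod C g = w" and u: "u \<in> Ar C" "Dom C u = Dom C f" "Cod C u = Dom C c"
    by auto
  note I = short_exact_simps[OF ic] and S = short_exact_simps[OF fg(1)]
  obtain v where v: "v \<in> Ar C" "Dom C v = Cod C f" "Cod C v = Cod C c" "v \<cdot> f = c \<cdot> u"
    by (rule orthD[OF o2 fg, of "c \<cdot> u"]) (use u I in auto)
  have l: "lifts C f c" by (rule orth_lifts[OF fg(1) ic]) (use o1 fg in simp)
  obtain h where h: "h \<in> Ar C" "Dom C h = Cod C f" "Cod C h = Dom C c" "h \<cdot> f = u" "c \<cdot> h = v"
    by (rule liftsE[OF l, of u v]) (use u v in auto)
  show "\<exists>v. (v \<in> Ar C \<and> Dom C v = Cod C f \<and> Cod C v = Dom C c) \<and> v \<cdot> f = u"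
    using h by blast
qed

lemma obj_retract_Ob: "obj_retract C a b \<Longrightarrow> a \<in> Ob C \<and> b \<in> Ob C"
  unfolding obj_retract_def by auto

lemma obj_retractE:
  assumes "obj_retract C a b"
  obtains i r where "i \<in> Ar C" "Dom C i = a" "Cod C i = b" "r \<in> Ar C" "Dom C r = b" "Cod C r = a"
    "r \<cdot> i = Ident C a"
  using assms unfolding obj_retract_def in_Hom by blast

lemma orth_retract_right:
  assumes o: "orth C w y" and r: "obj_retract C y' y"
  shows "orth C w y'"
  unfolding orth_def in_Hom
proof (intro allI impI)
  fix f g u assume a: "short_exact C f g \<and> Cod C g = w \<and> u \<in> Ar C \<and> Dom C u = Dom C f \<and> Cod C u = y'"
  then have fg: "short_exact C f g" "Cod C g = w" and u: "u \<in> Ar C" "Dom C u = Dom C f" "Cod C u = y'"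
    by auto
  obtain i r where r: "i \<in> Ar C" "Dom C i = y'" "Cod C i = y" "r \<in> Ar C" "Dom C r = y" "Cod C r = y'"
    "r \<cdot> i = Ident C y'" using r by (rule obj_retractE)
  obtain v where v: "v \<in> Ar C" "Dom C v = Cod C f" "Cod C v = y" "v \<cdot> f = i \<cdot> u"
    by (rule orthD[OF o fg, of "i \<cdot> u"]) (use u r in auto)
  show "\<exists>v. (v \<in> Ar C \<and> Dom C v = Cod C f \<and> Cod C v = y') \<and> v \<cdot> f = u"
    by (rule exI[of _ "r \<cdot> v"])
      (use r(1-6) u v short_exact_simps[OF fg(1)] in \<open>simp add: comp_ext[OF r(7)]\<close>)
qed

lemma orth_retract_left:
  assumes o: "orth C w y" and r: "obj_retract C w' w" and y: "y \<in> Ob C"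
  shows "orth C w' y"
proof (rule orthI_section[OF y])
  fix f g assume fg: "short_exact C f g" "Cod C g = w'" "Dom C f = y"
  obtain i r where r: "i \<in> Ar C" "Dom C i = w'" "Cod C i = w" "r \<in> Ar C" "Dom C r = w" "Cod C r = w'"
    "r \<cdot> i = Ident C w'" using r by (rule obj_retractE)
  obtain h where h: "h \<in> Ar C" "Dom C h = w" "Cod C h = Dom C g" "g \<cdot> h = r"
    by (rule orth_lift_obj[OF _ fg(1), of w r]) (use o fg r in auto)
  show "\<exists>s. s \<in> Ar C \<and> Dom C s = w' \<and> Cod C s = Dom C g \<and> g \<cdot> s = Ident C w'"
    by (rule exI[of _ "h \<cdot> i"])
      (use r h short_exact_simps[OF fg(1)] in \<open>simp add: comp_ext[OF h(4)]\<close>)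
qed

lemma is_productD:
  assumes "is_product C I X P \<pi>"
  shows "P \<in> Ob C" "i \<in> I \<Longrightarrow> \<pi> i \<in> Ar C" "i \<in> I \<Longrightarrow> Dom C (\<pi> i) = P" "i \<in> I \<Longrightarrow> Cod C (\<pi> i) = X i"
  using assms unfolding is_product_def by auto

lemma product_univ:
  assumes "is_product C I X P \<pi>" "A \<in> Ob C" "\<forall>i\<in>I. g i \<in> Hom C A (X i)"
  shows "\<exists>!h. h \<in> Hom C A P \<and> (\<forall>i\<in>I. \<pi> i \<cdot> h = g i)"
  using assms unfolding is_product_def
  by (elim conjE) (drule (1) bspec, drule spec, drule (1) mp, assumption)

lemma product_factor:
  assumes "is_product C I X P \<pi>" "A \<in> Ob C" "\<And>i. i \<in> I \<Longrightarrow> g i \<in> Ar C \<and> Dom C (g i) = A \<and> Cod C (g i) = X i"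
  obtains h where "h \<in> Ar C" "Dom C h = A" "Cod C h = P" "\<And>i. i \<in> I \<Longrightarrow> \<pi> i \<cdot> h = g i"
proof -
  have "\<forall>i\<in>I. g i \<in> Hom C A (X i)" using assms(3) by auto
  then obtain h where h: "h \<in> Hom C A P" "\<forall>i\<in>I. \<pi> i \<cdot> h = g i"
    using product_univ[OF assms(1,2)] by blast
  show ?thesis by (rule that[of h]) (use h in auto)
qed

lemma product_unique:
  assumes P: "is_product C I X P \<pi>" and h: "h \<in> Ar C" "h' \<in> Ar C" "Cod C h = P" "Cod C h' = P" "Dom C h = Dom C h'"
    and e: "\<And>i. i \<in> I \<Longrightarrow> \<pi> i \<cdot> h = \<pi> i \<cdot> h'"
  shows "h = h'"
proof -
  have "\<forall>i\<in>I. \<pi> i \<cdot> h' \<in> Hom C (Dom C h') (X i)"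
  proof
    fix i assume "i \<in> I"
    then show "\<pi> i \<cdot> h' \<in> Hom C (Dom C h') (X i)" using is_productD(2-4)[OF P \<open>i \<in> I\<close>] h by simp
  qed
  note fct = this
  have "Dom C h' \<in> Ob C" using h by simp
  then have uni: "\<exists>!k. k \<in> Hom C (Dom C h') P \<and> (\<forall>i\<in>I. \<pi> i \<cdot> k = \<pi> i \<cdot> h')"
    by (rule product_univ[OF P _ fct])
  have "h \<in> Hom C (Dom C h') P" "h' \<in> Hom C (Dom C h') P" using h by auto
  then show ?thesis using uni e by blast
qed

lemma orth_product:
  assumes P: "is_product C I Y P \<pi>" and o: "\<And>i. i \<in> I \<Longrightarrow> orth C w (Y i)"
  shows "orth C w P"
  unfolding orth_def in_Hom
proof (intro allI impI)
  fix f g u assume a: "short_exact C f g \<and> Cod C g = w \<and> u \<in> Ar C \<and> Dom C u = Dom C f \<and> Cod C u = P"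
  then have fg: "short_exact C f g" "Cod C g = w" and u: "u \<in> Ar C" "Dom C u = Dom C f" "Cod C u = P"
    by auto
  note S = short_exact_simps[OF fg(1)] and D = is_productD[OF P]
  have "\<exists>v. v \<in> Ar C \<and> Dom C v = Cod C f \<and> Cod C v = Y i \<and> v \<cdot> f = \<pi> i \<cdot> u" if i: "i \<in> I" for i
    by (rule orthD[OF o[OF i] fg, of "\<pi> i \<cdot> u"]) (use u D(2-4)[OF i] in auto)
  then obtain v where v: "\<And>i. i \<in> I \<Longrightarrow> v i \<in> Ar C \<and> Dom C (v i) = Cod C f \<and> Cod C (v i) = Y i \<and> v i \<cdot> f = \<pi> i \<cdot> u"
    by metis
  obtain h where h: "h \<in> Ar C" "Dom C h = Cod C f" "Cod C h = P" "\<And>i. i \<in> I \<Longrightarrow> \<pi> i \<cdot> h = v i"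
    by (rule product_factor[OF P, of "Cod C f" v]) (use v S in auto)
  have "h \<cdot> f = u"
  proof (rule product_unique[OF P])
    fix i assume i: "i \<in> I"
    show "\<pi> i \<cdot> (h \<cdot> f) = \<pi> i \<cdot> u"
      using v[OF i] h(1-3) D(2-4)[OF i] S(1) by (simp add: comp_ext[OF h(4)[OF i]])
  qed (use h(1-3) u S(1) in auto)
  then show "\<exists>v. (v \<in> Ar C \<and> Dom C v = Cod C f \<and> Cod C v = P) \<and> v \<cdot> f = u"
    using h(1-3) by blast
qed

lemma InjD:
  assumes "y \<in> Inj C" "monic C m" "u \<in> Ar C" "Dom C u = Dom C m" "Cod C u = y"
  obtains v where "v \<in> Ar C" "Dom C v = Cod C m" "Cod C v = y" "v \<cdot> m = u"
proof -
  have "u \<in> Hom C (Dom C m) y" using assms by simp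
  then obtain v where v: "v \<in> Hom C (Cod C m) y" "v \<cdot> m = u"
    using assms(1,2) unfolding Inj_def by blast
  show ?thesis by (rule that[of v]) (use v in auto)
qed

text \<open>Every monomorphism is the left half of a short exact sequence.\<close>

lemma Inj_iff_orth: "y \<in> Inj C \<longleftrightarrow> y \<in> Ob C \<and> (\<forall>w\<in>Ob C. orth C w y)"
proof
  assume y: "y \<in> Inj C"
  have "\<exists>v. (v \<in> Ar C \<and> Dom C v = Cod C f \<and> Cod C v = y) \<and> v \<cdot> f = u"
    if "short_exact C f g \<and> Cod C g = w \<and> u \<in> Ar C \<and> Dom C u = Dom C f \<and> Cod C u = y" for w f g u
    by (rule InjD[OF y, of f u]) (use that short_exact_simps[of f g] in auto)
  then show "y \<in> Ob C \<and> (\<forall>w\<in>Ob C. orth C w y)"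
    using y unfolding orth_def in_Hom Inj_def by blast
next
  assume y: "y \<in> Ob C \<and> (\<forall>w\<in>Ob C. orth C w y)"
  have "\<exists>g\<in>Hom C (Cod C m) y. g \<cdot> m = f" if m: "monic C m" "f \<in> Hom C (Dom C m) y" for m f
  proof -
    obtain c where c: "is_cokernel C m c" using ex_cokernel[of m] m by auto
    have s: "short_exact C m c" unfolding short_exact_iff_cokernel using c m by simp
    have "Cod C c \<in> Ob C" using is_cokernel_simps[OF c] by simp
    then have "orth C (Cod C c) y" using y by blast
    then show ?thesis using s m unfolding orth_def by blast
  qed
  then show "y \<in> Inj C" using y unfolding Inj_def by blast
qed

end


section \<open>Yoneda extensions\<close>

text \<open>What remains of the conditions on an extension when those on its first arrow are dropped. Unlike
  extensions, such tails are closed under removing the first arrow, which permits induction on the length.\<close>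

definition ext_tail :: "('o, 'm) cat \<Rightarrow> nat \<Rightarrow> 'o \<Rightarrow> 'm list \<Rightarrow> bool" where
  "ext_tail C n X e \<longleftrightarrow> length e = Suc n \<and> set e \<subseteq> Ar C \<and> Cod C (e ! n) = X \<and> epic C (e ! n) \<and>
     (\<forall>k<n. exact_at C (e ! k) (e ! Suc k))"

lemma extension_iff_tail:
  "extension C n X Y e \<longleftrightarrow> ext_tail C n X e \<and> monic C (e ! 0) \<and> Dom C (e ! 0) = Y"
  unfolding extension_def ext_tail_def by auto

lemma ext_tail_Cons:
  "ext_tail C (Suc n) X (a # e) \<longleftrightarrow> a \<in> Ar C \<and> exact_at C a (e ! 0) \<and> ext_tail C n X e"
  unfolding ext_tail_def by (auto simp: All_less_Suc2)

lemma ext_tail_0: "ext_tail C 0 X e \<longleftrightarrow> (\<exists>a. e = [a] \<and> epic C a \<and> a \<in> Ar C \<and> Cod C a = X)"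
  unfolding ext_tail_def by (auto simp: length_Suc_conv)

lemma ext_tail_SucE:
  assumes "ext_tail C (Suc n) X e"
  obtains a es where "e = a # es" "a \<in> Ar C" "exact_at C a (es ! 0)" "ext_tail C n X es"
proof -
  obtain a es where e: "e = a # es" using assms unfolding ext_tail_def by (auto simp: length_Suc_conv)
  show ?thesis using assms that[OF e] unfolding e ext_tail_Cons by blast
qed

definition chain_map where
  "chain_map C n e e' h \<longleftrightarrow> (\<forall>k\<le>n. h k \<in> Hom C (Dom C (e ! k)) (Dom C (e' ! k)) \<and>
     h (Suc k) \<cdot>\<^bsub>C\<^esub> (e ! k) = (e' ! k) \<cdot>\<^bsub>C\<^esub> h k)"

text \<open>In general, two extensions are in the same class only if a zigzag of morphisms joins them. If some
  extension receives a morphism from every other one, zigzags of length two suffice and \<open>Ext\<close> has one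
  element. Allowing an arbitrary arrow \<open>u\<close> at the left end makes the condition strong enough for an
  induction on the length of the extensions.\<close>

definition absorbing :: "('o, 'm) cat \<Rightarrow> nat \<Rightarrow> 'o \<Rightarrow> 'o \<Rightarrow> 'm list \<Rightarrow> bool" where
  "absorbing C n X Y t \<longleftrightarrow> extension C n X Y t \<and>
     (\<forall>K e u. extension C n X K e \<and> u \<in> Hom C K Y \<longrightarrow>
        (\<exists>h. h 0 = u \<and> h (Suc n) = Ident C X \<and> chain_map C n e t h))"

lemma absorbing_Ext_zero:
  assumes t: "absorbing C n X Y t" and Y: "Ident C Y \<in> Hom C Y Y"
  shows "Ext_zero C n X Y"
proof -
  define E where "E = {e. extension C n X Y e}"
  define R where "R = {(e, e'). extension C n X Y e \<and> extension C n X Y e' \<and>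
                 equivclp (extension_morphism C n X Y) e e'}"
  have tE: "t \<in> E" using t unfolding E_def absorbing_def by simp
  have m: "extension_morphism C n X Y e t" if "e \<in> E" for e
    using t that Y unfolding E_def absorbing_def extension_morphism_def chain_map_def by blast
  have c: "R `` {e} = E" if e: "e \<in> E" for e
  proof
    show "R `` {e} \<subseteq> E" unfolding R_def E_def by auto
    show "E \<subseteq> R `` {e}"
    proof
      fix e' assume e': "e' \<in> E"
      have "equivclp (extension_morphism C n X Y) e t" "equivclp (extension_morphism C n X Y) e' t"
        using m e e' by (auto intro: r_into_equivclp)
      then have "equivclp (extension_morphism C n X Y) e e'"
        by (meson equivclp_sym equivclp_trans)
      then show "e' \<in> R `` {e}" using e e' unfolding R_def E_def by auto
    qed
  qed
  have "E // R = {E}" unfolding quotient_def using c tE by auto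
  then show ?thesis unfolding Ext_zero_def Ext_def E_def R_def by simp
qed

context abelian
begin

text \<open>Both \<open>m\<close> and \<open>k\<close> are kernels of \<open>c\<close>, so they represent the same subobject.\<close>

lemma kernel_of_same_subobject:
  assumes k: "is_kernel C g k" and m: "monic C m" and f: "is_kernel C c m" "is_kernel C c k"
  shows "is_kernel C g m"
proof -
  note K = is_kernel_simps[OF k] and M = is_kernel_simps[OF f(1)] and L = is_kernel_simps[OF f(2)]
  obtain u where u: "u \<in> Ar C" "Dom C u = Dom C k" "Cod C u = Dom C m" "m \<cdot> u = k"
    by (rule kernel_factor[OF f(1), of k]) (use K M L in auto)
  obtain v where v: "v \<in> Ar C" "Dom C v = Dom C m" "Cod C v = Dom C k" "k \<cdot> v = m"
    by (rule kernel_factor[OF f(2), of m]) (use K M L in auto)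
  show ?thesis
  proof (rule is_kernelI)
    have "g \<cdot> (k \<cdot> v) = zer (Dom C m) (Cod C g)" using v(1-3) K by (simp add: comp_ext[OF K(4)])
    then show "g \<cdot> m = zer (Dom C m) (Cod C g)" unfolding v(4) .
    have gk: "Dom C g = Dom C c" using K(3) L(3) by simp
    then show "Cod C m = Dom C g" using M by simp
    fix h assume h: "h \<in> Ar C" "Cod C h = Dom C g" "g \<cdot> h = zer (Dom C h) (Cod C g)"
    obtain w where w: "w \<in> Ar C" "Dom C w = Dom C h" "Cod C w = Dom C k" "k \<cdot> w = h"
      by (rule kernel_factor[OF k, of h]) (use h in auto)
    show "\<exists>u. u \<in> Ar C \<and> Dom C u = Dom C h \<and> Cod C u = Dom C m \<and> m \<cdot> u = h"
      by (rule exI[of _ "u \<cdot> w"]) (use w u(1-3) M in \<open>simp add: comp_ext[OF u(4)]\<close>)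
  qed (use m K in auto)
qed

lemma exact_at_monic:
  assumes "monic C m"
  shows "exact_at C m g \<longleftrightarrow> is_kernel C g m"
proof
  assume "exact_at C m g"
  then obtain k c where kc: "is_cokernel C m c" "is_kernel C c k" "is_kernel C g k"
    unfolding exact_at_def is_image_def by blast
  show "is_kernel C g m"
    by (rule kernel_of_same_subobject[OF kc(3) assms monic_kernel_of_cokernel[OF assms kc(1)] kc(2)])
next
  assume k: "is_kernel C g m"
  obtain c where "is_cokernel C m c" using ex_cokernel[of m] assms by auto
  then show "exact_at C m g"
    unfolding exact_at_def is_image_def using k monic_kernel_of_cokernel[OF assms] by blast
qed

lemma cokernel_comp_epic:
  assumes q: "epic C q" and f: "f \<in> Ar C" "Dom C f = Cod C q"
  shows "is_cokernel C (f \<cdot> q) = is_cokernel C f"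
proof (rule ext, rule iffI)
  fix c assume c: "is_cokernel C (f \<cdot> q) c"
  note K = is_cokernel_simps[OF c]
  have Dc: "Dom C c = Cod C f" using K f q by simp
  show "is_cokernel C f c"
  proof (rule is_cokernelI)
    show cf: "c \<cdot> f = zer (Dom C f) (Cod C c)"
      by (rule epicD[OF q]) (use K f q Dc in auto)
    show "\<exists>u. u \<in> Ar C \<and> Cod C u = Cod C h \<and> Dom C u = Cod C c \<and> u \<cdot> c = h"
      if h: "h \<in> Ar C" "Dom C h = Cod C f" "h \<cdot> f = zer (Dom C f) (Cod C h)" for h
    proof -
      obtain u where "u \<in> Ar C" "Cod C u = Cod C h" "Dom C u = Cod C c" "u \<cdot> c = h"
        by (rule cokernel_factor[OF c, of h]) (use h f q in \<open>auto simp: comp_ext[OF h(3)]\<close>)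
      then show ?thesis by blast
    qed
  qed (use K f Dc in auto)
next
  fix c assume c: "is_cokernel C f c"
  note K = is_cokernel_simps[OF c]
  show "is_cokernel C (f \<cdot> q) c"
  proof (rule is_cokernelI)
    show "c \<cdot> (f \<cdot> q) = zer (Dom C (f \<cdot> q)) (Cod C c)"
      using f q K by (simp add: comp_ext[OF K(4)])
    show "\<exists>u. u \<in> Ar C \<and> Cod C u = Cod C h \<and> Dom C u = Cod C c \<and> u \<cdot> c = h"
      if h: "h \<in> Ar C" "Dom C h = Cod C (f \<cdot> q)" "h \<cdot> (f \<cdot> q) = zer (Dom C (f \<cdot> q)) (Cod C h)" for h
    proof -
      have hf: "h \<cdot> f = zer (Dom C f) (Cod C h)"
        by (rule epicD[OF q]) (use h f q in auto)
      obtain u where "u \<in> Ar C" "Cod C u = Cod C h" "Dom C u = Cod C c" "u \<cdot> c = h"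
        by (rule cokernel_factor[OF c, of h]) (use h f q hf in auto)
      then show ?thesis by blast
    qed
  qed (use K f q in auto)
qed

lemmas kernel_comp_monic = abelian.cokernel_comp_epic[OF abelian_op, simplified]

text \<open>Exactness depends only on the image of the first arrow and the kernel of the second.\<close>

lemma exact_at_comp:
  assumes "f \<in> Ar C"
  shows "epic C q \<Longrightarrow> Dom C f = Cod C q \<Longrightarrow> exact_at C (f \<cdot> q) g \<longleftrightarrow> exact_at C f g"
    and "monic C m \<Longrightarrow> Cod C f = Dom C m \<Longrightarrow> exact_at C g (m \<cdot> f) \<longleftrightarrow> exact_at C g f"
  using assms unfolding exact_at_def is_image_def
  by (simp_all add: cokernel_comp_epic kernel_comp_monic)

text \<open>To see that the arrow \<open>m\<close> induced on the coimage is monic, pull a test arrow \<open>h\<close> with \<open>m \<cdot> h = 0\<close> back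
  along \<open>c\<close>: the pulled back arrow is killed by \<open>f\<close>, so it factors through \<open>k\<close>, and \<open>h = 0\<close> follows.\<close>

lemma image_factor:
  assumes k: "is_kernel C f k" and c: "is_cokernel C k c"
  obtains m where "monic C m" "Dom C m = Cod C c" "Cod C m = Cod C f" "m \<cdot> c = f"
proof -
  note K = is_kernel_simps[OF k] and L = is_cokernel_simps[OF c]
  obtain m where m: "m \<in> Ar C" "Cod C m = Cod C f" "Dom C m = Cod C c" "m \<cdot> c = f"
    by (rule cokernel_factor[OF c, of f]) (use K in auto)
  have "monic C m"
  proof (rule monicI)
    fix h assume h: "h \<in> Ar C" "Cod C h = Dom C m" "m \<cdot> h = zer (Dom C h) (Cod C m)"
    obtain p q where pq: "is_pullback C c h p q" "epic C q"
      using ex_pullback[of c h] L h m by auto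
    note P = is_pullback_simps[OF pq(1)]
    have "(m \<cdot> c) \<cdot> p = zer (Dom C p) (Cod C f)"
      using P(1-8) h m(1-3) K L by (simp add: P(9) comp_ext[OF h(3)])
    then have fp: "f \<cdot> p = zer (Dom C p) (Cod C f)" unfolding m(4) .
    obtain s where s: "s \<in> Ar C" "Dom C s = Dom C p" "Cod C s = Dom C k" "k \<cdot> s = p"
      by (rule kernel_factor[OF k, of p]) (use fp P L K in auto)
    have "c \<cdot> (k \<cdot> s) = zer (Dom C p) (Cod C c)"
      using s(1-3) K L by (simp add: comp_ext[OF L(4)])
    then have hq: "h \<cdot> q = zer (Dom C p) (Cod C c)" unfolding s(4) P(9) .
    show "h = zer (Dom C h) (Dom C m)"
      by (rule epicD[OF pq(2)]) (use hq h(1,2) m(1-3) L P(2,4,6,8) in auto)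
  qed (use m in simp)
  then show ?thesis by (rule that) (use m in auto)
qed

lemma extension_1_iff:
  "extension C (Suc 0) X Y e \<longleftrightarrow> (\<exists>f g. e = [f, g] \<and> short_exact C f g \<and> Dom C f = Y \<and> Cod C g = X)"
proof
  assume "extension C (Suc 0) X Y e"
  then have t: "ext_tail C (Suc 0) X e" and m: "monic C (e ! 0)" "Dom C (e ! 0) = Y"
    unfolding extension_iff_tail by auto
  obtain f es where f: "e = f # es" "exact_at C f (es ! 0)" "ext_tail C 0 X es"
    using t by (rule ext_tail_SucE)
  obtain g where g: "es = [g]" "epic C g" "Cod C g = X" using f(3) unfolding ext_tail_0 by blast
  show "\<exists>f g. e = [f, g] \<and> short_exact C f g \<and> Dom C f = Y \<and> Cod C g = X"
    using f g m exact_at_monic[of f g] unfolding short_exact_iff_kernel by auto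
next
  assume "\<exists>f g. e = [f, g] \<and> short_exact C f g \<and> Dom C f = Y \<and> Cod C g = X"
  then obtain f g where fg: "e = [f, g]" "short_exact C f g" "Dom C f = Y" "Cod C g = X" by blast
  note S = short_exact_simps[OF fg(2)]
  show "extension C (Suc 0) X Y e"
    unfolding extension_iff_tail fg(1) ext_tail_Cons ext_tail_0 using S fg exact_at_monic[of f g] by auto
qed

lemma obtain_split_short_exact:
  assumes "y \<in> Ob C" "x \<in> Ob C"
  obtains P i1 i2 p1 p2 where "short_exact C i1 p2" "short_exact C i2 p1"
    "i1 \<in> Hom C y P" "i2 \<in> Hom C x P" "p1 \<in> Hom C P y" "p2 \<in> Hom C P x"
    "p1 \<cdot> i1 = Ident C y" "p2 \<cdot> i2 = Ident C x" "p1 \<cdot> i2 = zer x y" "p2 \<cdot> i1 = zer y x"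
    "i1 \<cdot> p1 \<boxplus> i2 \<cdot> p2 = Ident C P"
proof -
  obtain P i1 i2 p1 p2 where B: "P \<in> Ob C"
    "i1 \<in> Hom C y P" "i2 \<in> Hom C x P" "p1 \<in> Hom C P y" "p2 \<in> Hom C P x"
    "p1 \<cdot> i1 = Ident C y" "p2 \<cdot> i2 = Ident C x" "p1 \<cdot> i2 = zer x y" "p2 \<cdot> i1 = zer y x"
    "i1 \<cdot> p1 \<boxplus> i2 \<cdot> p2 = Ident C P"
    by (rule obtain_biproduct[OF assms])
  have t: "i1 \<in> Ar C" "i2 \<in> Ar C" "p1 \<in> Ar C" "p2 \<in> Ar C" "Dom C i1 = y" "Cod C i1 = P" "Dom C i2 = x"
    "Cod C i2 = P" "Dom C p1 = P" "Cod C p1 = y" "Dom C p2 = P" "Cod C p2 = x" using B by auto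
  have k: "is_kernel C p2 i1"
  proof (rule is_kernelI)
    show "monic C i1" by (rule split_monic[of p1]) (use t B in auto)
    fix h assume h: "h \<in> Ar C" "Cod C h = Dom C p2" "p2 \<cdot> h = zer (Dom C h) (Cod C p2)"
    have "(i1 \<cdot> p1 \<boxplus> i2 \<cdot> p2) \<cdot> h = i1 \<cdot> (p1 \<cdot> h)" using h t by simp
    then have "h = i1 \<cdot> (p1 \<cdot> h)" unfolding B(10) using h t by simp
    then show "\<exists>u. u \<in> Ar C \<and> Dom C u = Dom C h \<and> Cod C u = Dom C i1 \<and> i1 \<cdot> u = h"
      using h t by (intro exI[of _ "p1 \<cdot> h"]) simp
  qed (use t B in auto)
  have e: "epic C p2" by (rule split_epic[of _ i2]) (use t B in auto)
  have S: "short_exact C i1 p2" using k e unfolding short_exact_iff_kernel by simp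
  have k': "is_kernel C p1 i2"
  proof (rule is_kernelI)
    show "monic C i2" by (rule split_monic[of p2]) (use t B in auto)
    fix h assume h: "h \<in> Ar C" "Cod C h = Dom C p1" "p1 \<cdot> h = zer (Dom C h) (Cod C p1)"
    have "(i1 \<cdot> p1 \<boxplus> i2 \<cdot> p2) \<cdot> h = i2 \<cdot> (p2 \<cdot> h)" using h t by simp
    then have "h = i2 \<cdot> (p2 \<cdot> h)" unfolding B(10) using h t by simp
    then show "\<exists>u. u \<in> Ar C \<and> Dom C u = Dom C h \<and> Cod C u = Dom C i2 \<and> i2 \<cdot> u = h"
      using h t by (intro exI[of _ "p2 \<cdot> h"]) simp
  qed (use t B in auto)
  have e': "epic C p1" by (rule split_epic[of _ i1]) (use t B in auto)
  have S': "short_exact C i2 p1" using k' e' unfolding short_exact_iff_kernel by simp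
  show ?thesis by (rule that[OF S S' B(2-10)])
qed

text \<open>If \<open>Ext\<^sup>1(x, y)\<close> vanishes, the split extension is absorbing: the component of the required morphism in
  \<open>y\<close> is an extension of \<open>u\<close> along \<open>f\<close>.\<close>

lemma ex_absorbing_1:
  assumes o: "orth C x y" and xy: "x \<in> Ob C" "y \<in> Ob C"
  shows "\<exists>t. absorbing C (Suc 0) x y t"
proof -
  obtain P i1 i2 p1 p2 where B: "short_exact C i1 p2" "short_exact C i2 p1"
    "i1 \<in> Hom C y P" "i2 \<in> Hom C x P" "p1 \<in> Hom C P y" "p2 \<in> Hom C P x"
    "p1 \<cdot> i1 = Ident C y" "p2 \<cdot> i2 = Ident C x" "p1 \<cdot> i2 = zer x y" "p2 \<cdot> i1 = zer y x"
    "i1 \<cdot> p1 \<boxplus> i2 \<cdot> p2 = Ident C P"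
    by (rule obtain_split_short_exact[OF xy(2,1)])
  have t: "i1 \<in> Ar C" "i2 \<in> Ar C" "p1 \<in> Ar C" "p2 \<in> Ar C" "Dom C i1 = y" "Cod C i1 = P" "Dom C i2 = x"
    "Cod C i2 = P" "Dom C p1 = P" "Cod C p1 = y" "Dom C p2 = P" "Cod C p2 = x" using B by auto
  have "absorbing C (Suc 0) x y [i1, p2]"
    unfolding absorbing_def extension_1_iff
  proof (intro conjI allI impI)
    show "\<exists>f g. [i1, p2] = [f, g] \<and> short_exact C f g \<and> Dom C f = y \<and> Cod C g = x" using B t by blast
    fix K e u
    assume a: "(\<exists>f g. e = [f, g] \<and> short_exact C f g \<and> Dom C f = K \<and> Cod C g = x) \<and> u \<in> Hom C K y"
    then obtain f g where fg: "e = [f, g]" "short_exact C f g" "Dom C f = K" "Cod C g = x" by blast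
    note S = short_exact_simps[OF fg(2)]
    obtain v where v: "v \<in> Ar C" "Dom C v = Cod C f" "Cod C v = y" "v \<cdot> f = u"
      by (rule orthD[OF o fg(2,4), of u]) (use a fg in auto)
    define h where "h k = (if k = 0 then u else if k = Suc 0 then i1 \<cdot> v \<boxplus> i2 \<cdot> g else Ident C x)" for k
    have "chain_map C (Suc 0) e [i1, p2] h"
      unfolding chain_map_def fg(1) h_def
      using a v t S fg xy B(7-10)
      by (auto simp: le_Suc_eq comp_ext[OF B(8)] comp_ext[OF B(10)])
    then show "\<exists>h. h 0 = u \<and> h (Suc (Suc 0)) = Ident C x \<and> chain_map C (Suc 0) e [i1, p2] h"
      by (intro exI[of _ h]) (simp add: h_def)
  qed
  then show ?thesis by blast
qed

text \<open>Dimension shifting. Splice \<open>0 \<rightarrow> Dom j \<rightarrow> E \<rightarrow> z \<rightarrow> 0\<close>, where \<open>E\<close> is injective, onto an absorbing extension of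
  \<open>x\<close> by \<open>z\<close>. Given another extension, \<open>j \<cdot> u\<close> extends to an arrow \<open>v\<close> on its first inner term because
  \<open>E\<close> is injective. The arrow \<open>w\<close> that \<open>v\<close> induces on cokernels is the left end at which the absorbing
  extension of \<open>x\<close> by \<open>z\<close> takes over.\<close>

lemma absorbing_Suc:
  assumes t: "absorbing C (Suc n) x z t" and jq: "short_exact C j q" "Cod C q = z" and J: "Cod C j \<in> Inj C"
  shows "\<exists>t'. absorbing C (Suc (Suc n)) x (Dom C j) t'"
proof -
  note S = short_exact_simps[OF jq(1)]
  have "extension C (Suc n) x z t" using t unfolding absorbing_def by (rule conjunct1)
  then have et: "ext_tail C (Suc n) x t" "monic C (t ! 0)" "Dom C (t ! 0) = z"
    unfolding extension_iff_tail by simp_all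
  have univ: "\<exists>h. h 0 = u \<and> h (Suc (Suc n)) = Ident C x \<and> chain_map C (Suc n) e t h"
    if "extension C (Suc n) x K e" "u \<in> Hom C K z" for K e u
    using t that unfolding absorbing_def by blast
  obtain b ts where b: "t = b # ts" "b \<in> Ar C" "exact_at C b (ts ! 0)" "ext_tail C n x ts"
    using et(1) by (rule ext_tail_SucE)
  have b': "monic C b" "Dom C b = z" using et b by auto
  let ?t = "j # (b \<cdot> q) # ts"
  have "extension C (Suc (Suc n)) x (Dom C j) ?t"
    unfolding extension_iff_tail ext_tail_Cons
    using b b' S jq by (simp add: exact_at_comp exact_at_monic kernel_comp_monic)
  moreover have "\<exists>h. h 0 = u \<and> h (Suc (Suc (Suc n))) = Ident C x \<and> chain_map C (Suc (Suc n)) e ?t h"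
    if e: "extension C (Suc (Suc n)) x K e" and u: "u \<in> Hom C K (Dom C j)" for K e u
  proof -
    have te: "ext_tail C (Suc (Suc n)) x e" and m: "monic C (e ! 0)" "Dom C (e ! 0) = K"
      using e unfolding extension_iff_tail by auto
    obtain a0 e' where a0: "e = a0 # e'" "a0 \<in> Ar C" "exact_at C a0 (e' ! 0)" "ext_tail C (Suc n) x e'"
      using te by (rule ext_tail_SucE)
    obtain a1 es where a1: "e' = a1 # es" "a1 \<in> Ar C" "exact_at C a1 (es ! 0)" "ext_tail C n x es"
      using a0(4) by (rule ext_tail_SucE)
    have mo: "monic C a0" "Dom C a0 = K" using m a0 by auto
    have k: "is_kernel C a1 a0" using a0 a1 mo exact_at_monic by simp
    obtain c where c: "is_cokernel C a0 c" using ex_cokernel a0 by blast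
    note K = is_kernel_simps[OF k] and L = is_cokernel_simps[OF c]
    obtain m where m: "monic C m" "Dom C m = Cod C c" "Cod C m = Cod C a1" "m \<cdot> c = a1"
      using image_factor[OF k c] by blast
    have "exact_at C (m \<cdot> c) (es ! 0) = exact_at C m (es ! 0)"
      by (rule exact_at_comp(1)) (use m L in auto)
    then have "exact_at C m (es ! 0)" using a1(3) unfolding m(4) by simp
    then have mex: "extension C (Suc n) x (Cod C c) (m # es)"
      unfolding extension_iff_tail ext_tail_Cons
      using m(1,2) a1(4) by simp
    obtain v where v: "v \<in> Ar C" "Dom C v = Cod C a0" "Cod C v = Cod C j" "v \<cdot> a0 = j \<cdot> u"
      by (rule InjD[OF J mo(1), of "j \<cdot> u"]) (use u S mo in auto)
    have qv: "(q \<cdot> v) \<cdot> a0 = zer (Dom C a0) (Cod C q)"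
      using v S(1-3) u mo(2) a0(2) S(4) by (simp add: comp_ext[OF S(4)])
    obtain w where w: "w \<in> Ar C" "Cod C w = Cod C (q \<cdot> v)" "Dom C w = Cod C c" "w \<cdot> c = q \<cdot> v"
      by (rule cokernel_factor[OF c, of "q \<cdot> v"]) (use v S qv in auto)
    have "w \<in> Hom C (Cod C c) z" using w v S jq by simp
    then obtain h where h: "h 0 = w" "h (Suc (Suc n)) = Ident C x" "chain_map C (Suc n) (m # es) t h"
      using univ[OF mex] by blast
    \<comment> \<open>Index \<open>0\<close> and \<open>1\<close> belong to the spliced sequence; from index \<open>2\<close> on, \<open>h\<close> is shifted by one place.\<close>
    define h' where "h' k = (case k of 0 \<Rightarrow> u | Suc 0 \<Rightarrow> v | Suc (Suc k') \<Rightarrow> h (Suc k'))" for k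
    have hk: "h k \<in> Hom C (Dom C ((m # es) ! k)) (Dom C (t ! k)) \<and> h (Suc k) \<cdot> ((m # es) ! k) = (t ! k) \<cdot> h k"
      if "k \<le> Suc n" for k using h(3) that unfolding chain_map_def by blast
    have h1: "h (Suc 0) \<cdot> m = b \<cdot> w" using hk[of 0] h(1) b(1) by simp
    have h1t: "h (Suc 0) \<in> Ar C" "Dom C (h (Suc 0)) = Dom C (es ! 0)"
      using hk[of "Suc 0"] by auto
    have es0: "Dom C (es ! 0) = Cod C a1"
      using a1(3) is_kernel_simps(3) unfolding exact_at_def is_image_def
      by (metis is_cokernel_simps(3))
    have "chain_map C (Suc (Suc n)) e ?t h'"
      unfolding chain_map_def
    proof (intro allI impI)
      fix k assume le: "k \<le> Suc (Suc n)"
      consider "k = 0" | "k = Suc 0" | k' where "k = Suc (Suc k')" "Suc k' \<le> Suc n"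
        using le by (cases k; cases "k - 1") auto
      then show "h' k \<in> Hom C (Dom C (e ! k)) (Dom C (?t ! k)) \<and> h' (Suc k) \<cdot> (e ! k) = (?t ! k) \<cdot> h' k"
      proof cases
        case 1
        then show ?thesis using u v mo S unfolding h'_def a0(1) by simp
      next
        case 2
        have "(h (Suc 0) \<cdot> m) \<cdot> c = (b \<cdot> w) \<cdot> c" unfolding h1 ..
        then have "h (Suc 0) \<cdot> a1 = b \<cdot> (q \<cdot> v)"
          using h1t es0 m b(2) b' w L v(1-3) S jq(2) by simp
        then show ?thesis using 2 v K S b b' jq unfolding h'_def a0(1) a1(1) by simp
      next
        case 3
        show ?thesis using hk[OF 3(2)] unfolding h'_def a0(1) a1(1) b(1) 3(1) by simp
      qed
    qed
    then show ?thesis by (intro exI[of _ h']) (simp add: h'_def h)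
  qed
  ultimately show ?thesis unfolding absorbing_def by blast
qed

lemma equivclp_invariant:
  assumes "equivclp R a b" "\<And>a b. R a b \<Longrightarrow> P a \<longleftrightarrow> P b"
  shows "P a \<longleftrightarrow> P b"
  using assms(1) by (induction rule: equivclp_induct) (use assms(2) in blast)+

text \<open>From right to left, the split extension is absorbing. From left to right, a short exact sequence
  splits iff its first arrow has a retraction, and this property \<open>P\<close> is invariant under morphisms of
  extensions, hence under zigzags. If all extensions are in one class, they all split because one of them does.\<close>

lemma Ext_zero_iff_orth:
  assumes xy: "x \<in> Ob C" "y \<in> Ob C"
  shows "Ext_zero C 1 x y \<longleftrightarrow> orth C x y"
proof
  assume "orth C x y"
  then show "Ext_zero C 1 x y" using ex_absorbing_1 xy absorbing_Ext_zero[of C "Suc 0" x y] by auto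
next
  assume z: "Ext_zero C 1 x y"
  define E where "E = {e. extension C 1 x y e}"
  define R where "R = {(e, e'). extension C 1 x y e \<and> extension C 1 x y e' \<and>
                 equivclp (extension_morphism C 1 x y) e e'}"
  define P where "P e \<longleftrightarrow> (\<exists>r. r \<in> Ar C \<and> Dom C r = Cod C (e ! 0) \<and> Cod C r = y \<and> r \<cdot> (e ! 0) = Ident C y)" for e
  have inv: "P e \<longleftrightarrow> P e'" if em: "extension_morphism C 1 x y e e'" for e e'
  proof -
    obtain f g where e: "e = [f, g]" "short_exact C f g" "Dom C f = y" "Cod C g = x"
      using em unfolding extension_morphism_def by (auto simp: extension_1_iff)
    obtain f' g' where e': "e' = [f', g']" "short_exact C f' g'" "Dom C f' = y" "Cod C g' = x"
      using em unfolding extension_morphism_def by (auto simp: extension_1_iff)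
    obtain h :: "nat \<Rightarrow> 'b" where h: "h 0 = Ident C y" "h (Suc 1) = Ident C x"
      "\<forall>k\<le>1. h k \<in> Hom C (Dom C (e ! k)) (Dom C (e' ! k)) \<and> h (Suc k) \<cdot> (e ! k) = (e' ! k) \<cdot> h k"
      using em unfolding extension_morphism_def by blast
    note S = short_exact_simps[OF e(2)] and S' = short_exact_simps[OF e'(2)]
    define l where "l = h 1"
    have l: "l \<in> Ar C" "Dom C l = Dom C g" "Cod C l = Dom C g'" "g' \<cdot> l = g" "l \<cdot> f = f'"
    proof -
      have "h 1 \<in> Hom C (Dom C (e ! 1)) (Dom C (e' ! 1))" "h (Suc 0) \<cdot> (e ! 0) = (e' ! 0) \<cdot> h 0"
        "h (Suc 1) \<cdot> (e ! 1) = (e' ! 1) \<cdot> h 1"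
        using h(3) by (blast intro: le0 order_refl)+
      note hs = this[unfolded h(1,2) e(1) e'(1), simplified, folded One_nat_def l_def]
      show "l \<in> Ar C" "Dom C l = Dom C g" "Cod C l = Dom C g'" using hs by simp_all
      show "g' \<cdot> l = g" using hs(3) S(2) e(4) by simp
      show "l \<cdot> f = f'" using hs(2) S'(1) e'(3) by simp
    qed
    show ?thesis
    proof
      assume "P e"
      then obtain r where r: "r \<in> Ar C" "Cod C r = Dom C f" "Dom C r = Cod C f" "r \<cdot> f = Ident C (Dom C f)"
        unfolding P_def e(1) using e(3) by auto
      obtain s where s: "short_exact C s r" "g \<cdot> s = Ident C (Cod C g)" "Dom C s = Cod C g"
        using retraction_split[OF e(2) r] by auto
      note T = short_exact_simps[OF s(1)]
      have ls: "l \<cdot> s \<in> Ar C" "Dom C (l \<cdot> s) = Cod C g'" "Cod C (l \<cdot> s) = Dom C g'"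
        "g' \<cdot> (l \<cdot> s) = Ident C (Cod C g')"
        using l T r s e e' S S' by (auto simp: comp_ext[OF l(4)])
      obtain r' where r': "short_exact C (l \<cdot> s) r'" "r' \<cdot> f' = Ident C (Dom C f')" "Cod C r' = Dom C f'"
        using split_retraction[OF e'(2) ls] by blast
      show "P e'" unfolding P_def e'(1)
        using r' e'(3) short_exact_simps[OF r'(1)] ls S' by (intro exI[of _ r']) auto
    next
      assume "P e'"
      then obtain r where r: "r \<in> Ar C" "Dom C r = Cod C f'" "Cod C r = y" "r \<cdot> f' = Ident C y"
        unfolding P_def e'(1) by auto
      show "P e" unfolding P_def e(1)
        using r l S S' e(3) by (intro exI[of _ "r \<cdot> l"]) simp
    qed
  qed
  obtain A i1 i2 p1 p2 where B: "short_exact C i1 p2" "short_exact C i2 p1"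
    "i1 \<in> Hom C y A" "i2 \<in> Hom C x A" "p1 \<in> Hom C A y" "p2 \<in> Hom C A x"
    "p1 \<cdot> i1 = Ident C y"
    by (rule obtain_split_short_exact[OF xy(2,1)]) blast
  define t where "t = [i1, p2]"
  have tE: "t \<in> E" unfolding E_def t_def using B by (simp add: extension_1_iff)
  have Pt: "P t" unfolding P_def t_def using B by (intro exI[of _ p1]) simp
  obtain S where S: "E // R = {S}"
    using z unfolding Ext_zero_def Ext_def is_singleton_def E_def R_def by blast
  have "P e" if e: "e \<in> E" for e
  proof -
    have "R `` {e} \<in> E // R" "R `` {t} \<in> E // R" using e tE by (auto intro: quotientI)
    then have "R `` {e} = R `` {t}" using S by simp
    moreover have "(t, t) \<in> R" using tE unfolding R_def E_def by simp
    ultimately have "(e, t) \<in> R" by blast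
    then have "equivclp (extension_morphism C 1 x y) e t" unfolding R_def by blast
    from equivclp_invariant[OF this, of P, OF inv] Pt show "P e" by blast
  qed
  note all = this
  show "orth C x y"
  proof (rule orthI_retraction)
    fix f g assume "short_exact C f g" "Cod C g = x" "Dom C f = y"
    then have "[f, g] \<in> E" unfolding E_def by (simp add: extension_1_iff)
    then have "P [f, g]" by (rule all)
    then show "\<exists>r. r \<in> Ar C \<and> Dom C r = Cod C f \<and> Cod C r = y \<and> r \<cdot> f = Ident C y"
      unfolding P_def by simp
  qed
qed

end


section \<open>Complete cotorsion pairs\<close>

definition retract_closed_class :: "('o, 'm) cat \<Rightarrow> 'o set \<Rightarrow> bool" where
  "retract_closed_class C S \<longleftrightarrow> (\<forall>a b. b \<in> S \<and> obj_retract C a b \<longrightarrow> a \<in> S)"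

definition kernel_closed :: "('o, 'm) cat \<Rightarrow> 'o set \<Rightarrow> bool" where
  "kernel_closed C S \<longleftrightarrow> (\<forall>f g. short_exact C f g \<and> Dom C g \<in> S \<and> Cod C g \<in> S \<longrightarrow> Dom C f \<in> S)"

context abelian
begin

lemma right_perp_iff: "S \<subseteq> Ob C \<Longrightarrow> a \<in> right_perp C S \<longleftrightarrow> a \<in> Ob C \<and> (\<forall>s\<in>S. orth C s a)"
  unfolding right_perp_def using Ext_zero_iff_orth by blast

lemma left_perp_iff: "S \<subseteq> Ob C \<Longrightarrow> a \<in> left_perp C S \<longleftrightarrow> a \<in> Ob C \<and> (\<forall>s\<in>S. orth C a s)"
  unfolding left_perp_def using Ext_zero_iff_orth by blast

lemma cotorsion_pair_iff:
  "cotorsion_pair C X Y \<longleftrightarrow> X \<subseteq> Ob C \<and> Y \<subseteq> Ob C \<and> (\<forall>x\<in>X. \<forall>y\<in>Y. orth C x y) \<and>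
     (\<forall>a\<in>Ob C. (\<forall>y\<in>Y. orth C a y) \<longrightarrow> a \<in> X) \<and> (\<forall>a\<in>Ob C. (\<forall>x\<in>X. orth C x a) \<longrightarrow> a \<in> Y)"
proof
  assume c: "cotorsion_pair C X Y"
  then have cX: "X = left_perp C Y" and cY: "Y = right_perp C X"
    unfolding cotorsion_pair_def by blast+
  have Y: "Y \<subseteq> Ob C" by (subst cY) (auto simp: right_perp_def)
  have X: "X \<subseteq> Ob C" by (subst cX) (auto simp: left_perp_def)
  have "a \<in> X \<longleftrightarrow> a \<in> Ob C \<and> (\<forall>s\<in>Y. orth C a s)" for a
    by (subst cX) (rule left_perp_iff[OF Y])
  moreover have "a \<in> Y \<longleftrightarrow> a \<in> Ob C \<and> (\<forall>s\<in>X. orth C s a)" for a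
    by (subst cY) (rule right_perp_iff[OF X])
  moreover note X Y
  ultimately show "X \<subseteq> Ob C \<and> Y \<subseteq> Ob C \<and> (\<forall>x\<in>X. \<forall>y\<in>Y. orth C x y) \<and>
     (\<forall>a\<in>Ob C. (\<forall>y\<in>Y. orth C a y) \<longrightarrow> a \<in> X) \<and> (\<forall>a\<in>Ob C. (\<forall>x\<in>X. orth C x a) \<longrightarrow> a \<in> Y)"
    by blast
next
  assume a: "X \<subseteq> Ob C \<and> Y \<subseteq> Ob C \<and> (\<forall>x\<in>X. \<forall>y\<in>Y. orth C x y) \<and>
     (\<forall>a\<in>Ob C. (\<forall>y\<in>Y. orth C a y) \<longrightarrow> a \<in> X) \<and> (\<forall>a\<in>Ob C. (\<forall>x\<in>X. orth C x a) \<longrightarrow> a \<in> Y)"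
  show "cotorsion_pair C X Y"
  proof -
    from a have Y: "Y \<subseteq> Ob C" and X: "X \<subseteq> Ob C" by blast+
    have "x \<in> X \<longleftrightarrow> x \<in> left_perp C Y" for x
      unfolding left_perp_iff[OF Y] using a by blast
    moreover have "x \<in> Y \<longleftrightarrow> x \<in> right_perp C X" for x
      unfolding right_perp_iff[OF X] using a by blast
    ultimately show ?thesis unfolding cotorsion_pair_def by blast
  qed
qed

text \<open>An object \<open>a\<close> orthogonal to \<open>Y\<close> lifts its identity through an approximation by \<open>X\<close>, so it is a retract
  of an object of \<open>X\<close>; dually on the other side.\<close>

lemma complete_cotorsion_pairI:
  assumes X: "X \<subseteq> Ob C" "retract_closed_class C X" and Y: "Y \<subseteq> Ob C" "retract_closed_class C Y"
    and o: "\<And>x y. x \<in> X \<Longrightarrow> y \<in> Y \<Longrightarrow> orth C x y"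
    and c: "\<And>a. a \<in> Ob C \<Longrightarrow> \<exists>f g. short_exact C f g \<and> Dom C f \<in> Y \<and> Dom C g \<in> X \<and> Cod C g = a"
    and e: "\<And>a. a \<in> Ob C \<Longrightarrow> \<exists>f g. short_exact C f g \<and> Dom C f = a \<and> Dom C g \<in> Y \<and> Cod C g \<in> X"
  shows "complete_cotorsion_pair C X Y"
proof -
  have "a \<in> X" if a: "a \<in> Ob C" "\<forall>y\<in>Y. orth C a y" for a
  proof -
    obtain f g where fg: "short_exact C f g" "Dom C f \<in> Y" "Dom C g \<in> X" "Cod C g = a" using c[OF a(1)] by blast
    note S = short_exact_simps[OF fg(1)]
    have "orth C a (Dom C f)" using a fg by blast
    then obtain h where h: "h \<in> Ar C" "Dom C h = a" "Cod C h = Dom C g" "g \<cdot> h = Ident C a"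
      by (rule orth_lift_obj[OF _ fg(1), of a "Ident C a"]) (use fg a in auto)
    have "obj_retract C a (Dom C g)"
      unfolding obj_retract_def using h S fg by (intro exI[of _ h] exI[of _ g]) simp
    then show "a \<in> X" using X(2) fg unfolding retract_closed_class_def by blast
  qed
  moreover have "a \<in> Y" if a: "a \<in> Ob C" "\<forall>x\<in>X. orth C x a" for a
  proof -
    obtain f g where fg: "short_exact C f g" "Dom C f = a" "Dom C g \<in> Y" "Cod C g \<in> X" using e[OF a(1)] by blast
    note S = short_exact_simps[OF fg(1)]
    have "orth C (Cod C g) a" using a fg by blast
    then obtain r where r: "r \<in> Ar C" "Dom C r = Cod C f" "Cod C r = a" "r \<cdot> f = Ident C a"
      by (rule orth_retraction[OF _ fg(1) refl fg(2)])
    have "obj_retract C a (Dom C g)"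
      unfolding obj_retract_def using r S fg by (intro exI[of _ f] exI[of _ r]) simp
    then show "a \<in> Y" using Y(2) fg unfolding retract_closed_class_def by blast
  qed
  ultimately have "cotorsion_pair C X Y"
    unfolding cotorsion_pair_iff using X Y o by blast
  then show ?thesis unfolding complete_cotorsion_pair_def using c e by blast
qed

lemma cotorsion_retract_closed:
  assumes "cotorsion_pair C X Y"
  shows "retract_closed_class C X" "retract_closed_class C Y"
proof -
  note c = assms[unfolded cotorsion_pair_iff]
  show "retract_closed_class C X"
    unfolding retract_closed_class_def
    using c orth_retract_left obj_retract_Ob by (meson subsetD)
  show "retract_closed_class C Y"
    unfolding retract_closed_class_def
    using c orth_retract_right obj_retract_Ob by meson
qed

lemma cotorsion_extension_closed:
  assumes "cotorsion_pair C X Y" "short_exact C f g"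
  shows "Dom C f \<in> X \<Longrightarrow> Cod C g \<in> X \<Longrightarrow> Dom C g \<in> X"
    and "Dom C f \<in> Y \<Longrightarrow> Cod C g \<in> Y \<Longrightarrow> Dom C g \<in> Y"
proof -
  note c = assms(1)[unfolded cotorsion_pair_iff]
  have Ob: "Dom C g \<in> Ob C" using short_exact_simps[OF assms(2)] by simp
  show "Dom C g \<in> X" if "Dom C f \<in> X" "Cod C g \<in> X"
  proof -
    have "\<forall>y\<in>Y. orth C (Dom C g) y" using c that orth_ext_left[OF assms(2)] by blast
    then show ?thesis using c Ob by blast
  qed
  show "Dom C g \<in> Y" if "Dom C f \<in> Y" "Cod C g \<in> Y"
  proof -
    have "\<forall>x\<in>X. orth C x (Dom C g)" using c that orth_ext_right[OF assms(2)] by blast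
    then show ?thesis using c Ob by blast
  qed
qed

lemma cotorsion_product_closed:
  assumes "cotorsion_pair C X Y" "is_product C I Z P \<pi>" "\<And>i. i \<in> I \<Longrightarrow> Z i \<in> Y"
  shows "P \<in> Y"
proof -
  note c = assms(1)[unfolded cotorsion_pair_iff]
  have "\<forall>x\<in>X. orth C x P"
  proof
    fix x assume "x \<in> X"
    then show "orth C x P" using c assms(3) by (intro orth_product[OF assms(2)]) blast
  qed
  moreover have "P \<in> Ob C" using is_productD(1)[OF assms(2)] .
  ultimately show ?thesis using c by blast
qed

lemma injective_cotorsion_Ob:
  assumes "enough_injectives C"
  shows "complete_cotorsion_pair C (Ob C) (Inj C)"
proof (rule complete_cotorsion_pairI)
  show "retract_closed_class C (Ob C)" unfolding retract_closed_class_def using obj_retract_Ob by blast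
  show "retract_closed_class C (Inj C)"
    unfolding retract_closed_class_def Inj_iff_orth using obj_retract_Ob orth_retract_right by blast
  show "orth C x y" if "x \<in> Ob C" "y \<in> Inj C" for x y using that Inj_iff_orth by blast
  obtain z where z: "zero_object C z" "z \<in> Ob C" by (rule obtain_zero)
  have zI: "z \<in> Inj C"
  proof -
    have "g \<cdot> m = f" if "m \<in> Ar C" "f \<in> Hom C (Dom C m) z" "g = zer (Cod C m) z" for g m f
      using that z zero_object_into[OF z(1), of f] by simp
    then have "\<exists>g\<in>Hom C (Cod C m) z. g \<cdot> m = f" if "monic C m" "f \<in> Hom C (Dom C m) z" for m f
      using that z monic_Ar[of m] by (intro bexI[of _ "zer (Cod C m) z"]) auto
    then show ?thesis unfolding Inj_def using z by blast
  qed
  fix a assume a: "a \<in> Ob C"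
  show "\<exists>f g. short_exact C f g \<and> Dom C f \<in> Inj C \<and> Dom C g \<in> Ob C \<and> Cod C g = a"
    using short_exact_zer_Ident[OF z(1) a] zI z a by (intro exI[of _ "zer z a"] exI[of _ "Ident C a"]) simp
  obtain E m where E: "E \<in> Inj C" "m \<in> Hom C a E" "monic C m"
    using assms a unfolding enough_injectives_def by blast
  obtain c where c: "is_cokernel C m c" using ex_cokernel[of m] E by auto
  have S: "short_exact C m c" using c E unfolding short_exact_iff_cokernel by simp
  show "\<exists>f g. short_exact C f g \<and> Dom C f = a \<and> Dom C g \<in> Inj C \<and> Cod C g \<in> Ob C"
    using S E short_exact_simps[OF S] by (intro exI[of _ m] exI[of _ c]) auto
qed (auto simp: Inj_def)

subsection \<open>Factorisations\<close>

text \<open>First replace \<open>f\<close> by the epimorphism \<open>e = (f, e0)\<close> on \<open>Dom f \<oplus> Dom e0\<close>, where \<open>e0\<close> is an approximation of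
  \<open>Cod f\<close> by \<open>X\<close>. Then push the kernel of \<open>e\<close> out along an approximation \<open>m\<close> of it by \<open>Y\<close>. The induced
  epimorphism \<open>p\<close> has a kernel in \<open>Y\<close>, and the cokernel of the composite monomorphism \<open>Dom f \<rightarrow> Dom p\<close> is an
  extension of \<open>Cod x\<close> by \<open>Dom e0\<close>, both in \<open>X\<close>.\<close>

lemma cotorsion_factorization:
  assumes cp: "complete_cotorsion_pair C X Y" and f: "f \<in> Ar C"
  obtains i p c k where "short_exact C i c" "short_exact C k p" "Cod C i = Dom C p" "f = p \<cdot> i"
    "Cod C c \<in> X" "Dom C k \<in> Y"
proof -
  have co: "cotorsion_pair C X Y" using cp unfolding complete_cotorsion_pair_def by blast
  obtain k0 e0 where k0: "short_exact C k0 e0" "Dom C k0 \<in> Y" "Dom C e0 \<in> X" "Cod C e0 = Cod C f"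
    using cp f unfolding complete_cotorsion_pair_def by (meson Cod_Ob)
  note S0 = short_exact_simps[OF k0(1)]
  define a W where "a = Dom C f" and "W = Dom C e0"
  have aO: "a \<in> Ob C" "W \<in> Ob C" using f S0 unfolding a_def W_def by auto
  obtain P i1 i2 p1 p2 where B: "short_exact C i1 p2" "short_exact C i2 p1"
    "i1 \<in> Hom C a P" "i2 \<in> Hom C W P" "p1 \<in> Hom C P a" "p2 \<in> Hom C P W"
    "p1 \<cdot> i1 = Ident C a" "p2 \<cdot> i2 = Ident C W" "p1 \<cdot> i2 = zer W a" "p2 \<cdot> i1 = zer a W"
    "i1 \<cdot> p1 \<boxplus> i2 \<cdot> p2 = Ident C P"
    by (rule obtain_split_short_exact[OF aO])
  have t: "i1 \<in> Ar C" "i2 \<in> Ar C" "p1 \<in> Ar C" "p2 \<in> Ar C" "Dom C i1 = a" "Cod C i1 = P" "Dom C i2 = W"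
    "Cod C i2 = P" "Dom C p1 = P" "Cod C p1 = a" "Dom C p2 = P" "Cod C p2 = W" using B by auto
  have t0: "f \<in> Ar C" "Dom C f = a" "e0 \<in> Ar C" "Dom C e0 = W" "Cod C e0 = Cod C f"
    using f k0 S0 unfolding a_def W_def by auto
  define e where "e = f \<cdot> p1 \<boxplus> e0 \<cdot> p2"
  have e: "e \<in> Ar C" "Dom C e = P" "Cod C e = Cod C f" unfolding e_def using t t0 by simp_all
  have ei: "e \<cdot> i1 = f" "e \<cdot> i2 = e0" unfolding e_def using t t0 aO B(7-10) by simp_all
  have ee: "epic C e" by (rule epic_cancel[of e i2]) (use ei e t S0 in auto)
  obtain k where k: "is_kernel C e k" using ex_kernel e by blast
  have ke: "short_exact C k e" unfolding short_exact_iff_kernel using k ee by simp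
  note K = short_exact_simps[OF ke]
  obtain m x where mx: "short_exact C m x" "Dom C m = Dom C k" "Dom C x \<in> Y" "Cod C x \<in> X"
    using cp K(1) unfolding complete_cotorsion_pair_def by (meson Dom_Ob)
  note M = short_exact_simps[OF mx(1)]
  obtain u v where uv: "is_pushout C k m u v" using ex_pushout[of k m] K(1) M(1) mx(2) by auto
  note P = is_pushout_simps[OF uv]
  have mv: "monic C v" by (rule pushout_monic[OF uv K(5)])
  have mu: "monic C u" by (rule pushout_monic[OF is_pushout_sym[OF uv] M(5)])
  obtain p where p: "is_cokernel C v p" "p \<cdot> u = e" using pushout_cokernel[OF uv K(8)] by blast
  obtain c' where c': "is_cokernel C u c'" "c' \<cdot> v = x"
    using pushout_cokernel[OF is_pushout_sym[OF uv] M(8)] by blast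
  note Kp = is_cokernel_simps[OF p(1)] and Kc = is_cokernel_simps[OF c'(1)]
  have s1: "short_exact C v p" "short_exact C u c'"
    using p c' mu mv unfolding short_exact_iff_cokernel by auto
  have du: "Dom C u = P" using P(7) K(3) e(2) by simp
  have cv: "Cod C u = Cod C v" using P(6) .
  have ui: "u \<cdot> i1 \<in> Ar C" "monic C (u \<cdot> i1)" "Dom C (u \<cdot> i1) = a" "Cod C (u \<cdot> i1) = Dom C p"
    using P(3) t du mu short_exact_simps[OF B(1)] Kp(3) cv by (simp_all add: monic_comp)
  obtain d where d: "is_cokernel C (u \<cdot> i1) d" using ex_cokernel[OF ui(1)] by blast
  have sd: "short_exact C (u \<cdot> i1) d" using d ui unfolding short_exact_iff_cokernel by simp
  obtain \<phi> \<theta> where th: "short_exact C \<phi> \<theta>" "Dom C \<phi> = Cod C p2" "Dom C \<theta> = Cod C d" "Cod C \<theta> = Cod C c'"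
    using cokernel_comp_monic[OF B(1) s1(2) sd] du t by auto
  have "Cod C c' = Cod C x"
  proof -
    have "Cod C (c' \<cdot> v) = Cod C c'" using Kc P(4) cv by simp
    then show ?thesis unfolding c'(2) by simp
  qed
  then have dX: "Cod C d \<in> X"
    using cotorsion_extension_closed(1)[OF co th(1)] th t mx(4) k0(3) unfolding W_def by simp
  have vY: "Dom C v \<in> Y" using P(8) M(3) mx(3) by simp
  have "f = p \<cdot> (u \<cdot> i1)"
    using ei(1) Kp(1-3) P(3) t du cv by (simp add: comp_ext[OF p(2)])
  then show ?thesis by (rule that[OF sd s1(1) ui(4) _ dX vY])
qed

subsection \<open>Hereditary pairs\<close>

text \<open>To split an extension \<open>(a, b)\<close> of \<open>w\<close> by \<open>Cod q\<close>, approximate its middle term by \<open>e\<close> with \<open>Dom e\<close> in \<open>X\<close>. The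
  kernel \<open>\<kappa>\<close> of \<open>b \<cdot> e\<close> has its domain in \<open>X\<close> because \<open>X\<close> is closed under kernels of epimorphisms. So the arrow
  \<open>s\<close> that \<open>e\<close> induces from \<open>Dom \<kappa>\<close> to \<open>Cod q\<close> lifts through \<open>q\<close>, and the lift extends to \<open>L\<close> on \<open>Dom e\<close> because \<open>Cod j\<close>
  is injective. Subtracting \<open>a \<cdot> q \<cdot> L\<close> from \<open>e\<close> gives an arrow that kills \<open>\<kappa>\<close> and induces a section of \<open>b\<close>.\<close>

lemma cotorsion_coresolving:
  assumes cp: "complete_cotorsion_pair C X Y" and kc: "kernel_closed C X"
    and jq: "short_exact C j q" and y: "Dom C j \<in> Y" and J: "Cod C j \<in> Inj C"
  shows "Cod C q \<in> Y"
proof -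
  have co: "cotorsion_pair C X Y" using cp unfolding complete_cotorsion_pair_def by blast
  note cc = co[unfolded cotorsion_pair_iff]
  note S = short_exact_simps[OF jq]
  have ZO: "Cod C q \<in> Ob C" using S by simp
  have "orth C w (Cod C q)" if w: "w \<in> X" for w
  proof (rule orthI_section[OF ZO])
    fix a b assume ab: "short_exact C a b" "Cod C b = w" "Dom C a = Cod C q"
    note A = short_exact_simps[OF ab(1)]
    obtain k0 e where k0: "short_exact C k0 e" "Dom C e \<in> X" "Cod C e = Dom C b"
      using cp A(2) unfolding complete_cotorsion_pair_def by (meson Dom_Ob)
    note E = short_exact_simps[OF k0(1)]
    have be: "b \<cdot> e \<in> Ar C" "Dom C (b \<cdot> e) = Dom C e" "Cod C (b \<cdot> e) = w" "epic C (b \<cdot> e)"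
      using A E k0 ab by (simp_all add: epic_comp)
    obtain \<kappa> where \<kappa>: "is_kernel C (b \<cdot> e) \<kappa>" using ex_kernel[OF be(1)] by blast
    have kk: "short_exact C \<kappa> (b \<cdot> e)" unfolding short_exact_iff_kernel using \<kappa> be by simp
    note K = short_exact_simps[OF kk]
    have kX: "Dom C \<kappa> \<in> X"
      using kc kk be k0(2) w unfolding kernel_closed_def by metis
    have ck: "Cod C \<kappa> = Dom C e" using K(3) be(2) by simp
    have ek: "b \<cdot> (e \<cdot> \<kappa>) = zer (Dom C \<kappa>) (Cod C b)"
      using K(4) K(1) A(2) E(2) k0(3) ck by simp
    obtain s where s: "s \<in> Ar C" "Dom C s = Dom C (e \<cdot> \<kappa>)" "Cod C s = Dom C a" "a \<cdot> s = e \<cdot> \<kappa>"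
      by (rule kernel_factor[OF A(7), of "e \<cdot> \<kappa>"]) (use ek K(1) E(2) k0(3) ck in auto)
    have ds: "Dom C s = Dom C \<kappa>" using s(2) K(1) E(2) ck by simp
    have "orth C (Dom C \<kappa>) (Dom C j)" using cc kX y by blast
    then obtain l where l: "l \<in> Ar C" "Dom C l = Dom C \<kappa>" "Cod C l = Dom C q" "q \<cdot> l = s"
      by (rule orth_lift_obj[OF _ jq, of "Dom C \<kappa>" s]) (use s(1,3) ds ab in auto)
    obtain L where L: "L \<in> Ar C" "Dom C L = Cod C \<kappa>" "Cod C L = Cod C j" "L \<cdot> \<kappa> = l"
      by (rule InjD[OF J K(5), of l]) (use l S in auto)
    define D where "D = e \<boxminus> a \<cdot> (q \<cdot> L)"
    have t: "a \<cdot> (q \<cdot> L) \<in> Ar C" "Dom C (a \<cdot> (q \<cdot> L)) = Dom C e" "Cod C (a \<cdot> (q \<cdot> L)) = Cod C e"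
      using A(1,3) S(2,3) L(1-3) ab(3) ck k0(3) by simp_all
    have D: "D \<in> Ar C" "Dom C D = Dom C e" "Cod C D = Dom C b" unfolding D_def using t E(2) k0(3) by simp_all
    have "D \<cdot> \<kappa> = zer (Dom C \<kappa>) (Dom C b)"
    proof -
      have "D \<cdot> \<kappa> = e \<cdot> \<kappa> \<boxminus> a \<cdot> (q \<cdot> (L \<cdot> \<kappa>))"
        unfolding D_def using t E(2) K(1) ck A(1,3) S(2,3) L(1-3) ab(3) by simp
      also have "\<dots> = zer (Dom C \<kappa>) (Dom C b)"
        unfolding L(4) l(4) s(4) using E(2) K(1) ck k0(3) by simp
      finally show ?thesis .
    qed
    note Dk = this
    obtain \<sigma> where \<sigma>: "\<sigma> \<in> Ar C" "Cod C \<sigma> = Cod C D" "Dom C \<sigma> = Cod C (b \<cdot> e)" "\<sigma> \<cdot> (b \<cdot> e) = D"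
      by (rule cokernel_factor[OF K(8), of D]) (use D Dk ck in auto)
    have "b \<cdot> \<sigma> = Ident C w"
    proof (rule epicD[OF be(4)])
      have "b \<cdot> (\<sigma> \<cdot> (b \<cdot> e)) = b \<cdot> e"
      proof -
        have "b \<cdot> (a \<cdot> (q \<cdot> L)) = zer (Dom C e) (Cod C b)"
          using A(1-3) S(2,3) L(1-3) ab(3) ck by (simp add: comp_ext[OF A(4)])
        then show ?thesis
          unfolding \<sigma>(4) D_def using t E(2) k0(3) A(2) by simp
      qed
      then show "(b \<cdot> \<sigma>) \<cdot> (b \<cdot> e) = Ident C w \<cdot> (b \<cdot> e)"
        using \<sigma>(1-3) D be(1-3) A(2) E(2) k0(3) ab(2) by simp
    qed (use \<sigma>(1-3) D be(1-3) A(2) E(2) k0(3) ab(2) in auto)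
    then show "\<exists>s. s \<in> Ar C \<and> Dom C s = w \<and> Cod C s = Dom C b \<and> b \<cdot> s = Ident C w"
      using \<sigma>(1-3) D be by (intro exI[of _ \<sigma>]) simp
  qed
  then show ?thesis using cc ZO by blast
qed

text \<open>Embed \<open>y\<close> in an injective object; by \<open>cotorsion_coresolving\<close> the cokernel is in \<open>Y\<close> again, so the
  induction hypothesis applies to it.\<close>

lemma ex_absorbing:
  assumes cp: "complete_cotorsion_pair C X Y" and kc: "kernel_closed C X" and ei: "enough_injectives C"
    and x: "x \<in> X"
  shows "y \<in> Y \<Longrightarrow> \<exists>t. absorbing C (Suc n) x y t"
proof (induction n arbitrary: y)
  have "cotorsion_pair C X Y" using cp unfolding complete_cotorsion_pair_def by blast
  note cc = this[unfolded cotorsion_pair_iff]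
  case 0
  then show ?case using ex_absorbing_1 cc x by blast
next
  have "cotorsion_pair C X Y" using cp unfolding complete_cotorsion_pair_def by blast
  note cc = this[unfolded cotorsion_pair_iff]
  case (Suc n)
  have "y \<in> Ob C" using cc Suc.prems by blast
  then obtain E m where E: "E \<in> Inj C" "m \<in> Hom C y E" "monic C m"
    using ei unfolding enough_injectives_def by blast
  obtain c where c: "is_cokernel C m c" using ex_cokernel[of m] E by auto
  have S: "short_exact C m c" using c E unfolding short_exact_iff_cokernel by simp
  have "Cod C c \<in> Y" by (rule cotorsion_coresolving[OF cp kc S]) (use E Suc.prems in auto)
  from Suc.IH[OF this] obtain t where "absorbing C (Suc n) x (Cod C c) t" by blast
  from absorbing_Suc[OF this S refl] show ?case using E by auto
qed

lemma hereditaryI: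
  assumes cp: "complete_cotorsion_pair C X Y" and kc: "kernel_closed C X" and ei: "enough_injectives C"
  shows "hereditary_cotorsion_pair C X Y"
proof -
  have co: "cotorsion_pair C X Y" using cp unfolding complete_cotorsion_pair_def by blast
  note cc = co[unfolded cotorsion_pair_iff]
  have "Ext_zero C i x y" if "x \<in> X" "y \<in> Y" "i \<ge> 1" for x y i
  proof -
    obtain n where n: "i = Suc n" using \<open>i \<ge> 1\<close> by (cases i) auto
    have "\<exists>t. absorbing C i x y t" unfolding n by (rule ex_absorbing[OF cp kc ei that(1,2)])
    then obtain t where t: "absorbing C i x y t" by blast
    have "y \<in> Ob C" using cc that by blast
    then show ?thesis using absorbing_Ext_zero[OF t] by simp
  qed
  then show ?thesis unfolding hereditary_cotorsion_pair_def using co by blast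
qed

end


section \<open>The model structure of an injective cotorsion pair\<close>

lemma obj_retract_op [simp]: "obj_retract (op_cat C) = obj_retract C"
  unfolding obj_retract_def fun_eq_iff by auto

context abelian
begin

lemma monics_with_cokernel_iff:
  "i \<in> monics_with_cokernel_in C S \<longleftrightarrow> (\<exists>c. short_exact C i c \<and> Cod C c \<in> S)"
  unfolding monics_with_cokernel_in_def short_exact_iff_cokernel by blast

lemma epics_with_kernel_iff:
  "p \<in> epics_with_kernel_in C S \<longleftrightarrow> (\<exists>k. short_exact C k p \<and> Dom C k \<in> S)"
  unfolding epics_with_kernel_in_def short_exact_iff_kernel by blast

lemma kernel_retract:
  assumes k: "is_kernel C f k" and l: "is_kernel C g l"
    and i: "i \<in> Ar C" "Dom C i = Dom C f" "Cod C i = Dom C g"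
    and r: "r \<in> Ar C" "Dom C r = Dom C g" "Cod C r = Dom C f" "r \<cdot> i = Ident C (Dom C f)"
    and z: "g \<cdot> (i \<cdot> k) = zer (Dom C k) (Cod C g)" "f \<cdot> (r \<cdot> l) = zer (Dom C l) (Cod C f)"
  shows "obj_retract C (Dom C k) (Dom C l)"
proof -
  note K = is_kernel_simps[OF k] and L = is_kernel_simps[OF l]
  obtain a where a: "a \<in> Ar C" "Dom C a = Dom C (i \<cdot> k)" "Cod C a = Dom C l" "l \<cdot> a = i \<cdot> k"
    by (rule kernel_factor[OF l, of "i \<cdot> k"]) (use i K z in auto)
  obtain b where b: "b \<in> Ar C" "Dom C b = Dom C (r \<cdot> l)" "Cod C b = Dom C k" "k \<cdot> b = r \<cdot> l"
    by (rule kernel_factor[OF k, of "r \<cdot> l"]) (use r L z in auto)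
  have da: "Dom C a = Dom C k" "Dom C b = Dom C l" using a(2) b(2) i r K L by simp_all
  have "b \<cdot> a = Ident C (Dom C k)"
  proof (rule monicD[OF K(5)])
    have "k \<cdot> (b \<cdot> a) = (r \<cdot> l) \<cdot> a"
      by (rule comp_ext[OF b(4)]) (use a(1,3) b(1,3) da K in auto)
    also have "\<dots> = r \<cdot> (l \<cdot> a)" by (rule comp_assoc) (use a(1,3) r L in auto)
    also have "\<dots> = Ident C (Dom C f) \<cdot> k" unfolding a(4)
      by (rule comp_ext[OF r(4)]) (use i r K in auto)
    finally show "k \<cdot> (b \<cdot> a) = k \<cdot> Ident C (Dom C k)" using K by simp
  qed (use a(1,3) b(1,3) da K in auto)
  then show ?thesis unfolding obj_retract_def
    using a(1,3) b(1,3) da by (intro exI[of _ a] exI[of _ b]) simp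
qed

lemma kernel_choice:
  assumes "is_kernel C f k" "is_kernel C f l"
  shows "obj_retract C (Dom C k) (Dom C l)"
  by (rule kernel_retract[OF assms, of "Ident C (Dom C f)" "Ident C (Dom C f)"])
    (use is_kernel_simps[OF assms(1)] is_kernel_simps[OF assms(2)] in auto)

lemmas cokernel_choice = abelian.kernel_choice[OF abelian_op, simplified]
lemmas kernel_comp_epic = abelian.cokernel_comp_monic[OF abelian_op, simplified]

end

locale injective_pair = abelian C add zer for C (structure) and add (infixl "\<boxplus>" 65) and zer +
  fixes W F
  assumes icp: "injective_cotorsion_pair C W F"
begin

abbreviation "TC \<equiv> monics_with_cokernel_in C W"
abbreviation "TF \<equiv> epics_with_kernel_in C (Inj C)"
abbreviation "FIB \<equiv> epics_with_kernel_in C F"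

text \<open>The objects of \<open>F \<inter> W\<close> are the injective ones, so the trivial fibrations are the epimorphisms with injective
  kernel. An arrow is a weak equivalence if it is a trivial cofibration followed by a trivial fibration.\<close>

definition weq where
  "weq f \<longleftrightarrow> (\<exists>p i. p \<in> TF \<and> i \<in> TC \<and> Cod C i = Dom C p \<and> f = p \<cdot> i)"

lemma cp: "complete_cotorsion_pair C W F"
  and ei: "enough_injectives C"
  and WF: "W \<inter> F = Inj C"
  and thickW: "thick C W"
  using icp unfolding injective_cotorsion_pair_def by auto

lemma co: "cotorsion_pair C W F"
  using cp unfolding complete_cotorsion_pair_def by blast

lemma cpI: "complete_cotorsion_pair C (Ob C) (Inj C)"
  by (rule injective_cotorsion_Ob[OF ei])

lemma coI: "cotorsion_pair C (Ob C) (Inj C)"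
  using cpI unfolding complete_cotorsion_pair_def by blast

lemma WOb: "W \<subseteq> Ob C" and FOb: "F \<subseteq> Ob C" and orthWF: "w \<in> W \<Longrightarrow> y \<in> F \<Longrightarrow> orth C w y"
  using co unfolding cotorsion_pair_iff by blast+

lemma orth_Inj: "w \<in> Ob C \<Longrightarrow> y \<in> Inj C \<Longrightarrow> orth C w y"
  unfolding Inj_iff_orth by blast

lemma W_retract: "b \<in> W \<Longrightarrow> obj_retract C a b \<Longrightarrow> a \<in> W"
  and F_retract: "b \<in> F \<Longrightarrow> obj_retract C a b \<Longrightarrow> a \<in> F"
  and Inj_retract: "b \<in> Inj C \<Longrightarrow> obj_retract C a b \<Longrightarrow> a \<in> Inj C"
  using cotorsion_retract_closed[OF co] cotorsion_retract_closed[OF coI]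
  unfolding retract_closed_class_def by blast+

lemma W_thick:
  assumes "short_exact C f g"
  shows "Dom C f \<in> W \<Longrightarrow> Dom C g \<in> W \<Longrightarrow> Cod C g \<in> W"
    and "Dom C f \<in> W \<Longrightarrow> Cod C g \<in> W \<Longrightarrow> Dom C g \<in> W"
    and "Dom C g \<in> W \<Longrightarrow> Cod C g \<in> W \<Longrightarrow> Dom C f \<in> W"
  using thickW assms unfolding thick_def by blast+

lemma TC_E:
  assumes "i \<in> TC"
  obtains c where "short_exact C i c" "Cod C c \<in> W"
  using assms unfolding monics_with_cokernel_iff by blast

lemma TC_D: "i \<in> TC \<Longrightarrow> short_exact C i c \<Longrightarrow> Cod C c \<in> W"
  unfolding monics_with_cokernel_iff
  using cokernel_choice W_retract short_exact_simps(8) by blast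

lemma TC_monic: "i \<in> TC \<Longrightarrow> monic C i"
  unfolding monics_with_cokernel_in_def by blast

lemma TF_E:
  assumes "p \<in> TF"
  obtains k where "short_exact C k p" "Dom C k \<in> Inj C"
  using assms unfolding epics_with_kernel_iff by blast

lemma FIB_E:
  assumes "p \<in> FIB"
  obtains k where "short_exact C k p" "Dom C k \<in> F"
  using assms unfolding epics_with_kernel_iff by blast

lemma TF_epic: "p \<in> TF \<Longrightarrow> epic C p"
  unfolding epics_with_kernel_in_def by blast

lemma lifts_TC_FIB: "i \<in> TC \<Longrightarrow> p \<in> FIB \<Longrightarrow> lifts C i p"
  by (elim TC_E FIB_E) (rule orth_lifts, auto intro: orthWF)

lemma lifts_monic_TF: assumes "monic C m" "p \<in> TF" shows "lifts C m p"
proof -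
  obtain c where c: "is_cokernel C m c" using ex_cokernel[of m] assms by auto
  have s: "short_exact C m c" unfolding short_exact_iff_cokernel using c assms by simp
  obtain k where k: "short_exact C k p" "Dom C k \<in> Inj C" using assms(2) by (rule TF_E)
  show ?thesis by (rule orth_lifts[OF s k(1)]) (use k orth_Inj is_cokernel_simps[OF c] in auto)
qed

text \<open>The complement of the section is the kernel of \<open>q\<close>, an injective object and so a member of \<open>W\<close>.\<close>

lemma TF_section_TC:
  assumes q: "q \<in> TF" and s: "s \<in> Ar C" "Dom C s = Cod C q" "Cod C s = Dom C q" "q \<cdot> s = Ident C (Cod C q)"
  shows "s \<in> TC"
proof -
  obtain k where k: "short_exact C k q" "Dom C k \<in> Inj C" using q by (rule TF_E)
  obtain r where "short_exact C s r" "Cod C r = Dom C k" using split_retraction[OF k(1) s] by blast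
  then show ?thesis unfolding monics_with_cokernel_iff using k WF by auto
qed

text \<open>The cokernels of \<open>m1\<close>, \<open>m2 \<cdot> m1\<close> and \<open>m2\<close> form a short exact sequence, and \<open>W\<close> is thick.\<close>

lemma TC_comp_two_of_three:
  assumes m: "monic C m1" "monic C m2" "Dom C m2 = Cod C m1"
  shows "m1 \<in> TC \<Longrightarrow> m2 \<in> TC \<Longrightarrow> m2 \<cdot> m1 \<in> TC"
    and "m1 \<in> TC \<Longrightarrow> m2 \<cdot> m1 \<in> TC \<Longrightarrow> m2 \<in> TC"
    and "m2 \<in> TC \<Longrightarrow> m2 \<cdot> m1 \<in> TC \<Longrightarrow> m1 \<in> TC"
proof -
  have mm: "monic C (m2 \<cdot> m1)" by (rule monic_comp[OF m])
  obtain c1 where "is_cokernel C m1 c1" using ex_cokernel[of m1] m by auto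
  then have c1: "short_exact C m1 c1" unfolding short_exact_iff_cokernel using m by simp
  obtain c2 where "is_cokernel C m2 c2" using ex_cokernel[of m2] m by auto
  then have c2: "short_exact C m2 c2" unfolding short_exact_iff_cokernel using m by simp
  obtain c where "is_cokernel C (m2 \<cdot> m1) c" using ex_cokernel[of "m2 \<cdot> m1"] mm by auto
  then have c: "short_exact C (m2 \<cdot> m1) c" unfolding short_exact_iff_cokernel using mm by simp
  obtain \<phi> \<theta> where th: "short_exact C \<phi> \<theta>" "Dom C \<phi> = Cod C c1" "Dom C \<theta> = Cod C c" "Cod C \<theta> = Cod C c2"
    using cokernel_comp_monic[OF c1 c2 c m(3)] by blast
  note T = W_thick[OF th(1), unfolded th(2-4)]
  have e: "m1 \<in> TC \<longleftrightarrow> Cod C c1 \<in> W" "m2 \<in> TC \<longleftrightarrow> Cod C c2 \<in> W" "m2 \<cdot> m1 \<in> TC \<longleftrightarrow> Cod C c \<in> W"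
    using TC_D c1 c2 c unfolding monics_with_cokernel_iff by blast+
  show "m1 \<in> TC \<Longrightarrow> m2 \<in> TC \<Longrightarrow> m2 \<cdot> m1 \<in> TC" "m1 \<in> TC \<Longrightarrow> m2 \<cdot> m1 \<in> TC \<Longrightarrow> m2 \<in> TC"
    "m2 \<in> TC \<Longrightarrow> m2 \<cdot> m1 \<in> TC \<Longrightarrow> m1 \<in> TC" unfolding e using T by blast+
qed

text \<open>A trivial fibration can be cancelled below a monomorphism: lifting the identity gives a section
  \<open>s\<close> of \<open>q\<close> with \<open>s \<cdot> (q \<cdot> n) = n\<close>, and sections of trivial fibrations are trivial cofibrations.\<close>

lemma TC_cancel_TF:
  assumes q: "q \<in> TF" and n: "n \<in> Ar C" "Cod C n = Dom C q" and m: "monic C (q \<cdot> n)"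
  shows "n \<in> TC \<longleftrightarrow> q \<cdot> n \<in> TC"
proof -
  have qA: "q \<in> Ar C" using TF_epic[OF q] by simp
  have l: "lifts C (q \<cdot> n) q" by (rule lifts_monic_TF[OF m q])
  obtain s where s: "s \<in> Ar C" "Dom C s = Cod C (q \<cdot> n)" "Cod C s = Dom C q" "s \<cdot> (q \<cdot> n) = n" "q \<cdot> s = Ident C (Cod C q)"
    by (rule liftsE[OF l, of n "Ident C (Cod C q)"]) (use n qA in auto)
  have ds: "Dom C s = Cod C q" using s(2) n qA by simp
  have sT: "s \<in> TC" by (rule TF_section_TC[OF q s(1) ds s(3,5)])
  show ?thesis
    using TC_comp_two_of_three[OF m TC_monic[OF sT] s(2)] sT unfolding s(4) by blast
qed

lemma monic_TF_factor:
  assumes "f \<in> Ar C"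
  obtains p m where "p \<in> TF" "monic C m" "Cod C m = Dom C p" "f = p \<cdot> m"
proof -
  obtain i p c k where "short_exact C i c" "short_exact C k p" "Cod C i = Dom C p" "f = p \<cdot> i"
    "Cod C c \<in> Ob C" "Dom C k \<in> Inj C" by (rule cotorsion_factorization[OF cpI assms])
  then show ?thesis
    by (intro that[of p i]) (auto simp: epics_with_kernel_iff dest: short_exact_simps)
qed

text \<open>Two factorisations of the same arrow are compared in the pullback of their trivial fibrations: both
  monomorphisms arise from the induced arrow \<open>u\<close> by composing with trivial fibrations, which
  \<open>TC_cancel_TF\<close> cancels.\<close>

lemma weq_iff:
  assumes p: "p \<in> TF" and m: "monic C m" "Cod C m = Dom C p"
  shows "weq (p \<cdot> m) \<longleftrightarrow> m \<in> TC"
proof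
  assume "m \<in> TC"
  then show "weq (p \<cdot> m)" unfolding weq_def using p m by blast
next
  assume "weq (p \<cdot> m)"
  then obtain p' n where n: "p' \<in> TF" "n \<in> TC" "Cod C n = Dom C p'" "p \<cdot> m = p' \<cdot> n" unfolding weq_def by blast
  have pA: "p \<in> Ar C" "p' \<in> Ar C" using TF_epic p n by auto
  have nm: "monic C n" by (rule TC_monic[OF n(2)])
  have nA: "n \<in> Ar C" "m \<in> Ar C" using nm m by simp_all
  have "Cod C (p \<cdot> m) = Cod C p" "Cod C (p' \<cdot> n) = Cod C p'" "Dom C (p \<cdot> m) = Dom C m" "Dom C (p' \<cdot> n) = Dom C n"
    using pA nA m(2) n(3) by simp_all
  then have d: "Cod C p' = Cod C p" "Dom C m = Dom C n" using n(4) by simp_all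
  obtain q q' where qq: "is_pullback C p p' q q'" using ex_pullback[OF pA d(1)] by blast
  note P = is_pullback_simps[OF qq]
  obtain k where k: "short_exact C k p" "Dom C k \<in> Inj C" using p by (rule TF_E)
  obtain k' where k': "short_exact C k' p'" "Dom C k' \<in> Inj C" using n(1) by (rule TF_E)
  note qq' = is_pullback_sym[OF qq]
  have q': "q' \<in> TF"
  proof -
    obtain l where l: "is_kernel C q' l" "q \<cdot> l = k"
      using pullback_kernel[OF qq] short_exact_simps(7)[OF k(1)] by blast
    have "Dom C (q \<cdot> l) = Dom C l" using is_kernel_simps[OF l(1)] P(3,6) by simp
    then have "Dom C l = Dom C k" unfolding l(2) by simp
    then show ?thesis
      unfolding epics_with_kernel_in_def using l(1) k(2) pullback_epic[OF qq TF_epic[OF p]] by auto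
  qed
  have q: "q \<in> TF"
  proof -
    obtain l where l: "is_kernel C q l" "q' \<cdot> l = k'"
      using pullback_kernel[OF qq'] short_exact_simps(7)[OF k'(1)] by blast
    have "Dom C (q' \<cdot> l) = Dom C l" using is_kernel_simps[OF l(1)] P(4,6) by simp
    then have "Dom C l = Dom C k'" unfolding l(2) by simp
    then show ?thesis
      unfolding epics_with_kernel_in_def using l(1) k'(2) pullback_epic[OF qq' TF_epic[OF n(1)]] by auto
  qed
  obtain u where u: "u \<in> Ar C" "Dom C u = Dom C m" "Cod C u = Dom C q" "q \<cdot> u = m" "q' \<cdot> u = n"
    by (rule pullback_factor[OF qq, of m n]) (use nA d m(2) n(3,4) in auto)
  have "u \<in> TC \<longleftrightarrow> m \<in> TC"
    using TC_cancel_TF[OF q u(1,3)] m(1) unfolding u(4) by blast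
  moreover have "u \<in> TC \<longleftrightarrow> n \<in> TC"
    using TC_cancel_TF[OF q' u(1)] u(3) P(6) nm unfolding u(5) by simp
  ultimately show "m \<in> TC" using n(2) by blast
qed

lemma TF_comp:
  assumes "p \<in> TF" "p' \<in> TF" "Dom C p' = Cod C p"
  shows "p' \<cdot> p \<in> TF"
proof -
  have e: "epic C (p' \<cdot> p)" using epic_comp[of p' p] TF_epic assms by simp
  obtain k where k: "short_exact C k p" "Dom C k \<in> Inj C" using assms(1) by (rule TF_E)
  obtain k' where k': "short_exact C k' p'" "Dom C k' \<in> Inj C" using assms(2) by (rule TF_E)
  obtain l where "is_kernel C (p' \<cdot> p) l" using ex_kernel[of "p' \<cdot> p"] e by auto
  then have l: "short_exact C l (p' \<cdot> p)" unfolding short_exact_iff_kernel using e by simp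
  obtain \<phi> \<theta> where "short_exact C \<theta> \<phi>" "Cod C \<phi> = Dom C k'" "Cod C \<theta> = Dom C l" "Dom C \<theta> = Dom C k"
    using kernel_comp_epic[OF k'(1) k(1) l] assms(3) by auto
  then have "Dom C l \<in> Inj C"
    using cotorsion_extension_closed(2)[OF coI, of \<theta> \<phi>] k(2) k'(2) short_exact_simps(3)[of \<theta> \<phi>] by simp
  then show ?thesis unfolding epics_with_kernel_iff using l by blast
qed

text \<open>Factor \<open>f = p \<cdot> m\<close>, \<open>g = p' \<cdot> m'\<close> and interchange the middle arrows: \<open>m' \<cdot> p = p'' \<cdot> m''\<close>. Composing with a section of
  \<open>p\<close> shows that \<open>m''\<close> is a trivial cofibration iff \<open>m'\<close> is. Hence the three arrows are weak equivalences
  according to whether \<open>m\<close>, \<open>m''\<close> and \<open>m'' \<cdot> m\<close> are trivial cofibrations.\<close>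

lemma weq_two_of_three:
  assumes fg: "f \<in> Ar C" "g \<in> Ar C" "Cod C f = Dom C g"
  shows "weq f \<Longrightarrow> weq g \<Longrightarrow> weq (g \<cdot> f)" "weq f \<Longrightarrow> weq (g \<cdot> f) \<Longrightarrow> weq g"
    "weq g \<Longrightarrow> weq (g \<cdot> f) \<Longrightarrow> weq f"
proof -
  obtain p m where f: "p \<in> TF" "monic C m" "Cod C m = Dom C p" "f = p \<cdot> m"
    by (rule monic_TF_factor[OF fg(1)])
  obtain p' m' where g: "p' \<in> TF" "monic C m'" "Cod C m' = Dom C p'" "g = p' \<cdot> m'"
    by (rule monic_TF_factor[OF fg(2)])
  have A: "p \<in> Ar C" "p' \<in> Ar C" "m \<in> Ar C" "m' \<in> Ar C" using f g TF_epic by auto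
  have d: "Dom C m' = Cod C p" using fg(3) A f(3) g(3) unfolding f(4) g(4) by simp
  have mp: "m' \<cdot> p \<in> Ar C" using A d by simp
  obtain p'' m'' where h: "p'' \<in> TF" "monic C m''" "Cod C m'' = Dom C p''" "m' \<cdot> p = p'' \<cdot> m''"
    by (rule monic_TF_factor[OF mp])
  have A': "p'' \<in> Ar C" "m'' \<in> Ar C" using h TF_epic by auto
  have "Dom C (m' \<cdot> p) = Dom C p" "Cod C (m' \<cdot> p) = Cod C m'" using A d by simp_all
  then have d': "Dom C m'' = Dom C p" "Cod C p'' = Cod C m'" using A' h(3) unfolding h(4) by simp_all
  have gf: "g \<cdot> f = (p' \<cdot> p'') \<cdot> (m'' \<cdot> m)"
  proof -
    have "g \<cdot> f = p' \<cdot> ((m' \<cdot> p) \<cdot> m)" unfolding f(4) g(4) using A d f(3) g(3) by simp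
    also have "\<dots> = (p' \<cdot> p'') \<cdot> (m'' \<cdot> m)" unfolding h(4) using A A' d' f(3) g(3) h(3) by simp
    finally show ?thesis .
  qed
  have mm: "monic C (m'' \<cdot> m)" by (rule monic_comp) (use f h d' in auto)
  have pp: "p' \<cdot> p'' \<in> TF" by (rule TF_comp) (use g h d' in auto)
  obtain k where k: "short_exact C k p" "Dom C k \<in> Inj C" using f(1) by (rule TF_E)
  have "orth C (Cod C p) (Dom C k)" using k A orth_Inj by simp
  then obtain t where t: "t \<in> Ar C" "Dom C t = Cod C p" "Cod C t = Dom C p" "p \<cdot> t = Ident C (Cod C p)"
    by (rule orth_lift_obj[OF _ k(1), of "Cod C p" "Ident C (Cod C p)"]) (use A in auto)
  have tT: "t \<in> TC" by (rule TF_section_TC[OF f(1) t])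
  have "p'' \<cdot> (m'' \<cdot> t) = (m' \<cdot> p) \<cdot> t" unfolding h(4) using A' t d' h(3) by simp
  also have "\<dots> = m'" using A d t by simp
  finally have m't: "p'' \<cdot> (m'' \<cdot> t) = m'" .
  have "m'' \<cdot> t \<in> TC \<longleftrightarrow> m' \<in> TC"
    using TC_cancel_TF[OF h(1), of "m'' \<cdot> t"] A' t d' h(3) g(2) unfolding m't by simp
  moreover have "m'' \<cdot> t \<in> TC \<longleftrightarrow> m'' \<in> TC"
    using TC_comp_two_of_three[OF TC_monic[OF tT] h(2)] t(3) d'(1) tT by auto
  ultimately have eq: "m'' \<in> TC \<longleftrightarrow> m' \<in> TC" by blast
  have w: "weq f \<longleftrightarrow> m \<in> TC" "weq g \<longleftrightarrow> m'' \<in> TC" "weq (g \<cdot> f) \<longleftrightarrow> m'' \<cdot> m \<in> TC"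
  proof -
    show "weq f \<longleftrightarrow> m \<in> TC" unfolding f(4) by (rule weq_iff[OF f(1-3)])
    show "weq g \<longleftrightarrow> m'' \<in> TC" unfolding g(4) eq by (rule weq_iff[OF g(1-3)])
    show "weq (g \<cdot> f) \<longleftrightarrow> m'' \<cdot> m \<in> TC" unfolding gf
      by (rule weq_iff[OF pp mm]) (use A A' d' f(3) g(3) h(3) in auto)
  qed
  have dm: "Dom C m'' = Cod C m" using d' f(3) by simp
  show "weq f \<Longrightarrow> weq g \<Longrightarrow> weq (g \<cdot> f)" "weq f \<Longrightarrow> weq (g \<cdot> f) \<Longrightarrow> weq g"
    "weq g \<Longrightarrow> weq (g \<cdot> f) \<Longrightarrow> weq f"
    unfolding w using TC_comp_two_of_three[OF f(2) h(2) dm] by blast+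
qed

text \<open>Any extension of \<open>Cod c\<close> by an object of \<open>F\<close> is split by lifting \<open>c\<close> against its epimorphism with the
  zero arrow on \<open>Dom m\<close>, so \<open>Cod c\<close> is orthogonal to \<open>F\<close>.\<close>

lemma lifting_TC:
  assumes m: "monic C m" and l: "\<And>p. p \<in> FIB \<Longrightarrow> lifts C m p"
  shows "m \<in> TC"
proof -
  obtain c where c: "is_cokernel C m c" using ex_cokernel[of m] m by auto
  have s: "short_exact C m c" unfolding short_exact_iff_cokernel using c m by simp
  note S = short_exact_simps[OF s]
  have "orth C (Cod C c) y" if y: "y \<in> F" for y
  proof (rule orthI_section)
    show "y \<in> Ob C" using y FOb by blast
    fix f g assume fg: "short_exact C f g" "Cod C g = Cod C c" "Dom C f = y"
    note T = short_exact_simps[OF fg(1)]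
    have "g \<in> FIB" unfolding epics_with_kernel_iff using fg y by blast
    then have lg: "lifts C m g" by (rule l)
    obtain h where h: "h \<in> Ar C" "Dom C h = Cod C m" "Cod C h = Dom C g" "h \<cdot> m = zer (Dom C m) (Dom C g)" "g \<cdot> h = c"
      by (rule liftsE[OF lg, of "zer (Dom C m) (Dom C g)" c]) (use S T fg in auto)
    obtain t where t: "t \<in> Ar C" "Cod C t = Cod C h" "Dom C t = Cod C c" "t \<cdot> c = h"
      by (rule cokernel_factor[OF S(8), of h]) (use h S in auto)
    have "g \<cdot> t = Ident C (Cod C c)"
      by (rule epicD[OF S(6)]) (use t h fg(2) T S(2) in auto)
    then show "\<exists>s. s \<in> Ar C \<and> Dom C s = Cod C c \<and> Cod C s = Dom C g \<and> g \<cdot> s = Ident C (Cod C c)"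
      using t h by (intro exI[of _ t]) simp
  qed
  moreover have "Cod C c \<in> Ob C" using S by simp
  ultimately have "Cod C c \<in> W" using co unfolding cotorsion_pair_iff by blast
  then show ?thesis unfolding monics_with_cokernel_iff using s by blast
qed


lemma retract_ofE:
  assumes "retract_of C f g"
  obtains i r j s where "f \<in> Ar C" "g \<in> Ar C"
    "i \<in> Ar C" "Dom C i = Dom C f" "Cod C i = Dom C g" "r \<in> Ar C" "Dom C r = Dom C g" "Cod C r = Dom C f"
    "j \<in> Ar C" "Dom C j = Cod C f" "Cod C j = Cod C g" "s \<in> Ar C" "Dom C s = Cod C g" "Cod C s = Cod C f"
    "r \<cdot> i = Ident C (Dom C f)" "s \<cdot> j = Ident C (Cod C f)" "g \<cdot> i = j \<cdot> f" "f \<cdot> r = s \<cdot> g"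
  using assms unfolding retract_of_def in_Hom Bex_def by blast

text \<open>The lifts \<open>\<alpha>\<close>, \<open>\<beta>\<close> of the retraction to the factorisations compose to \<open>1 - k \<cdot> \<delta>\<close>
  with \<open>k\<close> the kernel of the trivial fibration. The error term factors through an injective object, so
  it does not obstruct the lifting property of \<open>m\<close>.\<close>

lemma weq_retract:
  assumes rt: "retract_of C f g" and wg: "weq g"
  shows "weq f"
proof -
  obtain i r j s where t: "f \<in> Ar C" "g \<in> Ar C"
    "i \<in> Ar C" "Dom C i = Dom C f" "Cod C i = Dom C g" "r \<in> Ar C" "Dom C r = Dom C g" "Cod C r = Dom C f"
    "j \<in> Ar C" "Dom C j = Cod C f" "Cod C j = Cod C g" "s \<in> Ar C" "Dom C s = Cod C g" "Cod C s = Cod C f"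
    "r \<cdot> i = Ident C (Dom C f)" "s \<cdot> j = Ident C (Cod C f)" "g \<cdot> i = j \<cdot> f" "f \<cdot> r = s \<cdot> g"
    using rt by (rule retract_ofE)
  obtain p m where pm: "p \<in> TF" "monic C m" "Cod C m = Dom C p" "f = p \<cdot> m"
    by (rule monic_TF_factor[OF t(1)])
  obtain p' n where pn: "p' \<in> TF" "n \<in> TC" "Cod C n = Dom C p'" "g = p' \<cdot> n"
    using wg unfolding weq_def by blast
  have A: "p \<in> Ar C" "p' \<in> Ar C" "m \<in> Ar C" "n \<in> Ar C" using pm pn TF_epic TC_monic by auto
  have d: "Dom C f = Dom C m" "Cod C f = Cod C p" "Dom C g = Dom C n" "Cod C g = Cod C p'"
    using A pm(3) pn(3) unfolding pm(4) pn(4) by simp_all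
  note T = t(3-14)[unfolded d]
  have ri: "r \<cdot> i = Ident C (Dom C m)" "s \<cdot> j = Ident C (Cod C p)"
    and sq: "p' \<cdot> (n \<cdot> i) = (j \<cdot> p) \<cdot> m" "p \<cdot> (m \<cdot> r) = (s \<cdot> p') \<cdot> n"
    using t(15-18) A T pm(3) pn(3) unfolding d unfolding pm(4) pn(4) by simp_all
  have l1: "lifts C m p'" by (rule lifts_monic_TF[OF pm(2) pn(1)])
  obtain \<alpha> where \<alpha>: "\<alpha> \<in> Ar C" "Dom C \<alpha> = Cod C m" "Cod C \<alpha> = Dom C p'" "\<alpha> \<cdot> m = n \<cdot> i" "p' \<cdot> \<alpha> = j \<cdot> p"
    by (rule liftsE[OF l1, of "n \<cdot> i" "j \<cdot> p"]) (use A T pm(3) pn(3) sq in auto)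
  have l2: "lifts C n p" by (rule lifts_monic_TF[OF TC_monic[OF pn(2)] pm(1)])
  obtain \<beta> where \<beta>: "\<beta> \<in> Ar C" "Dom C \<beta> = Cod C n" "Cod C \<beta> = Dom C p" "\<beta> \<cdot> n = m \<cdot> r" "p \<cdot> \<beta> = s \<cdot> p'"
    by (rule liftsE[OF l2, of "m \<cdot> r" "s \<cdot> p'"]) (use A T pm(3) pn(3) sq in auto)
  have ba: "\<beta> \<cdot> \<alpha> \<in> Ar C" "Dom C (\<beta> \<cdot> \<alpha>) = Dom C p" "Cod C (\<beta> \<cdot> \<alpha>) = Dom C p"
    using \<alpha>(1-3) \<beta>(1-3) pm(3) pn(3) by simp_all
  have bam: "\<beta> \<cdot> (\<alpha> \<cdot> m) = m"
  proof -
    have "\<beta> \<cdot> (n \<cdot> i) = (m \<cdot> r) \<cdot> i" by (rule comp_ext[OF \<beta>(4)]) (use A T \<beta> pn in auto)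
    also have "\<dots> = m \<cdot> (r \<cdot> i)" by (rule comp_assoc) (use A T in auto)
    finally show ?thesis unfolding \<alpha>(4) ri using A by simp
  qed
  have pba: "p \<cdot> (\<beta> \<cdot> \<alpha>) = p"
  proof -
    have "p \<cdot> (\<beta> \<cdot> \<alpha>) = (s \<cdot> p') \<cdot> \<alpha>" by (rule comp_ext[OF \<beta>(5)]) (use A T \<alpha>(1-3) \<beta>(1-3) pm(3) pn(3) in auto)
    also have "\<dots> = s \<cdot> (p' \<cdot> \<alpha>)" by (rule comp_assoc) (use A T \<alpha>(1-3) in auto)
    also have "\<dots> = Ident C (Cod C p) \<cdot> p" unfolding \<alpha>(5) by (rule comp_ext[OF ri(2)]) (use A T in auto)
    finally show ?thesis using A by simp
  qed
  define D where "D = Ident C (Dom C p) \<boxminus> \<beta> \<cdot> \<alpha>"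
  have D: "D \<in> Ar C" "Dom C D = Dom C p" "Cod C D = Dom C p" "D \<boxplus> \<beta> \<cdot> \<alpha> = Ident C (Dom C p)"
    unfolding D_def using ba A by simp_all
  have pD: "p \<cdot> D = zer (Dom C p) (Cod C p)" unfolding D_def using ba A by (simp add: pba)
  have Dm: "D \<cdot> m = zer (Dom C m) (Dom C p)"
  proof -
    have "(\<beta> \<cdot> \<alpha>) \<cdot> m = m" using bam \<alpha>(1-3) \<beta>(1-3) A pn(3) by simp
    then show ?thesis unfolding D_def using ba A pm(3) by (simp del: comp_assoc)
  qed
  obtain k where k: "short_exact C k p" "Dom C k \<in> Inj C" using pm(1) by (rule TF_E)
  note K = short_exact_simps[OF k(1)]
  obtain \<delta> where \<delta>: "\<delta> \<in> Ar C" "Dom C \<delta> = Dom C D" "Cod C \<delta> = Dom C k" "k \<cdot> \<delta> = D"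
    by (rule kernel_factor[OF K(7), of D]) (use D pD in auto)
  have dd: "Dom C \<delta> = Dom C p" using \<delta> D by simp
  have dm: "\<delta> \<cdot> m = zer (Dom C m) (Dom C k)"
  proof (rule monic_zerD[OF K(5)])
    have "k \<cdot> (\<delta> \<cdot> m) = D \<cdot> m" by (rule comp_ext[OF \<delta>(4)]) (use \<delta> dd A K pm(3) in auto)
    then show "k \<cdot> (\<delta> \<cdot> m) = zer (Dom C (\<delta> \<cdot> m)) (Cod C k)" using Dm \<delta>(1) dd A K(3) pm(3) by simp
  qed (use \<delta>(1,3) dd A pm(3) in auto)
  have "m \<in> TC"
  proof (rule lifting_TC[OF pm(2)])
    fix x assume x: "x \<in> FIB"
    obtain y where y: "short_exact C y x" "Dom C y \<in> F" using x by (rule FIB_E)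
    note X = short_exact_simps[OF y(1)]
    have ln: "lifts C n x" by (rule lifts_TC_FIB[OF pn(2) x])
    show "lifts C m x" unfolding lifts_def
    proof (intro ballI impI)
      fix u v assume uv: "u \<in> Hom C (Dom C m) (Dom C x)" "v \<in> Hom C (Cod C m) (Cod C x)" "x \<cdot> u = v \<cdot> m"
      have u: "u \<in> Ar C" "Dom C u = Dom C m" "Cod C u = Dom C x" and v: "v \<in> Ar C" "Dom C v = Dom C p" "Cod C v = Cod C x"
        using uv pm(3) by auto
      have sq2: "x \<cdot> (u \<cdot> r) = (v \<cdot> \<beta>) \<cdot> n"
      proof -
        have "x \<cdot> (u \<cdot> r) = v \<cdot> (m \<cdot> r)" by (rule comp_ext2[OF uv(3)]) (use u v X A T pm(3) in auto)
        then show ?thesis using u v \<beta> A pm(3) pn(3) by simp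
      qed
      obtain h where h: "h \<in> Ar C" "Dom C h = Cod C n" "Cod C h = Dom C x" "h \<cdot> n = u \<cdot> r" "x \<cdot> h = v \<cdot> \<beta>"
        by (rule liftsE[OF ln, of "u \<cdot> r" "v \<cdot> \<beta>"]) (use u v X A T \<beta>(1-3) sq2 pm(3) in auto)
      have "orth C (Dom C k) (Dom C y)" using k(2) WF y(2) orthWF by blast
      then obtain l where l: "l \<in> Ar C" "Dom C l = Dom C k" "Cod C l = Dom C x" "x \<cdot> l = v \<cdot> k"
        by (rule orth_lift_obj[OF _ y(1), of "Dom C k" "v \<cdot> k"]) (use v K in auto)
      \<comment> \<open>The lift \<open>h\<close> against \<open>n\<close>, corrected on the error term \<open>k \<cdot> \<delta> = 1 - \<beta> \<cdot> \<alpha>\<close>.\<close>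
      define H where "H = h \<cdot> \<alpha> \<boxplus> l \<cdot> \<delta>"
      have ha: "h \<cdot> \<alpha> \<in> Ar C" "Dom C (h \<cdot> \<alpha>) = Dom C p" "Cod C (h \<cdot> \<alpha>) = Dom C x"
        "l \<cdot> \<delta> \<in> Ar C" "Dom C (l \<cdot> \<delta>) = Dom C p" "Cod C (l \<cdot> \<delta>) = Dom C x"
        using h(1-3) \<alpha>(1-3) l(1-3) \<delta>(1,3) dd pm(3) pn(3) by simp_all
      have H: "H \<in> Ar C" "Dom C H = Dom C p" "Cod C H = Dom C x" unfolding H_def using ha by simp_all
      have h1: "h \<cdot> (\<alpha> \<cdot> m) = u"
      proof -
        have "h \<cdot> (n \<cdot> i) = (u \<cdot> r) \<cdot> i" by (rule comp_ext[OF h(4)]) (use h(1-3) A T in auto)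
        also have "\<dots> = u \<cdot> (r \<cdot> i)" by (rule comp_assoc) (use u T in auto)
        finally show ?thesis unfolding \<alpha>(4) ri using u by simp
      qed
      have "H \<cdot> m = h \<cdot> (\<alpha> \<cdot> m) \<boxplus> l \<cdot> (\<delta> \<cdot> m)"
        unfolding H_def using ha A pm(3) h(1-3) \<alpha>(1-3) l(1-3) \<delta>(1,3) dd pn(3) by simp
      then have Hm: "H \<cdot> m = u" unfolding h1 dm using u l A by simp
      have x1: "x \<cdot> (h \<cdot> \<alpha>) = v \<cdot> (\<beta> \<cdot> \<alpha>)"
        by (rule comp_ext2[OF h(5)]) (use h(1-3) X v \<beta>(1-3) \<alpha>(1-3) pm(3) pn(3) in auto)
      have x2: "x \<cdot> (l \<cdot> \<delta>) = v \<cdot> (k \<cdot> \<delta>)"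
        by (rule comp_ext2[OF l(4)]) (use l(1-3) X v K \<delta>(1,3) in auto)
      have "x \<cdot> H = v \<cdot> (\<beta> \<cdot> \<alpha>) \<boxplus> v \<cdot> D"
        unfolding H_def using ha X by (simp add: x1 x2 \<delta>(4))
      also have "\<dots> = v \<cdot> (\<beta> \<cdot> \<alpha> \<boxplus> D)" using ba D(1-3) v by simp
      also have "\<beta> \<cdot> \<alpha> \<boxplus> D = Ident C (Dom C p)" using add_comm[of "\<beta> \<cdot> \<alpha>" D] ba D by simp
      finally have xH: "x \<cdot> H = v" using v by simp
      show "\<exists>h\<in>Hom C (Cod C m) (Dom C x). h \<cdot> m = u \<and> x \<cdot> h = v"
        by (rule bexI[of _ H]) (use H Hm xH pm(3) in auto)
    qed
  qed
  then show ?thesis unfolding pm(4) using weq_iff[OF pm(1-3)] by blast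
qed

lemma monic_retract:
  assumes "retract_of C f g" "monic C g"
  shows "monic C f"
proof -
  obtain i r j s where t: "f \<in> Ar C" "g \<in> Ar C"
    "i \<in> Ar C" "Dom C i = Dom C f" "Cod C i = Dom C g" "r \<in> Ar C" "Dom C r = Dom C g" "Cod C r = Dom C f"
    "j \<in> Ar C" "Dom C j = Cod C f" "Cod C j = Cod C g" "s \<in> Ar C" "Dom C s = Cod C g" "Cod C s = Cod C f"
    "r \<cdot> i = Ident C (Dom C f)" "s \<cdot> j = Ident C (Cod C f)" "g \<cdot> i = j \<cdot> f" "f \<cdot> r = s \<cdot> g"
    using assms(1) by (rule retract_ofE)
  have "monic C i" by (rule split_monic[of r]) (use t in auto)
  then have "monic C (j \<cdot> f)" using monic_comp[of i g] assms(2) t(5,17) by simp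
  then show ?thesis by (rule monic_cancel) (use t in auto)
qed

lemma FIB_retract:
  assumes "retract_of C f g" "g \<in> FIB"
  shows "f \<in> FIB"
proof -
  obtain i r j s where t: "f \<in> Ar C" "g \<in> Ar C"
    "i \<in> Ar C" "Dom C i = Dom C f" "Cod C i = Dom C g" "r \<in> Ar C" "Dom C r = Dom C g" "Cod C r = Dom C f"
    "j \<in> Ar C" "Dom C j = Cod C f" "Cod C j = Cod C g" "s \<in> Ar C" "Dom C s = Cod C g" "Cod C s = Cod C f"
    "r \<cdot> i = Ident C (Dom C f)" "s \<cdot> j = Ident C (Cod C f)" "g \<cdot> i = j \<cdot> f" "f \<cdot> r = s \<cdot> g"
    using assms(1) by (rule retract_ofE)
  obtain l where l: "short_exact C l g" "Dom C l \<in> F" using assms(2) by (rule FIB_E)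
  note L = short_exact_simps[OF l(1)]
  have "epic C s" by (rule split_epic[of _ j]) (use t in auto)
  then have "epic C (f \<cdot> r)" using epic_comp[of s g] L(6) t(13,18) by simp
  then have ef: "epic C f" by (rule epic_cancel) (use t in auto)
  obtain k where k: "is_kernel C f k" using ex_kernel[OF t(1)] by blast
  note K = is_kernel_simps[OF k]
  have "obj_retract C (Dom C k) (Dom C l)"
  proof (rule kernel_retract[OF k L(7) t(3-8) t(15)])
    have "g \<cdot> (i \<cdot> k) = j \<cdot> (f \<cdot> k)" by (rule comp_ext2[OF t(17)]) (use t(1-14) K in auto)
    then show "g \<cdot> (i \<cdot> k) = zer (Dom C k) (Cod C g)" using K(4) t(1,9-11) K(2) by simp
    have "f \<cdot> (r \<cdot> l) = s \<cdot> (g \<cdot> l)" by (rule comp_ext2[OF t(18)]) (use t(1-14) L in auto)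
    then show "f \<cdot> (r \<cdot> l) = zer (Dom C l) (Cod C f)" using L(1,4) t(2,12-14) by simp
  qed
  then have "Dom C k \<in> F" using F_retract l by blast
  then show ?thesis unfolding epics_with_kernel_in_def using ef k by blast
qed

lemma Ident_TF: "a \<in> Ob C \<Longrightarrow> Ident C a \<in> TF"
proof -
  assume a: "a \<in> Ob C"
  obtain E m where E: "E \<in> Inj C" "m \<in> Hom C a E" using ei a unfolding enough_injectives_def by blast
  obtain z where z: "zero_object C z" "z \<in> Ob C" by (rule obtain_zero)
  have EO: "E \<in> Ob C" using E by (simp add: Inj_def)
  have "zer E z \<cdot> zer z E = Ident C z" using zero_object_iff z EO by simp
  then have "obj_retract C z E"
    unfolding obj_retract_def using z EO by (intro exI[of _ "zer z E"] exI[of _ "zer E z"]) simp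
  then have zI: "z \<in> Inj C" using Inj_retract E by blast
  show ?thesis unfolding epics_with_kernel_iff
    using short_exact_zer_Ident[OF z(1) a] zI z(2) a by (intro exI[of _ "zer z a"]) simp
qed

lemma weq_monic_iff: "monic C f \<Longrightarrow> weq f \<longleftrightarrow> f \<in> TC"
  using weq_iff[of "Ident C (Cod C f)" f] Ident_TF by simp

text \<open>If a fibration \<open>f = p \<cdot> m\<close> is a weak equivalence, it lifts against \<open>m\<close> and so becomes a retract of \<open>p\<close>;
  hence its kernel is a retract of an injective object.\<close>

lemma weq_FIB_iff: "f \<in> FIB \<and> weq f \<longleftrightarrow> f \<in> TF"
proof
  assume f: "f \<in> TF"
  have fA: "f \<in> Ar C" using TF_epic[OF f] by simp
  have "weq (f \<cdot> Ident C (Dom C f))"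
    using weq_iff[OF f, of "Ident C (Dom C f)"] weq_monic_iff[of "Ident C (Dom C f)"] fA
      TF_section_TC[OF Ident_TF, of "Dom C f" "Ident C (Dom C f)"] by simp
  then have "weq f" using fA by simp
  moreover have "f \<in> FIB" using f WF unfolding epics_with_kernel_in_def by blast
  ultimately show "f \<in> FIB \<and> weq f" by blast
next
  assume a: "f \<in> FIB \<and> weq f"
  obtain l where l: "short_exact C l f" "Dom C l \<in> F" using a FIB_E by blast
  note L = short_exact_simps[OF l(1)]
  obtain p m where pm: "p \<in> TF" "m \<in> TC" "Cod C m = Dom C p" "f = p \<cdot> m"
    using a unfolding weq_def by blast
  have A: "p \<in> Ar C" "m \<in> Ar C" using pm TF_epic TC_monic by auto
  have d: "Dom C m = Dom C f" "Cod C p = Cod C f" using A pm(3) unfolding pm(4) by simp_all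
  obtain k where k: "short_exact C k p" "Dom C k \<in> Inj C" using pm(1) by (rule TF_E)
  note K = short_exact_simps[OF k(1)]
  have lf: "lifts C m f" using lifts_TC_FIB pm(2) a by blast
  obtain h where h: "h \<in> Ar C" "Dom C h = Cod C m" "Cod C h = Dom C f" "h \<cdot> m = Ident C (Dom C f)" "f \<cdot> h = p"
    by (rule liftsE[OF lf, of "Ident C (Dom C f)" p]) (use A d L(2) pm(3) pm(4)[symmetric] in auto)
  have "obj_retract C (Dom C l) (Dom C k)"
  proof (rule kernel_retract[OF L(7) K(7)])
    show "m \<in> Ar C" "Dom C m = Dom C f" "Cod C m = Dom C p" "h \<in> Ar C" "Dom C h = Dom C p" "Cod C h = Dom C f"
      "h \<cdot> m = Ident C (Dom C f)" using A d h pm(3) by simp_all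
    have "p \<cdot> (m \<cdot> l) = f \<cdot> l" using A d(1) pm(3) L(1,3) unfolding pm(4) by simp
    then show "p \<cdot> (m \<cdot> l) = zer (Dom C l) (Cod C p)" using L(4) d(2) by simp
    have "f \<cdot> (h \<cdot> k) = p \<cdot> k" by (rule comp_ext[OF h(5)]) (use h(1-3) L(2) K pm(3) in auto)
    then show "f \<cdot> (h \<cdot> k) = zer (Dom C k) (Cod C f)" using K(4) d(2) by simp
  qed
  then have "Dom C l \<in> Inj C" using Inj_retract k(2) by blast
  then show "f \<in> TF" unfolding epics_with_kernel_iff using l(1) by blast
qed

lemma weq_Ar: "weq f \<Longrightarrow> f \<in> Ar C"
  unfolding weq_def using TF_epic TC_monic by auto

lemma monics_Ob: "monics_with_cokernel_in C (Ob C) = {m. monic C m}"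
  unfolding monics_with_cokernel_in_def using ex_cokernel is_cokernel_simps(2) by force

lemma model: "model_structure C {m. monic C m} {f. weq f} FIB"
  unfolding model_structure_def
proof (intro conjI ballI impI)
  show "{m. monic C m} \<subseteq> Ar C" "{f. weq f} \<subseteq> Ar C" using weq_Ar by auto
  show "FIB \<subseteq> Ar C" unfolding epics_with_kernel_in_def by auto
  show "retract_closed C {m. monic C m}" unfolding retract_closed_def using monic_retract by blast
  show "retract_closed C {f. weq f}" unfolding retract_closed_def using weq_retract by blast
  show "retract_closed C FIB" unfolding retract_closed_def using FIB_retract by blast
  show "lifts C i p" if "i \<in> {m. monic C m} \<inter> {f. weq f}" "p \<in> FIB" for i p
    using that weq_monic_iff lifts_TC_FIB by blast
  show "lifts C i p" if "i \<in> {m. monic C m}" "p \<in> FIB \<inter> {f. weq f}" for i p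
    using that weq_FIB_iff lifts_monic_TF by blast
  fix f assume f: "f \<in> Ar C"
  obtain i p c k where 1: "short_exact C i c" "short_exact C k p" "Cod C i = Dom C p" "f = p \<cdot> i"
    "Cod C c \<in> W" "Dom C k \<in> F" by (rule cotorsion_factorization[OF cp f])
  have "i \<in> TC" "p \<in> FIB" using 1 unfolding monics_with_cokernel_iff epics_with_kernel_iff by blast+
  then show "\<exists>i\<in>{m. monic C m} \<inter> {f. weq f}. \<exists>p\<in>FIB. Cod C i = Dom C p \<and> f = p \<cdot> i"
    using 1 TC_monic weq_monic_iff by blast
  obtain p m where 2: "p \<in> TF" "monic C m" "Cod C m = Dom C p" "f = p \<cdot> m"
    by (rule monic_TF_factor[OF f])
  then show "\<exists>i\<in>{m. monic C m}. \<exists>p\<in>FIB \<inter> {f. weq f}. Cod C i = Dom C p \<and> f = p \<cdot> i"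
    using weq_FIB_iff by blast
  fix g assume g: "g \<in> Ar C" "Cod C f = Dom C g"
  note T = weq_two_of_three[OF f g]
  show "f \<in> {f. weq f} \<and> g \<in> {f. weq f} \<Longrightarrow> g \<cdot> f \<in> {f. weq f}"
    "f \<in> {f. weq f} \<and> g \<cdot> f \<in> {f. weq f} \<Longrightarrow> g \<in> {f. weq f}"
    "g \<in> {f. weq f} \<and> g \<cdot> f \<in> {f. weq f} \<Longrightarrow> f \<in> {f. weq f}" using T by blast+
qed

lemma hovey_triple_of_model: "hovey_triple_of C {m. monic C m} {f. weq f} FIB = (Ob C, W, F)"
proof -
  obtain z where z: "zero_object C z" "z \<in> Ob C" by (rule obtain_zero)
  note SE = short_exact_zer_Ident[OF z(1)] and SE' = short_exact_Ident_zer[OF z(1)]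
  have 1: "cofibrant_objects C {m. monic C m} = Ob C"
  proof -
    have "\<exists>f\<in>{m. monic C m}. zero_object C (Dom C f) \<and> Cod C f = a" if a: "a \<in> Ob C" for a
      using short_exact_simps(5)[OF SE[OF a]] z a by (intro bexI[of _ "zer z a"]) auto
    then show ?thesis unfolding cofibrant_objects_def by blast
  qed
  have 2: "trivial_objects C {f. weq f} = W"
  proof (intro equalityI subsetI)
    fix a assume "a \<in> trivial_objects C {f. weq f}"
    then obtain f where f: "weq f" "zero_object C (Dom C f)" "Cod C f = a" "a \<in> Ob C"
      unfolding trivial_objects_def by blast
    have fz: "f = zer (Dom C f) a" using zero_object_from[OF f(2) weq_Ar[OF f(1)]] f(3) by simp
    have s: "short_exact C f (Ident C a)" using short_exact_zer_Ident[OF f(2,4)] fz by simp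
    have "f \<in> TC" using weq_monic_iff f(1) short_exact_simps(5)[OF s] by blast
    then show "a \<in> W" using TC_D[OF _ s] f(4) by simp
  next
    fix a assume a: "a \<in> W"
    have aO: "a \<in> Ob C" using a WOb by blast
    have "zer z a \<in> TC"
      unfolding monics_with_cokernel_iff using SE[OF aO] a aO by (intro exI[of _ "Ident C a"]) simp
    then have "weq (zer z a)" using weq_monic_iff short_exact_simps(5)[OF SE[OF aO]] by blast
    then show "a \<in> trivial_objects C {f. weq f}"
      unfolding trivial_objects_def using aO z by auto
  qed
  have 3: "fibrant_objects C FIB = F"
  proof (intro equalityI subsetI)
    fix a assume "a \<in> fibrant_objects C FIB"
    then obtain f where f: "f \<in> FIB" "zero_object C (Cod C f)" "Dom C f = a" "a \<in> Ob C"
      unfolding fibrant_objects_def by blast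
    obtain k where k: "short_exact C k f" "Dom C k \<in> F" using f(1) by (rule FIB_E)
    note K = short_exact_simps[OF k(1)]
    have fz: "f = zer a (Cod C f)" using zero_object_into[OF f(2) K(2)] f(3) by simp
    have s: "short_exact C (Ident C a) f" using short_exact_Ident_zer[OF f(2,4)] fz by simp
    have "obj_retract C (Dom C (Ident C a)) (Dom C k)"
      by (rule kernel_choice[OF short_exact_simps(7)[OF s] K(7)])
    then show "a \<in> F" using F_retract k(2) f(4) by simp
  next
    fix a assume a: "a \<in> F"
    have aO: "a \<in> Ob C" using a FOb by blast
    have "zer a z \<in> FIB"
      unfolding epics_with_kernel_iff using SE'[OF aO] a aO by (intro exI[of _ "Ident C a"]) simp
    then show "a \<in> fibrant_objects C FIB"
      unfolding fibrant_objects_def using aO z by (intro CollectI conjI bexI[of _ "zer a z"]) simp_all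
  qed
  show ?thesis unfolding hovey_triple_of_def 1 2 3 ..
qed

lemma injective_model: "injective_model_structure C {m. monic C m} {f. weq f} FIB"
proof -
  have "{m. monic C m} \<inter> {f. weq f} = TC" using weq_monic_iff TC_monic by blast
  moreover have "FIB \<inter> {f. weq f} = TF" using weq_FIB_iff by blast
  moreover have "Ob C \<inter> W = W" using WOb by blast
  moreover have "F \<inter> W = Inj C" using WF by blast
  ultimately have "abelian_model_structure C {m. monic C m} {f. weq f} FIB"
    unfolding abelian_model_structure_def hovey_triple_of_model
    using ab model monics_Ob by simp
  then show ?thesis unfolding injective_model_structure_def using icp hovey_triple_of_model by blast
qed

lemma hereditary_hovey: "hereditary_hovey_triple C (Ob C, W, F)"
proof -
  have "Ob C \<inter> W = W" using WOb by blast
  moreover have "kernel_closed C W" unfolding kernel_closed_def using W_thick(3) by blast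
  moreover have "kernel_closed C (Ob C)" unfolding kernel_closed_def using short_exact_simps(1) by auto
  ultimately show ?thesis
    unfolding hereditary_hovey_triple_def hovey_triple_def
    using thickW cp cpI WF hereditaryI[OF cp _ ei] hereditaryI[OF cpI _ ei] by simp
qed

end

lemma injective_cotorsion_pair_model_structure:
  assumes "abelian_category C" "injective_cotorsion_pair C W F"
  shows "\<exists>cof weq fib. injective_model_structure C cof weq fib \<and>
    hovey_triple_of C cof weq fib = (Ob C, W, F) \<and> hereditary_hovey_triple C (Ob C, W, F)"
proof -
  obtain add zer where "abelian C add zer" using assms(1) by (rule abelian_obtain)
  then have "injective_pair C add zer W F"
    using assms(2) by (intro injective_pair.intro injective_pair_axioms.intro)
  then interpret injective_pair C add zer W F .
  show ?thesis using injective_model hovey_triple_of_model hereditary_hovey by blast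
qed


section \<open>Functor categories\<close>

lemma functor_cat_simps [simp]:
  "Ob (functor_cat J C) = {F. is_functor J C F}" "Ar (functor_cat J C) = {\<eta>. is_ntrans J C \<eta>}"
  "Dom (functor_cat J C) = NDom" "Cod (functor_cat J C) = NCod"
  "NDom (Ident (functor_cat J C) F) = F" "NCod (Ident (functor_cat J C) F) = F"
  "a \<in> Ob J \<Longrightarrow> NComponent (Ident (functor_cat J C) F) a = Ident C (FOb F a)"
  "NDom (\<theta> \<cdot>\<^bsub>functor_cat J C\<^esub> \<eta>) = NDom \<eta>" "NCod (\<theta> \<cdot>\<^bsub>functor_cat J C\<^esub> \<eta>) = NCod \<theta>"
  "a \<in> Ob J \<Longrightarrow> NComponent (\<theta> \<cdot>\<^bsub>functor_cat J C\<^esub> \<eta>) a = NComponent \<theta> a \<cdot>\<^bsub>C\<^esub> NComponent \<eta> a"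
  by (simp_all add: functor_cat_def)

locale functor_category = J: category J + abelian C add zer
  for J :: "('i, 'j) cat" and C :: "('o, 'm) cat" (structure) and add (infixl "\<boxplus>" 65) and zer
begin

abbreviation FC where "FC \<equiv> functor_cat J C"

lemma functor_simps:
  assumes "is_functor J C F"
  shows "a \<in> Ob J \<Longrightarrow> FOb F a \<in> Ob C"
    and "a \<in> Ob J \<Longrightarrow> FAr F (Ident J a) = Ident C (FOb F a)"
    and "u \<in> Ar J \<Longrightarrow> FAr F u \<in> Ar C"
    and "u \<in> Ar J \<Longrightarrow> Dom C (FAr F u) = FOb F (Dom J u)"
    and "u \<in> Ar J \<Longrightarrow> Cod C (FAr F u) = FOb F (Cod J u)"
    and "u \<in> Ar J \<Longrightarrow> v \<in> Ar J \<Longrightarrow> Dom J v = Cod J u \<Longrightarrow> FAr F (v \<cdot>\<^bsub>J\<^esub> u) = FAr F v \<cdot> FAr F u"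
  using assms unfolding is_functor_def in_Hom by simp_all

lemma functorI:
  assumes "FOb F \<in> extensional (Ob J)" "FAr F \<in> extensional (Ar J)"
    and "\<And>a. a \<in> Ob J \<Longrightarrow> FOb F a \<in> Ob C"
    and "\<And>a. a \<in> Ob J \<Longrightarrow> FAr F (Ident J a) = Ident C (FOb F a)"
    and "\<And>u. u \<in> Ar J \<Longrightarrow> FAr F u \<in> Ar C \<and> Dom C (FAr F u) = FOb F (Dom J u) \<and> Cod C (FAr F u) = FOb F (Cod J u)"
    and "\<And>u v. u \<in> Ar J \<Longrightarrow> v \<in> Ar J \<Longrightarrow> Dom J v = Cod J u \<Longrightarrow> FAr F (v \<cdot>\<^bsub>J\<^esub> u) = FAr F v \<cdot> FAr F u"
  shows "is_functor J C F"
  using assms unfolding is_functor_def in_Hom by simp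

lemma ntrans_functors:
  assumes "is_ntrans J C \<eta>"
  shows "is_functor J C (NDom \<eta>)" "is_functor J C (NCod \<eta>)"
  using assms unfolding is_ntrans_def by simp_all

lemma ntrans_simps:
  assumes "is_ntrans J C \<eta>"
  shows "a \<in> Ob J \<Longrightarrow> NComponent \<eta> a \<in> Ar C"
    and "a \<in> Ob J \<Longrightarrow> Dom C (NComponent \<eta> a) = FOb (NDom \<eta>) a"
    and "a \<in> Ob J \<Longrightarrow> Cod C (NComponent \<eta> a) = FOb (NCod \<eta>) a"
    and "u \<in> Ar J \<Longrightarrow> NComponent \<eta> (Cod J u) \<cdot> FAr (NDom \<eta>) u = FAr (NCod \<eta>) u \<cdot> NComponent \<eta> (Dom J u)"
  using assms unfolding is_ntrans_def in_Hom by simp_all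

definition mk_ntrans where
  "mk_ntrans F G h = \<lparr>NDom = F, NCod = G, NComponent = restrict h (Ob J)\<rparr>"

lemma mk_ntrans_simps [simp]:
  "NDom (mk_ntrans F G h) = F" "NCod (mk_ntrans F G h) = G"
  "a \<in> Ob J \<Longrightarrow> NComponent (mk_ntrans F G h) a = h a"
  by (simp_all add: mk_ntrans_def)

lemma mk_ntransI:
  assumes "is_functor J C F" "is_functor J C G"
    and "\<And>a. a \<in> Ob J \<Longrightarrow> h a \<in> Ar C \<and> Dom C (h a) = FOb F a \<and> Cod C (h a) = FOb G a"
    and "\<And>u. u \<in> Ar J \<Longrightarrow> h (Cod J u) \<cdot> FAr F u = FAr G u \<cdot> h (Dom J u)"
  shows "is_ntrans J C (mk_ntrans F G h)"
  using assms unfolding is_ntrans_def in_Hom by (simp add: mk_ntrans_def)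

lemma ntrans_eqI:
  assumes "is_ntrans J C \<eta>" "is_ntrans J C \<theta>" "NDom \<eta> = NDom \<theta>" "NCod \<eta> = NCod \<theta>"
    and "\<And>a. a \<in> Ob J \<Longrightarrow> NComponent \<eta> a = NComponent \<theta> a"
  shows "\<eta> = \<theta>"
proof -
  have "NComponent \<eta> = NComponent \<theta>"
    by (rule extensionalityI[of _ "Ob J"]) (use assms in \<open>simp_all add: is_ntrans_def\<close>)
  then show ?thesis using assms(3,4) by (intro ntrans.equality) simp_all
qed

lemma Ident_FC: "Ident FC F = mk_ntrans F F (\<lambda>a. Ident C (FOb F a))"
  by (simp add: functor_cat_def mk_ntrans_def)

lemma Comp_FC: "\<theta> \<cdot>\<^bsub>FC\<^esub> \<eta> = mk_ntrans (NDom \<eta>) (NCod \<theta>) (\<lambda>a. NComponent \<theta> a \<cdot> NComponent \<eta> a)"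
  by (simp add: functor_cat_def mk_ntrans_def)

lemma Ident_ntrans: "is_functor J C F \<Longrightarrow> is_ntrans J C (Ident FC F)"
  unfolding Ident_FC by (rule mk_ntransI) (simp_all add: functor_simps)

lemma Comp_ntrans:
  assumes "is_ntrans J C \<eta>" "is_ntrans J C \<theta>" "NDom \<theta> = NCod \<eta>"
  shows "is_ntrans J C (\<theta> \<cdot>\<^bsub>FC\<^esub> \<eta>)"
  unfolding Comp_FC
proof (rule mk_ntransI)
  show "is_functor J C (NDom \<eta>)" "is_functor J C (NCod \<theta>)" using assms ntrans_functors by blast+
  note e = ntrans_simps[OF assms(1)] and t = ntrans_simps[OF assms(2), unfolded assms(3)]
  show "NComponent \<theta> a \<cdot> NComponent \<eta> a \<in> Ar C \<and> Dom C (NComponent \<theta> a \<cdot> NComponent \<eta> a) = FOb (NDom \<eta>) a \<and>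
      Cod C (NComponent \<theta> a \<cdot> NComponent \<eta> a) = FOb (NCod \<theta>) a" if "a \<in> Ob J" for a
    using e(1-3)[OF that] t(1-3)[OF that] by simp
  fix u assume u: "u \<in> Ar J"
  then have o: "Dom J u \<in> Ob J" "Cod J u \<in> Ob J" by auto
  note F = functor_simps(3-5)[OF ntrans_functors(1)[OF assms(1)] u]
    functor_simps(3-5)[OF ntrans_functors(2)[OF assms(1)] u]
    functor_simps(3-5)[OF ntrans_functors(2)[OF assms(2)] u]
  note c = e(1-3)[OF o(1)] e(1-3)[OF o(2)] t(1-3)[OF o(1)] t(1-3)[OF o(2)]
  have "(NComponent \<theta> (Cod J u) \<cdot> NComponent \<eta> (Cod J u)) \<cdot> FAr (NDom \<eta>) u
      = NComponent \<theta> (Cod J u) \<cdot> (FAr (NCod \<eta>) u \<cdot> NComponent \<eta> (Dom J u))"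
    using F c by (simp add: e(4)[OF u])
  also have "\<dots> = FAr (NCod \<theta>) u \<cdot> (NComponent \<theta> (Dom J u) \<cdot> NComponent \<eta> (Dom J u))"
    by (rule comp_ext2[OF t(4)[OF u]]) (use F c in auto)
  finally show "(NComponent \<theta> (Cod J u) \<cdot> NComponent \<eta> (Cod J u)) \<cdot> FAr (NDom \<eta>) u
      = FAr (NCod \<theta>) u \<cdot> (NComponent \<theta> (Dom J u) \<cdot> NComponent \<eta> (Dom J u))" .
qed

lemma category_FC: "category FC"
proof
  show "Dom FC f \<in> Ob FC" "Cod FC f \<in> Ob FC" if "f \<in> Ar FC" for f using that ntrans_functors by auto
  show "Ident FC a \<in> Hom FC a a" if "a \<in> Ob FC" for a using that Ident_ntrans by simp
  show "g \<cdot>\<^bsub>FC\<^esub> f \<in> Hom FC a c" if "f \<in> Hom FC a b" "g \<in> Hom FC b c" for f a b g c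
    using that Comp_ntrans[of f g] by simp
  fix f a b assume f: "f \<in> Hom FC a b"
  then have fn: "is_ntrans J C f" "NDom f = a" "NCod f = b" by auto
  note fs = ntrans_simps[OF fn(1), unfolded fn(2,3)]
  have ab: "is_functor J C a" "is_functor J C b" using ntrans_functors[OF fn(1)] fn by simp_all
  show "f \<cdot>\<^bsub>FC\<^esub> Ident FC a = f"
    by (rule ntrans_eqI) (use fn ab fs Ident_ntrans Comp_ntrans in auto)
  show "Ident FC b \<cdot>\<^bsub>FC\<^esub> f = f"
    by (rule ntrans_eqI) (use fn ab fs Ident_ntrans Comp_ntrans in auto)
  fix g c h d assume "g \<in> Hom FC b c" "h \<in> Hom FC c d"
  then have gh: "is_ntrans J C g" "NDom g = b" "NCod g = c" "is_ntrans J C h" "NDom h = c" "NCod h = d" by auto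
  note gs = ntrans_simps[OF gh(1), unfolded gh(2,3)] and hs = ntrans_simps[OF gh(4), unfolded gh(5,6)]
  show "(h \<cdot>\<^bsub>FC\<^esub> g) \<cdot>\<^bsub>FC\<^esub> f = h \<cdot>\<^bsub>FC\<^esub> (g \<cdot>\<^bsub>FC\<^esub> f)"
    by (rule ntrans_eqI) (use fn gh fs gs hs in \<open>simp_all add: Comp_ntrans\<close>)
qed

subsection \<open>Additive structure\<close>

definition padd where
  "padd \<eta> \<theta> = mk_ntrans (NDom \<eta>) (NCod \<eta>) (\<lambda>a. NComponent \<eta> a \<boxplus> NComponent \<theta> a)"

definition pzer where
  "pzer F G = mk_ntrans F G (\<lambda>a. zer (FOb F a) (FOb G a))"

lemma padd_simps [simp]:
  "NDom (padd \<eta> \<theta>) = NDom \<eta>" "NCod (padd \<eta> \<theta>) = NCod \<eta>"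
  "a \<in> Ob J \<Longrightarrow> NComponent (padd \<eta> \<theta>) a = NComponent \<eta> a \<boxplus> NComponent \<theta> a"
  "NDom (pzer F G) = F" "NCod (pzer F G) = G"
  "a \<in> Ob J \<Longrightarrow> NComponent (pzer F G) a = zer (FOb F a) (FOb G a)"
  by (simp_all add: padd_def pzer_def)

lemma pzer_ntrans: "is_functor J C F \<Longrightarrow> is_functor J C G \<Longrightarrow> is_ntrans J C (pzer F G)"
  unfolding pzer_def by (rule mk_ntransI) (simp_all add: functor_simps)

lemma pointwise_ntrans:
  assumes e: "is_ntrans J C \<eta>" and t: "is_ntrans J C \<theta>" and d: "NDom \<theta> = NDom \<eta>" "NCod \<theta> = NCod \<eta>"
    and op: "op = add \<or> op = sub"
  shows "is_ntrans J C (mk_ntrans (NDom \<eta>) (NCod \<eta>) (\<lambda>a. op (NComponent \<eta> a) (NComponent \<theta> a)))"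
proof (rule mk_ntransI)
  show "is_functor J C (NDom \<eta>)" "is_functor J C (NCod \<eta>)" using e ntrans_functors by blast+
  note es = ntrans_simps[OF e] and ts = ntrans_simps[OF t, unfolded d]
  show "op (NComponent \<eta> a) (NComponent \<theta> a) \<in> Ar C \<and> Dom C (op (NComponent \<eta> a) (NComponent \<theta> a)) = FOb (NDom \<eta>) a \<and>
      Cod C (op (NComponent \<eta> a) (NComponent \<theta> a)) = FOb (NCod \<eta>) a" if "a \<in> Ob J" for a
    using op es(1-3)[OF that] ts(1-3)[OF that] by (elim disjE) simp_all
  fix u assume u: "u \<in> Ar J"
  then have o: "Dom J u \<in> Ob J" "Cod J u \<in> Ob J" by auto
  note F = functor_simps(3-5)[OF ntrans_functors(1)[OF e] u] functor_simps(3-5)[OF ntrans_functors(2)[OF e] u]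
  show "op (NComponent \<eta> (Cod J u)) (NComponent \<theta> (Cod J u)) \<cdot> FAr (NDom \<eta>) u
     = FAr (NCod \<eta>) u \<cdot> op (NComponent \<eta> (Dom J u)) (NComponent \<theta> (Dom J u))"
    using op F es(1-3)[OF o(1)] es(1-3)[OF o(2)] ts(1-3)[OF o(1)] ts(1-3)[OF o(2)]
    by (elim disjE) (simp_all add: es(4)[OF u] ts(4)[OF u])
qed

lemma padd_ntrans:
  "is_ntrans J C \<eta> \<Longrightarrow> is_ntrans J C \<theta> \<Longrightarrow> NDom \<theta> = NDom \<eta> \<Longrightarrow> NCod \<theta> = NCod \<eta> \<Longrightarrow> is_ntrans J C (padd \<eta> \<theta>)"
  unfolding padd_def by (rule pointwise_ntrans) simp_all

lemma add_assoc:
  assumes "f \<in> Ar C" "g \<in> Ar C" "h \<in> Ar C" "Dom C g = Dom C f" "Cod C g = Cod C f" "Dom C h = Dom C f" "Cod C h = Cod C f"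
  shows "(f \<boxplus> g) \<boxplus> h = f \<boxplus> (g \<boxplus> h)"
proof -
  interpret comm_group "homgrp (Dom C f) (Cod C f)" using assms by (simp add: grp)
  show ?thesis using m_assoc[of f g h] assms by simp
qed

lemma preadditive_FC: "preadditive FC padd pzer"
  unfolding preadditive_def
proof (intro conjI ballI)
  fix F G assume "F \<in> Ob FC" "G \<in> Ob FC"
  then have F: "is_functor J C F" "is_functor J C G" by auto
  show "comm_group \<lparr>carrier = Hom FC F G, monoid.mult = padd, one = pzer F G\<rparr>"
  proof (rule comm_groupI, goal_cases)
    case (1 x y) then show ?case by (simp add: padd_ntrans)
  next
    case 2 show ?case using F by (simp add: pzer_ntrans)
  next
    case (3 x y z)
    then have n: "is_ntrans J C x" "NDom x = F" "NCod x = G" "is_ntrans J C y" "NDom y = F" "NCod y = G"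
      "is_ntrans J C z" "NDom z = F" "NCod z = G" by auto
    have "padd (padd x y) z = padd x (padd y z)"
      by (rule ntrans_eqI)
        (use n ntrans_simps(1-3)[OF n(1)] ntrans_simps(1-3)[OF n(4)] ntrans_simps(1-3)[OF n(7)] in
          \<open>simp_all add: padd_ntrans add_assoc\<close>)
    then show ?case by simp
  next
    case (4 x y)
    then have n: "is_ntrans J C x" "NDom x = F" "NCod x = G" "is_ntrans J C y" "NDom y = F" "NCod y = G" by auto
    have "padd x y = padd y x"
    proof (rule ntrans_eqI)
      fix a assume a: "a \<in> Ob J"
      show "NComponent (padd x y) a = NComponent (padd y x) a"
        using a n ntrans_simps(1-3)[OF n(1) a] ntrans_simps(1-3)[OF n(4) a] by (simp add: add_comm)
    qed (use n in \<open>simp_all add: padd_ntrans\<close>)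
    then show ?case by simp
  next
    case (5 x)
    then have n: "is_ntrans J C x" "NDom x = F" "NCod x = G" by auto
    have "padd (pzer F G) x = x"
      by (rule ntrans_eqI) (use n F ntrans_simps(1-3)[OF n(1)] in \<open>simp_all add: padd_ntrans pzer_ntrans\<close>)
    then show ?case by simp
  next
    case (6 x)
    then have n: "is_ntrans J C x" "NDom x = F" "NCod x = G" by auto
    let ?y = "mk_ntrans F G (\<lambda>a. NComponent (pzer F G) a \<boxminus> NComponent x a)"
    have y: "is_ntrans J C ?y"
      using pointwise_ntrans[of "pzer F G" x sub] n F by (simp add: pzer_ntrans)
    have "padd ?y x = pzer F G"
      by (rule ntrans_eqI)
        (use n F y ntrans_simps(1-3)[OF n(1)] functor_simps(1)[OF F(1)] functor_simps(1)[OF F(2)] in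
          \<open>simp_all add: padd_ntrans pzer_ntrans\<close>)
    then show ?case using y by (intro bexI[of _ ?y]) simp_all
  qed
next
  fix a b c f f' g g' assume "f \<in> Hom FC a b" "f' \<in> Hom FC a b" "g \<in> Hom FC b c" "g' \<in> Hom FC b c"
  then have n: "is_ntrans J C f" "NDom f = a" "NCod f = b" "is_ntrans J C f'" "NDom f' = a" "NCod f' = b"
    "is_ntrans J C g" "NDom g = b" "NCod g = c" "is_ntrans J C g'" "NDom g' = b" "NCod g' = c" by auto
  note s = ntrans_simps(1-3)[OF n(1)] ntrans_simps(1-3)[OF n(4)] ntrans_simps(1-3)[OF n(7)] ntrans_simps(1-3)[OF n(10)]
  show "g \<cdot>\<^bsub>FC\<^esub> padd f f' = padd (g \<cdot>\<^bsub>FC\<^esub> f) (g \<cdot>\<^bsub>FC\<^esub> f')"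
    by (rule ntrans_eqI) (use n s in \<open>simp_all add: Comp_ntrans padd_ntrans\<close>)
  show "padd g g' \<cdot>\<^bsub>FC\<^esub> f = padd (g \<cdot>\<^bsub>FC\<^esub> f) (g' \<cdot>\<^bsub>FC\<^esub> f)"
    by (rule ntrans_eqI) (use n s in \<open>simp_all add: Comp_ntrans padd_ntrans\<close>)
qed

lemma zero_object_FC: "\<exists>z. zero_object FC z"
proof -
  obtain z where z: "zero_object C z" "z \<in> Ob C" by (rule obtain_zero)
  define Z where "Z = \<lparr>FOb = (\<lambda>a\<in>Ob J. z), FAr = (\<lambda>u\<in>Ar J. Ident C z)\<rparr>"
  have Z: "is_functor J C Z"
    by (rule functorI) (use z in \<open>simp_all add: Z_def\<close>)
  have Za: "FOb Z a = z" if "a \<in> Ob J" for a using that by (simp add: Z_def)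
  have into: "f = pzer F Z" if f: "f \<in> Hom FC F Z" and F: "is_functor J C F" for f F
  proof (rule ntrans_eqI)
    have n: "is_ntrans J C f" "NDom f = F" "NCod f = Z" using f by auto
    show "is_ntrans J C f" "NDom f = NDom (pzer F Z)" "NCod f = NCod (pzer F Z)" using n by auto
    show "is_ntrans J C (pzer F Z)" using F Z by (rule pzer_ntrans)
    fix a assume a: "a \<in> Ob J"
    show "NComponent f a = NComponent (pzer F Z) a"
      using zero_object_into[OF z(1), of "NComponent f a"] ntrans_simps[OF n(1)] n a Za by simp
  qed
  have from_: "f = pzer Z F" if f: "f \<in> Hom FC Z F" and F: "is_functor J C F" for f F
  proof (rule ntrans_eqI)
    have n: "is_ntrans J C f" "NDom f = Z" "NCod f = F" using f by auto
    show "is_ntrans J C f" "NDom f = NDom (pzer Z F)" "NCod f = NCod (pzer Z F)" using n by auto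
    show "is_ntrans J C (pzer Z F)" using Z F by (rule pzer_ntrans)
    fix a assume a: "a \<in> Ob J"
    show "NComponent f a = NComponent (pzer Z F) a"
      using zero_object_from[OF z(1), of "NComponent f a"] ntrans_simps[OF n(1)] n a Za by simp
  qed
  have "zero_object FC Z"
    unfolding zero_object_def
  proof (intro conjI ballI)
    show "Z \<in> Ob FC" using Z by simp
    fix F assume "F \<in> Ob FC"
    then have F: "is_functor J C F" by simp
    show "\<exists>!f. f \<in> Hom FC F Z" by (rule ex1I[of _ "pzer F Z"]) (use pzer_ntrans F Z into in auto)
    show "\<exists>!f. f \<in> Hom FC Z F" by (rule ex1I[of _ "pzer Z F"]) (use pzer_ntrans F Z from_ in auto)
  qed
  then show ?thesis ..
qed

lemma additive_FC: "additive FC padd pzer"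
  by (intro additive.intro additive_axioms.intro category_FC preadditive_FC zero_object_FC)

end


context functor_category
begin

lemma FC_simps [simp]:
  "Ob FC = {F. is_functor J C F}" "Ar FC = {\<eta>. is_ntrans J C \<eta>}" "Dom FC = NDom" "Cod FC = NCod"
  by simp_all

subsection \<open>Pointwise constructions\<close>

text \<open>A pointwise chosen family of objects with jointly monic projections to functors \<open>D i\<close> is a functor
  as soon as the arrows of the \<open>D i\<close> restrict to it: joint monicity forces functoriality.\<close>

lemma pointwise_limit_functor:
  assumes D: "\<And>i. i \<in> I \<Longrightarrow> is_functor J C (D i)"
    and L: "\<And>a. a \<in> Ob J \<Longrightarrow> L a \<in> Ob C"
    and p: "\<And>a i. a \<in> Ob J \<Longrightarrow> i \<in> I \<Longrightarrow> p i a \<in> Ar C \<and> Dom C (p i a) = L a \<and> Cod C (p i a) = FOb (D i) a"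
    and jm: "\<And>a h h'. a \<in> Ob J \<Longrightarrow> h \<in> Ar C \<Longrightarrow> h' \<in> Ar C \<Longrightarrow> Dom C h = Dom C h' \<Longrightarrow> Cod C h = L a \<Longrightarrow>
      Cod C h' = L a \<Longrightarrow> (\<And>i. i \<in> I \<Longrightarrow> p i a \<cdot> h = p i a \<cdot> h') \<Longrightarrow> h = h'"
    and ex: "\<And>u. u \<in> Ar J \<Longrightarrow> \<exists>l. l \<in> Ar C \<and> Dom C l = L (Dom J u) \<and> Cod C l = L (Cod J u) \<and>
      (\<forall>i\<in>I. p i (Cod J u) \<cdot> l = FAr (D i) u \<cdot> p i (Dom J u))"
  obtains F where "is_functor J C F" "\<And>a. a \<in> Ob J \<Longrightarrow> FOb F a = L a"
    "\<And>i. i \<in> I \<Longrightarrow> is_ntrans J C (mk_ntrans F (D i) (p i))"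
proof -
  obtain l where l: "\<And>u. u \<in> Ar J \<Longrightarrow> l u \<in> Ar C \<and> Dom C (l u) = L (Dom J u) \<and> Cod C (l u) = L (Cod J u) \<and>
      (\<forall>i\<in>I. p i (Cod J u) \<cdot> l u = FAr (D i) u \<cdot> p i (Dom J u))"
    using ex by metis
  note l1 = l[THEN conjunct1] and l2 = l[THEN conjunct2, THEN conjunct1]
    and l3 = l[THEN conjunct2, THEN conjunct2, THEN conjunct1]
    and l4 = l[THEN conjunct2, THEN conjunct2, THEN conjunct2, rule_format]
  note p1 = p[THEN conjunct1] and p2 = p[THEN conjunct2, THEN conjunct1] and p3 = p[THEN conjunct2, THEN conjunct2]
  define F where "F = \<lparr>FOb = restrict L (Ob J), FAr = restrict l (Ar J)\<rparr>"
  have F: "is_functor J C F"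
  proof (rule functorI)
    show "FOb F \<in> extensional (Ob J)" "FAr F \<in> extensional (Ar J)" by (simp_all add: F_def)
    show "FOb F a \<in> Ob C" if "a \<in> Ob J" for a using that L by (simp add: F_def)
    show "FAr F (Ident J a) = Ident C (FOb F a)" if a: "a \<in> Ob J" for a
    proof -
      have ia: "Ident J a \<in> Ar J" "Dom J (Ident J a) = a" "Cod J (Ident J a) = a" using a by simp_all
      have "l (Ident J a) = Ident C (L a)"
      proof (rule jm[OF a])
        fix i assume i: "i \<in> I"
        have "p i a \<cdot> l (Ident J a) = FAr (D i) (Ident J a) \<cdot> p i a" using l4[OF ia(1) i] ia by simp
        also have "\<dots> = p i a" using functor_simps(2)[OF D[OF i] a] p1[OF a i] p3[OF a i] by simp
        also have "\<dots> = p i a \<cdot> Ident C (L a)" using p1[OF a i] p2[OF a i] by simp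
        finally show "p i a \<cdot> l (Ident J a) = p i a \<cdot> Ident C (L a)" .
      qed (use l1[OF ia(1)] l2[OF ia(1)] l3[OF ia(1)] ia L[OF a] in simp_all)
      then show ?thesis using a ia by (simp add: F_def)
    qed
    show "FAr F u \<in> Ar C \<and> Dom C (FAr F u) = FOb F (Dom J u) \<and> Cod C (FAr F u) = FOb F (Cod J u)"
      if "u \<in> Ar J" for u using that l1[OF that] l2[OF that] l3[OF that] by (simp add: F_def)
    show "FAr F (v \<cdot>\<^bsub>J\<^esub> u) = FAr F v \<cdot> FAr F u" if u: "u \<in> Ar J" and v: "v \<in> Ar J" and vu: "Dom J v = Cod J u" for u v
    proof -
      have w: "v \<cdot>\<^bsub>J\<^esub> u \<in> Ar J" "Dom J (v \<cdot>\<^bsub>J\<^esub> u) = Dom J u" "Cod J (v \<cdot>\<^bsub>J\<^esub> u) = Cod J v" using u v vu by simp_all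
      have o: "Dom J u \<in> Ob J" "Cod J u \<in> Ob J" "Cod J v \<in> Ob J" using u v by simp_all
      have "l (v \<cdot>\<^bsub>J\<^esub> u) = l v \<cdot> l u"
      proof (rule jm[OF o(3)])
        fix i assume i: "i \<in> I"
        note t = p1[OF o(1) i] p2[OF o(1) i] p3[OF o(1) i] p1[OF o(2) i] p2[OF o(2) i] p3[OF o(2) i]
          p1[OF o(3) i] p2[OF o(3) i] p3[OF o(3) i]
          functor_simps(3-5)[OF D[OF i] u] functor_simps(3-5)[OF D[OF i] v]
          l1[OF u] l2[OF u] l3[OF u] l1[OF v] l2[OF v] l3[OF v] vu
        have "p i (Cod J v) \<cdot> l (v \<cdot>\<^bsub>J\<^esub> u) = FAr (D i) (v \<cdot>\<^bsub>J\<^esub> u) \<cdot> p i (Dom J u)"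
          using l4[OF w(1) i] w by simp
        also have "\<dots> = FAr (D i) v \<cdot> (FAr (D i) u \<cdot> p i (Dom J u))"
          unfolding functor_simps(6)[OF D[OF i] u v vu] by (rule comp_assoc) (use t in auto)
        also have "\<dots> = FAr (D i) v \<cdot> (p i (Cod J u) \<cdot> l u)" using l4[OF u i] by simp
        also have "\<dots> = p i (Cod J v) \<cdot> (l v \<cdot> l u)"
          by (rule comp_ext2) (use l4[OF v i] t in auto)
        finally show "p i (Cod J v) \<cdot> l (v \<cdot>\<^bsub>J\<^esub> u) = p i (Cod J v) \<cdot> (l v \<cdot> l u)" .
      qed (use l1[OF u] l2[OF u] l3[OF u] l1[OF v] l2[OF v] l3[OF v] l1[OF w(1)] l2[OF w(1)] l3[OF w(1)] w vu in simp_all)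
      then show ?thesis using u v w by (simp add: F_def)
    qed
  qed
  have Fa: "FOb F a = L a" if "a \<in> Ob J" for a using that by (simp add: F_def)
  have "is_ntrans J C (mk_ntrans F (D i) (p i))" if i: "i \<in> I" for i
  proof (rule mk_ntransI)
    show "p i a \<in> Ar C \<and> Dom C (p i a) = FOb F a \<and> Cod C (p i a) = FOb (D i) a" if a: "a \<in> Ob J" for a
      using p[OF a i] Fa[OF a] by simp
    show "p i (Cod J u) \<cdot> FAr F u = FAr (D i) u \<cdot> p i (Dom J u)" if u: "u \<in> Ar J" for u
      using l4[OF u i] u by (simp add: F_def)
  qed (use F D i in auto)
  then show ?thesis using that F Fa by blast
qed

text \<open>The dual device for a single family of epimorphisms out of a functor.\<close>

lemma pointwise_quotient_functor:
  assumes D: "is_functor J C D"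
    and p: "\<And>a. a \<in> Ob J \<Longrightarrow> epic C (p a) \<and> Dom C (p a) = FOb D a"
    and ex: "\<And>u. u \<in> Ar J \<Longrightarrow> \<exists>l. l \<in> Ar C \<and> Dom C l = Cod C (p (Dom J u)) \<and> Cod C l = Cod C (p (Cod J u)) \<and>
      l \<cdot> p (Dom J u) = p (Cod J u) \<cdot> FAr D u"
  obtains F where "is_functor J C F" "is_ntrans J C (mk_ntrans D F p)"
proof -
  obtain l where l: "\<And>u. u \<in> Ar J \<Longrightarrow> l u \<in> Ar C \<and> Dom C (l u) = Cod C (p (Dom J u)) \<and> Cod C (l u) = Cod C (p (Cod J u)) \<and>
      l u \<cdot> p (Dom J u) = p (Cod J u) \<cdot> FAr D u"
    using ex by metis
  note l1 = l[THEN conjunct1] and l2 = l[THEN conjunct2, THEN conjunct1]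
    and l3 = l[THEN conjunct2, THEN conjunct2, THEN conjunct1]
    and l4 = l[THEN conjunct2, THEN conjunct2, THEN conjunct2]
  note pe = p[THEN conjunct1] and p2 = p[THEN conjunct2] and p1 = epic_Ar[OF p[THEN conjunct1]]
  define F where "F = \<lparr>FOb = (\<lambda>a\<in>Ob J. Cod C (p a)), FAr = restrict l (Ar J)\<rparr>"
  have F: "is_functor J C F"
  proof (rule functorI)
    show "FOb F \<in> extensional (Ob J)" "FAr F \<in> extensional (Ar J)" by (simp_all add: F_def)
    show "FOb F a \<in> Ob C" if "a \<in> Ob J" for a using that p1[OF that] by (simp add: F_def)
    show "FAr F (Ident J a) = Ident C (FOb F a)" if a: "a \<in> Ob J" for a
    proof -
      have ia: "Ident J a \<in> Ar J" "Dom J (Ident J a) = a" "Cod J (Ident J a) = a" using a by simp_all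
      have "l (Ident J a) = Ident C (Cod C (p a))"
        by (rule epicD[OF pe[OF a]])
          (use l1[OF ia(1)] l2[OF ia(1)] l3[OF ia(1)] l4[OF ia(1)] ia p1[OF a] p2[OF a] functor_simps(2)[OF D a] in simp_all)
      then show ?thesis using a ia by (simp add: F_def)
    qed
    show "FAr F u \<in> Ar C \<and> Dom C (FAr F u) = FOb F (Dom J u) \<and> Cod C (FAr F u) = FOb F (Cod J u)"
      if "u \<in> Ar J" for u using that l1[OF that] l2[OF that] l3[OF that] by (simp add: F_def)
    show "FAr F (v \<cdot>\<^bsub>J\<^esub> u) = FAr F v \<cdot> FAr F u" if u: "u \<in> Ar J" and v: "v \<in> Ar J" and vu: "Dom J v = Cod J u" for u v
    proof -
      have w: "v \<cdot>\<^bsub>J\<^esub> u \<in> Ar J" "Dom J (v \<cdot>\<^bsub>J\<^esub> u) = Dom J u" "Cod J (v \<cdot>\<^bsub>J\<^esub> u) = Cod J v" using u v vu by simp_all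
      have o: "Dom J u \<in> Ob J" "Cod J u \<in> Ob J" "Cod J v \<in> Ob J" using u v by simp_all
      note t = p1[OF o(1)] p2[OF o(1)] p1[OF o(2)] p2[OF o(2)] p1[OF o(3)] p2[OF o(3)]
          functor_simps(3-5)[OF D u] functor_simps(3-5)[OF D v]
          l1[OF u] l2[OF u] l3[OF u] l1[OF v] l2[OF v] l3[OF v] vu
      have "l (v \<cdot>\<^bsub>J\<^esub> u) = l v \<cdot> l u"
      proof (rule epicD[OF pe[OF o(1)]])
        have "l (v \<cdot>\<^bsub>J\<^esub> u) \<cdot> p (Dom J u) = p (Cod J v) \<cdot> (FAr D v \<cdot> FAr D u)"
          using l4[OF w(1)] w functor_simps(6)[OF D u v vu] by simp
        also have "\<dots> = l v \<cdot> (p (Dom J v) \<cdot> FAr D u)"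
          by (rule comp_ext2[symmetric, OF l4[OF v]]) (use t in auto)
        also have "\<dots> = (l v \<cdot> l u) \<cdot> p (Dom J u)"
          using l4[OF u] t by simp
        finally show "l (v \<cdot>\<^bsub>J\<^esub> u) \<cdot> p (Dom J u) = (l v \<cdot> l u) \<cdot> p (Dom J u)" .
      qed (use t l1[OF w(1)] l2[OF w(1)] l3[OF w(1)] w in simp_all)
      then show ?thesis using u v w by (simp add: F_def)
    qed
  qed
  have "is_ntrans J C (mk_ntrans D F p)"
  proof (rule mk_ntransI)
    show "p a \<in> Ar C \<and> Dom C (p a) = FOb D a \<and> Cod C (p a) = FOb F a" if a: "a \<in> Ob J" for a
      using p1[OF a] p2[OF a] a by (simp add: F_def)
    show "p (Cod J u) \<cdot> FAr D u = FAr F u \<cdot> p (Dom J u)" if u: "u \<in> Ar J" for u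
      using l4[OF u] u by (simp add: F_def)
  qed (use F D in auto)
  then show ?thesis using that F by blast
qed

interpretation FC: additive FC padd pzer by (rule additive_FC)

lemma pointwise_zero: "is_ntrans J C \<eta> \<Longrightarrow> NDom \<eta> = F \<Longrightarrow> NCod \<eta> = G \<Longrightarrow>
    (\<And>a. a \<in> Ob J \<Longrightarrow> NComponent \<eta> a = zer (FOb F a) (FOb G a)) \<Longrightarrow> \<eta> = pzer F G"
  by (rule ntrans_eqI) (auto intro: pzer_ntrans dest: ntrans_functors)

lemma pointwise_monic:
  assumes n: "is_ntrans J C \<eta>" and m: "\<And>a. a \<in> Ob J \<Longrightarrow> monic C (NComponent \<eta> a)"
  shows "monic FC \<eta>"
  unfolding monic_def
proof (intro conjI allI ballI impI)
  show "\<eta> \<in> Ar FC" using n by simp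
  fix F f g assume fg: "f \<in> Hom FC F (Dom FC \<eta>)" "g \<in> Hom FC F (Dom FC \<eta>)" "\<eta> \<cdot>\<^bsub>FC\<^esub> f = \<eta> \<cdot>\<^bsub>FC\<^esub> g"
  then have t: "is_ntrans J C f" "NDom f = F" "NCod f = NDom \<eta>" "is_ntrans J C g" "NDom g = F" "NCod g = NDom \<eta>" by auto
  show "f = g"
  proof (rule ntrans_eqI)
    fix a assume a: "a \<in> Ob J"
    have "NComponent (\<eta> \<cdot>\<^bsub>FC\<^esub> f) a = NComponent (\<eta> \<cdot>\<^bsub>FC\<^esub> g) a" using fg(3) by simp
    then have "NComponent \<eta> a \<cdot> NComponent f a = NComponent \<eta> a \<cdot> NComponent g a" using a by simp
    then show "NComponent f a = NComponent g a"
      by (rule monicD[OF m[OF a]]) (use t ntrans_simps[OF n] ntrans_simps[OF t(1)] ntrans_simps[OF t(4)] a in auto)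
  qed (use t in auto)
qed

lemma pointwise_epic:
  assumes n: "is_ntrans J C \<eta>" and m: "\<And>a. a \<in> Ob J \<Longrightarrow> epic C (NComponent \<eta> a)"
  shows "epic FC \<eta>"
  unfolding epic_def monic_def op_simps
proof (intro conjI allI ballI impI)
  show "\<eta> \<in> Ar FC" using n by simp
  fix F f g assume fg: "f \<in> Hom (op_cat FC) F (Cod FC \<eta>)" "g \<in> Hom (op_cat FC) F (Cod FC \<eta>)" "f \<cdot>\<^bsub>FC\<^esub> \<eta> = g \<cdot>\<^bsub>FC\<^esub> \<eta>"
  then have t: "is_ntrans J C f" "NCod f = F" "NDom f = NCod \<eta>" "is_ntrans J C g" "NCod g = F" "NDom g = NCod \<eta>" by auto
  show "f = g"
  proof (rule ntrans_eqI)
    fix a assume a: "a \<in> Ob J"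
    have "NComponent (f \<cdot>\<^bsub>FC\<^esub> \<eta>) a = NComponent (g \<cdot>\<^bsub>FC\<^esub> \<eta>) a" using fg(3) by simp
    then have "NComponent f a \<cdot> NComponent \<eta> a = NComponent g a \<cdot> NComponent \<eta> a" using a by simp
    then show "NComponent f a = NComponent g a"
      by (rule epicD[OF m[OF a]]) (use t ntrans_simps[OF n] ntrans_simps[OF t(1)] ntrans_simps[OF t(4)] a in auto)
  qed (use t in auto)
qed

lemma pointwise_kernel:
  assumes n: "is_ntrans J C \<eta>" and k: "is_ntrans J C \<kappa>" "NCod \<kappa> = NDom \<eta>"
    and pk: "\<And>a. a \<in> Ob J \<Longrightarrow> is_kernel C (NComponent \<eta> a) (NComponent \<kappa> a)"
  shows "is_kernel FC \<eta> \<kappa>"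
proof (rule FC.is_kernelI)
  note ns = ntrans_simps[OF n] and ks = ntrans_simps[OF k(1)]
  show "\<eta> \<in> Ar FC" "Cod FC \<kappa> = Dom FC \<eta>" using n k by auto
  show "monic FC \<kappa>" by (rule pointwise_monic[OF k(1)]) (rule is_kernel_simps(5)[OF pk])
  have "\<eta> \<cdot>\<^bsub>FC\<^esub> \<kappa> = pzer (NDom \<kappa>) (NCod \<eta>)"
  proof (rule pointwise_zero)
    fix a assume a: "a \<in> Ob J"
    show "NComponent (\<eta> \<cdot>\<^bsub>FC\<^esub> \<kappa>) a = zer (FOb (NDom \<kappa>) a) (FOb (NCod \<eta>) a)"
      using is_kernel_simps(4)[OF pk[OF a]] a ks ns by simp
  qed (use n k in \<open>auto intro: Comp_ntrans\<close>)
  then show "\<eta> \<cdot>\<^bsub>FC\<^esub> \<kappa> = pzer (Dom FC \<kappa>) (Cod FC \<eta>)" by simp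
  fix h assume "h \<in> Ar FC" "Cod FC h = Dom FC \<eta>" "\<eta> \<cdot>\<^bsub>FC\<^esub> h = pzer (Dom FC h) (Cod FC \<eta>)"
  then have h: "is_ntrans J C h" "NCod h = NDom \<eta>" and z: "\<eta> \<cdot>\<^bsub>FC\<^esub> h = pzer (NDom h) (NCod \<eta>)" by auto
  note hs = ntrans_simps[OF h(1)]
  have "\<exists>u. u \<in> Ar C \<and> Dom C u = FOb (NDom h) a \<and> Cod C u = FOb (NDom \<kappa>) a \<and> NComponent \<kappa> a \<cdot> u = NComponent h a"
    if a: "a \<in> Ob J" for a
  proof -
    have "NComponent (\<eta> \<cdot>\<^bsub>FC\<^esub> h) a = NComponent (pzer (NDom h) (NCod \<eta>)) a" using z by simp
    then have za: "NComponent \<eta> a \<cdot> NComponent h a = zer (FOb (NDom h) a) (FOb (NCod \<eta>) a)" using a by simp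
    obtain u where "u \<in> Ar C" "Dom C u = Dom C (NComponent h a)" "Cod C u = Dom C (NComponent \<kappa> a)"
      "NComponent \<kappa> a \<cdot> u = NComponent h a"
      by (rule kernel_factor[OF pk[OF a], of "NComponent h a"]) (use za hs ns h(2) a in auto)
    then show ?thesis using hs(2)[OF a] ks(2)[OF a] by auto
  qed
  then obtain u where u: "\<And>a. a \<in> Ob J \<Longrightarrow> u a \<in> Ar C \<and> Dom C (u a) = FOb (NDom h) a \<and> Cod C (u a) = FOb (NDom \<kappa>) a \<and>
      NComponent \<kappa> a \<cdot> u a = NComponent h a" by metis
  note u1 = u[THEN conjunct1] and u2 = u[THEN conjunct2, THEN conjunct1]
    and u3 = u[THEN conjunct2, THEN conjunct2, THEN conjunct1]
    and u4 = u[THEN conjunct2, THEN conjunct2, THEN conjunct2]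
  have nt: "is_ntrans J C (mk_ntrans (NDom h) (NDom \<kappa>) u)"
  proof (rule mk_ntransI)
    show "is_functor J C (NDom h)" "is_functor J C (NDom \<kappa>)" using ntrans_functors h k by blast+
    show "u a \<in> Ar C \<and> Dom C (u a) = FOb (NDom h) a \<and> Cod C (u a) = FOb (NDom \<kappa>) a" if "a \<in> Ob J" for a
      using u[OF that] by simp
    fix v assume v: "v \<in> Ar J"
    then have o: "Dom J v \<in> Ob J" "Cod J v \<in> Ob J" by auto
    note t = hs(1-3)[OF o(1)] hs(1-3)[OF o(2)] ks(1-3)[OF o(1)] ks(1-3)[OF o(2)]
      u1[OF o(1)] u2[OF o(1)] u3[OF o(1)] u1[OF o(2)] u2[OF o(2)] u3[OF o(2)] k(2) h(2)
      functor_simps(3-5)[OF ntrans_functors(1)[OF h(1)] v] functor_simps(3-5)[OF ntrans_functors(1)[OF k(1)] v]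
      functor_simps(3-5)[OF ntrans_functors(1)[OF n] v]
    show "u (Cod J v) \<cdot> FAr (NDom h) v = FAr (NDom \<kappa>) v \<cdot> u (Dom J v)"
    proof (rule monicD[OF is_kernel_simps(5)[OF pk[OF o(2)]]])
      have "NComponent \<kappa> (Cod J v) \<cdot> (u (Cod J v) \<cdot> FAr (NDom h) v) = NComponent h (Cod J v) \<cdot> FAr (NDom h) v"
        by (rule comp_ext[OF u4[OF o(2)]]) (use t in auto)
      also have "\<dots> = FAr (NDom \<eta>) v \<cdot> NComponent h (Dom J v)" using hs(4)[OF v] h(2) by simp
      also have "\<dots> = FAr (NDom \<eta>) v \<cdot> (NComponent \<kappa> (Dom J v) \<cdot> u (Dom J v))" using u4[OF o(1)] by simp
      also have "\<dots> = NComponent \<kappa> (Cod J v) \<cdot> (FAr (NDom \<kappa>) v \<cdot> u (Dom J v))"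
        by (rule comp_ext2[OF ks(4)[OF v, unfolded k(2), symmetric]]) (use t in auto)
      finally show "NComponent \<kappa> (Cod J v) \<cdot> (u (Cod J v) \<cdot> FAr (NDom h) v)
        = NComponent \<kappa> (Cod J v) \<cdot> (FAr (NDom \<kappa>) v \<cdot> u (Dom J v))" .
    qed (use t in auto)
  qed
  have "\<kappa> \<cdot>\<^bsub>FC\<^esub> mk_ntrans (NDom h) (NDom \<kappa>) u = h"
    by (rule ntrans_eqI) (use nt k h u4 in \<open>auto intro: Comp_ntrans\<close>)
  then show "\<exists>u. u \<in> Ar FC \<and> Dom FC u = Dom FC h \<and> Cod FC u = Dom FC \<kappa> \<and> \<kappa> \<cdot>\<^bsub>FC\<^esub> u = h"
    using nt by (intro exI[of _ "mk_ntrans (NDom h) (NDom \<kappa>) u"]) simp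
qed

lemma pointwise_cokernel:
  assumes n: "is_ntrans J C \<eta>" and k: "is_ntrans J C \<kappa>" "NDom \<kappa> = NCod \<eta>"
    and pk: "\<And>a. a \<in> Ob J \<Longrightarrow> is_cokernel C (NComponent \<eta> a) (NComponent \<kappa> a)"
  shows "is_cokernel FC \<eta> \<kappa>"
proof (rule FC.is_cokernelI)
  note ns = ntrans_simps[OF n] and ks = ntrans_simps[OF k(1)]
  show "\<eta> \<in> Ar FC" "Dom FC \<kappa> = Cod FC \<eta>" using n k by auto
  show "epic FC \<kappa>" by (rule pointwise_epic[OF k(1)]) (rule is_cokernel_simps(5)[OF pk])
  have "\<kappa> \<cdot>\<^bsub>FC\<^esub> \<eta> = pzer (NDom \<eta>) (NCod \<kappa>)"
  proof (rule pointwise_zero)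
    fix a assume a: "a \<in> Ob J"
    show "NComponent (\<kappa> \<cdot>\<^bsub>FC\<^esub> \<eta>) a = zer (FOb (NDom \<eta>) a) (FOb (NCod \<kappa>) a)"
      using is_cokernel_simps(4)[OF pk[OF a]] a ks ns by simp
  qed (use n k in \<open>auto intro: Comp_ntrans\<close>)
  then show "\<kappa> \<cdot>\<^bsub>FC\<^esub> \<eta> = pzer (Dom FC \<eta>) (Cod FC \<kappa>)" by simp
  fix h assume "h \<in> Ar FC" "Dom FC h = Cod FC \<eta>" "h \<cdot>\<^bsub>FC\<^esub> \<eta> = pzer (Dom FC \<eta>) (Cod FC h)"
  then have h: "is_ntrans J C h" "NDom h = NCod \<eta>" and z: "h \<cdot>\<^bsub>FC\<^esub> \<eta> = pzer (NDom \<eta>) (NCod h)" by auto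
  note hs = ntrans_simps[OF h(1)]
  have "\<exists>u. u \<in> Ar C \<and> Cod C u = FOb (NCod h) a \<and> Dom C u = FOb (NCod \<kappa>) a \<and> u \<cdot> NComponent \<kappa> a = NComponent h a"
    if a: "a \<in> Ob J" for a
  proof -
    have "NComponent (h \<cdot>\<^bsub>FC\<^esub> \<eta>) a = NComponent (pzer (NDom \<eta>) (NCod h)) a" using z by simp
    then have za: "NComponent h a \<cdot> NComponent \<eta> a = zer (FOb (NDom \<eta>) a) (FOb (NCod h) a)" using a by simp
    obtain u where "u \<in> Ar C" "Cod C u = Cod C (NComponent h a)" "Dom C u = Cod C (NComponent \<kappa> a)"
      "u \<cdot> NComponent \<kappa> a = NComponent h a"
      by (rule cokernel_factor[OF pk[OF a], of "NComponent h a"]) (use za hs ns h(2) a in auto)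
    then show ?thesis using hs(3)[OF a] ks(3)[OF a] by auto
  qed
  then obtain u where u: "\<And>a. a \<in> Ob J \<Longrightarrow> u a \<in> Ar C \<and> Cod C (u a) = FOb (NCod h) a \<and> Dom C (u a) = FOb (NCod \<kappa>) a \<and>
      u a \<cdot> NComponent \<kappa> a = NComponent h a" by metis
  note u1 = u[THEN conjunct1] and u2 = u[THEN conjunct2, THEN conjunct1]
    and u3 = u[THEN conjunct2, THEN conjunct2, THEN conjunct1]
    and u4 = u[THEN conjunct2, THEN conjunct2, THEN conjunct2]
  have nt: "is_ntrans J C (mk_ntrans (NCod \<kappa>) (NCod h) u)"
  proof (rule mk_ntransI)
    show "is_functor J C (NCod \<kappa>)" "is_functor J C (NCod h)" using ntrans_functors h k by blast+
    show "u a \<in> Ar C \<and> Dom C (u a) = FOb (NCod \<kappa>) a \<and> Cod C (u a) = FOb (NCod h) a" if "a \<in> Ob J" for a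
      using u[OF that] by simp
    fix v assume v: "v \<in> Ar J"
    then have o: "Dom J v \<in> Ob J" "Cod J v \<in> Ob J" by auto
    note t = hs(1-3)[OF o(1)] hs(1-3)[OF o(2)] ks(1-3)[OF o(1)] ks(1-3)[OF o(2)]
      u1[OF o(1)] u2[OF o(1)] u3[OF o(1)] u1[OF o(2)] u2[OF o(2)] u3[OF o(2)] k(2) h(2)
      functor_simps(3-5)[OF ntrans_functors(2)[OF h(1)] v] functor_simps(3-5)[OF ntrans_functors(2)[OF k(1)] v]
      functor_simps(3-5)[OF ntrans_functors(2)[OF n] v]
    show "u (Cod J v) \<cdot> FAr (NCod \<kappa>) v = FAr (NCod h) v \<cdot> u (Dom J v)"
    proof (rule epicD[OF is_cokernel_simps(5)[OF pk[OF o(1)]]])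
      have "(FAr (NCod h) v \<cdot> u (Dom J v)) \<cdot> NComponent \<kappa> (Dom J v) = FAr (NCod h) v \<cdot> (u (Dom J v) \<cdot> NComponent \<kappa> (Dom J v))"
        by (rule comp_assoc) (use t in auto)
      also have "\<dots> = NComponent h (Cod J v) \<cdot> FAr (NCod \<eta>) v" using hs(4)[OF v] h(2) u4[OF o(1)] by simp
      also have "\<dots> = (u (Cod J v) \<cdot> NComponent \<kappa> (Cod J v)) \<cdot> FAr (NCod \<eta>) v" using u4[OF o(2)] by simp
      also have "\<dots> = u (Cod J v) \<cdot> (NComponent \<kappa> (Cod J v) \<cdot> FAr (NCod \<eta>) v)"
        by (rule comp_assoc) (use t in auto)
      also have "\<dots> = u (Cod J v) \<cdot> (FAr (NCod \<kappa>) v \<cdot> NComponent \<kappa> (Dom J v))" using ks(4)[OF v] k(2) by simp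
      also have "\<dots> = (u (Cod J v) \<cdot> FAr (NCod \<kappa>) v) \<cdot> NComponent \<kappa> (Dom J v)"
        by (rule comp_assoc[symmetric]) (use t in auto)
      finally show "(u (Cod J v) \<cdot> FAr (NCod \<kappa>) v) \<cdot> NComponent \<kappa> (Dom J v)
        = (FAr (NCod h) v \<cdot> u (Dom J v)) \<cdot> NComponent \<kappa> (Dom J v)" by (rule sym)
    qed (use t in auto)
  qed
  have "mk_ntrans (NCod \<kappa>) (NCod h) u \<cdot>\<^bsub>FC\<^esub> \<kappa> = h"
    by (rule ntrans_eqI) (use nt k h u4 in \<open>auto intro: Comp_ntrans\<close>)
  then show "\<exists>u. u \<in> Ar FC \<and> Cod FC u = Cod FC h \<and> Dom FC u = Cod FC \<kappa> \<and> u \<cdot>\<^bsub>FC\<^esub> \<kappa> = h"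
    using nt by (intro exI[of _ "mk_ntrans (NCod \<kappa>) (NCod h) u"]) simp
qed

lemma ex_pointwise_kernel:
  assumes n: "is_ntrans J C \<eta>"
  obtains \<kappa> where "is_ntrans J C \<kappa>" "NCod \<kappa> = NDom \<eta>"
    "\<And>a. a \<in> Ob J \<Longrightarrow> is_kernel C (NComponent \<eta> a) (NComponent \<kappa> a)"
proof -
  note ns = ntrans_simps[OF n] and X = functor_simps[OF ntrans_functors(1)[OF n]] and Y = functor_simps[OF ntrans_functors(2)[OF n]]
  have "\<forall>a\<in>Ob J. \<exists>k. is_kernel C (NComponent \<eta> a) k" using ex_kernel ns(1) by blast
  then obtain k where k: "\<And>a. a \<in> Ob J \<Longrightarrow> is_kernel C (NComponent \<eta> a) (k a)" by metis
  note K = is_kernel_simps[OF k]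
  have kt: "k a \<in> Ar C" "Cod C (k a) = FOb (NDom \<eta>) a" if "a \<in> Ob J" for a
    using K(2,3)[OF that] ns(2)[OF that] by simp_all
  obtain F where F: "is_functor J C F" "\<And>a. a \<in> Ob J \<Longrightarrow> FOb F a = Dom C (k a)"
    "\<And>i. i \<in> {()} \<Longrightarrow> is_ntrans J C (mk_ntrans F (NDom \<eta>) k)"
  proof (rule pointwise_limit_functor[of "{()}" "\<lambda>_. NDom \<eta>" "\<lambda>a. Dom C (k a)" "\<lambda>_. k"])
    show "is_functor J C (NDom \<eta>)" using ntrans_functors n by blast
    show "Dom C (k a) \<in> Ob C" if "a \<in> Ob J" for a using kt[OF that] by simp
    show "k a \<in> Ar C \<and> Dom C (k a) = Dom C (k a) \<and> Cod C (k a) = FOb (NDom \<eta>) a" if "a \<in> Ob J" for a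
      using kt[OF that] by simp
    show "h = h'" if "a \<in> Ob J" "h \<in> Ar C" "h' \<in> Ar C" "Dom C h = Dom C h'" "Cod C h = Dom C (k a)" "Cod C h' = Dom C (k a)"
      "\<And>i. i \<in> {()} \<Longrightarrow> k a \<cdot> h = k a \<cdot> h'" for a h h'
      by (rule monicD[OF K(5)[OF that(1)]]) (use that in auto)
    fix u assume u: "u \<in> Ar J"
    then have o: "Dom J u \<in> Ob J" "Cod J u \<in> Ob J" by auto
    note t = kt[OF o(1)] kt[OF o(2)] ns(1-3)[OF o(1)] ns(1-3)[OF o(2)] X(3-5)[OF u] Y(3-5)[OF u]
    have "NComponent \<eta> (Cod J u) \<cdot> (FAr (NDom \<eta>) u \<cdot> k (Dom J u)) = FAr (NCod \<eta>) u \<cdot> (NComponent \<eta> (Dom J u) \<cdot> k (Dom J u))"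
      by (rule comp_ext2[OF ns(4)[OF u]]) (use t in auto)
    also have "\<dots> = zer (Dom C (k (Dom J u))) (FOb (NCod \<eta>) (Cod J u))" unfolding K(4)[OF o(1)] using t by simp
    finally have z: "NComponent \<eta> (Cod J u) \<cdot> (FAr (NDom \<eta>) u \<cdot> k (Dom J u)) = zer (Dom C (k (Dom J u))) (FOb (NCod \<eta>) (Cod J u))" .
    obtain l where "l \<in> Ar C" "Dom C l = Dom C (FAr (NDom \<eta>) u \<cdot> k (Dom J u))" "Cod C l = Dom C (k (Cod J u))"
      "k (Cod J u) \<cdot> l = FAr (NDom \<eta>) u \<cdot> k (Dom J u)"
      by (rule kernel_factor[OF k[OF o(2)], of "FAr (NDom \<eta>) u \<cdot> k (Dom J u)"]) (use t z in auto)
    then show "\<exists>l. l \<in> Ar C \<and> Dom C l = Dom C (k (Dom J u)) \<and> Cod C l = Dom C (k (Cod J u)) \<and>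
        (\<forall>i\<in>{()}. k (Cod J u) \<cdot> l = FAr (NDom \<eta>) u \<cdot> k (Dom J u))"
      using t by (intro exI[of _ l]) simp
  qed blast
  show ?thesis by (rule that[OF F(3)]) (use k in auto)
qed

lemma ex_pointwise_cokernel:
  assumes n: "is_ntrans J C \<eta>"
  obtains \<kappa> where "is_ntrans J C \<kappa>" "NDom \<kappa> = NCod \<eta>"
    "\<And>a. a \<in> Ob J \<Longrightarrow> is_cokernel C (NComponent \<eta> a) (NComponent \<kappa> a)"
proof -
  note ns = ntrans_simps[OF n] and X = functor_simps[OF ntrans_functors(1)[OF n]] and Y = functor_simps[OF ntrans_functors(2)[OF n]]
  have "\<forall>a\<in>Ob J. \<exists>k. is_cokernel C (NComponent \<eta> a) k" using ex_cokernel ns(1) by blast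
  then obtain k where k: "\<And>a. a \<in> Ob J \<Longrightarrow> is_cokernel C (NComponent \<eta> a) (k a)" by metis
  note K = is_cokernel_simps[OF k]
  have kt: "k a \<in> Ar C" "Dom C (k a) = FOb (NCod \<eta>) a" if "a \<in> Ob J" for a
    using K(2,3)[OF that] ns(3)[OF that] by simp_all
  obtain F where F: "is_functor J C F" "is_ntrans J C (mk_ntrans (NCod \<eta>) F k)"
  proof (rule pointwise_quotient_functor[of "NCod \<eta>" k])
    show "is_functor J C (NCod \<eta>)" using ntrans_functors n by blast
    show "epic C (k a) \<and> Dom C (k a) = FOb (NCod \<eta>) a" if "a \<in> Ob J" for a
      using kt[OF that] K(5)[OF that] by simp
    fix u assume u: "u \<in> Ar J"
    then have o: "Dom J u \<in> Ob J" "Cod J u \<in> Ob J" by auto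
    note t = kt[OF o(1)] kt[OF o(2)] ns(1-3)[OF o(1)] ns(1-3)[OF o(2)] X(3-5)[OF u] Y(3-5)[OF u]
    have "(k (Cod J u) \<cdot> FAr (NCod \<eta>) u) \<cdot> NComponent \<eta> (Dom J u) = k (Cod J u) \<cdot> (NComponent \<eta> (Cod J u) \<cdot> FAr (NDom \<eta>) u)"
      using t ns(4)[OF u] by simp
    also have "\<dots> = zer (Dom C (NComponent \<eta> (Cod J u))) (Cod C (k (Cod J u))) \<cdot> FAr (NDom \<eta>) u"
      by (rule comp_ext[OF K(4)[OF o(2)]]) (use t in auto)
    finally have z: "(k (Cod J u) \<cdot> FAr (NCod \<eta>) u) \<cdot> NComponent \<eta> (Dom J u) = zer (FOb (NDom \<eta>) (Dom J u)) (Cod C (k (Cod J u)))"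
      using t by simp
    obtain l where "l \<in> Ar C" "Cod C l = Cod C (k (Cod J u) \<cdot> FAr (NCod \<eta>) u)" "Dom C l = Cod C (k (Dom J u))"
      "l \<cdot> k (Dom J u) = k (Cod J u) \<cdot> FAr (NCod \<eta>) u"
      by (rule cokernel_factor[OF k[OF o(1)], of "k (Cod J u) \<cdot> FAr (NCod \<eta>) u"]) (use t z in auto)
    then show "\<exists>l. l \<in> Ar C \<and> Dom C l = Cod C (k (Dom J u)) \<and> Cod C l = Cod C (k (Cod J u)) \<and>
        l \<cdot> k (Dom J u) = k (Cod J u) \<cdot> FAr (NCod \<eta>) u"
      using t by (intro exI[of _ l]) simp
  qed blast
  show ?thesis by (rule that[OF F(2)]) (use k in auto)
qed

text \<open>A pointwise kernel is a kernel of \<open>\<eta>\<close>, so it is zero, and a component with zero kernel is monic.\<close>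

lemma monic_pointwise:
  assumes m: "monic FC \<eta>" and a: "a \<in> Ob J"
  shows "monic C (NComponent \<eta> a)"
proof -
  have n: "is_ntrans J C \<eta>" using FC.monic_Ar[OF m] by simp
  obtain \<kappa> where k: "is_ntrans J C \<kappa>" "NCod \<kappa> = NDom \<eta>"
    "\<And>a. a \<in> Ob J \<Longrightarrow> is_kernel C (NComponent \<eta> a) (NComponent \<kappa> a)" using n by (rule ex_pointwise_kernel) blast
  have K: "is_kernel FC \<eta> \<kappa>" by (rule pointwise_kernel[OF n k])
  have "\<kappa> = pzer (NDom \<kappa>) (NDom \<eta>)"
    by (rule FC.monic_zerD[OF m]) (use FC.is_kernel_simps[OF K] in auto)
  then have "NComponent \<kappa> a = NComponent (pzer (NDom \<kappa>) (NDom \<eta>)) a" by simp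
  then have z: "NComponent \<kappa> a = zer (FOb (NDom \<kappa>) a) (FOb (NDom \<eta>) a)" using a by simp
  note ns = ntrans_simps[OF n] and ks = ntrans_simps[OF k(1)]
  show ?thesis
  proof (rule monicI)
    fix f assume f: "f \<in> Ar C" "Cod C f = Dom C (NComponent \<eta> a)" "NComponent \<eta> a \<cdot> f = zer (Dom C f) (Cod C (NComponent \<eta> a))"
    obtain u where "u \<in> Ar C" "Dom C u = Dom C f" "Cod C u = Dom C (NComponent \<kappa> a)" "NComponent \<kappa> a \<cdot> u = f"
      by (rule kernel_factor[OF k(3)[OF a], of f]) (use f in auto)
    note u = this
    have "zer (FOb (NDom \<kappa>) a) (FOb (NDom \<eta>) a) \<cdot> u = zer (Dom C f) (FOb (NDom \<eta>) a)"
      using u(1-3) ks(1-3)[OF a] ns(1-3)[OF a] a functor_simps(1)[OF ntrans_functors(1)[OF n] a] by simp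
    then show "f = zer (Dom C f) (Dom C (NComponent \<eta> a))" using u(4) z ns(2)[OF a] by simp
  qed (use ns a in auto)
qed

lemma epic_pointwise:
  assumes m: "epic FC \<eta>" and a: "a \<in> Ob J"
  shows "epic C (NComponent \<eta> a)"
proof -
  have n: "is_ntrans J C \<eta>" using FC.epic_Ar[OF m] by simp
  obtain \<kappa> where k: "is_ntrans J C \<kappa>" "NDom \<kappa> = NCod \<eta>"
    "\<And>a. a \<in> Ob J \<Longrightarrow> is_cokernel C (NComponent \<eta> a) (NComponent \<kappa> a)" using n by (rule ex_pointwise_cokernel) blast
  have K: "is_cokernel FC \<eta> \<kappa>" by (rule pointwise_cokernel[OF n k])
  have "\<kappa> = pzer (NCod \<eta>) (NCod \<kappa>)"
    by (rule FC.epic_zerD[OF m]) (use FC.is_cokernel_simps[OF K] in auto)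
  then have "NComponent \<kappa> a = NComponent (pzer (NCod \<eta>) (NCod \<kappa>)) a" by simp
  then have z: "NComponent \<kappa> a = zer (FOb (NCod \<eta>) a) (FOb (NCod \<kappa>) a)" using a by simp
  note ns = ntrans_simps[OF n] and ks = ntrans_simps[OF k(1)]
  show ?thesis
  proof (rule epicI)
    fix f assume f: "f \<in> Ar C" "Dom C f = Cod C (NComponent \<eta> a)" "f \<cdot> NComponent \<eta> a = zer (Dom C (NComponent \<eta> a)) (Cod C f)"
    obtain u where "u \<in> Ar C" "Cod C u = Cod C f" "Dom C u = Cod C (NComponent \<kappa> a)" "u \<cdot> NComponent \<kappa> a = f"
      by (rule cokernel_factor[OF k(3)[OF a], of f]) (use f in auto)
    note u = this
    have "u \<cdot> zer (FOb (NCod \<eta>) a) (FOb (NCod \<kappa>) a) = zer (FOb (NCod \<eta>) a) (Cod C f)"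
      using u(1-3) ks(1-3)[OF a] ns(1-3)[OF a] a functor_simps(1)[OF ntrans_functors(2)[OF n] a] by simp
    then show "f = zer (Cod C (NComponent \<eta> a)) (Cod C f)" using u(4) z ns(3)[OF a] by simp
  qed (use ns a in auto)
qed

lemma has_binary_products_FC: "has_binary_products FC"
  unfolding has_binary_products_def
proof (intro ballI)
  fix A B assume "A \<in> Ob FC" "B \<in> Ob FC"
  then have AB: "is_functor J C A" "is_functor J C B" by auto
  define D where "D x = (if x then A else B)" for x
  have D: "is_functor J C (D x)" for x using AB by (simp add: D_def)
  have "\<exists>P \<pi>. is_product C (UNIV :: bool set) (\<lambda>x. FOb (D x) a) P \<pi>" if a: "a \<in> Ob J" for a
  proof -
    have "\<exists>P \<pi>. is_product C (UNIV :: bool set) (\<lambda>x. if x then FOb A a else FOb B a) P \<pi>"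
      using ab functor_simps(1)[OF AB(1) a] functor_simps(1)[OF AB(2) a]
      unfolding abelian_category_def has_binary_products_def by blast
    moreover have "(\<lambda>x. if x then FOb A a else FOb B a) = (\<lambda>x. FOb (D x) a)" by (auto simp: D_def)
    ultimately show ?thesis by simp
  qed
  then obtain L \<pi> where L: "\<And>a. a \<in> Ob J \<Longrightarrow> is_product C (UNIV :: bool set) (\<lambda>x. FOb (D x) a) (L a) (\<pi> a)" by metis
  note pd = is_productD[OF L]
  obtain P where P: "is_functor J C P" "\<And>a. a \<in> Ob J \<Longrightarrow> FOb P a = L a"
    "\<And>x. x \<in> UNIV \<Longrightarrow> is_ntrans J C (mk_ntrans P (D x) (\<lambda>a. \<pi> a x))"
  proof (rule pointwise_limit_functor[of UNIV D L "\<lambda>x a. \<pi> a x"])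
    show "is_functor J C (D x)" for x by (rule D)
    show "L a \<in> Ob C" if "a \<in> Ob J" for a by (rule pd(1)[OF that])
    show "\<pi> a x \<in> Ar C \<and> Dom C (\<pi> a x) = L a \<and> Cod C (\<pi> a x) = FOb (D x) a" if "a \<in> Ob J" for a x
      using pd(2-4)[OF that] by simp
    show "h = h'" if "a \<in> Ob J" "h \<in> Ar C" "h' \<in> Ar C" "Dom C h = Dom C h'" "Cod C h = L a" "Cod C h' = L a"
      "\<And>x. x \<in> UNIV \<Longrightarrow> \<pi> a x \<cdot> h = \<pi> a x \<cdot> h'" for a h h'
      by (rule product_unique[OF L[OF that(1)]]) (use that in auto)
    fix u assume u: "u \<in> Ar J"
    then have o: "Dom J u \<in> Ob J" "Cod J u \<in> Ob J" by auto
    obtain l where l: "l \<in> Ar C" "Dom C l = L (Dom J u)" "Cod C l = L (Cod J u)"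
      "\<And>x. x \<in> UNIV \<Longrightarrow> \<pi> (Cod J u) x \<cdot> l = FAr (D x) u \<cdot> \<pi> (Dom J u) x"
      by (rule product_factor[OF L[OF o(2)], of "L (Dom J u)" "\<lambda>x. FAr (D x) u \<cdot> \<pi> (Dom J u) x"])
        (use pd(1)[OF o(1)] pd(2-4)[OF o(1)] functor_simps(3-5)[OF D u] in auto)
    then show "\<exists>l. l \<in> Ar C \<and> Dom C l = L (Dom J u) \<and> Cod C l = L (Cod J u) \<and>
        (\<forall>x\<in>UNIV. \<pi> (Cod J u) x \<cdot> l = FAr (D x) u \<cdot> \<pi> (Dom J u) x)" by blast
  qed blast
  define p where "p x = mk_ntrans P (D x) (\<lambda>a. \<pi> a x)" for x
  have p: "is_ntrans J C (p x)" for x unfolding p_def by (rule P(3)) simp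
  have "is_product FC UNIV (\<lambda>x. if x then A else B) P p"
    unfolding is_product_def
  proof (intro conjI ballI allI impI)
    show "P \<in> Ob FC" using P by simp
    show "p x \<in> Hom FC P (if x then A else B)" for x using p[of x] by (simp add: p_def D_def)
    fix T g assume T: "T \<in> Ob FC" and g: "\<forall>x\<in>UNIV. g x \<in> Hom FC T (if x then A else B)"
    have gn: "is_ntrans J C (g x)" "NDom (g x) = T" "NCod (g x) = D x" for x
      using g[rule_format, of x] by (simp_all add: D_def)
    note gs = ntrans_simps[OF gn(1), unfolded gn(2,3)]
    have Tf: "is_functor J C T" using T by simp
    have "\<exists>h. h \<in> Ar C \<and> Dom C h = FOb T a \<and> Cod C h = L a \<and> (\<forall>x. \<pi> a x \<cdot> h = NComponent (g x) a)" if a: "a \<in> Ob J" for a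
    proof -
      obtain h where "h \<in> Ar C" "Dom C h = FOb T a" "Cod C h = L a"
        "\<And>x. x \<in> UNIV \<Longrightarrow> \<pi> a x \<cdot> h = NComponent (g x) a"
        by (rule product_factor[OF L[OF a], of "FOb T a" "\<lambda>x. NComponent (g x) a"])
          (use gs a functor_simps(1)[OF Tf a] in auto)
      then show ?thesis by blast
    qed
    then obtain h where h: "\<And>a. a \<in> Ob J \<Longrightarrow> h a \<in> Ar C \<and> Dom C (h a) = FOb T a \<and> Cod C (h a) = L a \<and>
      (\<forall>x. \<pi> a x \<cdot> h a = NComponent (g x) a)" by metis
    note h1 = h[THEN conjunct1] and h2 = h[THEN conjunct2, THEN conjunct1]
      and h3 = h[THEN conjunct2, THEN conjunct2, THEN conjunct1]
      and h4 = h[THEN conjunct2, THEN conjunct2, THEN conjunct2, rule_format]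
    note ps = ntrans_simps(4)[OF p, unfolded p_def, simplified]
    have nt: "is_ntrans J C (mk_ntrans T P h)"
    proof (rule mk_ntransI[OF Tf P(1)])
      show "h a \<in> Ar C \<and> Dom C (h a) = FOb T a \<and> Cod C (h a) = FOb P a" if a: "a \<in> Ob J" for a
        using h[OF a] P(2)[OF a] by simp
      fix u assume u: "u \<in> Ar J"
      then have o: "Dom J u \<in> Ob J" "Cod J u \<in> Ob J" by auto
      note t = h1[OF o(1)] h2[OF o(1)] h3[OF o(1)] h1[OF o(2)] h2[OF o(2)] h3[OF o(2)]
        functor_simps(3-5)[OF Tf u] functor_simps(3-5)[OF P(1) u, unfolded P(2)[OF o(1)] P(2)[OF o(2)]]
      show "h (Cod J u) \<cdot> FAr T u = FAr P u \<cdot> h (Dom J u)"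
      proof (rule product_unique[OF L[OF o(2)]])
        fix x
        note t' = t pd(2-4)[OF o(1), of x, simplified] pd(2-4)[OF o(2), of x, simplified] functor_simps(3-5)[OF D[of x] u]
        have "\<pi> (Cod J u) x \<cdot> (h (Cod J u) \<cdot> FAr T u) = NComponent (g x) (Cod J u) \<cdot> FAr T u"
          by (rule comp_ext[OF h4[OF o(2)]]) (use t' in auto)
        also have "\<dots> = FAr (D x) u \<cdot> (\<pi> (Dom J u) x \<cdot> h (Dom J u))"
          using gs(4)[OF u, of x] h4[OF o(1)] by simp
        also have "\<dots> = \<pi> (Cod J u) x \<cdot> (FAr P u \<cdot> h (Dom J u))"
          by (rule comp_ext2) (use ps[of u x] u o t' in auto)
        finally show "\<pi> (Cod J u) x \<cdot> (h (Cod J u) \<cdot> FAr T u) = \<pi> (Cod J u) x \<cdot> (FAr P u \<cdot> h (Dom J u))" .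
      qed (use t in auto)
    qed
    show "\<exists>!h. h \<in> Hom FC T P \<and> (\<forall>x\<in>UNIV. p x \<cdot>\<^bsub>FC\<^esub> h = g x)"
    proof (rule ex1I[of _ "mk_ntrans T P h"])
      have "p x \<cdot>\<^bsub>FC\<^esub> mk_ntrans T P h = g x" for x
        by (rule ntrans_eqI) (use nt p gn h4 in \<open>auto intro!: Comp_ntrans simp: p_def\<close>)
      then show "mk_ntrans T P h \<in> Hom FC T P \<and> (\<forall>x\<in>UNIV. p x \<cdot>\<^bsub>FC\<^esub> mk_ntrans T P h = g x)" using nt by simp
      fix k assume k: "k \<in> Hom FC T P \<and> (\<forall>x\<in>UNIV. p x \<cdot>\<^bsub>FC\<^esub> k = g x)"
      then have kn: "is_ntrans J C k" "NDom k = T" "NCod k = P" by auto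
      show "k = mk_ntrans T P h"
      proof (rule ntrans_eqI[OF kn(1) nt])
        fix a assume a: "a \<in> Ob J"
        have "NComponent k a = h a"
        proof (rule product_unique[OF L[OF a]])
          fix x
          have "NComponent (p x \<cdot>\<^bsub>FC\<^esub> k) a = NComponent (g x) a" using k by simp
          then show "\<pi> a x \<cdot> NComponent k a = \<pi> a x \<cdot> h a" using a h4[OF a] by (simp add: p_def)
        qed (use ntrans_simps(1-3)[OF kn(1) a] kn h1[OF a] h2[OF a] h3[OF a] P(2)[OF a] in auto)
        then show "NComponent k a = NComponent (mk_ntrans T P h) a" using a by simp
      qed (use kn in auto)
    qed
  qed
  then show "\<exists>P \<pi>. is_product FC (UNIV :: bool set) (\<lambda>x. if x then A else B) P \<pi>" by blast
qed

text \<open>A monomorphism is the kernel of its pointwise cokernel because each of its components is.\<close>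

lemma abelian_category_FC: "abelian_category FC"
  unfolding abelian_category_def
proof (intro conjI ballI allI impI)
  show "category FC" by (rule category_FC)
  show "\<exists>add zer. preadditive FC add zer" using preadditive_FC by blast
  show "\<exists>z. zero_object FC z" by (rule zero_object_FC)
  show "has_binary_products FC" by (rule has_binary_products_FC)
  then show "has_binary_products (op_cat FC)" by (rule FC.has_binary_products_op)
  show "\<exists>k. is_kernel FC \<eta> k" if "\<eta> \<in> Ar FC" for \<eta>
    using ex_pointwise_kernel[of \<eta>] pointwise_kernel[of \<eta>] that by (metis FC_simps(2) mem_Collect_eq)
  show "\<exists>k. is_cokernel FC \<eta> k" if "\<eta> \<in> Ar FC" for \<eta>
    using ex_pointwise_cokernel[of \<eta>] pointwise_cokernel[of \<eta>] that by (metis FC_simps(2) mem_Collect_eq)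
  fix \<eta>
  show "\<exists>f. is_kernel FC f \<eta>" if m: "monic FC \<eta>"
  proof -
    have n: "is_ntrans J C \<eta>" using FC.monic_Ar[OF m] by simp
    obtain \<kappa> where k: "is_ntrans J C \<kappa>" "NDom \<kappa> = NCod \<eta>"
      "\<And>a. a \<in> Ob J \<Longrightarrow> is_cokernel C (NComponent \<eta> a) (NComponent \<kappa> a)" using n by (rule ex_pointwise_cokernel) blast
    have "is_kernel FC \<kappa> \<eta>"
      by (rule pointwise_kernel[OF k(1) n]) (use k monic_kernel_of_cokernel monic_pointwise[OF m] in auto)
    then show ?thesis by blast
  qed
  show "\<exists>f. is_cokernel FC f \<eta>" if m: "epic FC \<eta>"
  proof -
    have n: "is_ntrans J C \<eta>" using FC.epic_Ar[OF m] by simp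
    obtain \<kappa> where k: "is_ntrans J C \<kappa>" "NCod \<kappa> = NDom \<eta>"
      "\<And>a. a \<in> Ob J \<Longrightarrow> is_kernel C (NComponent \<eta> a) (NComponent \<kappa> a)" using n by (rule ex_pointwise_kernel) blast
    have "is_cokernel FC \<kappa> \<eta>"
      by (rule pointwise_cokernel[OF k(1) n]) (use k epic_cokernel_of_kernel epic_pointwise[OF m] in auto)
    then show ?thesis by blast
  qed
qed

lemma abelian_FC: "abelian FC padd pzer"
  by (intro abelian.intro abelian_axioms.intro additive_FC abelian_category_FC)

end

sublocale functor_category \<subseteq> FC: abelian FC padd pzer by (rule abelian_FC)

context functor_category
begin

lemma kernel_pointwise:
  assumes k: "is_kernel FC \<eta> \<kappa>" and a: "a \<in> Ob J"
  shows "is_kernel C (NComponent \<eta> a) (NComponent \<kappa> a)"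
proof -
  note K = FC.is_kernel_simps[OF k]
  have n: "is_ntrans J C \<eta>" and kn: "is_ntrans J C \<kappa>" "NCod \<kappa> = NDom \<eta>" using K by auto
  obtain l where l: "is_ntrans J C l" "NCod l = NDom \<eta>"
    "\<And>a. a \<in> Ob J \<Longrightarrow> is_kernel C (NComponent \<eta> a) (NComponent l a)" using n by (rule ex_pointwise_kernel) blast
  have L: "is_kernel FC \<eta> l" by (rule pointwise_kernel[OF n l])
  obtain v where v: "v \<in> Ar FC" "Dom FC v = Dom FC l" "Cod FC v = Dom FC \<kappa>" "\<kappa> \<cdot>\<^bsub>FC\<^esub> v = l"
    by (rule FC.kernel_factor[OF k, of l]) (use FC.is_kernel_simps[OF L] in auto)
  have vn: "is_ntrans J C v" "NDom v = NDom l" "NCod v = NDom \<kappa>" using v by auto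
  note la = l(3)[OF a] and ks = ntrans_simps(1-3)[OF kn(1) a] and vs = ntrans_simps(1-3)[OF vn(1) a]
    and ls = ntrans_simps(1-3)[OF l(1) a] and ns = ntrans_simps(1-3)[OF n a]
  have va: "NComponent \<kappa> a \<cdot> NComponent v a = NComponent l a" using v(4) a by (metis functor_cat_simps(10))
  have km: "monic C (NComponent \<kappa> a)" by (rule monic_pointwise[OF K(5) a])
  have "NComponent (\<eta> \<cdot>\<^bsub>FC\<^esub> \<kappa>) a = NComponent (pzer (NDom \<kappa>) (NCod \<eta>)) a" using K(4) by simp
  then have z: "NComponent \<eta> a \<cdot> NComponent \<kappa> a = zer (FOb (NDom \<kappa>) a) (FOb (NCod \<eta>) a)" using a by simp
  show ?thesis
  proof (rule is_kernelI)
    fix h assume h: "h \<in> Ar C" "Cod C h = Dom C (NComponent \<eta> a)" "NComponent \<eta> a \<cdot> h = zer (Dom C h) (Cod C (NComponent \<eta> a))"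
    obtain t where t: "t \<in> Ar C" "Dom C t = Dom C h" "Cod C t = Dom C (NComponent l a)" "NComponent l a \<cdot> t = h"
      by (rule kernel_factor[OF la, of h]) (use h in auto)
    have "NComponent \<kappa> a \<cdot> (NComponent v a \<cdot> t) = NComponent l a \<cdot> t"
      by (rule comp_ext[OF va]) (use t(1-3) ks vs ls vn in auto)
    then show "\<exists>u. u \<in> Ar C \<and> Dom C u = Dom C h \<and> Cod C u = Dom C (NComponent \<kappa> a) \<and> NComponent \<kappa> a \<cdot> u = h"
      using t ks vs ls vn by (intro exI[of _ "NComponent v a \<cdot> t"]) simp
  qed (use ns ks kn km z in auto)
qed

lemma short_exact_pointwise:
  assumes "short_exact FC f g" "a \<in> Ob J"
  shows "short_exact C (NComponent f a) (NComponent g a)"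
  using assms kernel_pointwise epic_pointwise
  unfolding short_exact_iff_kernel FC.short_exact_iff_kernel by blast

lemma obj_retract_pointwise:
  assumes "obj_retract FC A B" "a \<in> Ob J"
  shows "obj_retract C (FOb A a) (FOb B a)"
proof -
  obtain i r where "i \<in> Ar FC" "Dom FC i = A" "Cod FC i = B" "r \<in> Ar FC" "Dom FC r = B" "Cod FC r = A"
    "r \<cdot>\<^bsub>FC\<^esub> i = Ident FC A" using assms(1) by (rule FC.obj_retractE)
  then have t: "is_ntrans J C i" "NDom i = A" "NCod i = B" "is_ntrans J C r" "NDom r = B" "NCod r = A"
    and e: "r \<cdot>\<^bsub>FC\<^esub> i = Ident FC A" by auto
  have "NComponent (r \<cdot>\<^bsub>FC\<^esub> i) a = NComponent (Ident FC A) a" using e by simp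
  then have "NComponent r a \<cdot> NComponent i a = Ident C (FOb A a)" using assms(2) by simp
  then show ?thesis unfolding obj_retract_def
    using ntrans_simps(1-3)[OF t(1) assms(2)] ntrans_simps(1-3)[OF t(4) assms(2)] t
    by (intro exI[of _ "NComponent i a"] exI[of _ "NComponent r a"]) simp
qed

end


section \<open>Right rooted quivers and orthogonality of representations\<close>

text \<open>Heads are below tails, so that well-founded recursion treats the targets of all arrows leaving a
  vertex before the vertex itself.\<close>

definition arrow_rel :: "('v, 'e) pre_digraph \<Rightarrow> ('v \<times> 'v) set" where
  "arrow_rel Q = {(head Q \<alpha>, tail Q \<alpha>) | \<alpha>. \<alpha> \<in> arcs Q}"

text \<open>Each \<open>W\<close> in the transfinite sequence consists of accessible vertices: arrows starting in a successor
  stage end in the stage before.\<close>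

lemma right_rooted_wf:
  assumes Q: "wf_digraph Q" and rr: "right_rooted Q"
  shows "wf (arrow_rel Q)"
proof -
  obtain r :: "'a set rel" and W l where r: "Well_order r" "rooted_sequence Q r W" "l \<in> Field r" "W l = verts Q"
    using rr unfolding right_rooted_def by blast
  have wfr: "wf (r - Id)" using r(1) unfolding well_order_on_def by simp
  have "a \<in> Field r \<longrightarrow> (\<forall>i\<in>W a. i \<in> Wellfounded.acc (arrow_rel Q))" for a
    using wfr
  proof (induction a rule: wf_induct_rule)
    case (less a)
    show ?case
    proof (intro impI ballI)
      fix i assume a: "a \<in> Field r" and i: "i \<in> W a"
      have IH: "j \<in> Wellfounded.acc (arrow_rel Q)" if "b \<in> underS r a" "j \<in> W b" for b j
        using less that unfolding underS_def Field_def by auto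
      note S = r(2)[unfolded rooted_sequence_def, rule_format, OF a]
      consider "underS r a = {}" | b where "b \<in> underS r a" "\<forall>c\<in>underS r a. (c, b) \<in> r"
        | "underS r a \<noteq> {}" "\<not> (\<exists>b\<in>underS r a. \<forall>c\<in>underS r a. (c, b) \<in> r)" by blast
      then show "i \<in> Wellfounded.acc (arrow_rel Q)"
      proof cases
        case 1
        then show ?thesis using S i by simp
      next
        case (2 b)
        then have "W a = rooted_step Q (W b)" using S by blast
        then have st: "\<And>\<alpha>. \<alpha> \<in> arcs Q \<Longrightarrow> tail Q \<alpha> = i \<Longrightarrow> head Q \<alpha> \<in> W b"
          using i unfolding rooted_step_def by blast
        show ?thesis
        proof (rule acc.accI)
          fix j assume "(j, i) \<in> arrow_rel Q"
          then have "j \<in> W b" using st unfolding arrow_rel_def by blast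
          then show "j \<in> Wellfounded.acc (arrow_rel Q)" using IH 2 by blast
        qed
      next
        case 3
        then have "W a = (\<Union>b\<in>underS r a. W b)" using S by blast
        then show ?thesis using i IH by blast
      qed
    qed
  qed
  then have v: "i \<in> Wellfounded.acc (arrow_rel Q)" if "i \<in> verts Q" for i using r that by blast
  have "i \<in> Wellfounded.acc (arrow_rel Q)" for i
  proof (cases "i \<in> verts Q")
    case False
    then have no: "(j, i) \<notin> arrow_rel Q" for j
      using wf_digraph.tail_in_verts[OF Q] unfolding arrow_rel_def by blast
    show ?thesis by (rule acc.accI) (use no in blast)
  qed (rule v)
  then show ?thesis by (simp add: wf_iff_acc)
qed

lemma path_cat_simps [simp]:
  "Ob (path_cat Q) = verts Q" "Dom (path_cat Q) (u, p, v) = u" "Cod (path_cat Q) (u, p, v) = v"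
  "Ident (path_cat Q) u = (u, [], u)"
  "(v', q, w) \<cdot>\<^bsub>path_cat Q\<^esub> (u, p, v) = (u, p @ q, w)"
  by (simp_all add: path_cat_def)

lemma path_cat_Ar: "(u, p, v) \<in> Ar (path_cat Q) \<longleftrightarrow> pre_digraph.awalk Q u p v"
  by (simp add: path_cat_def)

lemma category_path_cat:
  assumes "wf_digraph Q"
  shows "category (path_cat Q)"
proof -
  interpret Q: wf_digraph Q by fact
  show ?thesis
  proof
    fix f assume "f \<in> Ar (path_cat Q)"
    then show "Dom (path_cat Q) f \<in> Ob (path_cat Q)" "Cod (path_cat Q) f \<in> Ob (path_cat Q)"
      by (cases f; simp add: path_cat_Ar; blast intro: Q.awalk_hd_in_verts Q.awalk_last_in_verts)+
  next
    fix f g a b c assume "f \<in> Hom (path_cat Q) a b" "g \<in> Hom (path_cat Q) b c"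
    then show "g \<cdot>\<^bsub>path_cat Q\<^esub> f \<in> Hom (path_cat Q) a c"
      by (cases f; cases g) (auto simp: path_cat_Ar)
  next
    fix f g h a b c d assume "f \<in> Hom (path_cat Q) a b" "g \<in> Hom (path_cat Q) b c" "h \<in> Hom (path_cat Q) c d"
    then show "(h \<cdot>\<^bsub>path_cat Q\<^esub> g) \<cdot>\<^bsub>path_cat Q\<^esub> f = h \<cdot>\<^bsub>path_cat Q\<^esub> (g \<cdot>\<^bsub>path_cat Q\<^esub> f)"
      by (cases f; cases g; cases h) simp
  next
    fix f a b assume f: "f \<in> Hom (path_cat Q) a b"
    show "f \<cdot>\<^bsub>path_cat Q\<^esub> Ident (path_cat Q) a = f" using f by (cases f) simp
    show "Ident (path_cat Q) b \<cdot>\<^bsub>path_cat Q\<^esub> f = f" using f by (cases f) simp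
  qed (simp add: path_cat_Ar Q.awalk_Nil_iff)
qed

text \<open>The value on a path of the functor freely generated by objects \<open>Xo\<close> and arrows \<open>Xa\<close>.\<close>

primrec path_eval :: "('o, 'm) cat \<Rightarrow> ('v, 'e) pre_digraph \<Rightarrow> ('v \<Rightarrow> 'o) \<Rightarrow> ('e \<Rightarrow> 'm) \<Rightarrow> 'v \<Rightarrow> 'e list \<Rightarrow> 'm" where
  "path_eval M Q Xo Xa u [] = Ident M (Xo u)"
| "path_eval M Q Xo Xa u (\<alpha> # p) = path_eval M Q Xo Xa (head Q \<alpha>) p \<cdot>\<^bsub>M\<^esub> Xa \<alpha>"

text \<open>Products are needed only for families indexed by sets of arrows of \<open>Q\<close>; stated this way, existence and
  exactness of products do not refer to a bound on the size of index sets.\<close>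

locale quiver_reps = abelian M add zer
  for M :: "('o, 'm) cat" (structure) and add (infixl "\<boxplus>" 65) and zer +
  fixes Q :: "('v, 'e) pre_digraph"
  assumes Q: "wf_digraph Q" and wfQ: "wf (arrow_rel Q)"
    and prod_ex: "\<And>I X. I \<subseteq> arcs Q \<Longrightarrow> (\<And>\<alpha>. \<alpha> \<in> I \<Longrightarrow> X \<alpha> \<in> Ob M) \<Longrightarrow> \<exists>P \<pi>. is_product M I X P \<pi>"
    and prod_epic: "\<And>I X Y f P \<pi> P' \<pi>' g. I \<subseteq> arcs Q \<Longrightarrow> is_product M I X P \<pi> \<Longrightarrow> is_product M I Y P' \<pi>' \<Longrightarrow>
      (\<And>\<alpha>. \<alpha> \<in> I \<Longrightarrow> f \<alpha> \<in> Hom M (X \<alpha>) (Y \<alpha>) \<and> epic M (f \<alpha>)) \<Longrightarrow> g \<in> Hom M P P' \<Longrightarrow>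
      (\<And>\<alpha>. \<alpha> \<in> I \<Longrightarrow> \<pi>' \<alpha> \<cdot> g = f \<alpha> \<cdot> \<pi> \<alpha>) \<Longrightarrow> epic M g"

sublocale quiver_reps \<subseteq> functor_category "path_cat Q" M add zer
  by (intro functor_category.intro category_path_cat Q) unfold_locales

context quiver_reps
begin

abbreviation out where "out i \<equiv> {\<alpha> \<in> arcs Q. tail Q \<alpha> = i}"

lemma arc_verts: "\<alpha> \<in> arcs Q \<Longrightarrow> tail Q \<alpha> \<in> verts Q" "\<alpha> \<in> arcs Q \<Longrightarrow> head Q \<alpha> \<in> verts Q"
  by (rule wf_digraph.tail_in_verts[OF Q], assumption) (rule wf_digraph.head_in_verts[OF Q])

lemma arc_path: "\<alpha> \<in> arcs Q \<Longrightarrow> (tail Q \<alpha>, [\<alpha>], head Q \<alpha>) \<in> Ar (path_cat Q)"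
  unfolding path_cat_Ar using arc_verts by (simp add: pre_digraph.awalk_def pre_digraph.cas.simps)

lemma path_Nil: "(u, [], v) \<in> Ar (path_cat Q) \<longleftrightarrow> u \<in> verts Q \<and> u = v"
  unfolding path_cat_Ar by (auto simp: pre_digraph.awalk_def pre_digraph.cas.simps)

lemma path_Cons: "(u, \<alpha> # p, v) \<in> Ar (path_cat Q) \<longleftrightarrow> \<alpha> \<in> arcs Q \<and> u = tail Q \<alpha> \<and> (head Q \<alpha>, p, v) \<in> Ar (path_cat Q)"
  unfolding path_cat_Ar by (auto simp: pre_digraph.awalk_def pre_digraph.cas.simps arc_verts)

lemma rep_arrow_simps:
  assumes "is_functor (path_cat Q) M X" "\<alpha> \<in> arcs Q"
  shows "rep_arrow Q X \<alpha> \<in> Ar M" "Dom M (rep_arrow Q X \<alpha>) = FOb X (tail Q \<alpha>)"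
    "Cod M (rep_arrow Q X \<alpha>) = FOb X (head Q \<alpha>)"
  using functor_simps(3-5)[OF assms(1) arc_path[OF assms(2)]] unfolding rep_arrow_def by simp_all

lemma rep_Cons:
  assumes X: "is_functor (path_cat Q) M X" and p: "(head Q \<alpha>, p, v) \<in> Ar (path_cat Q)" "\<alpha> \<in> arcs Q"
  shows "FAr X (tail Q \<alpha>, \<alpha> # p, v) = FAr X (head Q \<alpha>, p, v) \<cdot> rep_arrow Q X \<alpha>"
  using functor_simps(6)[OF X arc_path[OF p(2)] p(1)] unfolding rep_arrow_def by simp

lemma ntrans_arrow:
  assumes "is_ntrans (path_cat Q) M h" "\<alpha> \<in> arcs Q"
  shows "NComponent h (head Q \<alpha>) \<cdot> rep_arrow Q (NDom h) \<alpha> = rep_arrow Q (NCod h) \<alpha> \<cdot> NComponent h (tail Q \<alpha>)"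
  using ntrans_simps(4)[OF assms(1) arc_path[OF assms(2)]] unfolding rep_arrow_def by simp

text \<open>Naturality with respect to arrows propagates to paths.\<close>

lemma rep_homI:
  assumes X: "is_functor (path_cat Q) M X" and Y: "is_functor (path_cat Q) M Y"
    and h: "\<And>i. i \<in> verts Q \<Longrightarrow> h i \<in> Ar M \<and> Dom M (h i) = FOb X i \<and> Cod M (h i) = FOb Y i"
    and n: "\<And>\<alpha>. \<alpha> \<in> arcs Q \<Longrightarrow> h (head Q \<alpha>) \<cdot> rep_arrow Q X \<alpha> = rep_arrow Q Y \<alpha> \<cdot> h (tail Q \<alpha>)"
  shows "is_ntrans (path_cat Q) M (mk_ntrans X Y h)"
proof (rule mk_ntransI[OF X Y])
  show "h i \<in> Ar M \<and> Dom M (h i) = FOb X i \<and> Cod M (h i) = FOb Y i" if "i \<in> Ob (path_cat Q)" for i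
    using h that by simp
  have "h v \<cdot> FAr X (u, p, v) = FAr Y (u, p, v) \<cdot> h u" if "(u, p, v) \<in> Ar (path_cat Q)" for u p v
    using that
  proof (induction p arbitrary: u)
    case Nil
    then have u: "u \<in> verts Q" "u = v" unfolding path_Nil by auto
    show ?case using functor_simps(2)[OF X, of u] functor_simps(2)[OF Y, of u] u h[OF u(1)] by simp
  next
    case (Cons \<alpha> p)
    then have a: "\<alpha> \<in> arcs Q" "u = tail Q \<alpha>" "(head Q \<alpha>, p, v) \<in> Ar (path_cat Q)" unfolding path_Cons by auto
    have v: "v \<in> verts Q" using J.Cod_Ob[OF a(3)] by simp
    note t = rep_arrow_simps[OF X a(1)] rep_arrow_simps[OF Y a(1)] functor_simps(3-5)[OF X a(3), simplified]
      functor_simps(3-5)[OF Y a(3), simplified] h[OF arc_verts(1)[OF a(1)]] h[OF arc_verts(2)[OF a(1)]] h[OF v]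
    have "h v \<cdot> FAr X (u, \<alpha> # p, v) = h v \<cdot> (FAr X (head Q \<alpha>, p, v) \<cdot> rep_arrow Q X \<alpha>)"
      unfolding a(2) rep_Cons[OF X a(3,1)] ..
    also have "\<dots> = FAr Y (head Q \<alpha>, p, v) \<cdot> (h (head Q \<alpha>) \<cdot> rep_arrow Q X \<alpha>)"
      by (rule comp_ext2[OF Cons.IH[OF a(3)]]) (use t in auto)
    also have "\<dots> = FAr Y (head Q \<alpha>, p, v) \<cdot> (rep_arrow Q Y \<alpha> \<cdot> h (tail Q \<alpha>))" unfolding n[OF a(1)] ..
    also have "\<dots> = FAr Y (u, \<alpha> # p, v) \<cdot> h u"
      unfolding a(2) rep_Cons[OF Y a(3,1)] by (rule comp_assoc[symmetric]) (use t in auto)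
    finally show ?case .
  qed
  then show "h (Cod (path_cat Q) w) \<cdot> FAr X w = FAr Y w \<cdot> h (Dom (path_cat Q) w)" if "w \<in> Ar (path_cat Q)" for w
    using that by (cases w) simp
qed

lemma ex_rep:
  assumes Xo: "\<And>i. i \<in> verts Q \<Longrightarrow> Xo i \<in> Ob M"
    and Xa: "\<And>\<alpha>. \<alpha> \<in> arcs Q \<Longrightarrow> Xa \<alpha> \<in> Ar M \<and> Dom M (Xa \<alpha>) = Xo (tail Q \<alpha>) \<and> Cod M (Xa \<alpha>) = Xo (head Q \<alpha>)"
  obtains X where "is_functor (path_cat Q) M X" "\<And>i. i \<in> verts Q \<Longrightarrow> FOb X i = Xo i"
    "\<And>\<alpha>. \<alpha> \<in> arcs Q \<Longrightarrow> rep_arrow Q X \<alpha> = Xa \<alpha>"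
proof -
  let ?e = "path_eval M Q Xo Xa"
  define X where "X = \<lparr>FOb = restrict Xo (verts Q), FAr = (\<lambda>w\<in>Ar (path_cat Q). ?e (fst w) (fst (snd w)))\<rparr>"
  have pe_type: "?e u p \<in> Ar M \<and> Dom M (?e u p) = Xo u \<and> Cod M (?e u p) = Xo v" if "(u, p, v) \<in> Ar (path_cat Q)" for u p v
    using that
  proof (induction p arbitrary: u)
    case Nil
    then have "u \<in> verts Q" "u = v" unfolding path_Nil by auto
    then show ?case using Xo[of v] by simp
  next
    case (Cons \<alpha> p)
    then have a: "\<alpha> \<in> arcs Q" "u = tail Q \<alpha>" "(head Q \<alpha>, p, v) \<in> Ar (path_cat Q)" unfolding path_Cons by auto
    show ?case using Cons.IH[OF a(3)] Xa[OF a(1)] a(2) by simp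
  qed
  have pe_append: "?e u (p @ q) = ?e v q \<cdot> ?e u p" if "(u, p, v) \<in> Ar (path_cat Q)" "(v, q, w) \<in> Ar (path_cat Q)" for u p v q w
    using that(1)
  proof (induction p arbitrary: u)
    case Nil
    then show ?case unfolding path_Nil using pe_type[OF that(2)] by auto
  next
    case (Cons \<alpha> p)
    then have a: "\<alpha> \<in> arcs Q" "u = tail Q \<alpha>" "(head Q \<alpha>, p, v) \<in> Ar (path_cat Q)" unfolding path_Cons by auto
    show ?case using Cons.IH[OF a(3)] pe_type[OF a(3)] pe_type[OF that(2)] Xa[OF a(1)] by simp
  qed
  have X: "is_functor (path_cat Q) M X"
  proof (rule functorI)
    show "FOb X \<in> extensional (Ob (path_cat Q))" "FAr X \<in> extensional (Ar (path_cat Q))" by (simp_all add: X_def)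
    show "FOb X i \<in> Ob M" if "i \<in> Ob (path_cat Q)" for i using that Xo by (simp add: X_def)
    show "FAr X (Ident (path_cat Q) i) = Ident M (FOb X i)" if "i \<in> Ob (path_cat Q)" for i
      using that by (simp add: X_def path_Nil)
    show "FAr X w \<in> Ar M \<and> Dom M (FAr X w) = FOb X (Dom (path_cat Q) w) \<and> Cod M (FAr X w) = FOb X (Cod (path_cat Q) w)"
      if w: "w \<in> Ar (path_cat Q)" for w
      using w pe_type J.Dom_Ob[OF w] J.Cod_Ob[OF w] by (cases w) (simp add: X_def)
    show "FAr X (w \<cdot>\<^bsub>path_cat Q\<^esub> w') = FAr X w \<cdot> FAr X w'"
      if w: "w' \<in> Ar (path_cat Q)" "w \<in> Ar (path_cat Q)" "Dom (path_cat Q) w = Cod (path_cat Q) w'" for w w'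
      using w J.comp_simps(1)[OF w] pe_append by (cases w; cases w') (simp add: X_def)
  qed
  show ?thesis
  proof (rule that[OF X])
    show "FOb X i = Xo i" if "i \<in> verts Q" for i using that by (simp add: X_def)
    show "rep_arrow Q X \<alpha> = Xa \<alpha>" if "\<alpha> \<in> arcs Q" for \<alpha>
      using arc_path[OF that] Xa[OF that] by (simp add: X_def rep_arrow_def)
  qed
qed

subsection \<open>Orthogonality by recursion along the quiver\<close>

lemma Psi_E:
  assumes "X \<in> Psi Q M F" "i \<in> verts Q"
  obtains P \<pi> \<psi> k where "is_product M (out i) (\<lambda>\<alpha>. FOb X (head Q \<alpha>)) P \<pi>"
    "\<psi> \<in> Ar M" "Dom M \<psi> = FOb X i" "Cod M \<psi> = P" "\<forall>\<alpha>\<in>out i. \<pi> \<alpha> \<cdot> \<psi> = rep_arrow Q X \<alpha>"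
    "short_exact M k \<psi>" "Dom M k \<in> F"
proof -
  have "\<exists>\<psi> k. is_psi Q M X i \<psi> \<and> epic M \<psi> \<and> is_kernel M \<psi> k \<and> Dom M k \<in> F"
    using assms unfolding Psi_def by blast
  then obtain \<psi> k where p: "is_psi Q M X i \<psi>" "short_exact M k \<psi>" "Dom M k \<in> F"
    unfolding short_exact_iff_kernel by blast
  obtain P \<pi> where "is_product M (out i) (\<lambda>\<alpha>. FOb X (head Q \<alpha>)) P \<pi>" "\<psi> \<in> Hom M (FOb X i) P"
    "\<forall>\<alpha>\<in>out i. \<pi> \<alpha> \<cdot> \<psi> = rep_arrow Q X \<alpha>"
    using p(1) unfolding is_psi_def by blast
  with p(2,3) show ?thesis by (intro that) auto
qed

lemma Psi_functor: "X \<in> Psi Q M F \<Longrightarrow> is_functor (path_cat Q) M X"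
  and Psi_Ob: "X \<in> Psi Q M F \<Longrightarrow> i \<in> verts Q \<Longrightarrow> FOb X i \<in> F"
  unfolding Psi_def Rep_def by auto

lemma PsiI:
  assumes X: "is_functor (path_cat Q) M X"
    and o: "\<And>i. i \<in> verts Q \<Longrightarrow> FOb X i \<in> F"
    and p: "\<And>i. i \<in> verts Q \<Longrightarrow> \<exists>P \<pi> \<psi> k. is_product M (out i) (\<lambda>\<alpha>. FOb X (head Q \<alpha>)) P \<pi> \<and>
      \<psi> \<in> Hom M (FOb X i) P \<and> (\<forall>\<alpha>\<in>out i. \<pi> \<alpha> \<cdot> \<psi> = rep_arrow Q X \<alpha>) \<and> short_exact M k \<psi> \<and> Dom M k \<in> F"
  shows "X \<in> Psi Q M F"
proof -
  have "\<exists>\<psi> k. is_psi Q M X i \<psi> \<and> epic M \<psi> \<and> is_kernel M \<psi> k \<and> Dom M k \<in> F" if i: "i \<in> verts Q" for i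
  proof -
    obtain P \<pi> \<psi> k where "is_product M (out i) (\<lambda>\<alpha>. FOb X (head Q \<alpha>)) P \<pi>"
      "\<psi> \<in> Hom M (FOb X i) P" "\<forall>\<alpha>\<in>out i. \<pi> \<alpha> \<cdot> \<psi> = rep_arrow Q X \<alpha>" "short_exact M k \<psi>" "Dom M k \<in> F"
      using p[OF i] by blast
    then show ?thesis unfolding is_psi_def short_exact_iff_kernel by blast
  qed
  then show ?thesis unfolding Psi_def Rep_def using X o by simp
qed

lemma Rep_class_iff: "X \<in> Rep_class Q M S \<longleftrightarrow> is_functor (path_cat Q) M X \<and> (\<forall>i\<in>verts Q. FOb X i \<in> S)"
  unfolding Rep_class_def Rep_def by simp

text \<open>To extend \<open>u\<close> along \<open>f\<close>, extend it vertex by vertex: once the extension is known at all targets of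
  arrows from \<open>i\<close>, extending at \<open>i\<close> is a lifting problem against \<open>\<psi>\<close>.\<close>

lemma orth_Rep_Psi:
  assumes o: "\<And>w y. w \<in> W \<Longrightarrow> y \<in> F \<Longrightarrow> orth M w y" and X: "X \<in> Rep_class Q M W" and Y: "Y \<in> Psi Q M F"
  shows "orth FC X Y"
  unfolding orth_def
proof (intro allI impI)
  fix f g u assume a: "short_exact FC f g \<and> Cod FC g = X \<and> u \<in> Hom FC (Dom FC f) Y"
  then have fg: "short_exact FC f g" and gX: "NCod g = X" and u: "is_ntrans (path_cat Q) M u" "NDom u = NDom f" "NCod u = Y"
    by auto
  note S = FC.short_exact_simps[OF fg]
  define A B where "A = NDom f" and "B = NCod f"
  have fn: "is_ntrans (path_cat Q) M f" "NDom f = A" "NCod f = B" using S unfolding A_def B_def by auto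
  have un: "NDom u = A" using u fn by simp
  have AB: "is_functor (path_cat Q) M A" "is_functor (path_cat Q) M B" using ntrans_functors[OF fn(1)] fn by auto
  note Yf = Psi_functor[OF Y]
  have comp: "NComponent f i \<in> Ar M" "Dom M (NComponent f i) = FOb A i" "Cod M (NComponent f i) = FOb B i"
    "NComponent u i \<in> Ar M" "Dom M (NComponent u i) = FOb A i" "Cod M (NComponent u i) = FOb Y i" if "i \<in> verts Q" for i
    using ntrans_simps(1-3)[OF fn(1), of i] ntrans_simps(1-3)[OF u(1), of i] that fn u(3) un by simp_all
  \<comment> \<open>\<open>r\<close> extends \<open>u\<close> at \<open>i\<close> and is compatible with the extensions \<open>h\<close> at the targets of arrows from \<open>i\<close>.\<close>
  define good where "good h i r \<longleftrightarrow> (i \<in> verts Q \<longrightarrow> r \<in> Ar M \<and> Dom M r = FOb B i \<and> Cod M r = FOb Y i \<and>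
      r \<cdot> NComponent f i = NComponent u i \<and> (\<forall>\<alpha>\<in>out i. h (head Q \<alpha>) \<cdot> rep_arrow Q B \<alpha> = rep_arrow Q Y \<alpha> \<cdot> r))" for h i r
  have "\<exists>h. \<forall>i. good h i (h i)"
  proof (rule dependent_wf_choice[OF wfQ])
    fix h h' :: "'v \<Rightarrow> 'm" and i r assume "\<And>z. (z, i) \<in> arrow_rel Q \<Longrightarrow> h z = h' z"
    then have "\<And>\<alpha>. \<alpha> \<in> out i \<Longrightarrow> h (head Q \<alpha>) = h' (head Q \<alpha>)" unfolding arrow_rel_def by blast
    then show "good h i r = good h' i r" unfolding good_def by simp
  next
    fix i h assume IH: "\<And>j. (j, i) \<in> arrow_rel Q \<Longrightarrow> good h j (h j)"
    show "\<exists>r. good h i r"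
    proof (cases "i \<in> verts Q")
      case i: True
      have hj: "h (head Q \<alpha>) \<in> Ar M" "Dom M (h (head Q \<alpha>)) = FOb B (head Q \<alpha>)" "Cod M (h (head Q \<alpha>)) = FOb Y (head Q \<alpha>)"
        "h (head Q \<alpha>) \<cdot> NComponent f (head Q \<alpha>) = NComponent u (head Q \<alpha>)" if "\<alpha> \<in> out i" for \<alpha>
      proof -
        have "(head Q \<alpha>, i) \<in> arrow_rel Q" using that unfolding arrow_rel_def by blast
        moreover have "head Q \<alpha> \<in> verts Q" using that arc_verts by blast
        ultimately show "h (head Q \<alpha>) \<in> Ar M" "Dom M (h (head Q \<alpha>)) = FOb B (head Q \<alpha>)" "Cod M (h (head Q \<alpha>)) = FOb Y (head Q \<alpha>)"
          "h (head Q \<alpha>) \<cdot> NComponent f (head Q \<alpha>) = NComponent u (head Q \<alpha>)"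
          using IH unfolding good_def by blast+
      qed
      obtain P \<pi> \<psi> k where P: "is_product M (out i) (\<lambda>\<alpha>. FOb Y (head Q \<alpha>)) P \<pi>"
        and \<psi>: "\<psi> \<in> Ar M" "Dom M \<psi> = FOb Y i" "Cod M \<psi> = P" "\<forall>\<alpha>\<in>out i. \<pi> \<alpha> \<cdot> \<psi> = rep_arrow Q Y \<alpha>"
        and k: "short_exact M k \<psi>" "Dom M k \<in> F"
        using Y i by (rule Psi_E)
      have ar: "rep_arrow Q A \<alpha> \<in> Ar M" "Dom M (rep_arrow Q A \<alpha>) = FOb A i" "Cod M (rep_arrow Q A \<alpha>) = FOb A (head Q \<alpha>)"
        "rep_arrow Q B \<alpha> \<in> Ar M" "Dom M (rep_arrow Q B \<alpha>) = FOb B i" "Cod M (rep_arrow Q B \<alpha>) = FOb B (head Q \<alpha>)"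
        "rep_arrow Q Y \<alpha> \<in> Ar M" "Dom M (rep_arrow Q Y \<alpha>) = FOb Y i" "Cod M (rep_arrow Q Y \<alpha>) = FOb Y (head Q \<alpha>)"
        "head Q \<alpha> \<in> verts Q" if "\<alpha> \<in> out i" for \<alpha>
      proof -
        have "\<alpha> \<in> arcs Q" "tail Q \<alpha> = i" using that by auto
        then show "rep_arrow Q A \<alpha> \<in> Ar M" "Dom M (rep_arrow Q A \<alpha>) = FOb A i" "Cod M (rep_arrow Q A \<alpha>) = FOb A (head Q \<alpha>)"
        "rep_arrow Q B \<alpha> \<in> Ar M" "Dom M (rep_arrow Q B \<alpha>) = FOb B i" "Cod M (rep_arrow Q B \<alpha>) = FOb B (head Q \<alpha>)"
        "rep_arrow Q Y \<alpha> \<in> Ar M" "Dom M (rep_arrow Q Y \<alpha>) = FOb Y i" "Cod M (rep_arrow Q Y \<alpha>) = FOb Y (head Q \<alpha>)"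
        "head Q \<alpha> \<in> verts Q"
          using rep_arrow_simps[OF AB(1)] rep_arrow_simps[OF AB(2)] rep_arrow_simps[OF Yf] arc_verts(2) by simp_all
      qed
      \<comment> \<open>Compatibility with the neighbours prescribes \<open>t = \<psi> \<cdot> r\<close>.\<close>
      obtain t where t: "t \<in> Ar M" "Dom M t = FOb B i" "Cod M t = P" "\<And>\<alpha>. \<alpha> \<in> out i \<Longrightarrow> \<pi> \<alpha> \<cdot> t = h (head Q \<alpha>) \<cdot> rep_arrow Q B \<alpha>"
        by (rule product_factor[OF P, of "FOb B i" "\<lambda>\<alpha>. h (head Q \<alpha>) \<cdot> rep_arrow Q B \<alpha>"])
          (use ar hj functor_simps(1)[OF AB(2), of i] i in auto)
      note ci = comp[OF i]
      have sq: "\<psi> \<cdot> NComponent u i = t \<cdot> NComponent f i"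
      proof (rule product_unique[OF P])
        fix \<alpha> assume \<alpha>: "\<alpha> \<in> out i"
        note cj = comp[OF ar(10)[OF \<alpha>]] and tt = ar(1-9)[OF \<alpha>] hj(1-3)[OF \<alpha>] is_productD(2-4)[OF P \<alpha>]
        have aQ: "\<alpha> \<in> arcs Q" "tail Q \<alpha> = i" using \<alpha> by auto
        have "\<pi> \<alpha> \<cdot> (\<psi> \<cdot> NComponent u i) = rep_arrow Q Y \<alpha> \<cdot> NComponent u i"
          by (rule comp_ext[OF \<psi>(4)[rule_format, OF \<alpha>]]) (use tt \<psi>(1-3) ci in auto)
        also have "\<dots> = NComponent u (head Q \<alpha>) \<cdot> rep_arrow Q A \<alpha>"
          using ntrans_arrow[OF u(1) aQ(1)] un u(3) aQ by simp
        also have "\<dots> = h (head Q \<alpha>) \<cdot> (NComponent f (head Q \<alpha>) \<cdot> rep_arrow Q A \<alpha>)"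
          by (rule comp_ext[OF hj(4)[OF \<alpha>], symmetric]) (use tt cj in auto)
        also have "\<dots> = h (head Q \<alpha>) \<cdot> (rep_arrow Q B \<alpha> \<cdot> NComponent f i)"
          using ntrans_arrow[OF fn(1) aQ(1)] fn aQ by simp
        also have "\<dots> = \<pi> \<alpha> \<cdot> (t \<cdot> NComponent f i)"
          by (rule comp_ext2[OF t(4)[OF \<alpha>, symmetric]]) (use tt t(1-3) ci in auto)
        finally show "\<pi> \<alpha> \<cdot> (\<psi> \<cdot> NComponent u i) = \<pi> \<alpha> \<cdot> (t \<cdot> NComponent f i)" .
      qed (use ci \<psi>(1-3) t(1-3) in auto)
      have fgi: "short_exact M (NComponent f i) (NComponent g i)" using short_exact_pointwise[OF fg] i by simp
      have gi: "Cod M (NComponent g i) = FOb X i" using ntrans_simps(3)[of g i] S gX i by simp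
      have "orth M (Cod M (NComponent g i)) (Dom M k)"
        using o[of "FOb X i" "Dom M k"] X i k(2) gi unfolding Rep_class_iff by simp
      then have l: "lifts M (NComponent f i) \<psi>" by (rule orth_lifts[OF fgi k(1)])
      obtain r where r: "r \<in> Ar M" "Dom M r = Cod M (NComponent f i)" "Cod M r = Dom M \<psi>" "r \<cdot> NComponent f i = NComponent u i" "\<psi> \<cdot> r = t"
        by (rule liftsE[OF l, of "NComponent u i" t]) (use ci \<psi>(1-3) t(1-3) sq in auto)
      have "h (head Q \<alpha>) \<cdot> rep_arrow Q B \<alpha> = rep_arrow Q Y \<alpha> \<cdot> r" if \<alpha>: "\<alpha> \<in> out i" for \<alpha>
      proof -
        have "\<pi> \<alpha> \<cdot> (\<psi> \<cdot> r) = rep_arrow Q Y \<alpha> \<cdot> r"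
          by (rule comp_ext[OF \<psi>(4)[rule_format, OF \<alpha>]]) (use is_productD(2-4)[OF P \<alpha>] \<psi>(1-3) r(1-3) in auto)
        then show ?thesis unfolding r(5) t(4)[OF \<alpha>] .
      qed
      then have "good h i r" unfolding good_def using r(1-4) ci(3) \<psi>(2) by simp
      then show ?thesis ..
    qed (simp add: good_def)
  qed
  then obtain h where h: "\<And>i. good h i (h i)" by blast
  have h': "h i \<in> Ar M \<and> Dom M (h i) = FOb B i \<and> Cod M (h i) = FOb Y i" "h i \<cdot> NComponent f i = NComponent u i" if "i \<in> verts Q" for i
    using h[of i] that unfolding good_def by blast+
  have nt: "is_ntrans (path_cat Q) M (mk_ntrans B Y h)"
  proof (rule rep_homI[OF AB(2) Yf h'(1)])
    show "h (head Q \<alpha>) \<cdot> rep_arrow Q B \<alpha> = rep_arrow Q Y \<alpha> \<cdot> h (tail Q \<alpha>)" if "\<alpha> \<in> arcs Q" for \<alpha>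
      using h[of "tail Q \<alpha>"] arc_verts(1)[OF that] that unfolding good_def by blast
  qed
  have "mk_ntrans B Y h \<cdot>\<^bsub>FC\<^esub> f = u"
    by (rule ntrans_eqI) (use nt fn u un h'(2) in \<open>auto intro: Comp_ntrans\<close>)
  then show "\<exists>v. v \<in> Hom FC (Cod FC f) Y \<and> v \<cdot>\<^bsub>FC\<^esub> f = u"
    using nt fn by (intro exI[of _ "mk_ntrans B Y h"]) simp
qed

text \<open>A retraction of \<open>Z\<close> onto \<open>Y\<close> induces one of the products over the outgoing arrows, given by \<open>\<iota>\<close> and \<open>\<sigma>\<close>
  below. So the map \<open>\<phi>\<close> of \<open>Y\<close> is a retract of the map \<open>\<psi>\<close> of \<open>Z\<close>, and so is its kernel.\<close>

lemma Psi_retract_closed: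
  assumes rF: "\<And>a b. b \<in> F \<Longrightarrow> obj_retract M a b \<Longrightarrow> a \<in> F"
  shows "retract_closed_class FC (Psi Q M F)"
  unfolding retract_closed_class_def
proof (intro allI impI)
  fix Y Z assume a: "Z \<in> Psi Q M F \<and> obj_retract FC Y Z"
  then have Z: "Z \<in> Psi Q M F" and YZ: "obj_retract FC Y Z" by auto
  obtain e r where "e \<in> Ar FC" "Dom FC e = Y" "Cod FC e = Z" "r \<in> Ar FC" "Dom FC r = Z" "Cod FC r = Y"
    "r \<cdot>\<^bsub>FC\<^esub> e = Ident FC Y" using YZ by (rule FC.obj_retractE)
  then have n: "is_ntrans (path_cat Q) M e" "NDom e = Y" "NCod e = Z" "is_ntrans (path_cat Q) M r" "NDom r = Z" "NCod r = Y"
    and re: "r \<cdot>\<^bsub>FC\<^esub> e = Ident FC Y" by auto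
  have Yf: "is_functor (path_cat Q) M Y" and Zf: "is_functor (path_cat Q) M Z" using ntrans_functors[OF n(1)] n by auto
  have rei: "NComponent r i \<cdot> NComponent e i = Ident M (FOb Y i)" if "i \<in> verts Q" for i
  proof -
    have "NComponent (r \<cdot>\<^bsub>FC\<^esub> e) i = NComponent (Ident FC Y) i" using re by simp
    then show ?thesis using that by simp
  qed
  have comp: "NComponent e i \<in> Ar M" "Dom M (NComponent e i) = FOb Y i" "Cod M (NComponent e i) = FOb Z i"
    "NComponent r i \<in> Ar M" "Dom M (NComponent r i) = FOb Z i" "Cod M (NComponent r i) = FOb Y i" if "i \<in> verts Q" for i
    using ntrans_simps(1-3)[OF n(1), of i] ntrans_simps(1-3)[OF n(4), of i] that n by simp_all
  show "Y \<in> Psi Q M F"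
  proof (rule PsiI[OF Yf])
    fix i assume i: "i \<in> verts Q"
    show "FOb Y i \<in> F" by (rule rF[OF Psi_Ob[OF Z i]]) (use obj_retract_pointwise[OF YZ] i in simp)
    obtain P \<pi> \<psi> k where P: "is_product M (out i) (\<lambda>\<alpha>. FOb Z (head Q \<alpha>)) P \<pi>"
      and \<psi>: "\<psi> \<in> Ar M" "Dom M \<psi> = FOb Z i" "Cod M \<psi> = P" "\<forall>\<alpha>\<in>out i. \<pi> \<alpha> \<cdot> \<psi> = rep_arrow Q Z \<alpha>"
      and k: "short_exact M k \<psi>" "Dom M k \<in> F" using Z i by (rule Psi_E)
    note K = short_exact_simps[OF k(1)]
    have hv: "head Q \<alpha> \<in> verts Q" "\<alpha> \<in> arcs Q" "tail Q \<alpha> = i" if "\<alpha> \<in> out i" for \<alpha> using that arc_verts by auto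
    have YO: "FOb Y (head Q \<alpha>) \<in> Ob M" if "\<alpha> \<in> out i" for \<alpha> using functor_simps(1)[OF Yf] hv[OF that] by simp
    have "\<exists>N \<rho>. is_product M (out i) (\<lambda>\<alpha>. FOb Y (head Q \<alpha>)) N \<rho>"
      by (rule prod_ex[OF _ YO]) auto
    then obtain N \<rho> where N: "is_product M (out i) (\<lambda>\<alpha>. FOb Y (head Q \<alpha>)) N \<rho>" by blast
    note ci = comp[OF i] and cj = comp[OF hv(1)] and pd = is_productD[OF P] and nd = is_productD[OF N]
    note ya = rep_arrow_simps[OF Yf hv(2)] and za = rep_arrow_simps[OF Zf hv(2)]
    obtain \<phi> where \<phi>: "\<phi> \<in> Ar M" "Dom M \<phi> = FOb Y i" "Cod M \<phi> = N" "\<And>\<alpha>. \<alpha> \<in> out i \<Longrightarrow> \<rho> \<alpha> \<cdot> \<phi> = rep_arrow Q Y \<alpha>"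
    proof (rule product_factor[OF N, of "FOb Y i" "rep_arrow Q Y"])
      show "FOb Y i \<in> Ob M" using functor_simps(1)[OF Yf] i by simp
      show "rep_arrow Q Y \<alpha> \<in> Ar M \<and> Dom M (rep_arrow Q Y \<alpha>) = FOb Y i \<and> Cod M (rep_arrow Q Y \<alpha>) = FOb Y (head Q \<alpha>)"
        if "\<alpha> \<in> out i" for \<alpha> using ya[OF that] hv[OF that] by simp
    qed blast
    obtain \<iota> where \<iota>: "\<iota> \<in> Ar M" "Dom M \<iota> = N" "Cod M \<iota> = P" "\<And>\<alpha>. \<alpha> \<in> out i \<Longrightarrow> \<pi> \<alpha> \<cdot> \<iota> = NComponent e (head Q \<alpha>) \<cdot> \<rho> \<alpha>"
    proof (rule product_factor[OF P nd(1), of "\<lambda>\<alpha>. NComponent e (head Q \<alpha>) \<cdot> \<rho> \<alpha>"])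
      show "NComponent e (head Q \<alpha>) \<cdot> \<rho> \<alpha> \<in> Ar M \<and> Dom M (NComponent e (head Q \<alpha>) \<cdot> \<rho> \<alpha>) = N \<and>
          Cod M (NComponent e (head Q \<alpha>) \<cdot> \<rho> \<alpha>) = FOb Z (head Q \<alpha>)" if "\<alpha> \<in> out i" for \<alpha>
        using cj[OF that] nd(2-4)[OF that] by simp
    qed blast
    obtain \<sigma> where \<sigma>: "\<sigma> \<in> Ar M" "Dom M \<sigma> = P" "Cod M \<sigma> = N" "\<And>\<alpha>. \<alpha> \<in> out i \<Longrightarrow> \<rho> \<alpha> \<cdot> \<sigma> = NComponent r (head Q \<alpha>) \<cdot> \<pi> \<alpha>"
    proof (rule product_factor[OF N pd(1), of "\<lambda>\<alpha>. NComponent r (head Q \<alpha>) \<cdot> \<pi> \<alpha>"])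
      show "NComponent r (head Q \<alpha>) \<cdot> \<pi> \<alpha> \<in> Ar M \<and> Dom M (NComponent r (head Q \<alpha>) \<cdot> \<pi> \<alpha>) = P \<and>
          Cod M (NComponent r (head Q \<alpha>) \<cdot> \<pi> \<alpha>) = FOb Y (head Q \<alpha>)" if "\<alpha> \<in> out i" for \<alpha>
        using cj[OF that] pd(2-4)[OF that] by simp
    qed blast
    have NO: "N \<in> Ob M" by (rule nd(1))
    have si: "\<sigma> \<cdot> \<iota> = Ident M N"
    proof (rule product_unique[OF N])
      fix \<alpha> assume \<alpha>: "\<alpha> \<in> out i"
      have "\<rho> \<alpha> \<cdot> (\<sigma> \<cdot> \<iota>) = NComponent r (head Q \<alpha>) \<cdot> (\<pi> \<alpha> \<cdot> \<iota>)"
        by (rule comp_ext2[OF \<sigma>(4)[OF \<alpha>]]) (use cj[OF \<alpha>] pd(2-4)[OF \<alpha>] nd(2-4)[OF \<alpha>] \<sigma>(1-3) \<iota>(1-3) in auto)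
      also have "\<dots> = NComponent r (head Q \<alpha>) \<cdot> (NComponent e (head Q \<alpha>) \<cdot> \<rho> \<alpha>)" unfolding \<iota>(4)[OF \<alpha>] ..
      also have "\<dots> = Ident M (FOb Y (head Q \<alpha>)) \<cdot> \<rho> \<alpha>"
        by (rule comp_ext[OF rei[OF hv(1)[OF \<alpha>]]]) (use cj[OF \<alpha>] nd(2-4)[OF \<alpha>] in auto)
      finally show "\<rho> \<alpha> \<cdot> (\<sigma> \<cdot> \<iota>) = \<rho> \<alpha> \<cdot> Ident M N" using nd(2-4)[OF \<alpha>] by simp
    qed (use \<sigma>(1-3) \<iota>(1-3) NO in auto)
    have sq1: "\<phi> \<cdot> NComponent r i = \<sigma> \<cdot> \<psi>"
    proof (rule product_unique[OF N])
      fix \<alpha> assume \<alpha>: "\<alpha> \<in> out i"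
      note tt = cj[OF \<alpha>] pd(2-4)[OF \<alpha>] nd(2-4)[OF \<alpha>] ya[OF \<alpha>] za[OF \<alpha>] hv[OF \<alpha>]
      have "\<rho> \<alpha> \<cdot> (\<phi> \<cdot> NComponent r i) = rep_arrow Q Y \<alpha> \<cdot> NComponent r i"
        by (rule comp_ext[OF \<phi>(4)[OF \<alpha>]]) (use tt \<phi>(1-3) ci in auto)
      also have "\<dots> = NComponent r (head Q \<alpha>) \<cdot> (\<pi> \<alpha> \<cdot> \<psi>)"
        using ntrans_arrow[OF n(4) hv(2)[OF \<alpha>]] n hv(3)[OF \<alpha>] \<psi>(4)[rule_format, OF \<alpha>] by simp
      also have "\<dots> = \<rho> \<alpha> \<cdot> (\<sigma> \<cdot> \<psi>)"
        by (rule comp_ext2[OF \<sigma>(4)[OF \<alpha>], symmetric]) (use tt \<sigma>(1-3) \<psi>(1-3) in auto)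
      finally show "\<rho> \<alpha> \<cdot> (\<phi> \<cdot> NComponent r i) = \<rho> \<alpha> \<cdot> (\<sigma> \<cdot> \<psi>)" .
    qed (use \<sigma>(1-3) \<phi>(1-3) \<psi>(1-3) ci in auto)
    have sq2: "\<psi> \<cdot> NComponent e i = \<iota> \<cdot> \<phi>"
    proof (rule product_unique[OF P])
      fix \<alpha> assume \<alpha>: "\<alpha> \<in> out i"
      note tt = cj[OF \<alpha>] pd(2-4)[OF \<alpha>] nd(2-4)[OF \<alpha>] ya[OF \<alpha>] za[OF \<alpha>] hv[OF \<alpha>]
      have "\<pi> \<alpha> \<cdot> (\<psi> \<cdot> NComponent e i) = rep_arrow Q Z \<alpha> \<cdot> NComponent e i"
        by (rule comp_ext[OF \<psi>(4)[rule_format, OF \<alpha>]]) (use tt \<psi>(1-3) ci in auto)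
      also have "\<dots> = NComponent e (head Q \<alpha>) \<cdot> (\<rho> \<alpha> \<cdot> \<phi>)"
        using ntrans_arrow[OF n(1) hv(2)[OF \<alpha>]] n hv(3)[OF \<alpha>] \<phi>(4)[OF \<alpha>] by simp
      also have "\<dots> = \<pi> \<alpha> \<cdot> (\<iota> \<cdot> \<phi>)"
        by (rule comp_ext2[OF \<iota>(4)[OF \<alpha>], symmetric]) (use tt \<iota>(1-3) \<phi>(1-3) in auto)
      finally show "\<pi> \<alpha> \<cdot> (\<psi> \<cdot> NComponent e i) = \<pi> \<alpha> \<cdot> (\<iota> \<cdot> \<phi>)" .
    qed (use \<iota>(1-3) \<phi>(1-3) \<psi>(1-3) ci in auto)
    have es: "epic M \<sigma>" by (rule split_epic[of _ \<iota>]) (use si \<sigma>(1-3) \<iota>(1-3) in auto)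
    have "epic M (\<sigma> \<cdot> \<psi>)" by (rule epic_comp) (use es K(6) \<sigma>(1-3) \<psi>(1-3) in auto)
    then have "epic M (\<phi> \<cdot> NComponent r i)" unfolding sq1 .
    then have ep: "epic M \<phi>" by (rule epic_cancel) (use \<phi>(1-3) ci in auto)
    obtain l where l: "is_kernel M \<phi> l" using ex_kernel[OF \<phi>(1)] by blast
    note L = is_kernel_simps[OF l]
    have "obj_retract M (Dom M l) (Dom M k)"
    proof (rule kernel_retract[OF l K(7)])
      show "NComponent e i \<in> Ar M" "Dom M (NComponent e i) = Dom M \<phi>" "Cod M (NComponent e i) = Dom M \<psi>"
        "NComponent r i \<in> Ar M" "Dom M (NComponent r i) = Dom M \<psi>" "Cod M (NComponent r i) = Dom M \<phi>"
        "NComponent r i \<cdot> NComponent e i = Ident M (Dom M \<phi>)"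
        using ci rei[OF i] \<phi>(2) \<psi>(2) by simp_all
      have "\<psi> \<cdot> (NComponent e i \<cdot> l) = \<iota> \<cdot> (\<phi> \<cdot> l)"
        by (rule comp_ext2[OF sq2]) (use \<iota>(1-3) \<phi>(1-3) \<psi>(1-3) ci L in auto)
      then show "\<psi> \<cdot> (NComponent e i \<cdot> l) = zer (Dom M l) (Cod M \<psi>)" using L(2,4) \<iota>(1-3) \<phi>(3) \<psi>(3) by simp
      have "\<phi> \<cdot> (NComponent r i \<cdot> k) = \<sigma> \<cdot> (\<psi> \<cdot> k)"
        by (rule comp_ext2[OF sq1]) (use \<sigma>(1-3) \<phi>(1-3) \<psi>(1-3) ci K in auto)
      then show "\<phi> \<cdot> (NComponent r i \<cdot> k) = zer (Dom M k) (Cod M \<phi>)" using K(1,4) \<sigma>(1-3) \<phi>(3) \<psi>(3) by simp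
    qed
    then have lF: "Dom M l \<in> F" using rF k(2) by blast
    have "short_exact M l \<phi>" unfolding short_exact_iff_kernel using l ep by simp
    then show "\<exists>P \<pi> \<psi> k. is_product M (out i) (\<lambda>\<alpha>. FOb Y (head Q \<alpha>)) P \<pi> \<and>
      \<psi> \<in> Hom M (FOb Y i) P \<and> (\<forall>\<alpha>\<in>out i. \<pi> \<alpha> \<cdot> \<psi> = rep_arrow Q Y \<alpha>) \<and> short_exact M k \<psi> \<and> Dom M k \<in> F"
      using N \<phi> lF by (intro exI[of _ N] exI[of _ \<rho>] exI[of _ \<phi>] exI[of _ l]) simp
  qed
qed

end


section \<open>Factorisation of morphisms of representations\<close>

text \<open>The limit of the diagram formed by \<open>\<beta> \<alpha> : B \<rightarrow> Cod (q \<alpha>)\<close> and \<open>q \<alpha> : Dom (q \<alpha>) \<rightarrow> Cod (q \<alpha>)\<close> for all \<open>\<alpha> \<in> I\<close>.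
  For a natural transformation \<open>q\<close> of representations and \<open>I\<close> the arrows leaving a vertex \<open>i\<close>, it is the
  universal object over \<open>B\<close> with compatible arrows to the values of the source of \<open>q\<close> at the targets.\<close>

definition is_wide_pullback ::
    "('o, 'm) cat \<Rightarrow> 'i set \<Rightarrow> 'o \<Rightarrow> ('i \<Rightarrow> 'm) \<Rightarrow> ('i \<Rightarrow> 'm) \<Rightarrow> 'm \<Rightarrow> ('i \<Rightarrow> 'm) \<Rightarrow> bool" where
  "is_wide_pullback C I B q \<beta> b t \<longleftrightarrow>
     b \<in> Ar C \<and> Cod C b = B \<and>
     (\<forall>\<alpha>\<in>I. t \<alpha> \<in> Ar C \<and> Dom C (t \<alpha>) = Dom C b \<and> Cod C (t \<alpha>) = Dom C (q \<alpha>) \<and>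
        q \<alpha> \<cdot>\<^bsub>C\<^esub> t \<alpha> = \<beta> \<alpha> \<cdot>\<^bsub>C\<^esub> b) \<and>
     (\<forall>x y. x \<in> Ar C \<and> Cod C x = B \<and>
        (\<forall>\<alpha>\<in>I. y \<alpha> \<in> Ar C \<and> Dom C (y \<alpha>) = Dom C x \<and> Cod C (y \<alpha>) = Dom C (q \<alpha>) \<and>
           q \<alpha> \<cdot>\<^bsub>C\<^esub> y \<alpha> = \<beta> \<alpha> \<cdot>\<^bsub>C\<^esub> x) \<longrightarrow>
        (\<exists>u. u \<in> Ar C \<and> Dom C u = Dom C x \<and> Cod C u = Dom C b \<and> b \<cdot>\<^bsub>C\<^esub> u = x \<and>
           (\<forall>\<alpha>\<in>I. t \<alpha> \<cdot>\<^bsub>C\<^esub> u = y \<alpha>))) \<and>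
     (\<forall>u v. u \<in> Ar C \<and> v \<in> Ar C \<and> Dom C u = Dom C v \<and> Cod C u = Dom C b \<and> Cod C v = Dom C b \<and>
        b \<cdot>\<^bsub>C\<^esub> u = b \<cdot>\<^bsub>C\<^esub> v \<and> (\<forall>\<alpha>\<in>I. t \<alpha> \<cdot>\<^bsub>C\<^esub> u = t \<alpha> \<cdot>\<^bsub>C\<^esub> v) \<longrightarrow> u = v)"

lemma is_wide_pullback_simps:
  assumes "is_wide_pullback C I B q \<beta> b t"
  shows "b \<in> Ar C" "Cod C b = B" "\<alpha> \<in> I \<Longrightarrow> t \<alpha> \<in> Ar C" "\<alpha> \<in> I \<Longrightarrow> Dom C (t \<alpha>) = Dom C b"
    "\<alpha> \<in> I \<Longrightarrow> Cod C (t \<alpha>) = Dom C (q \<alpha>)" "\<alpha> \<in> I \<Longrightarrow> q \<alpha> \<cdot>\<^bsub>C\<^esub> t \<alpha> = \<beta> \<alpha> \<cdot>\<^bsub>C\<^esub> b"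
  using assms unfolding is_wide_pullback_def by simp_all

lemma wide_pullback_factor:
  assumes "is_wide_pullback C I B q \<beta> b t" "x \<in> Ar C" "Cod C x = B"
    and "\<And>\<alpha>. \<alpha> \<in> I \<Longrightarrow> y \<alpha> \<in> Ar C \<and> Dom C (y \<alpha>) = Dom C x \<and> Cod C (y \<alpha>) = Dom C (q \<alpha>) \<and>
      q \<alpha> \<cdot>\<^bsub>C\<^esub> y \<alpha> = \<beta> \<alpha> \<cdot>\<^bsub>C\<^esub> x"
  obtains u where "u \<in> Ar C" "Dom C u = Dom C x" "Cod C u = Dom C b" "b \<cdot>\<^bsub>C\<^esub> u = x"
    "\<forall>\<alpha>\<in>I. t \<alpha> \<cdot>\<^bsub>C\<^esub> u = y \<alpha>"
proof -
  have "\<forall>\<alpha>\<in>I. y \<alpha> \<in> Ar C \<and> Dom C (y \<alpha>) = Dom C x \<and> Cod C (y \<alpha>) = Dom C (q \<alpha>) \<and> q \<alpha> \<cdot>\<^bsub>C\<^esub> y \<alpha> = \<beta> \<alpha> \<cdot>\<^bsub>C\<^esub> x"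
    using assms(4) by (rule ballI)
  then have "\<exists>u. u \<in> Ar C \<and> Dom C u = Dom C x \<and> Cod C u = Dom C b \<and> b \<cdot>\<^bsub>C\<^esub> u = x \<and> (\<forall>\<alpha>\<in>I. t \<alpha> \<cdot>\<^bsub>C\<^esub> u = y \<alpha>)"
    using assms(1-3) unfolding is_wide_pullback_def
    by (elim conjE) (drule spec, drule spec, erule mp, intro conjI)
  then show ?thesis using that by blast
qed

lemma wide_pullback_unique:
  assumes "is_wide_pullback C I B q \<beta> b t" "u \<in> Ar C" "v \<in> Ar C" "Dom C u = Dom C v" "Cod C u = Dom C b"
    "Cod C v = Dom C b" "b \<cdot>\<^bsub>C\<^esub> u = b \<cdot>\<^bsub>C\<^esub> v" "\<And>\<alpha>. \<alpha> \<in> I \<Longrightarrow> t \<alpha> \<cdot>\<^bsub>C\<^esub> u = t \<alpha> \<cdot>\<^bsub>C\<^esub> v"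
  shows "u = v"
proof -
  have "\<forall>\<alpha>\<in>I. t \<alpha> \<cdot>\<^bsub>C\<^esub> u = t \<alpha> \<cdot>\<^bsub>C\<^esub> v" using assms(8) by (rule ballI)
  then show ?thesis using assms(1-7) unfolding is_wide_pullback_def
    by (elim conjE) (drule spec, drule spec, erule mp, intro conjI)
qed

context quiver_reps
begin

text \<open>It is the pullback of the product of the \<open>q \<alpha>\<close> along the arrow with components \<open>\<beta> \<alpha>\<close>. The product of the
  epimorphisms \<open>q \<alpha>\<close> is an epimorphism, hence so is \<open>b\<close>.\<close>

lemma ex_wide_pullback:
  assumes I: "I \<subseteq> arcs Q" and B: "B \<in> Ob M" and q: "\<And>\<alpha>. \<alpha> \<in> I \<Longrightarrow> epic M (q \<alpha>)"
    and \<beta>: "\<And>\<alpha>. \<alpha> \<in> I \<Longrightarrow> \<beta> \<alpha> \<in> Ar M \<and> Dom M (\<beta> \<alpha>) = B \<and> Cod M (\<beta> \<alpha>) = Cod M (q \<alpha>)"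
  shows "\<exists>b t. is_wide_pullback M I B q \<beta> b t \<and> epic M b"
proof -
  have qa: "q \<alpha> \<in> Ar M" if "\<alpha> \<in> I" for \<alpha> using epic_Ar[OF q[OF that]] .
  have ba: "\<beta> \<alpha> \<in> Ar M" "Dom M (\<beta> \<alpha>) = B" "Cod M (\<beta> \<alpha>) = Cod M (q \<alpha>)" if "\<alpha> \<in> I" for \<alpha> using \<beta>[OF that] by auto
  have "\<exists>P \<pi>. is_product M I (\<lambda>\<alpha>. Dom M (q \<alpha>)) P \<pi>" by (rule prod_ex[OF I]) (use qa in auto)
  then obtain PC \<pi> where PC: "is_product M I (\<lambda>\<alpha>. Dom M (q \<alpha>)) PC \<pi>" by blast
  have "\<exists>P \<pi>. is_product M I (\<lambda>\<alpha>. Cod M (q \<alpha>)) P \<pi>" by (rule prod_ex[OF I]) (use qa in auto)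
  then obtain PB \<rho> where PB: "is_product M I (\<lambda>\<alpha>. Cod M (q \<alpha>)) PB \<rho>" by blast
  note c = is_productD[OF PC] and d = is_productD[OF PB]
  obtain \<theta> where th: "\<theta> \<in> Ar M" "Dom M \<theta> = PC" "Cod M \<theta> = PB" "\<And>\<alpha>. \<alpha> \<in> I \<Longrightarrow> \<rho> \<alpha> \<cdot> \<theta> = q \<alpha> \<cdot> \<pi> \<alpha>"
  proof (rule product_factor[OF PB c(1), of "\<lambda>\<alpha>. q \<alpha> \<cdot> \<pi> \<alpha>"])
    show "q \<alpha> \<cdot> \<pi> \<alpha> \<in> Ar M \<and> Dom M (q \<alpha> \<cdot> \<pi> \<alpha>) = PC \<and> Cod M (q \<alpha> \<cdot> \<pi> \<alpha>) = Cod M (q \<alpha>)" if "\<alpha> \<in> I" for \<alpha>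
      using qa[OF that] c(2-4)[OF that] by simp
  qed blast
  have eth: "epic M \<theta>"
  proof (rule prod_epic[OF I PC PB, of q])
    show "q \<alpha> \<in> Hom M (Dom M (q \<alpha>)) (Cod M (q \<alpha>)) \<and> epic M (q \<alpha>)" if "\<alpha> \<in> I" for \<alpha> using q[OF that] qa[OF that] by simp
    show "\<theta> \<in> Hom M PC PB" using th by simp
  qed (rule th(4))
  obtain \<gamma> where ga: "\<gamma> \<in> Ar M" "Dom M \<gamma> = B" "Cod M \<gamma> = PB" "\<And>\<alpha>. \<alpha> \<in> I \<Longrightarrow> \<rho> \<alpha> \<cdot> \<gamma> = \<beta> \<alpha>"
    by (rule product_factor[OF PB B, of \<beta>]) (use \<beta> in blast)+
  obtain p b where pb: "is_pullback M \<theta> \<gamma> p b" "epic M b"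
    using ex_pullback[OF th(1) ga(1)] th(3) ga(3) eth by auto
  note P = is_pullback_simps[OF pb(1), unfolded th(2) ga(2)]
  define t where "t \<alpha> = \<pi> \<alpha> \<cdot> p" for \<alpha>
  have ta: "t \<alpha> \<in> Ar M" "Dom M (t \<alpha>) = Dom M b" "Cod M (t \<alpha>) = Dom M (q \<alpha>)" "q \<alpha> \<cdot> t \<alpha> = \<beta> \<alpha> \<cdot> b" if \<alpha>: "\<alpha> \<in> I" for \<alpha>
  proof -
    note tt = qa[OF \<alpha>] c(2-4)[OF \<alpha>] d(2-4)[OF \<alpha>] ba[OF \<alpha>]
    show "t \<alpha> \<in> Ar M" "Dom M (t \<alpha>) = Dom M b" "Cod M (t \<alpha>) = Dom M (q \<alpha>)" unfolding t_def using tt P by simp_all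
    have "q \<alpha> \<cdot> (\<pi> \<alpha> \<cdot> p) = \<rho> \<alpha> \<cdot> (\<theta> \<cdot> p)"
      by (rule comp_ext2[OF th(4)[OF \<alpha>], symmetric]) (use tt P th(1-3) in auto)
    also have "\<dots> = \<rho> \<alpha> \<cdot> (\<gamma> \<cdot> b)" unfolding P(9) ..
    also have "\<dots> = \<beta> \<alpha> \<cdot> b" by (rule comp_ext[OF ga(4)[OF \<alpha>]]) (use tt P ga(1-3) in auto)
    finally show "q \<alpha> \<cdot> t \<alpha> = \<beta> \<alpha> \<cdot> b" unfolding t_def .
  qed
  have tu: "t \<alpha> \<cdot> u = \<pi> \<alpha> \<cdot> (p \<cdot> u)" if "\<alpha> \<in> I" "u \<in> Ar M" "Cod M u = Dom M b" for \<alpha> u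
    unfolding t_def by (rule comp_assoc) (use c(2-4)[OF that(1)] P that in auto)
  have "is_wide_pullback M I B q \<beta> b t"
    unfolding is_wide_pullback_def
  proof (intro conjI allI impI ballI)
    show "b \<in> Ar M" "Cod M b = B" using P by auto
    show "t \<alpha> \<in> Ar M" "Dom M (t \<alpha>) = Dom M b" "Cod M (t \<alpha>) = Dom M (q \<alpha>)" "q \<alpha> \<cdot> t \<alpha> = \<beta> \<alpha> \<cdot> b" if "\<alpha> \<in> I" for \<alpha>
      using ta[OF that] by auto
  next
    fix x y assume a: "x \<in> Ar M \<and> Cod M x = B \<and> (\<forall>\<alpha>\<in>I. y \<alpha> \<in> Ar M \<and> Dom M (y \<alpha>) = Dom M x \<and> Cod M (y \<alpha>) = Dom M (q \<alpha>) \<and>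
           q \<alpha> \<cdot> y \<alpha> = \<beta> \<alpha> \<cdot> x)"
    then have x: "x \<in> Ar M" "Cod M x = B" "Dom M x \<in> Ob M" by auto
    have y: "y \<alpha> \<in> Ar M" "Dom M (y \<alpha>) = Dom M x" "Cod M (y \<alpha>) = Dom M (q \<alpha>)" "q \<alpha> \<cdot> y \<alpha> = \<beta> \<alpha> \<cdot> x" if "\<alpha> \<in> I" for \<alpha>
      using a that by blast+
    obtain y' where y': "y' \<in> Ar M" "Dom M y' = Dom M x" "Cod M y' = PC" "\<And>\<alpha>. \<alpha> \<in> I \<Longrightarrow> \<pi> \<alpha> \<cdot> y' = y \<alpha>"
      by (rule product_factor[OF PC x(3), of y]) (use y in blast)+
    have "\<theta> \<cdot> y' = \<gamma> \<cdot> x"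
    proof (rule product_unique[OF PB])
      fix \<alpha> assume \<alpha>: "\<alpha> \<in> I"
      note tt = qa[OF \<alpha>] c(2-4)[OF \<alpha>] d(2-4)[OF \<alpha>] ba[OF \<alpha>]
      have "\<rho> \<alpha> \<cdot> (\<theta> \<cdot> y') = q \<alpha> \<cdot> (\<pi> \<alpha> \<cdot> y')" by (rule comp_ext2[OF th(4)[OF \<alpha>]]) (use tt th(1-3) y'(1-3) in auto)
      also have "\<dots> = \<beta> \<alpha> \<cdot> x" unfolding y'(4)[OF \<alpha>] y(4)[OF \<alpha>] ..
      also have "\<dots> = \<rho> \<alpha> \<cdot> (\<gamma> \<cdot> x)" by (rule comp_ext[OF ga(4)[OF \<alpha>], symmetric]) (use tt x ga(1-3) in auto)
      finally show "\<rho> \<alpha> \<cdot> (\<theta> \<cdot> y') = \<rho> \<alpha> \<cdot> (\<gamma> \<cdot> x)" .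
    qed (use th(1-3) ga(1-3) y'(1-3) x in auto)
    then obtain u where u: "u \<in> Ar M" "Dom M u = Dom M y'" "Cod M u = Dom M p" "p \<cdot> u = y'" "b \<cdot> u = x"
      using pullback_factor[OF pb(1) y'(1) x(1)] y'(2,3) x(2) th(2) ga(2) by metis
    have "\<forall>\<alpha>\<in>I. t \<alpha> \<cdot> u = y \<alpha>" using tu[OF _ u(1)] u(3,4) P(6) y'(4) by simp
    then show "\<exists>u. u \<in> Ar M \<and> Dom M u = Dom M x \<and> Cod M u = Dom M b \<and> b \<cdot> u = x \<and> (\<forall>\<alpha>\<in>I. t \<alpha> \<cdot> u = y \<alpha>)"
      using u(1,2,3,5) y'(2) P(6) by (intro exI[of _ u]) simp
  next
    fix u v assume a: "u \<in> Ar M \<and> v \<in> Ar M \<and> Dom M u = Dom M v \<and> Cod M u = Dom M b \<and> Cod M v = Dom M b \<and>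
        b \<cdot> u = b \<cdot> v \<and> (\<forall>\<alpha>\<in>I. t \<alpha> \<cdot> u = t \<alpha> \<cdot> v)"
    then have uv: "u \<in> Ar M" "v \<in> Ar M" "Dom M u = Dom M v" "Cod M u = Dom M b" "Cod M v = Dom M b"
      and e: "b \<cdot> u = b \<cdot> v" "\<forall>\<alpha>\<in>I. t \<alpha> \<cdot> u = t \<alpha> \<cdot> v" by blast+
    have "p \<cdot> u = p \<cdot> v"
    proof (rule product_unique[OF PC])
      show "\<pi> \<alpha> \<cdot> (p \<cdot> u) = \<pi> \<alpha> \<cdot> (p \<cdot> v)" if "\<alpha> \<in> I" for \<alpha>
        using e(2) that tu[OF that uv(1,4)] tu[OF that uv(2,5)] by simp
    qed (use uv P in auto)
    then show "u = v" by (rule pullback_unique[OF pb(1), rotated 5]) (use uv e(1) P in auto)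
  qed
  then show ?thesis using pb(2) by blast
qed

text \<open>One vertex of the factorisation of a morphism \<open>f\<close> of representations: \<open>g\<close> is the component of \<open>f\<close> at a
  vertex \<open>i\<close>, and \<open>g\<close> together with the arrows \<open>c \<alpha> \<cdot> a \<alpha>\<close> determined by the factorisation at the neighbours
  maps to the wide pullback. Factoring that arrow as \<open>\<chi> \<cdot> c'\<close> gives the new object together with its arrows
  \<open>t \<alpha> \<cdot> \<chi>\<close> to the neighbours.\<close>

lemma factorization_step:
  assumes cp: "complete_cotorsion_pair M W F" and I: "I \<subseteq> arcs Q" and g: "g \<in> Ar M"
    and q: "\<And>\<alpha>. \<alpha> \<in> I \<Longrightarrow> epic M (q \<alpha>)"
    and c: "\<And>\<alpha>. \<alpha> \<in> I \<Longrightarrow> c \<alpha> \<in> Ar M \<and> Dom M (q \<alpha>) = Cod M (c \<alpha>)"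
    and a: "\<And>\<alpha>. \<alpha> \<in> I \<Longrightarrow> a \<alpha> \<in> Ar M \<and> Dom M (a \<alpha>) = Dom M g \<and> Cod M (a \<alpha>) = Dom M (c \<alpha>)"
    and \<beta>: "\<And>\<alpha>. \<alpha> \<in> I \<Longrightarrow> \<beta> \<alpha> \<in> Ar M \<and> Dom M (\<beta> \<alpha>) = Cod M g \<and> Cod M (\<beta> \<alpha>) = Cod M (q \<alpha>)"
    and e: "\<And>\<alpha>. \<alpha> \<in> I \<Longrightarrow> q \<alpha> \<cdot> (c \<alpha> \<cdot> a \<alpha>) = \<beta> \<alpha> \<cdot> g"
  obtains c' d b t \<chi> k where "is_wide_pullback M I (Cod M g) q \<beta> b t" "epic M b" "short_exact M c' d" "Cod M d \<in> W"
    "Dom M c' = Dom M g" "short_exact M k \<chi>" "Dom M k \<in> F" "Dom M \<chi> = Cod M c'" "Cod M \<chi> = Dom M b"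
    "(b \<cdot> \<chi>) \<cdot> c' = g" "\<forall>\<alpha>\<in>I. (t \<alpha> \<cdot> \<chi>) \<cdot> c' = c \<alpha> \<cdot> a \<alpha>"
proof -
  have "\<exists>b t. is_wide_pullback M I (Cod M g) q \<beta> b t \<and> epic M b"
    using ex_wide_pullback[OF I _ q \<beta>] g by simp
  then obtain b t where bt: "is_wide_pullback M I (Cod M g) q \<beta> b t" "epic M b" by blast
  note T = is_wide_pullback_simps[OF bt(1)]
  obtain v where v: "v \<in> Ar M" "Dom M v = Dom M g" "Cod M v = Dom M b" "b \<cdot> v = g" "\<forall>\<alpha>\<in>I. t \<alpha> \<cdot> v = c \<alpha> \<cdot> a \<alpha>"
  proof (rule wide_pullback_factor[OF bt(1) g refl, of "\<lambda>\<alpha>. c \<alpha> \<cdot> a \<alpha>"])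
    show "c \<alpha> \<cdot> a \<alpha> \<in> Ar M \<and> Dom M (c \<alpha> \<cdot> a \<alpha>) = Dom M g \<and> Cod M (c \<alpha> \<cdot> a \<alpha>) = Dom M (q \<alpha>) \<and> q \<alpha> \<cdot> (c \<alpha> \<cdot> a \<alpha>) = \<beta> \<alpha> \<cdot> g"
      if "\<alpha> \<in> I" for \<alpha> using a[OF that] c[OF that] e[OF that] by simp
  qed blast
  obtain c' \<chi> d k where f: "short_exact M c' d" "short_exact M k \<chi>" "Cod M c' = Dom M \<chi>" "v = \<chi> \<cdot> c'"
    "Cod M d \<in> W" "Dom M k \<in> F"
    using cp v(1) by (rule cotorsion_factorization)
  note S = short_exact_simps[OF f(1)] and K = short_exact_simps[OF f(2)]
  have dc: "Dom M c' = Dom M g" "Cod M \<chi> = Dom M b" using v(2,3) f(3) S(1) K(2) unfolding f(4) by simp_all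
  have "(b \<cdot> \<chi>) \<cdot> c' = g" using v(4) S(1) K(2) f(3) dc T(1) unfolding f(4) by (subst comp_assoc) simp_all
  moreover have "\<forall>\<alpha>\<in>I. (t \<alpha> \<cdot> \<chi>) \<cdot> c' = c \<alpha> \<cdot> a \<alpha>"
  proof
    fix \<alpha> assume \<alpha>: "\<alpha> \<in> I"
    then show "(t \<alpha> \<cdot> \<chi>) \<cdot> c' = c \<alpha> \<cdot> a \<alpha>"
      using v(5) S(1) K(2) f(3) dc T(3-4)[OF \<alpha>] unfolding f(4) by (subst comp_assoc) simp_all
  qed
  ultimately show ?thesis using that[OF bt f(1,5) dc(1) f(2,6) f(3)[symmetric] dc(2)] by blast
qed

text \<open>The kernels \<open>\<kappa> \<alpha>\<close> define an arrow \<open>\<theta>\<close> from \<open>N\<close> to the wide pullback whose composite with \<open>b\<close> is zero.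
  An arrow \<open>x\<close> with \<open>\<chi> \<cdot> x = \<theta> \<cdot> y\<close> is thus killed by \<open>b \<cdot> \<chi>\<close>, so \<open>\<psi>\<close> is the pullback of \<open>\<chi>\<close> along \<open>\<theta>\<close>.
  For a factorisation of representations, \<open>\<psi>\<close> is the map from the kernel at a vertex to the product over
  the outgoing arrows, which therefore is epic with kernel in the right class.\<close>

lemma wide_pullback_kernel:
  assumes wp: "is_wide_pullback M I B q \<beta> b t" and \<beta>: "\<And>\<alpha>. \<alpha> \<in> I \<Longrightarrow> \<beta> \<alpha> \<in> Ar M \<and> Dom M (\<beta> \<alpha>) = B"
    and \<chi>: "short_exact M k \<chi>" "Cod M \<chi> = Dom M b"
    and \<kappa>0: "is_kernel M (b \<cdot> \<chi>) \<kappa>0" and \<kappa>: "\<And>\<alpha>. \<alpha> \<in> I \<Longrightarrow> is_kernel M (q \<alpha>) (\<kappa> \<alpha>)"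
    and N: "is_product M I (\<lambda>\<alpha>. Dom M (\<kappa> \<alpha>)) N \<rho>"
    and \<psi>: "\<psi> \<in> Ar M" "Dom M \<psi> = Dom M \<kappa>0" "Cod M \<psi> = N"
    and e: "\<And>\<alpha>. \<alpha> \<in> I \<Longrightarrow> \<kappa> \<alpha> \<cdot> (\<rho> \<alpha> \<cdot> \<psi>) = (t \<alpha> \<cdot> \<chi>) \<cdot> \<kappa>0"
  shows "\<exists>k'. short_exact M k' \<psi> \<and> Dom M k' = Dom M k"
proof -
  note T = is_wide_pullback_simps[OF wp] and K = short_exact_simps[OF \<chi>(1)] and n = is_productD[OF N]
  have bx: "b \<cdot> \<chi> \<in> Ar M" "Dom M (b \<cdot> \<chi>) = Dom M \<chi>" "Cod M (b \<cdot> \<chi>) = B" using T(1,2) K(2) \<chi>(2) by simp_all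
  note K0 = is_kernel_simps[OF \<kappa>0, unfolded bx(2,3)]
  have Ka: "q \<alpha> \<in> Ar M" "\<kappa> \<alpha> \<in> Ar M" "Cod M (\<kappa> \<alpha>) = Dom M (q \<alpha>)" "q \<alpha> \<cdot> \<kappa> \<alpha> = zer (Dom M (\<kappa> \<alpha>)) (Cod M (q \<alpha>))" "monic M (\<kappa> \<alpha>)"
    if "\<alpha> \<in> I" for \<alpha> using is_kernel_simps[OF \<kappa>[OF that]] by auto
  have ba: "\<beta> \<alpha> \<in> Ar M" "Dom M (\<beta> \<alpha>) = B" if "\<alpha> \<in> I" for \<alpha> using \<beta>[OF that] by auto
  have bc: "Cod M (\<beta> \<alpha>) = Cod M (q \<alpha>)" if "\<alpha> \<in> I" for \<alpha>
  proof -
    have "Cod M (\<beta> \<alpha> \<cdot> b) = Cod M (\<beta> \<alpha>)" using ba[OF that] T(1,2) by simp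
    moreover have "Cod M (q \<alpha> \<cdot> t \<alpha>) = Cod M (q \<alpha>)" using Ka(1)[OF that] T(3,5)[OF that] by simp
    ultimately show ?thesis using T(6)[OF that] by simp
  qed
  have BO: "B \<in> Ob M" using T(1,2) by auto
  obtain \<theta> where th: "\<theta> \<in> Ar M" "Dom M \<theta> = Dom M (zer N B)" "Cod M \<theta> = Dom M b" "b \<cdot> \<theta> = zer N B"
    "\<forall>\<alpha>\<in>I. t \<alpha> \<cdot> \<theta> = \<kappa> \<alpha> \<cdot> \<rho> \<alpha>"
  proof (rule wide_pullback_factor[OF wp, of "zer N B" "\<lambda>\<alpha>. \<kappa> \<alpha> \<cdot> \<rho> \<alpha>"])
    show "zer N B \<in> Ar M" "Cod M (zer N B) = B" using n(1) BO by simp_all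
    fix \<alpha> assume \<alpha>: "\<alpha> \<in> I"
    note tt = Ka[OF \<alpha>] n(2-4)[OF \<alpha>] ba[OF \<alpha>] bc[OF \<alpha>]
    have "q \<alpha> \<cdot> (\<kappa> \<alpha> \<cdot> \<rho> \<alpha>) = zer (Dom M (\<kappa> \<alpha>)) (Cod M (q \<alpha>)) \<cdot> \<rho> \<alpha>"
      by (rule comp_ext[OF tt(4)]) (use tt in auto)
    also have "\<dots> = \<beta> \<alpha> \<cdot> zer N B" using tt n(1) BO by simp
    finally show "\<kappa> \<alpha> \<cdot> \<rho> \<alpha> \<in> Ar M \<and> Dom M (\<kappa> \<alpha> \<cdot> \<rho> \<alpha>) = Dom M (zer N B) \<and> Cod M (\<kappa> \<alpha> \<cdot> \<rho> \<alpha>) = Dom M (q \<alpha>) \<and>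
        q \<alpha> \<cdot> (\<kappa> \<alpha> \<cdot> \<rho> \<alpha>) = \<beta> \<alpha> \<cdot> zer N B" using tt n(1) BO by simp
  qed blast
  have dth: "Dom M \<theta> = N" using th(2) n(1) BO by simp
  have pb: "is_pullback M \<chi> \<theta> \<kappa>0 \<psi>"
    unfolding is_pullback_def
  proof (intro conjI ballI impI)
    show "\<chi> \<in> Ar M" "\<theta> \<in> Ar M" "\<kappa>0 \<in> Ar M" "\<psi> \<in> Ar M" "Cod M \<chi> = Cod M \<theta>" "Dom M \<kappa>0 = Dom M \<psi>"
      "Cod M \<kappa>0 = Dom M \<chi>" "Cod M \<psi> = Dom M \<theta>" using K th \<chi>(2) K0 \<psi> dth by simp_all
    show "\<chi> \<cdot> \<kappa>0 = \<theta> \<cdot> \<psi>"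
    proof (rule wide_pullback_unique[OF wp])
      have "b \<cdot> (\<chi> \<cdot> \<kappa>0) = zer (Dom M \<kappa>0) B" using K0 K(2) \<chi>(2) T(1) by (subst comp_assoc[symmetric]) simp_all
      moreover have "b \<cdot> (\<theta> \<cdot> \<psi>) = zer N B \<cdot> \<psi>" by (rule comp_ext[OF th(4)]) (use th(1,3) dth T(1) \<psi> in auto)
      ultimately show "b \<cdot> (\<chi> \<cdot> \<kappa>0) = b \<cdot> (\<theta> \<cdot> \<psi>)" using \<psi> n(1) BO by simp
      fix \<alpha> assume \<alpha>: "\<alpha> \<in> I"
      note tt = Ka[OF \<alpha>] n(2-4)[OF \<alpha>] T(3-5)[OF \<alpha>]
      have "t \<alpha> \<cdot> (\<theta> \<cdot> \<psi>) = \<kappa> \<alpha> \<cdot> (\<rho> \<alpha> \<cdot> \<psi>)"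
        by (rule comp_ext2[OF th(5)[rule_format, OF \<alpha>]]) (use tt th(1,3) dth \<psi> in auto)
      also have "\<dots> = t \<alpha> \<cdot> (\<chi> \<cdot> \<kappa>0)" unfolding e[OF \<alpha>] using tt K(2) K0 \<chi>(2) by (subst comp_assoc) simp_all
      finally show "t \<alpha> \<cdot> (\<chi> \<cdot> \<kappa>0) = t \<alpha> \<cdot> (\<theta> \<cdot> \<psi>)" by (rule sym)
    qed (use K(2) K0 \<chi>(2) th(1,3) dth \<psi> in auto)
  next
    fix x y assume xy: "x \<in> Ar M" "y \<in> Ar M" and a: "Dom M x = Dom M y \<and> Cod M x = Dom M \<chi> \<and> Cod M y = Dom M \<theta> \<and> \<chi> \<cdot> x = \<theta> \<cdot> y"
    from a have d: "Dom M x = Dom M y" "Cod M x = Dom M \<chi>" "Cod M y = N" and sq: "\<chi> \<cdot> x = \<theta> \<cdot> y" using dth by auto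
    have "(b \<cdot> \<chi>) \<cdot> x = b \<cdot> (\<theta> \<cdot> y)" unfolding sq[symmetric] by (rule comp_assoc) (use xy d T(1) K(2) \<chi>(2) in auto)
    also have "\<dots> = zer N B \<cdot> y" by (rule comp_ext[OF th(4)]) (use th(1,3) dth T(1) xy d in auto)
    also have "\<dots> = zer (Dom M x) B" using xy d n(1) BO by simp
    finally have z: "(b \<cdot> \<chi>) \<cdot> x = zer (Dom M x) (Cod M (b \<cdot> \<chi>))" using bx by simp
    obtain u where u: "u \<in> Ar M" "Dom M u = Dom M x" "Cod M u = Dom M \<kappa>0" "\<kappa>0 \<cdot> u = x"
      by (rule kernel_factor[OF \<kappa>0 xy(1) _ z]) (use d(2) bx(2) in auto)
    have "\<psi> \<cdot> u = y"
    proof (rule product_unique[OF N])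
      fix \<alpha> assume \<alpha>: "\<alpha> \<in> I"
      note tt = Ka[OF \<alpha>] n(2-4)[OF \<alpha>] T(3-5)[OF \<alpha>]
      have "\<kappa> \<alpha> \<cdot> (\<rho> \<alpha> \<cdot> (\<psi> \<cdot> u)) = (\<kappa> \<alpha> \<cdot> (\<rho> \<alpha> \<cdot> \<psi>)) \<cdot> u"
        using tt \<psi> u(1-3) by simp
      also have "\<dots> = t \<alpha> \<cdot> (\<chi> \<cdot> (\<kappa>0 \<cdot> u))" unfolding e[OF \<alpha>] using tt u(1-3) K0 K(2) \<chi>(2) by simp
      also have "\<dots> = t \<alpha> \<cdot> (\<theta> \<cdot> y)" unfolding u(4) sq ..
      also have "\<dots> = \<kappa> \<alpha> \<cdot> (\<rho> \<alpha> \<cdot> y)"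
        by (rule comp_ext2[OF th(5)[rule_format, OF \<alpha>]]) (use tt th(1,3) dth xy d in auto)
      finally have ee: "\<kappa> \<alpha> \<cdot> (\<rho> \<alpha> \<cdot> (\<psi> \<cdot> u)) = \<kappa> \<alpha> \<cdot> (\<rho> \<alpha> \<cdot> y)" .
      show "\<rho> \<alpha> \<cdot> (\<psi> \<cdot> u) = \<rho> \<alpha> \<cdot> y"
        by (rule monicD[OF tt(5) ee]) (use tt \<psi> u(1-3) xy d in auto)
    qed (use \<psi> u(1-3) xy d in auto)
    then have uu: "u \<in> Hom M (Dom M x) (Dom M \<kappa>0) \<and> \<kappa>0 \<cdot> u = x \<and> \<psi> \<cdot> u = y" using u by simp
    show "\<exists>!u. u \<in> Hom M (Dom M x) (Dom M \<kappa>0) \<and> \<kappa>0 \<cdot> u = x \<and> \<psi> \<cdot> u = y"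
    proof (rule ex1I[of _ u])
      show "u \<in> Hom M (Dom M x) (Dom M \<kappa>0) \<and> \<kappa>0 \<cdot> u = x \<and> \<psi> \<cdot> u = y" by (rule uu)
    next
      fix u' assume a: "u' \<in> Hom M (Dom M x) (Dom M \<kappa>0) \<and> \<kappa>0 \<cdot> u' = x \<and> \<psi> \<cdot> u' = y"
      show "u' = u" by (rule monicD[OF K0(5)]) (use a u in auto)
    qed
  qed
  have ep: "epic M \<psi>" by (rule pullback_epic[OF pb K(6)])
  obtain k' where k': "is_kernel M \<psi> k'" "\<kappa>0 \<cdot> k' = k" using pullback_kernel[OF pb K(7)] by blast
  note K' = is_kernel_simps[OF k'(1)]
  have "Dom M (\<kappa>0 \<cdot> k') = Dom M k'" using K' K0 \<psi>(2) by simp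
  then show ?thesis unfolding short_exact_iff_kernel using k' ep by auto
qed

end


context abelian
begin

text \<open>Factoring \<open>0 \<rightarrow> a\<close> gives the approximation of \<open>a\<close> by \<open>X\<close>, and factoring \<open>a \<rightarrow> 0\<close> the one by \<open>Y\<close>.\<close>

lemma complete_cotorsion_pair_factorizationI:
  assumes X: "X \<subseteq> Ob C" "retract_closed_class C X" and Y: "Y \<subseteq> Ob C" "retract_closed_class C Y"
    and o: "\<And>x y. x \<in> X \<Longrightarrow> y \<in> Y \<Longrightarrow> orth C x y"
    and fac: "\<And>f. f \<in> Ar C \<Longrightarrow> \<exists>i d k p. short_exact C i d \<and> short_exact C k p \<and> Cod C i = Dom C p \<and> p \<cdot> i = f \<and>
      Cod C d \<in> X \<and> Dom C k \<in> Y"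
  shows "complete_cotorsion_pair C X Y"
proof (rule complete_cotorsion_pairI[OF X Y o])
  obtain z where z: "zero_object C z" "z \<in> Ob C" by (rule obtain_zero)
  fix a assume a: "a \<in> Ob C"
  show "\<exists>f g. short_exact C f g \<and> Dom C f \<in> Y \<and> Dom C g \<in> X \<and> Cod C g = a"
  proof -
    obtain i d k p where f: "short_exact C i d" "short_exact C k p" "Cod C i = Dom C p" "p \<cdot> i = zer z a" "Cod C d \<in> X" "Dom C k \<in> Y"
      using fac[of "zer z a"] a z by auto
    note I = short_exact_simps[OF f(1)] and P = short_exact_simps[OF f(2)]
    have pi: "Dom C (p \<cdot> i) = Dom C i" "Cod C (p \<cdot> i) = Cod C p" using I(1) P(2) f(3) by simp_all
    have e: "Dom C i = z" "Cod C p = a" using pi a z(2) unfolding f(4) by simp_all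
    have "i = zer z (Cod C i)" by (rule zero_object_from[OF z(1) I(1) e(1)])
    then have "short_exact C i (Ident C (Cod C i))" using short_exact_zer_Ident[OF z(1), of "Cod C i"] I(1) by simp
    then have "is_cokernel C i (Ident C (Cod C i))" by (rule short_exact_simps(8))
    then have "obj_retract C (Cod C (Ident C (Cod C i))) (Cod C d)" using I(8) by (rule cokernel_choice)
    then have "Cod C i \<in> X" using X(2) f(5) I(1) unfolding retract_closed_class_def by auto
    then show ?thesis using f(2,3,6) e(2) by auto
  qed
  show "\<exists>f g. short_exact C f g \<and> Dom C f = a \<and> Dom C g \<in> Y \<and> Cod C g \<in> X"
  proof -
    obtain i d k p where f: "short_exact C i d" "short_exact C k p" "Cod C i = Dom C p" "p \<cdot> i = zer a z" "Cod C d \<in> X" "Dom C k \<in> Y"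
      using fac[of "zer a z"] a z by auto
    note I = short_exact_simps[OF f(1)] and P = short_exact_simps[OF f(2)]
    have pi: "Dom C (p \<cdot> i) = Dom C i" "Cod C (p \<cdot> i) = Cod C p" using I(1) P(2) f(3) by simp_all
    have e: "Dom C i = a" "Cod C p = z" using pi a z(2) unfolding f(4) by simp_all
    have "p = zer (Dom C p) z" by (rule zero_object_into[OF z(1) P(2) e(2)])
    then have "short_exact C (Ident C (Dom C p)) p" using short_exact_Ident_zer[OF z(1), of "Dom C p"] P(2) by simp
    then have "is_kernel C p (Ident C (Dom C p))" by (rule short_exact_simps(7))
    then have "obj_retract C (Dom C (Ident C (Dom C p))) (Dom C k)" using P(7) by (rule kernel_choice)
    then have "Dom C p \<in> Y" using Y(2) f(6) P(2) unfolding retract_closed_class_def by auto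
    then show ?thesis using f(1,3,5) e(1) I(3) by (intro exI[of _ i] exI[of _ d]) simp
  qed
qed

end

context quiver_reps
begin

text \<open>The factorisation is built by well-founded recursion, \<open>factorization_step\<close> being the recursion step. The
  value chosen at a vertex \<open>i\<close> is a triple: the monomorphism out of \<open>A i\<close>, the epimorphism onto \<open>B i\<close>, and the
  arrows of the middle representation that leave \<open>i\<close>. By \<open>wide_pullback_kernel\<close> the kernel \<open>Y\<close> of the
  epimorphism satisfies the conditions of \<open>Psi\<close> on the maps \<open>\<psi>\<close>; that its values are in \<open>F\<close> follows by a
  second induction, since each is an extension of a product of values at smaller vertices by an object of \<open>F\<close>.\<close>

lemma factorization_reps:
  assumes cp: "complete_cotorsion_pair M W F" and f: "is_ntrans (path_cat Q) M f"
  shows "\<exists>c d k q. short_exact FC c d \<and> short_exact FC k q \<and> NCod c = NDom q \<and> q \<cdot>\<^bsub>FC\<^esub> c = f \<and>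
    NCod d \<in> Rep_class Q M W \<and> NDom k \<in> Psi Q M F"
proof -
  have co: "cotorsion_pair M W F" using cp unfolding complete_cotorsion_pair_def by blast
  note rc = cotorsion_retract_closed(1)[OF co, unfolded retract_closed_class_def, rule_format]
  define A B where "A = NDom f" and "B = NCod f"
  have fn: "NDom f = A" "NCod f = B" unfolding A_def B_def by auto
  have Af: "is_functor (path_cat Q) M A" and Bf: "is_functor (path_cat Q) M B" using ntrans_functors[OF f] fn by auto
  have fi: "NComponent f i \<in> Ar M" "Dom M (NComponent f i) = FOb A i" "Cod M (NComponent f i) = FOb B i" if "i \<in> verts Q" for i
    using ntrans_simps(1-3)[OF f, of i] that fn by simp_all
  have aa: "rep_arrow Q A \<alpha> \<in> Ar M" "Dom M (rep_arrow Q A \<alpha>) = FOb A (tail Q \<alpha>)" "Cod M (rep_arrow Q A \<alpha>) = FOb A (head Q \<alpha>)"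
    "rep_arrow Q B \<alpha> \<in> Ar M" "Dom M (rep_arrow Q B \<alpha>) = FOb B (tail Q \<alpha>)" "Cod M (rep_arrow Q B \<alpha>) = FOb B (head Q \<alpha>)"
    "NComponent f (head Q \<alpha>) \<cdot> rep_arrow Q A \<alpha> = rep_arrow Q B \<alpha> \<cdot> NComponent f (tail Q \<alpha>)" if "\<alpha> \<in> arcs Q" for \<alpha>
    using rep_arrow_simps[OF Af that] rep_arrow_simps[OF Bf that] ntrans_arrow[OF f that] fn by simp_all
  define cc qq ca where "cc = (\<lambda>x :: 'm \<times> 'm \<times> ('e \<Rightarrow> 'm). fst x)" and "qq = (\<lambda>x :: 'm \<times> 'm \<times> ('e \<Rightarrow> 'm). fst (snd x))"
    and "ca = (\<lambda>x :: 'm \<times> 'm \<times> ('e \<Rightarrow> 'm). snd (snd x))"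
  \<comment> \<open>\<open>base\<close> concerns the vertex \<open>i\<close> alone, \<open>fibre\<close> records how the value arose from the wide pullback, and \<open>arr\<close> is compatibility with the neighbours.\<close>
  define base where "base i x \<longleftrightarrow> cc x \<in> Ar M \<and> Dom M (cc x) = FOb A i \<and> epic M (qq x) \<and> Dom M (qq x) = Cod M (cc x) \<and>
      Cod M (qq x) = FOb B i \<and> qq x \<cdot> cc x = NComponent f i \<and> (\<exists>d. short_exact M (cc x) d \<and> Cod M d \<in> W)" for i x
  define fibre where "fibre h i x \<longleftrightarrow> (\<exists>b t \<chi> k. is_wide_pullback M (out i) (FOb B i) (\<lambda>\<alpha>. qq (h (head Q \<alpha>))) (rep_arrow Q B) b t \<and>
      short_exact M k \<chi> \<and> Dom M k \<in> F \<and> Dom M \<chi> = Cod M (cc x) \<and> Cod M \<chi> = Dom M b \<and> b \<cdot> \<chi> = qq x \<and> (\<forall>\<alpha>\<in>out i. t \<alpha> \<cdot> \<chi> = ca x \<alpha>))" for h i x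
  define arr where "arr h i x \<longleftrightarrow> (\<forall>\<alpha>\<in>out i. ca x \<alpha> \<in> Ar M \<and> Dom M (ca x \<alpha>) = Cod M (cc x) \<and> Cod M (ca x \<alpha>) = Cod M (cc (h (head Q \<alpha>))) \<and>
      ca x \<alpha> \<cdot> cc x = cc (h (head Q \<alpha>)) \<cdot> rep_arrow Q A \<alpha> \<and> qq (h (head Q \<alpha>)) \<cdot> ca x \<alpha> = rep_arrow Q B \<alpha> \<cdot> qq x)" for h i x
  define good where "good h i x \<longleftrightarrow> (i \<in> verts Q \<longrightarrow> base i x \<and> fibre h i x \<and> arr h i x)" for h i x
  have "\<exists>h. \<forall>i. good h i (h i)"
  proof (rule dependent_wf_choice[OF wfQ])
    fix h h' :: "'v \<Rightarrow> 'm \<times> 'm \<times> ('e \<Rightarrow> 'm)" and i x assume "\<And>z. (z, i) \<in> arrow_rel Q \<Longrightarrow> h z = h' z"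
    then have e: "h (head Q \<alpha>) = h' (head Q \<alpha>)" if "\<alpha> \<in> out i" for \<alpha> using that unfolding arrow_rel_def by blast
    have "arr h i x = arr h' i x" unfolding arr_def using e by simp
    moreover have "is_wide_pullback M (out i) (FOb B i) (\<lambda>\<alpha>. qq (h (head Q \<alpha>))) (rep_arrow Q B) b t =
      is_wide_pullback M (out i) (FOb B i) (\<lambda>\<alpha>. qq (h' (head Q \<alpha>))) (rep_arrow Q B) b t" for b t
      unfolding is_wide_pullback_def using e by simp
    ultimately show "good h i x = good h' i x" unfolding good_def fibre_def by simp
  next
    fix i h assume IH: "\<And>j. (j, i) \<in> arrow_rel Q \<Longrightarrow> good h j (h j)"
    show "\<exists>r. good h i r"
    proof (cases "i \<in> verts Q")
      case i: True
      define cj qj where "cj \<alpha> = cc (h (head Q \<alpha>))" and "qj \<alpha> = qq (h (head Q \<alpha>))" for \<alpha>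
      have hv: "\<alpha> \<in> arcs Q" "tail Q \<alpha> = i" "head Q \<alpha> \<in> verts Q" if "\<alpha> \<in> out i" for \<alpha> using that arc_verts by auto
      have bj: "base (head Q \<alpha>) (h (head Q \<alpha>))" if "\<alpha> \<in> out i" for \<alpha>
      proof -
        have "(head Q \<alpha>, i) \<in> arrow_rel Q" using that unfolding arrow_rel_def by blast
        then show ?thesis using IH hv(3)[OF that] unfolding good_def by blast
      qed
      have J: "cj \<alpha> \<in> Ar M" "Dom M (cj \<alpha>) = FOb A (head Q \<alpha>)" "epic M (qj \<alpha>)" "Dom M (qj \<alpha>) = Cod M (cj \<alpha>)"
        "Cod M (qj \<alpha>) = FOb B (head Q \<alpha>)" "qj \<alpha> \<cdot> cj \<alpha> = NComponent f (head Q \<alpha>)" "qj \<alpha> \<in> Ar M" if "\<alpha> \<in> out i" for \<alpha>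
        using bj[OF that] unfolding base_def cj_def qj_def by auto
      have aj: "rep_arrow Q A \<alpha> \<in> Ar M" "Dom M (rep_arrow Q A \<alpha>) = FOb A i" "Cod M (rep_arrow Q A \<alpha>) = FOb A (head Q \<alpha>)"
        "rep_arrow Q B \<alpha> \<in> Ar M" "Dom M (rep_arrow Q B \<alpha>) = FOb B i" "Cod M (rep_arrow Q B \<alpha>) = FOb B (head Q \<alpha>)"
        "NComponent f (head Q \<alpha>) \<cdot> rep_arrow Q A \<alpha> = rep_arrow Q B \<alpha> \<cdot> NComponent f i" if "\<alpha> \<in> out i" for \<alpha>
        using aa[OF hv(1)[OF that]] unfolding hv(2)[OF that] by auto
      have sq: "qj \<alpha> \<cdot> (cj \<alpha> \<cdot> rep_arrow Q A \<alpha>) = rep_arrow Q B \<alpha> \<cdot> NComponent f i" if "\<alpha> \<in> out i" for \<alpha>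
      proof -
        have "qj \<alpha> \<cdot> (cj \<alpha> \<cdot> rep_arrow Q A \<alpha>) = NComponent f (head Q \<alpha>) \<cdot> rep_arrow Q A \<alpha>"
          by (rule comp_ext[OF J(6)[OF that]]) (use J[OF that] aj[OF that] in auto)
        then show ?thesis using aj(7)[OF that] by simp
      qed
      note fi = fi[OF i]
      obtain c d b t \<chi> k where st: "is_wide_pullback M (out i) (Cod M (NComponent f i)) qj (rep_arrow Q B) b t" "epic M b"
        "short_exact M c d" "Cod M d \<in> W" "Dom M c = Dom M (NComponent f i)" "short_exact M k \<chi>" "Dom M k \<in> F"
        "Dom M \<chi> = Cod M c" "Cod M \<chi> = Dom M b" "(b \<cdot> \<chi>) \<cdot> c = NComponent f i"
        "\<forall>\<alpha>\<in>out i. (t \<alpha> \<cdot> \<chi>) \<cdot> c = cj \<alpha> \<cdot> rep_arrow Q A \<alpha>"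
      proof (rule factorization_step[OF cp, of "out i" "NComponent f i" qj cj "rep_arrow Q A" "rep_arrow Q B"])
        show "out i \<subseteq> arcs Q" by auto
        show "NComponent f i \<in> Ar M" by (rule fi(1))
        fix \<alpha> assume \<alpha>: "\<alpha> \<in> out i"
        note tt = J[OF \<alpha>] aj[OF \<alpha>] fi
        show "epic M (qj \<alpha>)" by (rule tt(3))
        show "cj \<alpha> \<in> Ar M \<and> Dom M (qj \<alpha>) = Cod M (cj \<alpha>)" using tt by simp
        show "rep_arrow Q A \<alpha> \<in> Ar M \<and> Dom M (rep_arrow Q A \<alpha>) = Dom M (NComponent f i) \<and> Cod M (rep_arrow Q A \<alpha>) = Dom M (cj \<alpha>)"
          using tt by simp
        show "rep_arrow Q B \<alpha> \<in> Ar M \<and> Dom M (rep_arrow Q B \<alpha>) = Cod M (NComponent f i) \<and> Cod M (rep_arrow Q B \<alpha>) = Cod M (qj \<alpha>)"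
          using tt by simp
      qed (rule sq)
      note T = is_wide_pullback_simps[OF st(1), unfolded fi(3)] and S = short_exact_simps[OF st(3)] and K = short_exact_simps[OF st(6)]
      define x where "x = (c, b \<cdot> \<chi>, \<lambda>\<alpha>. t \<alpha> \<cdot> \<chi>)"
      have xs: "cc x = c" "qq x = b \<cdot> \<chi>" "ca x \<alpha> = t \<alpha> \<cdot> \<chi>" for \<alpha> unfolding x_def cc_def qq_def ca_def by simp_all
      have eb: "epic M (b \<cdot> \<chi>)" by (rule epic_comp) (use st(2) K(6) st(9) in auto)
      have "base i x" unfolding base_def xs
      proof (intro conjI)
        show "\<exists>d. short_exact M c d \<and> Cod M d \<in> W" using st(3,4) by blast
        show "b \<cdot> \<chi> \<cdot> c = NComponent f i" by (rule st(10))
      qed (use S(1) st(5,8,9) eb fi T(1,2) K(2) in auto)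
      moreover have "fibre h i x" unfolding fibre_def xs
        using st(1,6-9) unfolding fi(3) qj_def by blast
      moreover have "arr h i x" unfolding arr_def xs
      proof (intro ballI conjI)
        fix \<alpha> assume \<alpha>: "\<alpha> \<in> out i"
        note tt = J[OF \<alpha>] aj[OF \<alpha>] T(3-6)[OF \<alpha>] T(1,2) K(2) st(8,9)
        show "t \<alpha> \<cdot> \<chi> \<in> Ar M" "Dom M (t \<alpha> \<cdot> \<chi>) = Cod M c" "Cod M (t \<alpha> \<cdot> \<chi>) = Cod M (cc (h (head Q \<alpha>)))"
          using tt unfolding cj_def by simp_all
        show "(t \<alpha> \<cdot> \<chi>) \<cdot> c = cc (h (head Q \<alpha>)) \<cdot> rep_arrow Q A \<alpha>" using st(11) \<alpha> unfolding cj_def by blast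
        have "qj \<alpha> \<cdot> (t \<alpha> \<cdot> \<chi>) = rep_arrow Q B \<alpha> \<cdot> (b \<cdot> \<chi>)"
          by (rule comp_ext2[OF T(6)[OF \<alpha>]]) (use tt in auto)
        then show "qq (h (head Q \<alpha>)) \<cdot> (t \<alpha> \<cdot> \<chi>) = rep_arrow Q B \<alpha> \<cdot> (b \<cdot> \<chi>)" unfolding qj_def .
      qed
      ultimately show ?thesis unfolding good_def by blast
    qed (simp add: good_def)
  qed
  then obtain h where h: "\<And>i. good h i (h i)" by blast
  define ci qi where "ci i = cc (h i)" and "qi i = qq (h i)" for i
  have V: "ci i \<in> Ar M" "Dom M (ci i) = FOb A i" "epic M (qi i)" "qi i \<in> Ar M" "Dom M (qi i) = Cod M (ci i)"
    "Cod M (qi i) = FOb B i" "qi i \<cdot> ci i = NComponent f i" "\<exists>d. short_exact M (ci i) d \<and> Cod M d \<in> W" "fibre h i (h i)" if "i \<in> verts Q" for i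
    using h[of i] that unfolding good_def base_def ci_def qi_def by auto
  have E: "ca (h (tail Q \<alpha>)) \<alpha> \<in> Ar M" "Dom M (ca (h (tail Q \<alpha>)) \<alpha>) = Cod M (ci (tail Q \<alpha>))"
    "Cod M (ca (h (tail Q \<alpha>)) \<alpha>) = Cod M (ci (head Q \<alpha>))" "ca (h (tail Q \<alpha>)) \<alpha> \<cdot> ci (tail Q \<alpha>) = ci (head Q \<alpha>) \<cdot> rep_arrow Q A \<alpha>"
    "qi (head Q \<alpha>) \<cdot> ca (h (tail Q \<alpha>)) \<alpha> = rep_arrow Q B \<alpha> \<cdot> qi (tail Q \<alpha>)" if "\<alpha> \<in> arcs Q" for \<alpha>
  proof -
    have "arr h (tail Q \<alpha>) (h (tail Q \<alpha>))" using h[of "tail Q \<alpha>"] arc_verts(1)[OF that] unfolding good_def by blast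
    moreover have "\<alpha> \<in> out (tail Q \<alpha>)" using that by simp
    ultimately show "ca (h (tail Q \<alpha>)) \<alpha> \<in> Ar M" "Dom M (ca (h (tail Q \<alpha>)) \<alpha>) = Cod M (ci (tail Q \<alpha>))"
    "Cod M (ca (h (tail Q \<alpha>)) \<alpha>) = Cod M (ci (head Q \<alpha>))" "ca (h (tail Q \<alpha>)) \<alpha> \<cdot> ci (tail Q \<alpha>) = ci (head Q \<alpha>) \<cdot> rep_arrow Q A \<alpha>"
    "qi (head Q \<alpha>) \<cdot> ca (h (tail Q \<alpha>)) \<alpha> = rep_arrow Q B \<alpha> \<cdot> qi (tail Q \<alpha>)" unfolding arr_def ci_def qi_def by blast+
  qed
  obtain X where X: "is_functor (path_cat Q) M X" "\<And>i. i \<in> verts Q \<Longrightarrow> FOb X i = Cod M (ci i)"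
    "\<And>\<alpha>. \<alpha> \<in> arcs Q \<Longrightarrow> rep_arrow Q X \<alpha> = ca (h (tail Q \<alpha>)) \<alpha>"
  proof (rule ex_rep[of "\<lambda>i. Cod M (ci i)" "\<lambda>\<alpha>. ca (h (tail Q \<alpha>)) \<alpha>"])
    show "Cod M (ci i) \<in> Ob M" if "i \<in> verts Q" for i using V(1)[OF that] by simp
    show "ca (h (tail Q \<alpha>)) \<alpha> \<in> Ar M \<and> Dom M (ca (h (tail Q \<alpha>)) \<alpha>) = Cod M (ci (tail Q \<alpha>)) \<and>
      Cod M (ca (h (tail Q \<alpha>)) \<alpha>) = Cod M (ci (head Q \<alpha>))" if "\<alpha> \<in> arcs Q" for \<alpha> using E(1-3)[OF that] by blast
  qed blast
  define c q where "c = mk_ntrans A X ci" and "q = mk_ntrans X B qi"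
  have cn: "is_ntrans (path_cat Q) M c" unfolding c_def
  proof (rule rep_homI[OF Af X(1)])
    show "ci i \<in> Ar M \<and> Dom M (ci i) = FOb A i \<and> Cod M (ci i) = FOb X i" if "i \<in> verts Q" for i using V(1,2)[OF that] X(2)[OF that] by simp
    show "ci (head Q \<alpha>) \<cdot> rep_arrow Q A \<alpha> = rep_arrow Q X \<alpha> \<cdot> ci (tail Q \<alpha>)" if "\<alpha> \<in> arcs Q" for \<alpha>
      unfolding X(3)[OF that] E(4)[OF that] ..
  qed
  have qn: "is_ntrans (path_cat Q) M q" unfolding q_def
  proof (rule rep_homI[OF X(1) Bf])
    show "qi i \<in> Ar M \<and> Dom M (qi i) = FOb X i \<and> Cod M (qi i) = FOb B i" if "i \<in> verts Q" for i using V(4-6)[OF that] X(2)[OF that] by simp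
    show "qi (head Q \<alpha>) \<cdot> rep_arrow Q X \<alpha> = rep_arrow Q B \<alpha> \<cdot> qi (tail Q \<alpha>)" if "\<alpha> \<in> arcs Q" for \<alpha>
      unfolding X(3)[OF that] E(5)[OF that] ..
  qed
  have cs: "NDom c = A" "NCod c = X" "NDom q = X" "NCod q = B" "\<And>i. i \<in> verts Q \<Longrightarrow> NComponent c i = ci i"
    "\<And>i. i \<in> verts Q \<Longrightarrow> NComponent q i = qi i" unfolding c_def q_def by simp_all
  have "q \<cdot>\<^bsub>FC\<^esub> c = f"
  proof (rule ntrans_eqI)
    show "is_ntrans (path_cat Q) M (q \<cdot>\<^bsub>FC\<^esub> c)" by (rule Comp_ntrans[OF cn qn]) (simp add: cs)
    show "NComponent (q \<cdot>\<^bsub>FC\<^esub> c) i = NComponent f i" if "i \<in> Ob (path_cat Q)" for i using that cs(5,6) V(7) by simp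
  qed (use f fn cs in auto)
  note qc = this
  have "monic FC c"
  proof (rule pointwise_monic[OF cn])
    fix i assume "i \<in> Ob (path_cat Q)"
    then have i: "i \<in> verts Q" by simp
    obtain d where "short_exact M (ci i) d" using V(8)[OF i] by blast
    then show "monic M (NComponent c i)" unfolding cs(5)[OF i] by (rule short_exact_simps(5))
  qed
  moreover obtain d where "is_cokernel FC c d" using FC.ex_cokernel[of c] cn by auto
  ultimately have cd: "short_exact FC c d" unfolding FC.short_exact_iff_cokernel by blast
  note D = FC.short_exact_simps[OF cd]
  have dn: "is_ntrans (path_cat Q) M d" using D by simp
  have dW: "NCod d \<in> Rep_class Q M W" unfolding Rep_class_iff
  proof (intro conjI ballI)
    show "is_functor (path_cat Q) M (NCod d)" by (rule ntrans_functors(2)[OF dn])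
    fix i assume i: "i \<in> verts Q"
    have "short_exact M (NComponent c i) (NComponent d i)" using short_exact_pointwise[OF cd] i by simp
    then have s: "short_exact M (ci i) (NComponent d i)" unfolding cs(5)[OF i] .
    obtain d' where d': "short_exact M (ci i) d'" "Cod M d' \<in> W" using V(8)[OF i] by blast
    have "obj_retract M (Cod M (NComponent d i)) (Cod M d')"
      by (rule cokernel_choice[OF short_exact_simps(8)[OF s] short_exact_simps(8)[OF d'(1)]])
    then show "FOb (NCod d) i \<in> W" using rc[of "Cod M d'"] d'(2) ntrans_simps(3)[OF dn, of i] i by simp
  qed
  have eq: "epic FC q" by (rule pointwise_epic[OF qn]) (use cs(6) V(3) in auto)
  obtain k where k: "is_kernel FC q k" using FC.ex_kernel[of q] qn by auto
  have kq: "short_exact FC k q" unfolding FC.short_exact_iff_kernel using k eq by blast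
  note K = FC.is_kernel_simps[OF k]
  have kn: "is_ntrans (path_cat Q) M k" "NCod k = X" using K cs by auto
  define Y where "Y = NDom k"
  have Yf: "is_functor (path_cat Q) M Y" unfolding Y_def by (rule ntrans_functors(1)[OF kn(1)])
  have ki: "is_kernel M (qi i) (NComponent k i)" "Dom M (NComponent k i) = FOb Y i" if "i \<in> verts Q" for i
    using kernel_pointwise[OF k, of i] that cs(6) ntrans_simps(2)[OF kn(1), of i] unfolding Y_def by simp_all
  have psi: "\<exists>N \<rho> \<psi> k'. is_product M (out i) (\<lambda>\<alpha>. FOb Y (head Q \<alpha>)) N \<rho> \<and> \<psi> \<in> Hom M (FOb Y i) N \<and>
      (\<forall>\<alpha>\<in>out i. \<rho> \<alpha> \<cdot> \<psi> = rep_arrow Q Y \<alpha>) \<and> short_exact M k' \<psi> \<and> Dom M k' \<in> F" if i: "i \<in> verts Q" for i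
  proof -
    have hv: "\<alpha> \<in> arcs Q" "tail Q \<alpha> = i" "head Q \<alpha> \<in> verts Q" if "\<alpha> \<in> out i" for \<alpha> using that arc_verts by auto
    obtain b t \<chi> l where fb: "is_wide_pullback M (out i) (FOb B i) (\<lambda>\<alpha>. qi (head Q \<alpha>)) (rep_arrow Q B) b t"
      "short_exact M l \<chi>" "Dom M l \<in> F" "Dom M \<chi> = Cod M (ci i)" "Cod M \<chi> = Dom M b" "b \<cdot> \<chi> = qi i" "\<forall>\<alpha>\<in>out i. t \<alpha> \<cdot> \<chi> = ca (h i) \<alpha>"
      using V(9)[OF i] unfolding fibre_def qi_def ci_def by blast
    have Yh: "FOb Y (head Q \<alpha>) \<in> Ob M" if "\<alpha> \<in> out i" for \<alpha> using functor_simps(1)[OF Yf] hv(3)[OF that] by simp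
    have "\<exists>P \<pi>. is_product M (out i) (\<lambda>\<alpha>. FOb Y (head Q \<alpha>)) P \<pi>" by (rule prod_ex[OF _ Yh]) auto
    then obtain N \<rho> where N: "is_product M (out i) (\<lambda>\<alpha>. FOb Y (head Q \<alpha>)) N \<rho>" by blast
    have N': "is_product M (out i) (\<lambda>\<alpha>. Dom M (NComponent k (head Q \<alpha>))) N \<rho>"
      using N unfolding is_product_def by (simp add: ki(2) arc_verts(2))
    have YO: "FOb Y i \<in> Ob M" using functor_simps(1)[OF Yf, of i] i by simp
    have ya: "rep_arrow Q Y \<alpha> \<in> Ar M" "Dom M (rep_arrow Q Y \<alpha>) = FOb Y i" "Cod M (rep_arrow Q Y \<alpha>) = FOb Y (head Q \<alpha>)" if "\<alpha> \<in> out i" for \<alpha>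
      using rep_arrow_simps[OF Yf hv(1)[OF that]] unfolding hv(2)[OF that] .
    obtain \<psi> where ps: "\<psi> \<in> Ar M" "Dom M \<psi> = FOb Y i" "Cod M \<psi> = N" "\<And>\<alpha>. \<alpha> \<in> out i \<Longrightarrow> \<rho> \<alpha> \<cdot> \<psi> = rep_arrow Q Y \<alpha>"
      by (rule product_factor[OF N YO, of "rep_arrow Q Y"]) (use ya in blast)+
    have "\<exists>k'. short_exact M k' \<psi> \<and> Dom M k' = Dom M l"
    proof (rule wide_pullback_kernel[OF fb(1) _ fb(2,5) _ _ N' ps(1) _ ps(3)])
      show "is_kernel M (b \<cdot> \<chi>) (NComponent k i)" unfolding fb(6) by (rule ki(1)[OF i])
      show "Dom M \<psi> = Dom M (NComponent k i)" using ps(2) ki(2)[OF i] by simp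
      fix \<alpha> assume \<alpha>: "\<alpha> \<in> out i"
      show "rep_arrow Q B \<alpha> \<in> Ar M \<and> Dom M (rep_arrow Q B \<alpha>) = FOb B i" using aa[OF hv(1)[OF \<alpha>]] unfolding hv(2)[OF \<alpha>] by simp
      show "is_kernel M (qi (head Q \<alpha>)) (NComponent k (head Q \<alpha>))" by (rule ki(1)[OF hv(3)[OF \<alpha>]])
      have "NComponent k (head Q \<alpha>) \<cdot> rep_arrow Q Y \<alpha> = rep_arrow Q X \<alpha> \<cdot> NComponent k i"
        using ntrans_arrow[OF kn(1) hv(1)[OF \<alpha>]] unfolding kn(2) Y_def hv(2)[OF \<alpha>] .
      then show "NComponent k (head Q \<alpha>) \<cdot> (\<rho> \<alpha> \<cdot> \<psi>) = t \<alpha> \<cdot> \<chi> \<cdot> NComponent k i"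
        unfolding ps(4)[OF \<alpha>] X(3)[OF hv(1)[OF \<alpha>]] hv(2)[OF \<alpha>] using fb(7) \<alpha> by simp
    qed
    then obtain k' where k': "short_exact M k' \<psi>" "Dom M k' = Dom M l" by blast
    show ?thesis
      by (rule exI[of _ N], rule exI[of _ \<rho>], rule exI[of _ \<psi>], rule exI[of _ k']) (use N ps k' fb(3) in auto)
  qed
  have YF: "i \<in> verts Q \<longrightarrow> FOb Y i \<in> F" for i
    using wfQ
  proof (induction i rule: wf_induct_rule)
    case (less i)
    show ?case
    proof
      assume i: "i \<in> verts Q"
      obtain N \<rho> \<psi> k' where p: "is_product M (out i) (\<lambda>\<alpha>. FOb Y (head Q \<alpha>)) N \<rho>" "\<psi> \<in> Hom M (FOb Y i) N"
        "short_exact M k' \<psi>" "Dom M k' \<in> F" using psi[OF i] by blast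
      have "N \<in> F"
      proof (rule cotorsion_product_closed[OF co p(1)])
        fix \<alpha> assume \<alpha>: "\<alpha> \<in> out i"
        have "(head Q \<alpha>, i) \<in> arrow_rel Q" using \<alpha> unfolding arrow_rel_def by blast
        moreover have "head Q \<alpha> \<in> verts Q" using \<alpha> arc_verts by blast
        ultimately show "FOb Y (head Q \<alpha>) \<in> F" using less by blast
      qed
      then show "FOb Y i \<in> F" using cotorsion_extension_closed(2)[OF co p(3)] p(2,4) by simp
    qed
  qed
  have "Y \<in> Psi Q M F" by (rule PsiI[OF Yf]) (use YF psi in blast)+
  then show ?thesis using cd kq qc dW cs(2,3) unfolding Y_def
    by (intro exI[of _ c] exI[of _ d] exI[of _ k] exI[of _ q]) simp
qed

lemma complete_cotorsion_pair_reps: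
  assumes cp: "complete_cotorsion_pair M W F"
  shows "complete_cotorsion_pair FC (Rep_class Q M W) (Psi Q M F)"
proof -
  have co: "cotorsion_pair M W F" using cp unfolding complete_cotorsion_pair_def by blast
  note rc = cotorsion_retract_closed[OF co, unfolded retract_closed_class_def, rule_format]
  show ?thesis
  proof (rule FC.complete_cotorsion_pair_factorizationI)
    show "Rep_class Q M W \<subseteq> Ob FC" unfolding Rep_class_iff[abs_def] using Rep_class_iff by auto
    show "Psi Q M F \<subseteq> Ob FC" using Psi_functor by auto
    show "retract_closed_class FC (Rep_class Q M W)"
      unfolding retract_closed_class_def
    proof (intro allI impI)
      fix A B assume a: "B \<in> Rep_class Q M W \<and> obj_retract FC A B"
      then have A: "is_functor (path_cat Q) M A" using FC.obj_retract_Ob by auto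
      have "FOb A i \<in> W" if i: "i \<in> verts Q" for i
      proof (rule rc(1))
        show "FOb B i \<in> W \<and> obj_retract M (FOb A i) (FOb B i)"
          using a i obj_retract_pointwise[of A B i] unfolding Rep_class_iff by simp
      qed
      then show "A \<in> Rep_class Q M W" unfolding Rep_class_iff using A by blast
    qed
    show "retract_closed_class FC (Psi Q M F)" by (rule Psi_retract_closed) (use rc(2) in blast)
    show "orth FC x y" if "x \<in> Rep_class Q M W" "y \<in> Psi Q M F" for x y
    proof (rule orth_Rep_Psi[OF _ that])
      have "\<forall>x\<in>W. \<forall>y\<in>F. orth M x y" using co unfolding cotorsion_pair_iff by (elim conjE)
      then show "orth M w v" if "w \<in> W" "v \<in> F" for w v using that by blast
    qed
    show "\<exists>i d k p. short_exact FC i d \<and> short_exact FC k p \<and> Cod FC i = Dom FC p \<and> p \<cdot>\<^bsub>FC\<^esub> i = f \<and>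
      Cod FC d \<in> Rep_class Q M W \<and> Dom FC k \<in> Psi Q M F" if "f \<in> Ar FC" for f
    proof -
      have "is_ntrans (path_cat Q) M f" using that by simp
      then show ?thesis unfolding FC_simps by (rule factorization_reps[OF cp])
    qed
  qed
qed

end


section \<open>The injective model structure on representations\<close>

lemma product_reindex:
  assumes f: "bij_betw f I J" and P: "is_product C J X P \<pi>"
  shows "is_product C I (\<lambda>i. X (f i)) P (\<lambda>i. \<pi> (f i))"
  unfolding is_product_def
proof (intro conjI ballI allI impI)
  have fI: "f i \<in> J" if "i \<in> I" for i using f that unfolding bij_betw_def by blast
  show "P \<in> Ob C" using P unfolding is_product_def by blast
  show "\<pi> (f i) \<in> Hom C P (X (f i))" if "i \<in> I" for i using P fI[OF that] unfolding is_product_def by blast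
  fix A g assume A: "A \<in> Ob C" and g: "\<forall>i\<in>I. g i \<in> Hom C A (X (f i))"
  define g' where "g' j = g (inv_into I f j)" for j
  have J: "\<forall>j\<in>J. inv_into I f j \<in> I \<and> f (inv_into I f j) = j"
    using f unfolding bij_betw_def by (auto simp: f_inv_into_f inv_into_into)
  then have "\<forall>j\<in>J. g' j \<in> Hom C A (X j)" using g unfolding g'_def by metis
  then have "\<exists>!h. h \<in> Hom C A P \<and> (\<forall>j\<in>J. \<pi> j \<cdot>\<^bsub>C\<^esub> h = g' j)"
    using P A unfolding is_product_def by (elim conjE) (drule (1) bspec, drule spec, erule (1) mp)
  moreover have "(\<forall>j\<in>J. \<pi> j \<cdot>\<^bsub>C\<^esub> h = g' j) \<longleftrightarrow> (\<forall>i\<in>I. \<pi> (f i) \<cdot>\<^bsub>C\<^esub> h = g i)" for h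
  proof -
    have "g' (f i) = g i" if "i \<in> I" for i
      using f that unfolding g'_def bij_betw_def by simp
    moreover have "J = f ` I" using f unfolding bij_betw_def by simp
    ultimately show ?thesis by simp
  qed
  ultimately show "\<exists>!h. h \<in> Hom C A P \<and> (\<forall>i\<in>I. \<pi> (f i) \<cdot>\<^bsub>C\<^esub> h = g i)" by simp
qed

lemma product_cong:
  assumes "\<And>i. i \<in> I \<Longrightarrow> X i = Y i" "is_product C I X P \<pi>"
  shows "is_product C I Y P \<pi>"
  using assms(2) unfolding is_product_def by (simp add: assms(1))

text \<open>A product is a limit over a discrete category, here the image of \<open>I\<close> in \<open>'u\<close> with only identities.\<close>

lemma complete_cat_products:
  assumes C: "category C" and cc: "complete_cat TYPE('u) C" and I: "small TYPE('u) I"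
    and X: "\<And>i. i \<in> I \<Longrightarrow> X i \<in> Ob C"
  shows "\<exists>P \<pi>. is_product C I X P \<pi>"
proof -
  interpret category C by (rule C)
  obtain e :: "_ \<Rightarrow> 'u" where e: "inj_on e I" using I unfolding small_def by blast
  define X' where "X' j = X (inv_into I e j)" for j
  have X': "X' j \<in> Ob C" if "j \<in> e ` I" for j unfolding X'_def using X inv_into_into[OF that] by blast
  \<comment> \<open>The only arrows are identities, so composites are trivial.\<close>
  define J :: "('u, 'u) cat" where "J = \<lparr>Ob = e ` I, Ar = e ` I, Dom = id, Cod = id, Ident = id, Comp = (\<lambda>g f. f)\<rparr>"
  define D where "D = \<lparr>FOb = restrict X' (e ` I), FAr = restrict (\<lambda>j. Ident C (X' j)) (e ` I)\<rparr>"
  have J: "category J" unfolding category_def J_def Hom_def by simp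
  have II: "Ident C (X' j) \<in> Ar C" "Dom C (Ident C (X' j)) = X' j" "Cod C (Ident C (X' j)) = X' j" if "j \<in> e ` I" for j
    using Ident_in_Hom[OF X'[OF that]] unfolding Hom_def by simp_all
  have idem: "Ident C (X' j) \<cdot>\<^bsub>C\<^esub> Ident C (X' j) = Ident C (X' j)" if "j \<in> e ` I" for j
    by (rule Comp_Ident_right[OF Ident_in_Hom[OF X'[OF that]]])
  have "is_functor J C D"
    unfolding is_functor_def
  proof (intro conjI ballI impI)
    show "FOb D \<in> extensional (Ob J)" "FAr D \<in> extensional (Ar J)" unfolding D_def J_def by simp_all
    show "FOb D a \<in> Ob C" "FAr D (Ident J a) = Ident C (FOb D a)" if "a \<in> Ob J" for a
      using that X' unfolding D_def J_def by simp_all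
    show "FAr D f \<in> Hom C (FOb D (Dom J f)) (FOb D (Cod J f))" if "f \<in> Ar J" for f
      using that Ident_in_Hom[OF X', of f] unfolding D_def J_def by simp
    show "FAr D (g \<cdot>\<^bsub>J\<^esub> f) = FAr D g \<cdot>\<^bsub>C\<^esub> FAr D f" if "f \<in> Ar J" "g \<in> Ar J" "Cod J f = Dom J g" for f g
      using that idem[of f] unfolding D_def J_def by simp
  qed
  then obtain L \<pi> where L: "is_limit J C D L \<pi>" using cc J unfolding complete_cat_def by blast
  have cone: "is_cone J C D A g \<longleftrightarrow> A \<in> Ob C \<and> (\<forall>j\<in>e ` I. g j \<in> Hom C A (X' j))" for A g
  proof -
    have "Ident C (X' j) \<cdot>\<^bsub>C\<^esub> g j = g j" if "j \<in> e ` I" "g j \<in> Hom C A (X' j)" for j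
      using Comp_Ident_left[OF that(2)] .
    then show ?thesis unfolding is_cone_def D_def J_def by auto
  qed
  have "is_product C (e ` I) X' L \<pi>"
    unfolding is_product_def
  proof (intro conjI ballI allI impI)
    have L0: "is_cone J C D L \<pi>" using L unfolding is_limit_def by blast
    then show "L \<in> Ob C" unfolding cone by blast
    show "\<pi> j \<in> Hom C L (X' j)" if "j \<in> e ` I" for j using L0 that unfolding cone by blast
    fix A g assume "A \<in> Ob C" "\<forall>j\<in>e ` I. g j \<in> Hom C A (X' j)"
    then have "is_cone J C D A g" unfolding cone by blast
    then have "\<exists>!h. h \<in> Hom C A L \<and> (\<forall>j\<in>Ob J. \<pi> j \<cdot>\<^bsub>C\<^esub> h = g j)"
      using L unfolding is_limit_def by (elim conjE) (drule spec, drule spec, erule (1) mp)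
    then show "\<exists>!h. h \<in> Hom C A L \<and> (\<forall>j\<in>e ` I. \<pi> j \<cdot>\<^bsub>C\<^esub> h = g j)" unfolding J_def by simp
  qed
  then have "is_product C I (\<lambda>i. X' (e i)) L (\<lambda>i. \<pi> (e i))"
    by (rule product_reindex[rotated]) (use e in \<open>simp add: bij_betw_def\<close>)
  then have "is_product C I X L (\<lambda>i. \<pi> (e i))"
    by (rule product_cong[rotated]) (use e in \<open>simp add: X'_def\<close>)
  then show ?thesis by blast
qed

context quiver_reps
begin

text \<open>The pair of all objects and injective objects is a complete cotorsion pair of \<open>M\<close>. Transferring it to
  representations computes the injective representations and provides embeddings into them.\<close>

lemma Inj_reps:
  assumes ei: "enough_injectives M"
  shows "Inj FC = Psi Q M (Inj M)" "enough_injectives FC"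
proof -
  have R: "Rep_class Q M (Ob M) = Ob FC"
  proof (intro equalityI subsetI)
    fix X assume "X \<in> Ob FC"
    then have "is_functor (path_cat Q) M X" by simp
    then show "X \<in> Rep_class Q M (Ob M)" unfolding Rep_class_iff using functor_simps(1)[of X] by simp
  qed (simp add: Rep_class_iff)
  have cp: "complete_cotorsion_pair FC (Ob FC) (Psi Q M (Inj M))"
    by (rule subst[OF R, of "\<lambda>X. complete_cotorsion_pair FC X (Psi Q M (Inj M))"])
      (rule complete_cotorsion_pair_reps[OF injective_cotorsion_Ob[OF ei]])
  have co: "cotorsion_pair FC (Ob FC) (Psi Q M (Inj M))"
    using cp unfolding complete_cotorsion_pair_def by (rule conjunct1)
  note cc = co[unfolded FC.cotorsion_pair_iff]
  have sub: "Psi Q M (Inj M) \<subseteq> Ob FC" using cc by (elim conjE)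
  have o: "\<forall>x\<in>Ob FC. \<forall>y\<in>Psi Q M (Inj M). orth FC x y" using cc by (elim conjE)
  have perp: "\<forall>a\<in>Ob FC. (\<forall>x\<in>Ob FC. orth FC x a) \<longrightarrow> a \<in> Psi Q M (Inj M)" using cc by (elim conjE)
  show e: "Inj FC = Psi Q M (Inj M)"
  proof (intro equalityI subsetI)
    show "a \<in> Psi Q M (Inj M)" if "a \<in> Inj FC" for a
      using that perp unfolding FC.Inj_iff_orth by (elim conjE) (drule (1) bspec, erule (1) mp)
    show "a \<in> Inj FC" if "a \<in> Psi Q M (Inj M)" for a
      unfolding FC.Inj_iff_orth using subsetD[OF sub that] bspec[OF bspec[OF o] that] by (intro conjI ballI)
  qed
  show "enough_injectives FC" unfolding enough_injectives_def
  proof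
    fix a assume "a \<in> Ob FC"
    then obtain f g where fg: "short_exact FC f g" "Dom FC f = a" "Dom FC g \<in> Inj FC"
      using cp unfolding complete_cotorsion_pair_def e by meson
    note S = FC.short_exact_simps[OF fg(1)]
    have "f \<in> Hom FC a (Dom FC g)" using S(1,3) fg(2) unfolding in_Hom by blast
    then show "\<exists>E\<in>Inj FC. \<exists>m\<in>Hom FC a E. monic FC m" using fg(3) S(5) by blast
  qed
qed

text \<open>The kernel of \<open>\<psi>\<close> at \<open>i\<close> is in \<open>W\<close> if all values of the representation are: the product over the outgoing
  arrows is in \<open>W\<close>, and \<open>W\<close> is thick. So the trivial fibrant representations are those with kernels and
  values in \<open>W \<inter> F = Inj M\<close>, which are the injective ones.\<close>

lemma injective_cotorsion_pair_reps:
  assumes ip: "injective_cotorsion_pair M W F"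
    and Wp: "\<And>I X P \<pi>. I \<subseteq> arcs Q \<Longrightarrow> is_product M I X P \<pi> \<Longrightarrow> (\<And>\<alpha>. \<alpha> \<in> I \<Longrightarrow> X \<alpha> \<in> W) \<Longrightarrow> P \<in> W"
  shows "injective_cotorsion_pair FC (Rep_class Q M W) (Psi Q M F)"
proof -
  have ei: "enough_injectives M" and cp: "complete_cotorsion_pair M W F" and WF: "W \<inter> F = Inj M" and th: "thick M W"
    using ip unfolding injective_cotorsion_pair_def by blast+
  have rcp: "complete_cotorsion_pair FC (Rep_class Q M W) (Psi Q M F)" by (rule complete_cotorsion_pair_reps[OF cp])
  then have rco: "cotorsion_pair FC (Rep_class Q M W) (Psi Q M F)" unfolding complete_cotorsion_pair_def by (rule conjunct1)
  have "Rep_class Q M W \<inter> Psi Q M F = Psi Q M (Inj M)"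
  proof (intro equalityI subsetI)
    fix X assume a: "X \<in> Rep_class Q M W \<inter> Psi Q M F"
    then have X: "X \<in> Psi Q M F" by blast
    have XW: "FOb X i \<in> W" if "i \<in> verts Q" for i using IntD1[OF a] that unfolding Rep_class_iff by blast
    show "X \<in> Psi Q M (Inj M)"
    proof (rule PsiI[OF Psi_functor[OF X]])
      fix i assume i: "i \<in> verts Q"
      show "FOb X i \<in> Inj M" using WF XW[OF i] Psi_Ob[OF X i] by blast
      obtain P \<pi> \<psi> k where P: "is_product M (out i) (\<lambda>\<alpha>. FOb X (head Q \<alpha>)) P \<pi>"
        and \<psi>: "\<psi> \<in> Ar M" "Dom M \<psi> = FOb X i" "Cod M \<psi> = P" "\<forall>\<alpha>\<in>out i. \<pi> \<alpha> \<cdot> \<psi> = rep_arrow Q X \<alpha>"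
        and k: "short_exact M k \<psi>" "Dom M k \<in> F" using X i by (rule Psi_E)
      have "FOb X (head Q \<alpha>) \<in> W" if "\<alpha> \<in> out i" for \<alpha> by (rule XW, rule arc_verts(2)) (use that in simp)
      then have "P \<in> W" by (rule Wp[OF _ P, rotated]) auto
      then have "Dom M k \<in> W" using th k(1) \<psi>(2,3) XW[OF i] unfolding thick_def by simp
      then have kI: "Dom M k \<in> Inj M" using WF k(2) by blast
      show "\<exists>P \<pi> \<psi> k. is_product M (out i) (\<lambda>\<alpha>. FOb X (head Q \<alpha>)) P \<pi> \<and>
        \<psi> \<in> Hom M (FOb X i) P \<and> (\<forall>\<alpha>\<in>out i. \<pi> \<alpha> \<cdot> \<psi> = rep_arrow Q X \<alpha>) \<and> short_exact M k \<psi> \<and> Dom M k \<in> Inj M"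
        using P \<psi> k(1) kI by (intro exI[of _ P] exI[of _ \<pi>] exI[of _ \<psi>] exI[of _ k]) simp
    qed
  next
    fix X assume "X \<in> Psi Q M (Inj M)"
    then have X: "X \<in> Psi Q M (W \<inter> F)" unfolding WF .
    have "X \<in> Psi Q M F"
    proof (rule PsiI[OF Psi_functor[OF X]])
      fix i assume i: "i \<in> verts Q"
      show "FOb X i \<in> F" using Psi_Ob[OF X i] by blast
      obtain P \<pi> \<psi> k where "is_product M (out i) (\<lambda>\<alpha>. FOb X (head Q \<alpha>)) P \<pi>"
        "\<psi> \<in> Ar M" "Dom M \<psi> = FOb X i" "Cod M \<psi> = P" "\<forall>\<alpha>\<in>out i. \<pi> \<alpha> \<cdot> \<psi> = rep_arrow Q X \<alpha>"
        "short_exact M k \<psi>" "Dom M k \<in> W \<inter> F" using X i by (rule Psi_E)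
      then show "\<exists>P \<pi> \<psi> k. is_product M (out i) (\<lambda>\<alpha>. FOb X (head Q \<alpha>)) P \<pi> \<and>
        \<psi> \<in> Hom M (FOb X i) P \<and> (\<forall>\<alpha>\<in>out i. \<pi> \<alpha> \<cdot> \<psi> = rep_arrow Q X \<alpha>) \<and> short_exact M k \<psi> \<and> Dom M k \<in> F"
        by (intro exI[of _ P] exI[of _ \<pi>] exI[of _ \<psi>] exI[of _ k]) simp
    qed
    moreover have "X \<in> Rep_class Q M W"
      unfolding Rep_class_iff using Psi_functor[OF X] Psi_Ob[OF X] by simp
    ultimately show "X \<in> Rep_class Q M W \<inter> Psi Q M F" by (rule IntI[rotated])
  qed
  then have inter: "Rep_class Q M W \<inter> Psi Q M F = Inj FC" unfolding Inj_reps(1)[OF ei] .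
  have "thick FC (Rep_class Q M W)"
    unfolding thick_def
  proof (intro conjI allI impI)
    show "Rep_class Q M W \<subseteq> Ob FC" using rco unfolding FC.cotorsion_pair_iff by (rule conjunct1)
    fix a b assume a: "b \<in> Rep_class Q M W \<and> direct_summand FC a b"
    then obtain a' \<pi> where p: "a \<in> Ob FC" "a' \<in> Ob FC" "is_product FC (UNIV :: bool set) (\<lambda>x. if x then a else a') b \<pi>"
      unfolding direct_summand_def by blast
    obtain i1 i2 p1 p2 where "b \<in> Ob FC" "i1 \<in> Hom FC a b" "i2 \<in> Hom FC a' b" "p1 \<in> Hom FC b a" "p2 \<in> Hom FC b a'"
      "p1 \<cdot>\<^bsub>FC\<^esub> i1 = Ident FC a" by (rule FC.product_biproduct[OF p(3,1,2)])
    then have "obj_retract FC a b" unfolding obj_retract_def by blast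
    then show "a \<in> Rep_class Q M W" using FC.cotorsion_retract_closed(1)[OF rco] a unfolding retract_closed_class_def by blast
  next
    fix f g assume fg: "short_exact FC f g"
    note S = FC.short_exact_simps[OF fg]
    have n: "is_ntrans (path_cat Q) M f" "is_ntrans (path_cat Q) M g" using S by auto
    have fu: "is_functor (path_cat Q) M (NDom f)" "is_functor (path_cat Q) M (NDom g)" "is_functor (path_cat Q) M (NCod g)"
      using ntrans_functors[OF n(1)] ntrans_functors[OF n(2)] by auto
    have two: "(FOb (NDom f) i \<in> W \<and> FOb (NDom g) i \<in> W \<longrightarrow> FOb (NCod g) i \<in> W) \<and>
        (FOb (NDom f) i \<in> W \<and> FOb (NCod g) i \<in> W \<longrightarrow> FOb (NDom g) i \<in> W) \<and>
        (FOb (NDom g) i \<in> W \<and> FOb (NCod g) i \<in> W \<longrightarrow> FOb (NDom f) i \<in> W)" if i: "i \<in> verts Q" for i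
    proof -
      have s: "short_exact M (NComponent f i) (NComponent g i)" using short_exact_pointwise[OF fg] i by simp
      have "Dom M (NComponent f i) = FOb (NDom f) i" "Dom M (NComponent g i) = FOb (NDom g) i" "Cod M (NComponent g i) = FOb (NCod g) i"
        using ntrans_simps(2,3)[OF n(1), of i] ntrans_simps(2,3)[OF n(2), of i] i by simp_all
      note d = this
      have t: "(Dom M (NComponent f i) \<in> W \<and> Dom M (NComponent g i) \<in> W \<longrightarrow> Cod M (NComponent g i) \<in> W) \<and>
        (Dom M (NComponent f i) \<in> W \<and> Cod M (NComponent g i) \<in> W \<longrightarrow> Dom M (NComponent g i) \<in> W) \<and>
        (Dom M (NComponent g i) \<in> W \<and> Cod M (NComponent g i) \<in> W \<longrightarrow> Dom M (NComponent f i) \<in> W)"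
        using th s unfolding thick_def by (elim conjE) (drule spec, drule spec, erule (1) mp)
      show ?thesis using t unfolding d .
    qed
    show "Cod FC g \<in> Rep_class Q M W" if "Dom FC f \<in> Rep_class Q M W \<and> Dom FC g \<in> Rep_class Q M W"
      using that two fu unfolding FC_simps Rep_class_iff by blast
    show "Dom FC g \<in> Rep_class Q M W" if "Dom FC f \<in> Rep_class Q M W \<and> Cod FC g \<in> Rep_class Q M W"
      using that two fu unfolding FC_simps Rep_class_iff by blast
    show "Dom FC f \<in> Rep_class Q M W" if "Dom FC g \<in> Rep_class Q M W \<and> Cod FC g \<in> Rep_class Q M W"
      using that two fu unfolding FC_simps Rep_class_iff by blast
  qed
  then show ?thesis unfolding injective_cotorsion_pair_def using Inj_reps(2)[OF ei] rcp inter by blast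
qed

end

theorem theorem3p6:
  fixes M :: "('o, 'm) cat"
    and Q :: "('v, 'e) pre_digraph"
    and W F :: "'o set"
  assumes "infinite (UNIV :: 'u set)"
    and "abelian_category M"
    and "bicomplete TYPE('u) M"
    and "enough_projectives M"
    and "enough_injectives M"
    and "coproducts_of_monics_monic TYPE('u) M"
    and "products_of_epics_epic TYPE('u) M"
    and "wf_digraph Q"
    and "small TYPE('u) (verts Q)"
    and "small TYPE('u) (arcs Q)"
    and "right_rooted Q"
    and "injective_cotorsion_pair M W F"
    and "hereditary_cotorsion_pair M W F"
    and "closed_under_products TYPE('u) M W"
  shows "\<exists>cof weq fib.
    injective_model_structure (Rep Q M) cof weq fib \<and>
    hovey_triple_of (Rep Q M) cof weq fib = (Ob (Rep Q M), Rep_class Q M W, Psi Q M F) \<and>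
    hereditary_hovey_triple (Rep Q M) (Ob (Rep Q M), Rep_class Q M W, Psi Q M F)"
proof -
  obtain add zer where ab: "abelian M add zer" using assms(2) by (rule abelian_obtain)
  obtain e :: "'e \<Rightarrow> 'u" where e: "inj_on e (arcs Q)" using assms(10) unfolding small_def by blast
  \<comment> \<open>Smallness moves families indexed by arrows of \<open>Q\<close> to index sets in \<open>'u\<close>.\<close>
  have bij: "bij_betw (inv_into I e) (e ` I) I" if "I \<subseteq> arcs Q" for I
    using inj_on_subset[OF e that] by (simp add: bij_betw_inv_into bij_betw_imageI)
  have sm: "small TYPE('u) I" if "I \<subseteq> arcs Q" for I
    unfolding small_def using inj_on_subset[OF e that] by blast
  have cM: "category M" "complete_cat TYPE('u) M" using assms(2,3) unfolding abelian_category_def bicomplete_def by blast+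
  have "quiver_reps M add zer Q"
  proof (intro quiver_reps.intro ab quiver_reps_axioms.intro)
    show "wf_digraph Q" by (rule assms(8))
    show "wf (arrow_rel Q)" by (rule right_rooted_wf[OF assms(8,11)])
    show "\<exists>P \<pi>. is_product M I X P \<pi>" if "I \<subseteq> arcs Q" "\<And>\<alpha>. \<alpha> \<in> I \<Longrightarrow> X \<alpha> \<in> Ob M" for I X
      using that(2) by (rule complete_cat_products[OF cM sm[OF that(1)]])
  next
    fix I X Y f P \<pi> P' \<pi>' g
    assume I: "I \<subseteq> arcs Q" and P: "is_product M I X P \<pi>" and P': "is_product M I Y P' \<pi>'"
      and f: "\<And>\<alpha>. \<alpha> \<in> I \<Longrightarrow> f \<alpha> \<in> Hom M (X \<alpha>) (Y \<alpha>) \<and> epic M (f \<alpha>)"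
      and g: "g \<in> Hom M P P'" "\<And>\<alpha>. \<alpha> \<in> I \<Longrightarrow> \<pi>' \<alpha> \<cdot>\<^bsub>M\<^esub> g = f \<alpha> \<cdot>\<^bsub>M\<^esub> \<pi> \<alpha>"
    let ?r = "inv_into I e"
    have r: "?r j \<in> I" if "j \<in> e ` I" for j using inv_into_into[OF that] .
    have "\<forall>j\<in>e ` I. f (?r j) \<in> Hom M (X (?r j)) (Y (?r j)) \<and> epic M (f (?r j))" using f r by blast
    moreover have "\<forall>j\<in>e ` I. \<pi>' (?r j) \<cdot>\<^bsub>M\<^esub> g = f (?r j) \<cdot>\<^bsub>M\<^esub> \<pi> (?r j)" using g(2) r by blast
    moreover note product_reindex[OF bij[OF I] P] product_reindex[OF bij[OF I] P'] g(1)
    ultimately show "epic M g"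
      by (intro assms(7)[unfolded products_of_epics_epic_def, rule_format, where I = "e ` I"
          and X = "\<lambda>j. X (?r j)" and Y = "\<lambda>j. Y (?r j)" and f = "\<lambda>j. f (?r j)" and \<pi> = "\<lambda>j. \<pi> (?r j)"
          and \<pi>' = "\<lambda>j. \<pi>' (?r j)" and g = g] conjI)
  qed
  then interpret quiver_reps M add zer Q .
  have "injective_cotorsion_pair FC (Rep_class Q M W) (Psi Q M F)"
  proof (rule injective_cotorsion_pair_reps[OF assms(12)])
    fix I X P \<pi> assume I: "I \<subseteq> arcs Q" and P: "is_product M I X P \<pi>" and X: "\<And>\<alpha>. \<alpha> \<in> I \<Longrightarrow> X \<alpha> \<in> W"
    have "\<forall>j\<in>e ` I. X (inv_into I e j) \<in> W" using X inv_into_into[of _ e I] by blast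
    with product_reindex[OF bij[OF I] P] show "P \<in> W"
      by (intro assms(14)[unfolded closed_under_products_def, rule_format, where I = "e ` I"
          and X = "\<lambda>j. X (inv_into I e j)"] conjI)
  qed
  then show ?thesis unfolding Rep_def by (rule injective_cotorsion_pair_model_structure[OF abelian_category_FC])
qed

end
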